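(* Let $\tau>0$, $m\ge4$ and $U=(\psi,\eta)\in\mathbb H^m_{(S)}(\mathbb R^2/\Gamma_\tau)$ with $\|U\|_4$ small enough. Then there exists a unique function $\mathcal Z\in C^{m-3}(\mathbb R^2)$ of $Z=(z_1,z_2)$ such that $$\frac{\partial\mathcal Z}{\partial z_1}=\frac{V_2}{V_1}(z_1,\mathcal Z),\qquad \Pi_1\mathcal Z=z_2,$$ where $\Pi_1$ denotes the average over a period in $z_1$. Moreover $\mathcal Z$ is even in $z_1$, odd in $z_2$, $$\mathcal Z(Z)=\mathcal Z(Z+(2\pi,0))=\mathcal Z(Z+(0,2\pi/\tau))-2\pi/\tau=\mathcal Z(Z+(\pi,\pi/\tau))-\pi/\tau,$$ and for $\delta\in\mathbb R$ the shifted function $\mathcal Z(\cdot+\delta,\cdot)$ is the solution of the same system with $V$ replaced by $V(\cdot+\delta,\cdot)$. The mapping $$x_1=z_1,\qquad x_2=z_2-\tilde d_1(z_1,z_2)=\mathcal Z(z_1,z_2),$$ and its inverse $z_1=x_1$, $z_2=x_2+d_1(x_1,x_2)$, define automorphisms of the torus $\mathbb R^2/\Gamma_\tau$: $X\mapsto Z=\mathcal U_1(X)$, $X=\mathcal U_1^{-1}(Z)$. The functions $d_1,\tilde d_1$ are even in the first and odd in the second variable and satisfy the tame estimate $$\|d_1\|_{C^{m-3}}+\|\tilde d_1\|_{C^{m-3}}\le c_m(\|U\|_4)\|U\|_m.$$ The automorphism $\mathcal U_1$ takes the integral curves of the vector field $V$ (which coincide with the bicharacteristics of the operator $\mathcal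 G_\eta-\mathcal J^*(\mathfrak a^{-1}\mathcal J\cdot)$) onto straight lines $\{z_2=\text{const}\}$; in other words, the bicharacteristics form a foliation of the torus with rotation number equal to $0$.
   Context: $\Gamma_\tau$ is the lattice of periods dual to the lattice of wave vectors generated by $(1,\pm\tau)$. $\mathbb H^m_{(S)}(\mathbb R^2/\Gamma_\tau)$: pairs $U=(\psi,\eta)$ of $\Gamma_\tau$-periodic functions of $X=(x_1,x_2)$ in the Sobolev space $H^m$, $\psi$ of zero average, odd in $x_1$ and even in $x_2$, $\eta$ even in $x_1$ and in $x_2$; $\|U\|_m=\|\psi\|_{H^m}+\|\eta\|_{H^m}$. With $\mathbf u_0=(1,0)$: $\mathfrak b=\frac{\nabla\eta\cdot(\mathbf u_0+\nabla\psi)}{1+|\nabla\eta|^2}$, $V=(V_1,V_2)=\nabla\psi+\mathbf u_0-\mathfrak b\nabla\eta$, $\mathcal J=V\cdot\nabla$, $\mathcal J^*f=-\nabla\cdot(fV)$, $\mathfrak a=V\cdot\nabla\mathfrak b+\mu$ ($\mu>0$ a parameter). $\mathcal G_\eta\psi=(\partial_{x_3}\varphi-\nabla_X\eta\cdot\nabla_X\varphi)|_{x_3=\eta(X)}$, where $\varphi$ is $\Gamma_\tau$-periodic in $X$, harmonic in $x_3<\eta(X)$, $\varphi=\psi$ on $x_3=\eta(X)$, $\nabla\varphi\to0$ as $x_3\to-\infty$ (a first-order operator, while $\mathcal J^*(\mathfrak a^{-1}\mathcal J\cdot)$ is of second order). *)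

theory Defs
  imports "HOL-Analysis.Analysis" "HOL-Library.Disjoint_Sets"
begin

section \<open>Differential calculus\<close>

abbreviation pt :: "real \<Rightarrow> real \<Rightarrow> real^2"
  where "pt a b \<equiv> vector [a, b]"

definition dirderiv ::
    "'a::real_normed_vector \<Rightarrow> ('a \<Rightarrow> 'b::real_normed_vector) \<Rightarrow> 'a \<Rightarrow> 'b"
  where "dirderiv v f x = frechet_derivative f (at x) v"

abbreviation D1 :: "(real^2 \<Rightarrow> 'b::real_normed_vector) \<Rightarrow> real^2 \<Rightarrow> 'b"
  where "D1 \<equiv> dirderiv (pt 1 0)"

abbreviation D2 :: "(real^2 \<Rightarrow> 'b::real_normed_vector) \<Rightarrow> real^2 \<Rightarrow> 'b"
  where "D2 \<equiv> dirderiv (pt 0 1)"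

definition grad :: "(real^2 \<Rightarrow> real) \<Rightarrow> real^2 \<Rightarrow> real^2"
  where "grad f X = pt (D1 f X) (D2 f X)"

text \<open>Functions of class \<open>C\<^sup>k\<close> on an \<^emph>\<open>open\<close> set.\<close>

fun Ck_on :: "nat \<Rightarrow> 'a::real_normed_vector set \<Rightarrow> ('a \<Rightarrow> 'b::real_normed_vector) \<Rightarrow> bool"
  where
    "Ck_on 0 S f \<longleftrightarrow> continuous_on S f"
  | "Ck_on (Suc k) S f \<longleftrightarrow>
       (\<forall>x\<in>S. f differentiable (at x)) \<and> (\<forall>v. Ck_on k S (dirderiv v f))"

abbreviation Ck :: "nat \<Rightarrow> ('a::real_normed_vector \<Rightarrow> 'b::real_normed_vector) \<Rightarrow> bool"
  where "Ck k \<equiv> Ck_on k UNIV"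

text \<open>The norm takes the value \<open>\<infinity>\<close> when some derivative is unbounded.\<close>

definition ck_norm :: "nat \<Rightarrow> (real^2 \<Rightarrow> real) \<Rightarrow> ennreal"
  where "ck_norm k f =
    (\<Sum>(i, j) \<in> {(i, j). i + j \<le> k}. SUP X. ennreal \<bar>(D1 ^^ i) ((D2 ^^ j) f) X\<bar>)"


section \<open>The torus and its Sobolev spaces\<close>

definition wave_lattice :: "real \<Rightarrow> (real^2) set"
  where "wave_lattice \<tau> = {of_int i *\<^sub>R pt 1 \<tau> + of_int j *\<^sub>R pt 1 (- \<tau>) | i j :: int. True}"

definition period_lattice :: "real \<Rightarrow> (real^2) set"
  where "period_lattice \<tau> = {X. \<forall>K \<in> wave_lattice \<tau>. \<exists>n::int. K \<bullet> X = 2 * pi * of_int n}"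

definition periodic :: "real \<Rightarrow> (real^2 \<Rightarrow> 'b) \<Rightarrow> bool"
  where "periodic \<tau> f \<longleftrightarrow> (\<forall>X. \<forall>g \<in> period_lattice \<tau>. f (X + g) = f X)"

text \<open>
  The period lattice is generated by \<open>(\<pi>, \<pi>/\<tau>)\<close> and \<open>(\<pi>, -\<pi>/\<tau>)\<close>.  The rectangle below consists
  of two fundamental cells, so that the mean over it is the mean over the torus.
\<close>

definition torus_mean :: "real \<Rightarrow> (real^2 \<Rightarrow> 'b::banach) \<Rightarrow> 'b"
  where "torus_mean \<tau> f =
    (\<tau> / (4 * pi^2)) *\<^sub>R integral (cbox (pt 0 0) (pt (2 * pi) (2 * pi / \<tau>))) f"

definition expwave :: "real^2 \<Rightarrow> real^2 \<Rightarrow> complex"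
  where "expwave K X = cis (K \<bullet> X)"

definition fourier_coeff :: "real \<Rightarrow> (real^2 \<Rightarrow> real) \<Rightarrow> real^2 \<Rightarrow> complex"
  where "fourier_coeff \<tau> u K = torus_mean \<tau> (\<lambda>X. complex_of_real (u X) * expwave (- K) X)"

definition sobolev_weight :: "real \<Rightarrow> nat \<Rightarrow> (real^2 \<Rightarrow> real) \<Rightarrow> real^2 \<Rightarrow> real"
  where "sobolev_weight \<tau> m u K = (1 + (norm K)^2)^m * (cmod (fourier_coeff \<tau> u K))^2"

text \<open>
  For \<open>m \<ge> 2\<close> every class in \<open>H\<^sup>m\<close> of the (two-dimensional) torus contains exactly one continuous
  function; classes are represented by it, so that derivatives can be taken pointwise.
\<close>

definition sobolev :: "real \<Rightarrow> nat \<Rightarrow> (real^2 \<Rightarrow> real) set"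
  where "sobolev \<tau> m = {u. continuous_on UNIV u \<and> periodic \<tau> u \<and>
           sobolev_weight \<tau> m u summable_on wave_lattice \<tau>}"

definition sobolev_norm :: "real \<Rightarrow> nat \<Rightarrow> (real^2 \<Rightarrow> real) \<Rightarrow> real"
  where "sobolev_norm \<tau> m u = sqrt (infsum (sobolev_weight \<tau> m u) (wave_lattice \<tau>))"

definition even1 :: "(real^2 \<Rightarrow> real) \<Rightarrow> bool"
  where "even1 f \<longleftrightarrow> (\<forall>a b. f (pt (- a) b) = f (pt a b))"

definition even2 :: "(real^2 \<Rightarrow> real) \<Rightarrow> bool"
  where "even2 f \<longleftrightarrow> (\<forall>a b. f (pt a (- b)) = f (pt a b))"

definition odd1 :: "(real^2 \<Rightarrow> real) \<Rightarrow> bool"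
  where "odd1 f \<longleftrightarrow> (\<forall>a b. f (pt (- a) b) = - f (pt a b))"

definition odd2 :: "(real^2 \<Rightarrow> real) \<Rightarrow> bool"
  where "odd2 f \<longleftrightarrow> (\<forall>a b. f (pt a (- b)) = - f (pt a b))"

definition sobolev_S :: "real \<Rightarrow> nat \<Rightarrow> ((real^2 \<Rightarrow> real) \<times> (real^2 \<Rightarrow> real)) set"
  where "sobolev_S \<tau> m = {(\<psi>, \<eta>).
           \<psi> \<in> sobolev \<tau> m \<and> torus_mean \<tau> \<psi> = 0 \<and> odd1 \<psi> \<and> even2 \<psi> \<and>
           \<eta> \<in> sobolev \<tau> m \<and> even1 \<eta> \<and> even2 \<eta>}"

definition pair_norm :: "real \<Rightarrow> nat \<Rightarrow> (real^2 \<Rightarrow> real) \<times> (real^2 \<Rightarrow> real) \<Rightarrow> real"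
  where "pair_norm \<tau> m U = sobolev_norm \<tau> m (fst U) + sobolev_norm \<tau> m (snd U)"


section \<open>Coefficients and operators of the linearised problem\<close>

definition u0 :: "real^2"
  where "u0 = pt 1 0"

definition bcoef :: "(real^2 \<Rightarrow> real) \<times> (real^2 \<Rightarrow> real) \<Rightarrow> real^2 \<Rightarrow> real"
  where "bcoef U X = (case U of (\<psi>, \<eta>) \<Rightarrow>
           (grad \<eta> X \<bullet> (u0 + grad \<psi> X)) / (1 + (norm (grad \<eta> X))^2))"

definition Vfield :: "(real^2 \<Rightarrow> real) \<times> (real^2 \<Rightarrow> real) \<Rightarrow> real^2 \<Rightarrow> real^2"
  where "Vfield U X = (case U of (\<psi>, \<eta>) \<Rightarrow> grad \<psi> X + u0 - bcoef U X *\<^sub>R grad \<eta> X)"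

definition acoef :: "real \<Rightarrow> (real^2 \<Rightarrow> real) \<times> (real^2 \<Rightarrow> real) \<Rightarrow> real^2 \<Rightarrow> real"
  where "acoef \<mu> U X = Vfield U X \<bullet> grad (bcoef U) X + \<mu>"

definition Jop :: "(real^2 \<Rightarrow> real^2) \<Rightarrow> (real^2 \<Rightarrow> complex) \<Rightarrow> real^2 \<Rightarrow> complex"
  where "Jop V u X = V X $ 1 *\<^sub>R D1 u X + V X $ 2 *\<^sub>R D2 u X"

text \<open>
  Periodic distributions are represented by their action on smooth periodic test functions, a
  function \<open>f\<close> acting by the mean of \<open>f w\<close>.  The function \<open>\<aa>\<close> need not be differentiable when
  \<open>m = 4\<close>; accordingly \<open>-\<nabla>\<cdot>(f V)\<close> is the distributional divergence, which acts on \<open>w\<close> as the mean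
  of \<open>f V\<cdot>\<nabla>w\<close>.
\<close>

type_synonym distr = "(real^2 \<Rightarrow> complex) \<Rightarrow> complex"

definition distr_of :: "real \<Rightarrow> (real^2 \<Rightarrow> complex) \<Rightarrow> distr"
  where "distr_of \<tau> f w = torus_mean \<tau> (\<lambda>X. f X * w X)"

definition Jadj :: "real \<Rightarrow> (real^2 \<Rightarrow> real^2) \<Rightarrow> (real^2 \<Rightarrow> complex) \<Rightarrow> distr"
  where "Jadj \<tau> V f w = torus_mean \<tau> (\<lambda>X. f X * Jop V w X)"

text \<open>
  \<open>is_DN \<tau> \<eta> u g\<close> says \<open>g = \<G>\<^sub>\<eta> u\<close>.  Points \<open>(X, x\<^sub>3)\<close> have type \<open>(real^2) \<times> real\<close>; the trace of
  \<open>\<partial>\<^sub>3\<phi> - \<nabla>\<eta>\<cdot>\<nabla>\<^sub>X\<phi>\<close> on the surface is the limit from inside the domain, and the filter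
  \<open>filtercomap snd at_bot\<close> expresses \<open>x\<^sub>3 \<longlongrightarrow> -\<infinity>\<close>, uniformly in \<open>X\<close>.  The operator is given by its
  graph, since its definition presupposes that the boundary value problem is uniquely solvable.
\<close>

definition fluid_domain :: "(real^2 \<Rightarrow> real) \<Rightarrow> ((real^2) \<times> real) set"
  where "fluid_domain \<eta> = {(X, s). s < \<eta> X}"

definition is_DN ::
    "real \<Rightarrow> (real^2 \<Rightarrow> real) \<Rightarrow> (real^2 \<Rightarrow> complex) \<Rightarrow> (real^2 \<Rightarrow> complex) \<Rightarrow> bool"
  where "is_DN \<tau> \<eta> u g \<longleftrightarrow> (\<exists>\<phi> :: (real^2) \<times> real \<Rightarrow> complex.
      (\<forall>X s. \<forall>p \<in> period_lattice \<tau>. s \<le> \<eta> X \<longrightarrow> \<phi> (X + p, s) = \<phi> (X, s)) \<and>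
      Ck_on 2 (fluid_domain \<eta>) \<phi> \<and>
      (\<forall>x \<in> fluid_domain \<eta>. (\<Sum>e\<in>Basis. dirderiv e (dirderiv e \<phi>) x) = 0) \<and>
      continuous_on {(X, s). s \<le> \<eta> X} \<phi> \<and>
      (\<forall>X. \<phi> (X, \<eta> X) = u X) \<and>
      (\<forall>v. (dirderiv v \<phi> \<longlongrightarrow> 0) (filtercomap snd at_bot)) \<and>
      (\<forall>X. ((\<lambda>x. dirderiv (0, 1) \<phi> x
                  - (grad \<eta> X $ 1 *\<^sub>R dirderiv (pt 1 0, 0) \<phi> x
                     + grad \<eta> X $ 2 *\<^sub>R dirderiv (pt 0 1, 0) \<phi> x))
             \<longlongrightarrow> g X) (at (X, \<eta> X) within fluid_domain \<eta>)))"

text \<open>The graph of \<open>\<G>\<^sub>\<eta> - \<J>\<^sup>*(\<aa>\<^sup>-\<^sup>1 \<J> \<cdot>)\<close>.\<close>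

definition lin_op ::
    "real \<Rightarrow> real \<Rightarrow> (real^2 \<Rightarrow> real) \<times> (real^2 \<Rightarrow> real) \<Rightarrow> (real^2 \<Rightarrow> complex) \<Rightarrow> distr \<Rightarrow> bool"
  where "lin_op \<tau> \<mu> U u T \<longleftrightarrow> (\<exists>g. is_DN \<tau> (snd U) u g \<and>
      T = (\<lambda>w. distr_of \<tau> g w
               - Jadj \<tau> (Vfield U) (\<lambda>X. (1 / acoef \<mu> U X) *\<^sub>R Jop (Vfield U) u X) w))"


section \<open>Bicharacteristics\<close>

text \<open>
  \<open>p\<close> is the principal symbol of order \<open>k\<close> of an operator \<open>L\<close> (given by its graph) on the torus:
  \<open>n\<^sup>-\<^sup>k e\<^sup>-\<^sup>i\<^sup>n\<^sup>K\<^sup>\<cdot>\<^sup>X L(e\<^sup>i\<^sup>n\<^sup>K\<^sup>\<cdot>\<^sup>X) \<longlonglongrightarrow> p(X, K)\<close> as a distribution, for every wave vector \<open>K\<close>.  As the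
  directions of wave vectors are dense, continuity and homogeneity in \<open>\<xi>\<close> determine \<open>p\<close>.
\<close>

definition principal_symbol ::
    "real \<Rightarrow> nat \<Rightarrow> ((real^2 \<Rightarrow> complex) \<Rightarrow> distr \<Rightarrow> bool) \<Rightarrow> ((real^2) \<times> (real^2) \<Rightarrow> complex) \<Rightarrow> bool"
  where "principal_symbol \<tau> k L p \<longleftrightarrow>
      continuous_on UNIV p \<and>
      (\<forall>\<xi>. periodic \<tau> (\<lambda>X. p (X, \<xi>))) \<and>
      (\<forall>X \<xi> t. 0 < t \<longrightarrow> p (X, t *\<^sub>R \<xi>) = t^k *\<^sub>R p (X, \<xi>)) \<and>
      (\<forall>K \<in> wave_lattice \<tau>. \<forall>T w.
         (\<forall>n. L (expwave (real n *\<^sub>R K)) (T n)) \<and> periodic \<tau> w \<and> (\<forall>j. Ck j w) \<longrightarrow>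
         (\<lambda>n. T n (\<lambda>X. expwave (- (real n *\<^sub>R K)) X * w X) / of_nat n ^ k)
           \<longlonglongrightarrow> distr_of \<tau> (\<lambda>X. p (X, K)) w)"

definition char_set :: "((real^2) \<times> (real^2) \<Rightarrow> complex) \<Rightarrow> ((real^2) \<times> (real^2)) set"
  where "char_set p = {(X, \<xi>). \<xi> \<noteq> 0 \<and> p (X, \<xi>) = 0}"

definition tangent_vectors :: "'a::real_normed_vector set \<Rightarrow> 'a \<Rightarrow> 'a set"
  where "tangent_vectors S x = {v. \<exists>c. c 0 = x \<and> (\<forall>\<^sub>F t in at (0::real). c t \<in> S) \<and>
           (c has_vector_derivative v) (at 0)}"

definition symp :: "(real^2) \<times> (real^2) \<Rightarrow> (real^2) \<times> (real^2) \<Rightarrow> real"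
  where "symp a b = snd a \<bullet> fst b - snd b \<bullet> fst a"

definition open_interval :: "real set \<Rightarrow> bool"
  where "open_interval I \<longleftrightarrow> open I \<and> is_interval I \<and> I \<noteq> {}"

text \<open>
  Bicharacteristic strips are the leaves of the characteristic foliation of the hypersurface
  \<open>p = 0\<close>, \<open>\<xi> \<noteq> 0\<close> of phase space: regular curves in it, tangent to the symplectic orthogonal of its
  tangent space.  Where \<open>dp \<noteq> 0\<close> for a real symbol these are the null integral curves of the
  Hamiltonian field of \<open>p\<close>, up to parametrisation.  That field cannot be used directly here, because
  the zeros of the principal symbol \<open>-\<aa>\<^sup>-\<^sup>1(V\<cdot>\<xi>)\<^sup>2\<close> are double and the field vanishes on them.
\<close>

definition bichar_strip ::
    "((real^2) \<times> (real^2) \<Rightarrow> complex) \<Rightarrow> real set \<Rightarrow> (real \<Rightarrow> (real^2) \<times> (real^2)) \<Rightarrow> bool"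
  where "bichar_strip p I \<gamma> \<longleftrightarrow> (\<exists>\<gamma>'. continuous_on I \<gamma>' \<and>
      (\<forall>t\<in>I. (\<gamma> has_vector_derivative \<gamma>' t) (at t) \<and> \<gamma>' t \<noteq> 0 \<and> \<gamma> t \<in> char_set p \<and>
              (\<forall>v \<in> tangent_vectors (char_set p) (\<gamma> t). symp (\<gamma>' t) v = 0)))"

text \<open>Bicharacteristics and integral curves as unparametrised arcs in the \<open>X\<close>-plane.\<close>

definition bicharacteristics :: "((real^2) \<times> (real^2) \<Rightarrow> complex) \<Rightarrow> (real^2) set set"
  where "bicharacteristics p = {(\<lambda>t. fst (\<gamma> t)) ` I | \<gamma> I. open_interval I \<and> bichar_strip p I \<gamma>}"

definition integral_curves :: "(real^2 \<Rightarrow> real^2) \<Rightarrow> (real^2) set set"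
  where "integral_curves V = {x ` I | x I. open_interval I \<and>
           (\<forall>t\<in>I. (x has_vector_derivative V (x t)) (at t))}"

definition maximal_arcs :: "'a set set \<Rightarrow> 'a set set"
  where "maximal_arcs A = {L \<in> A. \<forall>L'\<in>A. L \<subseteq> L' \<longrightarrow> L' = L}"


section \<open>Foliations and automorphisms of the torus\<close>

text \<open>
  Objects on the torus are given by their lifts to the plane: a map of the plane is an automorphism
  of the torus if it descends to a bijection of the quotient and is of class \<open>C\<^sup>k\<close> together with its
  inverse; a one-dimensional foliation of the torus is a foliation of the plane invariant under the
  periods.
\<close>

definition torus_automorphism :: "real \<Rightarrow> nat \<Rightarrow> (real^2 \<Rightarrow> real^2) \<Rightarrow> bool"
  where "torus_automorphism \<tau> k F \<longleftrightarrow> bij F \<and> Ck k F \<and> Ck k (inv F) \<and>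
      (\<forall>X Y. X - Y \<in> period_lattice \<tau> \<longleftrightarrow> F X - F Y \<in> period_lattice \<tau>)"

definition torus_foliation :: "real \<Rightarrow> (real^2) set set \<Rightarrow> bool"
  where "torus_foliation \<tau> F \<longleftrightarrow> partition_on UNIV F \<and>
      (\<forall>L\<in>F. \<forall>g\<in>period_lattice \<tau>. (+) g ` L \<in> F) \<and>
      (\<forall>X. \<exists>N h k. open N \<and> X \<in> N \<and> homeomorphism N (box 0 (1::real^2)) h k \<and>
         (\<forall>L\<in>F. \<forall>C \<in> components (L \<inter> N). \<exists>c. h ` C = {z \<in> box 0 1. z $ 2 = c}))"

text \<open>
  Asymptotic slope of the lifted leaves; the requirement that the filter is proper says that \<open>x\<^sub>1\<close>
  is unbounded along the leaf.
\<close>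

definition rotation_number :: "(real^2) set set \<Rightarrow> real \<Rightarrow> bool"
  where "rotation_number F r \<longleftrightarrow> (\<forall>L\<in>F.
      (let G = inf (filtercomap (\<lambda>X. \<bar>X $ 1\<bar>) at_top) (principal L)
       in G \<noteq> bot \<and> ((\<lambda>X. X $ 2 / X $ 1) \<longlongrightarrow> r) G))"


section \<open>The straightening system\<close>

definition average_z1 :: "(real^2 \<Rightarrow> real) \<Rightarrow> real \<Rightarrow> real"
  where "average_z1 f z2 = (1 / (2 * pi)) * integral {0..2 * pi} (\<lambda>s. f (pt s z2))"

definition straightening :: "nat \<Rightarrow> (real^2 \<Rightarrow> real^2) \<Rightarrow> (real^2 \<Rightarrow> real) \<Rightarrow> bool"
  where "straightening k V Z \<longleftrightarrow> Ck k Z \<and>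
      (\<forall>z1 z2. D1 Z (pt z1 z2) = V (pt z1 (Z (pt z1 z2))) $ 2 / V (pt z1 (Z (pt z1 z2))) $ 1) \<and>
      (\<forall>z2. average_z1 Z z2 = z2)"

definition shift1 :: "real \<Rightarrow> (real^2 \<Rightarrow> 'b) \<Rightarrow> real^2 \<Rightarrow> 'b"
  where "shift1 \<delta> f X = f (X + pt \<delta> 0)"

end

theory Submission
  imports Defs
begin

text \<open>
  For small \<open>U\<close> the slope \<open>f = V\<^sub>2/V\<^sub>1\<close> is small, odd in each variable and periodic, so the scalar
  equation \<open>y' = f(x, y)\<close> has only periodic solutions and exactly one with a prescribed average
  \<open>z\<^sub>2\<close>, found by a contraction argument; its dependence on \<open>z\<^sub>2\<close> is \<open>\<Z>\<close>, and the symmetries and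
  periods follow from uniqueness.  The tame estimate is obtained without Moser inequalities:
  choosing \<open>L\<close> with \<open>L^(m-4) = \<parallel>U\<parallel>\<^sub>m / \<parallel>U\<parallel>\<^sub>4\<close>, interpolation bounds the derivatives of \<open>f\<close> of
  order \<open>i + 1\<close> by a multiple of \<open>L^i \<parallel>U\<parallel>\<^sub>4\<close>, and bounds of this homogeneous form are stable under
  products and composition.  For the principal symbol only a linear bound in the frequency on the
  Dirichlet-Neumann operator is needed, which an explicit barrier gives; the symbol is then
  \<open>-(V\<cdot>\<xi>)\<^sup>2/\<aa>\<close>, whose zero set \<open>V\<cdot>\<xi> = 0\<close> has the integral curves of \<open>V\<close> as projections of its
  characteristic leaves.
\<close>

text \<open>Counting powers of \<open>L\<close> shapes the tame estimate. The norm in C^(m-3) must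
  not exceed a multiple of \<open>L^(m-4)\<close> times the H^4 norm, so one of the m - 3
  derivatives has to be free of \<open>L\<close>. This is what separates \<open>SS\<close> from
  \<open>Qb\<close>, and it is possible because H^4 alone controls two derivatives of \<psi> and
  \<eta> pointwise, one more than the gradient that enters V. For m = 4 the slope f is just of class
  C^1. Differentiability of \<Z> in z_2 therefore rests on an exact formula: the difference of two
  solutions is an exponential of the integrated mean-value quotient of f, which is continuous up to
  the diagonal. Oddness in the first variable is what prevents drift: the primitive of an odd
  periodic function is even, hence again periodic. Every solution thus stays within a bounded
  distance of its average, and the rotation number is 0. Constants are always chosen before
  \<open>L\<close>, f and \<open>U\<close>, and \<epsilon> comes from the bounds at m = 4 alone, so
  that one \<epsilon> serves every m. Sobolev functions are given through Fourier coefficients;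
  their pointwise derivatives become accessible by Fourier inversion.\<close>

section \<open>Coordinates of the plane and directional derivatives\<close>

lemma pt_eta [simp]: "pt (X $ 1) (X $ 2) = X"
  by (simp add: vec_eq_iff forall_2)

lemma vec2_eq_iff: "(X :: real^2) = Y \<longleftrightarrow> X $ 1 = Y $ 1 \<and> X $ 2 = Y $ 2"
  by (simp add: vec_eq_iff forall_2)

lemma pt_eq_axis: "pt 1 0 = axis 1 1" "pt 0 1 = axis 2 1"
  by (simp_all add: vec2_eq_iff axis_def)

lemma Basis_vec2: "(Basis :: (real^2) set) = {pt 1 0, pt 0 1}"
  by (auto simp: Basis_vec_def pt_eq_axis UNIV_2)

lemma pt_arith [simp]:
  "pt a b + pt c d = pt (a + c) (b + d)" "pt a b - pt c d = pt (a - c) (b - d)"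
  "r *\<^sub>R pt a b = pt (r * a) (r * b)" "- pt a b = pt (- a) (- b)"
  "pt a b \<bullet> X = a * X $ 1 + b * X $ 2" "X \<bullet> pt a b = a * X $ 1 + b * X $ 2"
  "pt 0 0 = 0" "pt a b = pt c d \<longleftrightarrow> a = c \<and> b = d"
  by (auto simp: vec2_eq_iff inner_vec_def sum_2)

lemma inner_vec2: "(X :: real^2) \<bullet> Y = X $ 1 * Y $ 1 + X $ 2 * Y $ 2"
  by (simp add: inner_vec_def sum_2)

lemma norm_vec2: "norm (X :: real^2) = sqrt ((X $ 1)^2 + (X $ 2)^2)"
  by (simp add: norm_vec_def L2_set_def sum_2)

lemma pt_linear: "v = (v :: real^2) $ 1 *\<^sub>R pt 1 0 + v $ 2 *\<^sub>R pt 0 1"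
  by (simp add: vec2_eq_iff)

lemma bounded_linear_pt [simp]: "bounded_linear (\<lambda>a. pt a 0)" "bounded_linear (\<lambda>b. pt 0 b)"
  by (intro linear_conv_bounded_linear[THEN iffD1] linearI; simp)+

lemma has_derivative_pt [derivative_intros]:
  assumes "(f has_derivative f') F" "(g has_derivative g') F"
  shows "((\<lambda>x. pt (f x) (g x)) has_derivative (\<lambda>h. pt (f' h) (g' h))) F"
  using has_derivative_add[OF bounded_linear.has_derivative[OF bounded_linear_pt(1) assms(1)]
      bounded_linear.has_derivative[OF bounded_linear_pt(2) assms(2)]]
  by simp

lemma has_vector_derivative_pt [derivative_intros]:
  assumes "(f has_real_derivative f') F" "(g has_real_derivative g') F"
  shows "((\<lambda>x. pt (f x) (g x)) has_vector_derivative pt f' g') F"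
  using has_derivative_pt[of f "\<lambda>h. h * f'" F g "\<lambda>h. h * g'"] assms
  by (simp add: has_vector_derivative_def has_field_derivative_def mult.commute[of _ f'] mult.commute[of _ g'])

lemma continuous_on_pt [continuous_intros]:
  assumes "continuous_on S f" "continuous_on S g"
  shows "continuous_on S (\<lambda>x. pt (f x) (g x))"
proof -
  have "continuous_on S (\<lambda>x. pt (f x) 0 + pt 0 (g x))"
    using assms by (intro continuous_on_add linear_continuous_on_compose
        bounded_linear.continuous_on[OF bounded_linear_pt(1)] bounded_linear.continuous_on[OF bounded_linear_pt(2)])
  then show ?thesis by simp
qed

lemma has_derivative_nth [derivative_intros]:
  assumes "(f has_derivative f') F"
  shows "((\<lambda>x. (f x :: real^2) $ i) has_derivative (\<lambda>h. f' h $ i)) F"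
  by (rule bounded_linear.has_derivative[OF bounded_linear_vec_nth assms])

lemma dirderiv_eqI: "(f has_derivative f') (at x) \<Longrightarrow> dirderiv v f x = f' v"
  unfolding dirderiv_def using frechet_derivative_at by metis

lemma has_derivative_dirderiv:
  "f differentiable (at x) \<Longrightarrow> (f has_derivative (\<lambda>v. dirderiv v f x)) (at x)"
  by (simp add: dirderiv_def[abs_def] frechet_derivative_works[symmetric])

lemma dirderiv_linear:
  fixes f :: "real^2 \<Rightarrow> 'b::real_normed_vector"
  assumes "f differentiable (at x)"
  shows "dirderiv v f x = v $ 1 *\<^sub>R D1 f x + v $ 2 *\<^sub>R D2 f x"
proof -
  have l: "linear (\<lambda>v. dirderiv v f x)"
    using has_derivative_dirderiv[OF assms] has_derivative_linear by blast
  have "dirderiv (v $ 1 *\<^sub>R pt 1 0 + v $ 2 *\<^sub>R pt 0 1) f x = v $ 1 *\<^sub>R D1 f x + v $ 2 *\<^sub>R D2 f x"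
    unfolding linear_add[OF l] linear_scale[OF l] ..
  then show ?thesis by (simp only: pt_linear[symmetric])
qed

lemma has_derivative_D12:
  fixes f :: "real^2 \<Rightarrow> 'b::real_normed_vector"
  assumes "f differentiable (at x)"
  shows "(f has_derivative (\<lambda>v. v $ 1 *\<^sub>R D1 f x + v $ 2 *\<^sub>R D2 f x)) (at x)"
proof -
  have "(\<lambda>v. dirderiv v f x) = (\<lambda>v. v $ 1 *\<^sub>R D1 f x + v $ 2 *\<^sub>R D2 f x)"
    by (intro ext dirderiv_linear assms)
  from this has_derivative_dirderiv[OF assms] show ?thesis
    by (rule subst[where P = "\<lambda>D. (f has_derivative D) (at x)"])
qed

lemma dirderiv_simps:
  fixes f g :: "'a::real_normed_vector \<Rightarrow> real"
  assumes "f differentiable (at x)" "g differentiable (at x)"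
  shows dirderiv_add: "dirderiv v (\<lambda>x. f x + g x) x = dirderiv v f x + dirderiv v g x"
    and dirderiv_diff: "dirderiv v (\<lambda>x. f x - g x) x = dirderiv v f x - dirderiv v g x"
    and dirderiv_mult: "dirderiv v (\<lambda>x. f x * g x) x = dirderiv v f x * g x + f x * dirderiv v g x"
  using assms[THEN has_derivative_dirderiv]
  by (simp_all add: dirderiv_eqI[OF has_derivative_add] dirderiv_eqI[OF has_derivative_diff]
      dirderiv_eqI[OF has_derivative_mult])

lemma dirderiv_const [simp]: "dirderiv v (\<lambda>x. c) x = 0"
  by (rule dirderiv_eqI[THEN trans, OF has_derivative_const]) simp

lemma dirderiv_uminus:
  assumes "f differentiable (at x)"
  shows "dirderiv v (\<lambda>x. - f x) x = - dirderiv v f x"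
  by (rule dirderiv_eqI[OF has_derivative_minus[OF has_derivative_dirderiv[OF assms]]])

lemma dirderiv_real_comp:
  fixes f :: "'a::real_normed_vector \<Rightarrow> real"
  assumes "f differentiable (at x)" "(h has_real_derivative c) (at (f x))"
  shows "dirderiv v (\<lambda>x. h (f x)) x = c * dirderiv v f x"
    and "(\<lambda>x. h (f x)) differentiable (at x)"
proof -
  have *: "((\<lambda>x. h (f x)) has_derivative (\<lambda>v. c * dirderiv v f x)) (at x)"
    using has_derivative_compose[OF has_derivative_dirderiv[OF assms(1)] assms(2)[unfolded has_field_derivative_def]] .
  show "dirderiv v (\<lambda>x. h (f x)) x = c * dirderiv v f x" by (rule dirderiv_eqI[OF *])
  show "(\<lambda>x. h (f x)) differentiable (at x)" using * by (auto simp: differentiable_def)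
qed

lemma dirderiv_nth:
  "dirderiv v (\<lambda>X. (X :: real^2) $ i) x = v $ i" "(\<lambda>X. (X :: real^2) $ i) differentiable (at x)"
proof -
  have *: "((\<lambda>X. (X :: real^2) $ i) has_derivative (\<lambda>v. v $ i)) (at x)"
    by (rule derivative_intros)+
  show "dirderiv v (\<lambda>X. (X :: real^2) $ i) x = v $ i" by (rule dirderiv_eqI[OF *])
  show "(\<lambda>X. (X :: real^2) $ i) differentiable (at x)" using * by (auto simp: differentiable_def)
qed


section \<open>Derivative bounds with a frequency weight\<close>

text \<open>\<open>L\<close> acts as a frequency: a derivative of order \<open>i\<close> may be as
  large as \<open>A * L^i\<close>. Under the Leibniz rule the exponents of \<open>L\<close> add up,
  so products keep the same shape with constants depending on \<open>k\<close> only. Continuity is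
  demanded at order 0; at higher orders differentiability supplies it, so a function with such a
  bound is of class C^k.\<close>

fun Qb :: "real \<Rightarrow> nat \<Rightarrow> real \<Rightarrow> (real^2 \<Rightarrow> real) \<Rightarrow> bool" where
  "Qb L 0 A f \<longleftrightarrow> continuous_on UNIV f \<and> (\<forall>X. \<bar>f X\<bar> \<le> A)"
| "Qb L (Suc k) A f \<longleftrightarrow> (\<forall>X. \<bar>f X\<bar> \<le> A) \<and> (\<forall>X. f differentiable (at X)) \<and>
      (\<forall>e\<in>Basis. Qb L k (A * L) (dirderiv e f))"

lemma differentiable_continuous_UNIV: "(\<And>X. f differentiable (at X)) \<Longrightarrow> continuous_on UNIV f"
  by (simp add: continuous_at_imp_continuous_on differentiable_imp_continuous_within)

lemma Qb_bound: "Qb L k A f \<Longrightarrow> \<bar>f X\<bar> \<le> A"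
  by (cases k) auto

lemma Qb_nonneg: "Qb L k A f \<Longrightarrow> 0 \<le> A"
  using Qb_bound[of L k A f 0] by linarith

lemma Qb_continuous: "Qb L k A f \<Longrightarrow> continuous_on UNIV f"
  by (cases k) (auto intro: differentiable_continuous_UNIV)

lemma Qb_mono:
  assumes "1 \<le> L" "Qb L k A f" "A \<le> B"
  shows "Qb L k B f"
  using assms(2,3)
proof (induction k arbitrary: A B f)
  case (Suc k)
  then have "A * L \<le> B * L" using assms(1) by (simp add: mult_right_mono)
  with Suc show ?case by (fastforce intro: order_trans)
qed (auto intro: order_trans)

lemma Qb_Suc_lower: "1 \<le> L \<Longrightarrow> Qb L (Suc k) A f \<Longrightarrow> Qb L k A f"
proof (induction k arbitrary: A f)
  case 0 then show ?case by (auto intro: differentiable_continuous_UNIV)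
next
  case (Suc k)
  then show ?case by (metis Qb.simps(2))
qed

lemma Qb_lower: "1 \<le> L \<Longrightarrow> Qb L k A f \<Longrightarrow> j \<le> k \<Longrightarrow> Qb L j A f"
  by (induction k) (auto simp: le_Suc_eq simp del: Qb.simps dest: Qb_Suc_lower)

lemma Qb_const: "1 \<le> L \<Longrightarrow> \<bar>c\<bar> \<le> A \<Longrightarrow> Qb L k A (\<lambda>X. c)"
proof (induction k arbitrary: A c)
  case (Suc k)
  have "Qb L k (A * L) (\<lambda>X. 0)" using Suc by (intro Suc.IH) auto
  moreover have "dirderiv e (\<lambda>X. c) = (\<lambda>X. 0)" for e :: "real^2" by (simp add: fun_eq_iff)
  ultimately show ?case using Suc by simp
qed auto

lemma Qb_add: "Qb L k A f \<Longrightarrow> Qb L k B g \<Longrightarrow> Qb L k (A + B) (\<lambda>X. f X + g X)"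
proof (induction k arbitrary: A B f g)
  case 0
  have "\<bar>f X + g X\<bar> \<le> A + B" for X using 0 abs_triangle_ineq[of "f X" "g X"] by (smt (verit) Qb.simps(1))
  with 0 show ?case by (auto intro: continuous_on_add)
next
  case (Suc k)
  have "dirderiv e (\<lambda>X. f X + g X) = (\<lambda>X. dirderiv e f X + dirderiv e g X)" for e
    using Suc.prems by (intro ext dirderiv_add) auto
  moreover have "\<bar>f X + g X\<bar> \<le> A + B" for X
    using Qb_bound[OF Suc.prems(1), of X] Qb_bound[OF Suc.prems(2), of X] by linarith
  moreover have "Qb L k (A * L + B * L) (\<lambda>X. dirderiv e f X + dirderiv e g X)" if "e \<in> Basis" for e
    using Suc.prems that by (intro Suc.IH) auto
  ultimately show ?case using Suc.prems by (auto simp: distrib_right intro: differentiable_add)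
qed

lemma Qb_uminus: "Qb L k A f \<Longrightarrow> Qb L k A (\<lambda>X. - f X)"
proof (induction k arbitrary: A f)
  case 0 then show ?case by (auto intro: continuous_on_minus)
next
  case (Suc k)
  have "dirderiv e (\<lambda>X. - f X) = (\<lambda>X. - dirderiv e f X)" for e
    using Suc.prems by (intro ext dirderiv_uminus) auto
  moreover have "(\<lambda>X. - f X) differentiable (at X)" for X
    using Suc.prems by (intro differentiable_minus) auto
  ultimately show ?case using Suc by simp
qed

lemma Qb_diff: "Qb L k A f \<Longrightarrow> Qb L k B g \<Longrightarrow> Qb L k (A + B) (\<lambda>X. f X - g X)"
  using Qb_add[OF _ Qb_uminus, of L k A f B g] by simp

text \<open>The factor \<open>2^k\<close> counts the terms of the \<open>k\<close>-fold Leibniz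
  rule.\<close>

lemma Qb_mult:
  assumes L: "1 \<le> L"
  shows "Qb L k A f \<Longrightarrow> Qb L k B g \<Longrightarrow> Qb L k (2^k * A * B) (\<lambda>X. f X * g X)"
proof (induction k arbitrary: A B f g)
  case 0 
  then have "\<bar>f X * g X\<bar> \<le> A * B" for X by (auto simp: abs_mult intro!: mult_mono intro: order_trans[OF abs_ge_zero])
  with 0 show ?case by (auto intro: continuous_intros)
next
  case (Suc k)
  have n: "0 \<le> A" "0 \<le> B" using Suc.prems Qb_nonneg by blast+
  have d: "dirderiv e (\<lambda>X. f X * g X) = (\<lambda>X. dirderiv e f X * g X + f X * dirderiv e g X)" for e
    using Suc.prems by (intro ext dirderiv_mult) auto
  have "\<bar>f X * g X\<bar> \<le> 1 * (A * B)" for X 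
    using Suc.prems by (auto simp: abs_mult intro!: mult_mono intro: order_trans[OF abs_ge_zero])
  also have "\<dots> \<le> 2 ^ Suc k * (A * B)" using n by (intro mult_right_mono one_le_power) auto
  finally have 1: "\<bar>f X * g X\<bar> \<le> 2 ^ Suc k * A * B" for X by (simp add: mult.assoc)
  have "Qb L k (2^k * (A * L) * B + 2^k * A * (B * L)) (\<lambda>X. dirderiv e f X * g X + f X * dirderiv e g X)"
    if "e \<in> Basis" for e
    using Suc.prems that by (intro Qb_add Suc.IH) (auto intro: Qb_Suc_lower[OF L])
  moreover have "2^k * (A * L) * B + 2^k * A * (B * L) = 2 ^ Suc k * A * B * L" by (simp add: algebra_simps)
  ultimately show ?case using 1 Suc.prems unfolding Qb.simps d by (auto intro: differentiable_mult)
qed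

lemma dirderiv_cmult:
  fixes f :: "'a::real_normed_vector \<Rightarrow> real"
  assumes "f differentiable (at x)"
  shows "dirderiv v (\<lambda>x. a * f x) x = a * dirderiv v f x"
  using assms by (simp add: dirderiv_mult)

lemma Ck_add:
  fixes f g :: "'a::real_normed_vector \<Rightarrow> real"
  shows "Ck k f \<Longrightarrow> Ck k g \<Longrightarrow> Ck k (\<lambda>X. f X + g X)"
proof (induction k arbitrary: f g)
  case 0 then show ?case by (auto intro: continuous_on_add)
next
  case (Suc k)
  have "dirderiv v (\<lambda>X. f X + g X) = (\<lambda>X. dirderiv v f X + dirderiv v g X)" for v
    using Suc.prems by (intro ext dirderiv_add) auto
  with Suc show ?case by (auto intro: differentiable_add)
qed

lemma Ck_cmult:
  fixes f :: "'a::real_normed_vector \<Rightarrow> real"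
  shows "Ck k f \<Longrightarrow> Ck k (\<lambda>X. a * f X)"
proof (induction k arbitrary: f)
  case 0 then show ?case by (auto intro: continuous_on_mult_left)
next
  case (Suc k)
  have "dirderiv v (\<lambda>X. a * f X) = (\<lambda>X. a * dirderiv v f X)" for v
    using Suc.prems by (intro ext dirderiv_cmult) auto
  with Suc show ?case by (auto intro: differentiable_mult)
qed

lemma Ck_SucI:
  fixes f :: "real^2 \<Rightarrow> real"
  assumes "\<And>X. f differentiable (at X)" "Ck k (D1 f)" "Ck k (D2 f)"
  shows "Ck (Suc k) f"
proof -
  have *: "dirderiv v f = (\<lambda>X. v $ 1 * D1 f X + v $ 2 * D2 f X)" for v
    using dirderiv_linear[OF assms(1), of v] by (intro ext) simp
  have "Ck k (dirderiv v f)" for v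
    by (subst *) (intro Ck_add Ck_cmult assms)
  with assms(1) show ?thesis by simp
qed

lemma Qb_imp_Ck: "Qb L k A f \<Longrightarrow> Ck k f"
proof (induction k arbitrary: A f)
  case (Suc k)
  have "Qb L k (A * L) (D1 f)" "Qb L k (A * L) (D2 f)" "\<And>X. f differentiable (at X)"
    using Suc.prems by (simp_all add: Basis_vec2)
  then show ?case using Suc.IH by (intro Ck_SucI)
qed auto


text \<open>Transported from pairs of reals, where a first partial together with a continuous second
  partial yields the full derivative. The functions defined below by integrals, and \<open>Z\<close>
  itself, are differentiated through it.\<close>

lemma has_derivative_partials_vec2:
  fixes G G1 G2 :: "real^2 \<Rightarrow> real"
  assumes d1: "\<And>a b. ((\<lambda>x. G (pt x b)) has_real_derivative G1 (pt a b)) (at a)"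
    and d2: "\<And>a b. ((\<lambda>y. G (pt a y)) has_real_derivative G2 (pt a b)) (at b)"
    and c: "continuous_on UNIV G2"
  shows "(G has_derivative (\<lambda>h. h $ 1 * G1 X + h $ 2 * G2 X)) (at X)"
proof -
  have "continuous_on UNIV (\<lambda>p. pt (fst p) (snd p))" by (intro continuous_intros)
  from continuous_on_compose2[OF c this] have "continuous_on UNIV (\<lambda>p. G2 (pt (fst p) (snd p)))" by simp
  then have "continuous_on UNIV (\<lambda>p. blinfun_mult_right (G2 (pt (fst p) (snd p))))"
    by (intro bounded_linear.continuous_on[OF bounded_linear_blinfun_mult_right])
  then have "continuous (at (X $ 1, X $ 2)) (\<lambda>p. blinfun_mult_right (G2 (pt (fst p) (snd p))))"
    by (simp add: continuous_on_eq_continuous_at)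
  then have "((\<lambda>(x, y). G (pt x y)) has_derivative
      (\<lambda>(tx, ty). G1 (pt (X $ 1) (X $ 2)) * tx + blinfun_mult_right (G2 (pt (X $ 1) (X $ 2))) ty))
      (at (X $ 1, X $ 2) within UNIV \<times> UNIV)"
    using d1[of "X $ 2" "X $ 1"] d2 by (intro has_derivative_partialsI)
      (auto simp: has_field_derivative_def case_prod_unfold)
  then have *: "((\<lambda>(x, y). G (pt x y)) has_derivative (\<lambda>(tx, ty). G1 X * tx + G2 X * ty)) (at (X $ 1, X $ 2))"
    by simp
  have "((\<lambda>X :: real^2. (X $ 1, X $ 2)) has_derivative (\<lambda>h. (h $ 1, h $ 2))) (at X)"
    by (intro derivative_intros)
  from has_derivative_compose[OF this *] show ?thesis by (simp add: mult.commute)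
qed

lemma dirderiv_partials_vec2:
  fixes G G1 G2 :: "real^2 \<Rightarrow> real"
  assumes "\<And>a b. ((\<lambda>x. G (pt x b)) has_real_derivative G1 (pt a b)) (at a)"
    and "\<And>a b. ((\<lambda>y. G (pt a y)) has_real_derivative G2 (pt a b)) (at b)"
    and "continuous_on UNIV G2"
  shows "G differentiable (at X)" "D1 G = G1" "D2 G = G2"
proof -
  note * = has_derivative_partials_vec2[of G, OF assms]
  show "G differentiable (at X)" using * by (auto simp: differentiable_def)
  show "D1 G = G1" "D2 G = G2" using dirderiv_eqI[OF *] by (auto simp: fun_eq_iff)
qed

lemma has_real_derivative_D1:
  fixes f :: "real^2 \<Rightarrow> real"
  assumes "f differentiable (at (pt a b))"
  shows "((\<lambda>x. f (pt x b)) has_real_derivative D1 f (pt a b)) (at a)"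
    and "((\<lambda>y. f (pt a y)) has_real_derivative D2 f (pt a b)) (at b)"
proof -
  have "((\<lambda>x. pt x b) has_derivative (\<lambda>h. pt h 0)) (at a)" "((\<lambda>y. pt a y) has_derivative (\<lambda>h. pt 0 h)) (at b)"
    by (intro derivative_intros)+
  from this[THEN has_derivative_compose, OF has_derivative_D12[OF assms]]
  show "((\<lambda>x. f (pt x b)) has_real_derivative D1 f (pt a b)) (at a)"
    "((\<lambda>y. f (pt a y)) has_real_derivative D2 f (pt a b)) (at b)"
    by (simp_all add: has_field_derivative_def mult_commute_abs)
qed

lemma dirderiv_affine:
  assumes "f differentiable (at (l x + c))" "bounded_linear l"
  shows "dirderiv v (\<lambda>x. f (l x + c)) x = dirderiv (l v) f (l x + c)"
    and "(\<lambda>x. f (l x + c)) differentiable (at x)"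
proof -
  have "((\<lambda>x. l x + c) has_derivative l) (at x)"
    using has_derivative_add_const[OF bounded_linear_imp_has_derivative[OF assms(2)]] .
  from has_derivative_compose[OF this has_derivative_dirderiv[OF assms(1)]]
  have *: "((\<lambda>x. f (l x + c)) has_derivative (\<lambda>h. dirderiv (l h) f (l x + c))) (at x)" .
  show "dirderiv v (\<lambda>x. f (l x + c)) x = dirderiv (l v) f (l x + c)" by (rule dirderiv_eqI[OF *])
  show "(\<lambda>x. f (l x + c)) differentiable (at x)" using * by (auto simp: differentiable_def)
qed

lemma dirderiv_shift:
  assumes "f differentiable (at (x + c))"
  shows "dirderiv v (\<lambda>x. f (x + c)) x = dirderiv v f (x + c)"
    and "(\<lambda>x. f (x + c)) differentiable (at x)"
  using dirderiv_affine[where l = "\<lambda>x. x" and c = c, OF _ bounded_linear_ident, of f x] assms by auto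

text \<open>Induction through (1/f)' = -f' (1/f)^2, whose right side needs bounds of lower order on
  1/f only. The constant is fixed before \<open>L\<close> and \<open>f\<close>, which later makes it
  uniform in \<open>U\<close>.\<close>

lemma Qb_inverse:
  assumes "0 < c"
  shows "\<exists>C\<ge>0. \<forall>L f. 1 \<le> L \<longrightarrow> Qb L k A f \<longrightarrow> (\<forall>X. c \<le> f X) \<longrightarrow> Qb L k C (\<lambda>X. 1 / f X)"
proof (induction k)
  case 0
  have "Qb L 0 (1 / c) (\<lambda>X. 1 / f X)" if "Qb L 0 A f" "\<forall>X. c \<le> f X" for L f
  proof -
    have p: "0 < f X" for X using that(2) assms by (meson less_le_trans)
    then have "continuous_on UNIV (\<lambda>X. 1 / f X)"
      using that(1) by (intro continuous_on_divide) (auto simp: less_imp_neq[THEN not_sym])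
    moreover have "\<bar>1 / f X\<bar> \<le> 1 / c" for X
      using p[of X] that(2) assms by (simp add: divide_simps mult.commute)
    ultimately show ?thesis by simp
  qed
  then show ?case using assms by (intro exI[of _ "1 / c"]) auto
next
  case (Suc k)
  then obtain C where C: "0 \<le> C" "\<forall>L f. 1 \<le> L \<longrightarrow> Qb L k A f \<longrightarrow> (\<forall>X. c \<le> f X) \<longrightarrow> Qb L k C (\<lambda>X. 1 / f X)"
    by blast
  define C' where "C' = max (1 / c) (2^k * A * (2^k * C * C))"
  have "Qb L (Suc k) C' (\<lambda>X. 1 / f X)" if L: "1 \<le> L" and f: "Qb L (Suc k) A f" "\<forall>X. c \<le> f X" for L f
  proof -
    have p: "0 < f X" for X using f(2) assms by (meson less_le_trans)
    have df: "f differentiable (at X)" for X using f by auto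
    have dr: "((\<lambda>t. 1 / t) has_real_derivative - (1 / f X * (1 / f X))) (at (f X))" for X
      using p[of X] by (auto intro!: derivative_eq_intros simp: power2_eq_square field_simps)
    have d: "dirderiv e (\<lambda>X. 1 / f X) = (\<lambda>X. - (dirderiv e f X * (1 / f X * (1 / f X))))" for e
      using dirderiv_real_comp(1)[OF df dr] by (intro ext) simp
    have inv: "Qb L k C (\<lambda>X. 1 / f X)" using C(2) L Qb_Suc_lower[OF L f(1)] f(2) by blast
    have "Qb L k (2^k * (A * L) * (2^k * C * C)) (\<lambda>X. dirderiv e f X * (1 / f X * (1 / f X)))"
      if "e \<in> Basis" for e
      using f that by (intro Qb_mult L inv) auto
    moreover have "2^k * (A * L) * (2^k * C * C) \<le> C' * L"
    proof -
      have "2^k * (A * L) * (2^k * C * C) = (2^k * A * (2^k * C * C)) * L" by simp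
      also have "\<dots> \<le> C' * L" using L by (intro mult_right_mono) (auto simp: C'_def)
      finally show ?thesis .
    qed
    ultimately have "Qb L k (C' * L) (dirderiv e (\<lambda>X. 1 / f X))" if "e \<in> Basis" for e
      unfolding d using Qb_uminus Qb_mono[OF L] that by blast
    moreover have "\<bar>1 / f X\<bar> \<le> C'" for X
    proof -
      have "\<bar>1 / f X\<bar> \<le> 1 / c" using p[of X] f(2) assms by (simp add: divide_simps mult.commute)
      then show ?thesis by (simp add: C'_def)
    qed
    ultimately show ?thesis using dirderiv_real_comp(2)[OF df dr] by simp
  qed
  moreover have "0 \<le> C'" using assms by (simp add: C'_def le_max_iff_disj)
  ultimately show ?case by blast
qed

lemma Qb_exp: "\<exists>C\<ge>0. \<forall>L f. 1 \<le> L \<longrightarrow> Qb L k A f \<longrightarrow> Qb L k C (\<lambda>X. exp (f X))"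
proof (induction k)
  case 0
  have "Qb L 0 (exp A) (\<lambda>X. exp (f X))" if "Qb L 0 A f" for L f
    using that by (auto intro: continuous_on_exp abs_le_D1)
  then show ?case by (intro exI[of _ "exp A"]) auto
next
  case (Suc k)
  then obtain C where C: "0 \<le> C" "\<forall>L f. 1 \<le> L \<longrightarrow> Qb L k A f \<longrightarrow> Qb L k C (\<lambda>X. exp (f X))"
    by blast
  define C' where "C' = max (exp A) (2^k * A * C)"
  have "Qb L (Suc k) C' (\<lambda>X. exp (f X))" if L: "1 \<le> L" and f: "Qb L (Suc k) A f" for L f
  proof -
    have df: "f differentiable (at X)" for X using f by auto
    have dr: "(exp has_real_derivative exp (f X)) (at (f X))" for X by (rule DERIV_exp)
    have d: "dirderiv e (\<lambda>X. exp (f X)) = (\<lambda>X. dirderiv e f X * exp (f X))" for e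
      using dirderiv_real_comp(1)[OF df dr] by (intro ext) simp
    have "Qb L k (2^k * (A * L) * C) (dirderiv e (\<lambda>X. exp (f X)))" if "e \<in> Basis" for e
      unfolding d using f that by (intro Qb_mult L C(2)[rule_format] Qb_Suc_lower[OF L f(1)]) auto
    moreover have "2^k * (A * L) * C \<le> C' * L"
    proof -
      have "2^k * (A * L) * C = (2^k * A * C) * L" by simp
      also have "\<dots> \<le> C' * L" using L by (intro mult_right_mono) (auto simp: C'_def)
      finally show ?thesis .
    qed
    ultimately have "Qb L k (C' * L) (dirderiv e (\<lambda>X. exp (f X)))" if "e \<in> Basis" for e
      using Qb_mono[OF L] that by blast
    moreover have "\<bar>exp (f X)\<bar> \<le> C'" for X
      using Qb_bound[OF f, of X] by (auto simp: C'_def le_max_iff_disj)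
    ultimately show ?thesis using dirderiv_real_comp(2)[OF df dr] by simp
  qed
  moreover have "0 \<le> C'" by (simp add: C'_def le_max_iff_disj)
  ultimately show ?case by blast
qed

lemma dirderiv_graph_comp:
  fixes f Z :: "real^2 \<Rightarrow> real"
  assumes "f differentiable (at (pt (X $ 1) (Z X)))" "Z differentiable (at X)"
  shows "dirderiv e (\<lambda>X. f (pt (X $ 1) (Z X))) X =
      e $ 1 * D1 f (pt (X $ 1) (Z X)) + dirderiv e Z X * D2 f (pt (X $ 1) (Z X))"
    and "(\<lambda>X. f (pt (X $ 1) (Z X))) differentiable (at X)"
proof -
  have "((\<lambda>X. pt (X $ 1) (Z X)) has_derivative (\<lambda>h. pt (h $ 1) (dirderiv h Z X))) (at X)"
    by (intro derivative_intros has_derivative_dirderiv assms)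
  from has_derivative_compose[OF this has_derivative_D12[OF assms(1)]]
  have *: "((\<lambda>X. f (pt (X $ 1) (Z X))) has_derivative
      (\<lambda>h. h $ 1 * D1 f (pt (X $ 1) (Z X)) + dirderiv h Z X * D2 f (pt (X $ 1) (Z X)))) (at X)"
    by simp
  show "dirderiv e (\<lambda>X. f (pt (X $ 1) (Z X))) X =
      e $ 1 * D1 f (pt (X $ 1) (Z X)) + dirderiv e Z X * D2 f (pt (X $ 1) (Z X))"
    by (rule dirderiv_eqI[OF *])
  show "(\<lambda>X. f (pt (X $ 1) (Z X))) differentiable (at X)" using * by (auto simp: differentiable_def)
qed

lemma continuous_on_nth [continuous_intros]:
  "continuous_on S f \<Longrightarrow> continuous_on S (\<lambda>x. (f x :: real^2) $ i)"
  by (rule continuous_on_component)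

lemma continuous_on_comp_pt:
  fixes f :: "real^2 \<Rightarrow> 'b::topological_space"
  assumes "continuous_on UNIV f" "continuous_on S g" "continuous_on S h"
  shows "continuous_on S (\<lambda>X. f (pt (g X) (h X)))"
  by (rule continuous_on_compose2[OF assms(1) continuous_on_pt[OF assms(2,3)]]) simp

text \<open>The gradient of \<open>Z\<close> is bounded by \<open>B\<close> at order 0, without a
  factor \<open>L\<close>; each derivative of the composite then costs exactly one \<open>L\<close>,
  and it comes from \<open>f\<close>. The bound stays linear in \<open>A\<close>, so smallness of
  \<open>f\<close> survives the composition.\<close>

lemma Qb_graph_comp:
  assumes "0 \<le> B"
  shows "\<exists>C\<ge>0. \<forall>L A f Z. 1 \<le> L \<longrightarrow> Qb L k A f \<longrightarrow> (\<forall>X. Z differentiable (at X)) \<longrightarrow>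
    (\<forall>e\<in>Basis. Qb L (k - 1) B (dirderiv e Z)) \<longrightarrow> Qb L k (C * A) (\<lambda>X. f (pt (X $ 1) (Z X)))"
proof (induction k)
  case 0
  have "Qb L 0 (1 * A) (\<lambda>X. f (pt (X $ 1) (Z X)))" if f: "Qb L 0 A f" and "\<forall>X. Z differentiable (at X)" for L A f Z
  proof -
    have "continuous_on UNIV Z" using that by (intro differentiable_continuous_UNIV) auto
    then have "continuous_on UNIV (\<lambda>X. f (pt (X $ 1) (Z X)))"
      using f by (intro continuous_on_comp_pt continuous_on_nth continuous_on_id) simp
    with f show ?thesis by simp
  qed
  then show ?case by (intro exI[of _ 1] conjI zero_le_one allI impI)
next
  case (Suc k)
  then obtain C where C: "0 \<le> C" "\<forall>L A f Z. 1 \<le> L \<longrightarrow> Qb L k A f \<longrightarrow> (\<forall>X. Z differentiable (at X)) \<longrightarrow>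
    (\<forall>e\<in>Basis. Qb L (k - 1) B (dirderiv e Z)) \<longrightarrow> Qb L k (C * A) (\<lambda>X. f (pt (X $ 1) (Z X)))"
    by blast
  define C' where "C' = max 1 (2^k * C + 2^k * B * C)"
  have "Qb L (Suc k) (C' * A) (\<lambda>X. f (pt (X $ 1) (Z X)))"
    if L: "1 \<le> L" and f: "Qb L (Suc k) A f" and Z: "\<forall>X. Z differentiable (at X)"
      "\<forall>e\<in>Basis. Qb L k B (dirderiv e Z)" for L A f Z
  proof -
    have A: "0 \<le> A" using Qb_nonneg f by blast
    have df: "f differentiable (at X)" for X using f by auto
    have dZ: "Z differentiable (at X)" for X using Z by auto
    have Z': "\<forall>e\<in>Basis. Qb L (k - 1) B (dirderiv e Z)" using Z(2) Qb_lower[OF L] by fastforce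
    have fT: "Qb L k (C * (A * L)) (\<lambda>X. dirderiv e f (pt (X $ 1) (Z X)))" if "e \<in> Basis" for e
      using C(2) L f Z(1) Z' that by simp
    have "Qb L k (2^k * 1 * (C * (A * L)) + 2^k * B * (C * (A * L))) (dirderiv e (\<lambda>X. f (pt (X $ 1) (Z X))))"
      if e: "e \<in> Basis" for e
      unfolding dirderiv_graph_comp(1)[OF df dZ, abs_def] using f Z e
      by (intro Qb_add Qb_mult L Qb_const fT) (auto simp: Basis_vec2)
    moreover have "2^k * 1 * (C * (A * L)) + 2^k * B * (C * (A * L)) \<le> C' * A * L"
    proof -
      have "2^k * 1 * (C * (A * L)) + 2^k * B * (C * (A * L)) = (2^k * C + 2^k * B * C) * (A * L)"
        by (simp add: algebra_simps)
      also have "\<dots> \<le> C' * (A * L)" using L A by (intro mult_right_mono) (auto simp: C'_def)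
      finally show ?thesis by (simp add: mult.assoc)
    qed
    ultimately have "Qb L k (C' * A * L) (dirderiv e (\<lambda>X. f (pt (X $ 1) (Z X))))" if "e \<in> Basis" for e
      using Qb_mono[OF L] that by blast
    moreover have "\<bar>f (pt (X $ 1) (Z X))\<bar> \<le> C' * A" for X
      using Qb_bound[OF f, of "pt (X $ 1) (Z X)"] mult_right_mono[of 1 C' A] A by (simp add: C'_def)
    ultimately show ?thesis using dirderiv_graph_comp(2)[OF df dZ] by (simp only: Qb.simps) simp
  qed
  moreover have "0 \<le> C'" by (simp add: C'_def le_max_iff_disj)
  ultimately show ?case by (simp only: diff_Suc_1) blast
qed

text \<open>One derivative is free of charge: order \<open>i + 1\<close> is bounded by
  \<open>B * L^i\<close>. This is the shape of the gradient of \<psi> and \<eta>, whose first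
  derivatives H^4 controls pointwise. At order \<open>n + 1\<close> only \<open>L^n\<close> is lost,
  which matches the H^(4+n) norm exactly.\<close>

definition SS :: "real \<Rightarrow> nat \<Rightarrow> real \<Rightarrow> (real^2 \<Rightarrow> real) \<Rightarrow> bool" where
  "SS L k B g \<longleftrightarrow> (\<forall>X. \<bar>g X\<bar> \<le> B) \<and> (\<forall>X. g differentiable (at X)) \<and> (\<forall>e\<in>Basis. Qb L k B (dirderiv e g))"

lemma SSD:
  assumes "SS L k B g"
  shows "\<bar>g X\<bar> \<le> B" "g differentiable (at X)" "e \<in> Basis \<Longrightarrow> Qb L k B (dirderiv e g)" "0 \<le> B"
proof -
  show "\<bar>g X\<bar> \<le> B" "g differentiable (at X)" "e \<in> Basis \<Longrightarrow> Qb L k B (dirderiv e g)"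
    using assms by (auto simp: SS_def)
  then show "0 \<le> B" by linarith
qed

lemma SS_mono: "1 \<le> L \<Longrightarrow> SS L k A g \<Longrightarrow> A \<le> B \<Longrightarrow> SS L k B g"
  unfolding SS_def using Qb_mono by (metis order_trans)

lemma SS_lower: "1 \<le> L \<Longrightarrow> SS L k A g \<Longrightarrow> j \<le> k \<Longrightarrow> SS L j A g"
  unfolding SS_def using Qb_lower by blast

lemma SS_imp_Qb_Suc:
  assumes L: "1 \<le> L" and g: "SS L k B g"
  shows "Qb L (Suc k) B g"
proof -
  have "B \<le> B * L" using SSD(4)[OF g] L by (simp add: mult_le_cancel_left1)
  then have "Qb L k (B * L) (dirderiv e g)" if "e \<in> Basis" for e
    using Qb_mono[OF L SSD(3)[OF g that]] by blast
  then show ?thesis using g by (simp add: SS_def)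
qed

lemma SS_imp_Qb: "1 \<le> L \<Longrightarrow> SS L k B g \<Longrightarrow> Qb L k B g"
  using SS_imp_Qb_Suc Qb_Suc_lower by blast

lemma SS_const: "1 \<le> L \<Longrightarrow> \<bar>c\<bar> \<le> A \<Longrightarrow> SS L k A (\<lambda>X. c)"
proof -
  assume a: "1 \<le> L" "\<bar>c\<bar> \<le> A"
  have "dirderiv e (\<lambda>X. c) = (\<lambda>X. 0)" for e :: "real^2" by (simp add: fun_eq_iff)
  moreover have "Qb L k A (\<lambda>X. 0)" using a by (intro Qb_const) auto
  ultimately show ?thesis using a by (simp add: SS_def)
qed

lemma SS_add:
  assumes f: "SS L k A f" and g: "SS L k B g"
  shows "SS L k (A + B) (\<lambda>X. f X + g X)"
proof -
  have d: "dirderiv e (\<lambda>X. f X + g X) = (\<lambda>X. dirderiv e f X + dirderiv e g X)" for e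
    by (intro ext dirderiv_add SSD(2)[OF f] SSD(2)[OF g])
  have "Qb L k (A + B) (dirderiv e (\<lambda>X. f X + g X))" if "e \<in> Basis" for e
    unfolding d by (intro Qb_add SSD(3)[OF f that] SSD(3)[OF g that])
  moreover have "\<bar>f X + g X\<bar> \<le> A + B" for X using SSD(1)[OF f, of X] SSD(1)[OF g, of X] by linarith
  ultimately show ?thesis using SSD(2)[OF f] SSD(2)[OF g] by (simp add: SS_def)
qed

lemma SS_mult:
  assumes L: "1 \<le> L" and f: "SS L k A f" and g: "SS L k B g"
  shows "SS L k (2 ^ Suc k * A * B) (\<lambda>X. f X * g X)"
proof -
  have d: "dirderiv e (\<lambda>X. f X * g X) = (\<lambda>X. dirderiv e f X * g X + f X * dirderiv e g X)" for e
    by (intro ext dirderiv_mult SSD(2)[OF f] SSD(2)[OF g])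
  have "Qb L k (2^k * A * B + 2^k * A * B) (dirderiv e (\<lambda>X. f X * g X))" if "e \<in> Basis" for e
    unfolding d by (intro Qb_add Qb_mult L SSD(3)[OF f that] SSD(3)[OF g that] SS_imp_Qb[OF L f] SS_imp_Qb[OF L g])
  moreover have "2^k * A * B + 2^k * A * B = 2 ^ Suc k * A * B" by simp
  moreover have "\<bar>f X * g X\<bar> \<le> 2 ^ Suc k * A * B" for X
  proof -
    have "\<bar>f X * g X\<bar> \<le> 1 * (A * B)"
      using SSD(1)[OF f, of X] SSD(1)[OF g, of X] SSD(4)[OF f] by (simp add: abs_mult mult_mono)
    also have "\<dots> \<le> 2 ^ Suc k * (A * B)"
      using SSD(4)[OF f] SSD(4)[OF g] by (intro mult_right_mono one_le_power) auto
    finally show ?thesis by (simp add: mult.assoc)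
  qed
  ultimately show ?thesis using SSD(2)[OF f] SSD(2)[OF g] by (simp add: SS_def)
qed

lemma SS_uminus: "1 \<le> L \<Longrightarrow> SS L k A f \<Longrightarrow> SS L k A (\<lambda>X. - f X)"
proof -
  assume L: "1 \<le> L" and f: "SS L k A f"
  have "dirderiv e (\<lambda>X. - f X) = (\<lambda>X. - dirderiv e f X)" for e
    by (intro ext dirderiv_uminus SSD(2)[OF f])
  then have "Qb L k A (dirderiv e (\<lambda>X. - f X))" if "e \<in> Basis" for e
    using Qb_uminus[OF SSD(3)[OF f that]] by simp
  then show ?thesis using SSD(1,2)[OF f] by (simp add: SS_def differentiable_minus)
qed

lemma SS_inverse:
  assumes "0 < c"
  shows "\<exists>C\<ge>0. \<forall>L f. 1 \<le> L \<longrightarrow> SS L k A f \<longrightarrow> (\<forall>X. c \<le> f X) \<longrightarrow> SS L k C (\<lambda>X. 1 / f X)"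
proof -
  obtain C where C: "0 \<le> C" "\<forall>L f. 1 \<le> L \<longrightarrow> Qb L k A f \<longrightarrow> (\<forall>X. c \<le> f X) \<longrightarrow> Qb L k C (\<lambda>X. 1 / f X)"
    using Qb_inverse[OF assms] by blast
  define C' where "C' = max C (2^k * A * (2^k * C * C))"
  have "SS L k C' (\<lambda>X. 1 / f X)" if L: "1 \<le> L" and f: "SS L k A f" "\<forall>X. c \<le> f X" for L f
  proof -
    have p: "0 < f X" for X using f(2) assms by (meson less_le_trans)
    have dr: "((\<lambda>t. 1 / t) has_real_derivative - (1 / f X * (1 / f X))) (at (f X))" for X
      using p[of X] by (auto intro!: derivative_eq_intros simp: power2_eq_square field_simps)
    have d: "dirderiv e (\<lambda>X. 1 / f X) = (\<lambda>X. - (dirderiv e f X * (1 / f X * (1 / f X))))" for e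
      using dirderiv_real_comp(1)[OF SSD(2)[OF f(1)] dr] by (intro ext) simp
    have inv: "Qb L k C (\<lambda>X. 1 / f X)" using C(2) L SS_imp_Qb[OF L f(1)] f(2) by blast
    have "Qb L k C' (dirderiv e (\<lambda>X. 1 / f X))" if "e \<in> Basis" for e
    proof -
      have "Qb L k (2^k * A * (2^k * C * C)) (dirderiv e (\<lambda>X. 1 / f X))"
        unfolding d by (intro Qb_uminus Qb_mult L inv SSD(3)[OF f(1) that])
      then show ?thesis by (rule Qb_mono[OF L]) (simp add: C'_def)
    qed
    moreover have "\<bar>1 / f X\<bar> \<le> C'" for X using Qb_bound[OF inv, of X] by (simp add: C'_def)
    ultimately show ?thesis using dirderiv_real_comp(2)[OF SSD(2)[OF f(1)] dr] by (simp add: SS_def)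
  qed
  moreover have "0 \<le> C'" using C(1) by (simp add: C'_def)
  ultimately show ?thesis by blast
qed


section \<open>Primitives and averages in the first variable\<close>

lemma integral_param_continuous:
  fixes F :: "'a::topological_space \<Rightarrow> real \<Rightarrow> 'b::banach"
  assumes "continuous_on UNIV (\<lambda>(x, t). F x t)"
  shows "continuous_on UNIV (\<lambda>x. integral {a..b} (F x))"
  using integral_continuous_on_param[of UNIV a b F] assms continuous_on_subset by fastforce

lemma integral_param_deriv:
  fixes F :: "real \<Rightarrow> real \<Rightarrow> real"
  assumes d: "\<And>y t. ((\<lambda>y. F y t) has_real_derivative F' y t) (at y)"
    and c: "continuous_on UNIV (\<lambda>(y, t). F y t)" and c': "continuous_on UNIV (\<lambda>(y, t). F' y t)"
  shows "((\<lambda>y. integral {a..b} (F y)) has_real_derivative integral {a..b} (F' y)) (at y)"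
proof -
  have "continuous_on {a..b} (F y)" for y
  proof -
    have "continuous_on {a..b} (\<lambda>t. case (y, t) of (y, t) \<Rightarrow> F y t)"
      by (rule continuous_on_compose2[OF c]) (auto intro: continuous_on_Pair)
    then show ?thesis by simp
  qed
  then have i: "F y integrable_on {a..b}" for y by (rule integrable_continuous_real)
  have "continuous_on (UNIV \<times> cbox a b) (\<lambda>(y, t). F' y t)" using c' continuous_on_subset by blast
  from leibniz_rule_field_derivative[where U = UNIV and f = F and fx = F' and a = a and b = b, OF _ _ this]
  show ?thesis using d i by simp
qed

lemma continuous_on_case_prodI:
  "continuous_on UNIV (\<lambda>p. F (fst p) (snd p)) \<Longrightarrow> continuous_on UNIV (\<lambda>(x, y). F x y)"
  by (simp add: case_prod_unfold)

lemma continuous_on_slice: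
  assumes "continuous_on UNIV (h :: real^2 \<Rightarrow> real)"
  shows "continuous_on S (\<lambda>x. h (pt x b))" "continuous_on S (\<lambda>y. h (pt a y))"
  by (intro continuous_on_comp_pt[OF assms] continuous_on_id continuous_on_const)+


text \<open>The primitive from 0 to x_1, written over the fixed interval [0,1]: negative x_1 then
  needs no oriented integral, and differentiation in x_2 is differentiation under an integral with
  fixed endpoints.\<close>

definition Int1 :: "(real^2 \<Rightarrow> real) \<Rightarrow> real^2 \<Rightarrow> real" where
  "Int1 h X = X $ 1 * integral {0..1} (\<lambda>t. h (pt (t * X $ 1) (X $ 2)))"

text \<open>The average is regarded as a function on the plane, so that \<open>Qb\<close> and
  \<open>dirderiv\<close> apply to it.\<close>

definition Av1 :: "(real^2 \<Rightarrow> real) \<Rightarrow> real^2 \<Rightarrow> real" where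
  "Av1 h X = average_z1 h (X $ 2)"

lemma scaled_integral_antiderivative:
  fixes h :: "real \<Rightarrow> real"
  assumes c: "continuous_on UNIV h" and g: "\<And>x. \<bar>x\<bar> \<le> R \<Longrightarrow> (g has_real_derivative h x) (at x)" and x: "\<bar>x\<bar> \<le> R"
  shows "x * integral {0..1} (\<lambda>t. h (t * x)) = g x - g 0"
proof -
  have *: "((\<lambda>t. g (t * x)) has_vector_derivative h (t * x) * x) (at t within {0..1})" if "t \<in> {0..1}" for t
  proof -
    have "\<bar>t * x\<bar> \<le> R"
      using that x mult_right_mono[of t 1 "\<bar>x\<bar>"] by (auto simp: abs_mult)
    then have "(g has_real_derivative h (t * x)) (at (t * x))" by (rule g)
    then have "((\<lambda>t. g (t * x)) has_real_derivative h (t * x) * x) (at t)"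
      by (rule DERIV_chain2[where g = "\<lambda>t. t * x"]) (auto intro!: derivative_eq_intros)
    then show ?thesis
      by (auto simp: has_real_derivative_iff_has_vector_derivative[symmetric]
          intro: has_field_derivative_at_within)
  qed
  have "((\<lambda>t. h (t * x) * x) has_integral g (1 * x) - g (0 * x)) {0..1}"
    by (rule fundamental_theorem_of_calculus) (use * in auto)
  then have "integral {0..1} (\<lambda>t. h (t * x) * x) = g x - g 0"
    by (rule integral_unique[THEN trans]) simp
  then show ?thesis by (simp add: mult.commute)
qed

text \<open>Near \<open>x\<close> the scaled integral differs by a constant from an antiderivative
  on a compact interval. The local choice is thus replaced by one formula valid on the whole
  line.\<close>

lemma antiderivative_UNIV:
  fixes h :: "real \<Rightarrow> real"
  assumes c: "continuous_on UNIV h"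
  shows "((\<lambda>x. x * integral {0..1} (\<lambda>t. h (t * x))) has_real_derivative h x) (at x)"
proof -
  define R where "R = \<bar>x\<bar> + 1"
  obtain g where g0: "\<And>u. u \<in> {-R-1..R+1} \<Longrightarrow> (g has_vector_derivative h u) (at u within {-R-1..R+1})"
    using antiderivative_continuous[of "-R-1" "R+1" h] c continuous_on_subset by blast
  then have g: "(g has_real_derivative h u) (at u)" if "\<bar>u\<bar> \<le> R" for u
  proof -
    have "at u within {-R-1..R+1} = at u" using that by (intro at_within_interior) auto
    moreover have "(g has_vector_derivative h u) (at u within {-R-1..R+1})" using that by (intro g0) auto
    ultimately show ?thesis by (simp add: has_real_derivative_iff_has_vector_derivative)
  qed
  have eq: "g u - g 0 = u * integral {0..1} (\<lambda>t. h (t * u))" if "u \<in> {-R<..<R}" for u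
    using scaled_integral_antiderivative[OF c g, of R u] that by auto
  have "((\<lambda>u. g u - g 0) has_real_derivative h x) (at x)"
    using DERIV_diff[OF g[of x] DERIV_const] by (simp add: R_def)
  then show ?thesis
    by (rule has_field_derivative_transform_within_open[where S = "{-R<..<R}"])
      (use eq in \<open>auto simp: R_def\<close>)
qed

lemma Int1_continuous:
  assumes "continuous_on UNIV h"
  shows "continuous_on UNIV (Int1 h)"
proof -
  have "continuous_on UNIV (\<lambda>(X :: real^2, t). h (pt (t * X $ 1) (X $ 2)))"
    by (intro continuous_on_case_prodI continuous_on_comp_pt[OF assms]) (intro continuous_intros)+
  then have "continuous_on UNIV (\<lambda>X :: real^2. integral {0..1} (\<lambda>t. h (pt (t * X $ 1) (X $ 2))))"
    by (rule integral_param_continuous)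
  then show ?thesis unfolding Int1_def[abs_def] by (intro continuous_intros)
qed

lemma Int1_deriv1:
  assumes "continuous_on UNIV h"
  shows "((\<lambda>x. Int1 h (pt x b)) has_real_derivative h (pt a b)) (at a)"
  using antiderivative_UNIV[OF continuous_on_slice(1)[OF assms], of b a] by (simp add: Int1_def)

lemma Int1_deriv2:
  assumes d: "\<And>X. h differentiable (at X)" and c: "continuous_on UNIV (D2 h)"
  shows "((\<lambda>y. Int1 h (pt a y)) has_real_derivative Int1 (D2 h) (pt a b)) (at b)"
proof -
  have "continuous_on UNIV h" by (rule differentiable_continuous_UNIV[OF d])
  then have c1: "continuous_on UNIV (\<lambda>(y, t). h (pt (t * a) y))" 
    by (intro continuous_on_case_prodI, rule continuous_on_comp_pt) (auto intro!: continuous_intros)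
  have c2: "continuous_on UNIV (\<lambda>(y, t). D2 h (pt (t * a) y))" 
    by (intro continuous_on_case_prodI continuous_on_comp_pt[OF c]) (intro continuous_intros)+
  have "((\<lambda>y. integral {0..1} (\<lambda>t. h (pt (t * a) y))) has_real_derivative
      integral {0..1} (\<lambda>t. D2 h (pt (t * a) b))) (at b)"
    by (rule integral_param_deriv[OF _ c1 c2]) (rule has_real_derivative_D1(2)[OF d])
  from DERIV_cmult[OF this, of a] show ?thesis by (simp add: Int1_def)
qed

lemma Int1_D:
  assumes d: "\<And>X. h differentiable (at X)" and c: "continuous_on UNIV (D2 h)"
  shows "Int1 h differentiable (at X)" "D1 (Int1 h) = h" "D2 (Int1 h) = Int1 (D2 h)"
proof -
  have "continuous_on UNIV h" by (rule differentiable_continuous_UNIV[OF d])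
  note * = dirderiv_partials_vec2[of "Int1 h" h "Int1 (D2 h)",
      OF Int1_deriv1[OF this] Int1_deriv2[OF d c] Int1_continuous[OF c]]
  show "Int1 h differentiable (at X)" "D1 (Int1 h) = h" "D2 (Int1 h) = Int1 (D2 h)" using * by auto
qed

lemma Av1_continuous:
  assumes "continuous_on UNIV h"
  shows "continuous_on UNIV (Av1 h)"
proof -
  have "continuous_on UNIV (\<lambda>(X :: real^2, s). h (pt s (X $ 2)))"
    by (intro continuous_on_case_prodI continuous_on_comp_pt[OF assms]) (intro continuous_intros)+
  then have "continuous_on UNIV (\<lambda>X :: real^2. integral {0..2*pi} (\<lambda>s. h (pt s (X $ 2))))"
    by (rule integral_param_continuous)
  then show ?thesis unfolding Av1_def[abs_def] average_z1_def by (intro continuous_intros)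
qed

lemma Av1_D:
  assumes d: "\<And>X. h differentiable (at X)" and c: "continuous_on UNIV (D2 h)"
  shows "Av1 h differentiable (at X)" "D1 (Av1 h) = (\<lambda>X. 0)" "D2 (Av1 h) = Av1 (D2 h)"
proof -
  have "continuous_on UNIV h" by (rule differentiable_continuous_UNIV[OF d])
  then have c1: "continuous_on UNIV (\<lambda>(y, s). h (pt s y))" 
    by (intro continuous_on_case_prodI, rule continuous_on_comp_pt) (auto intro!: continuous_intros)
  have c2: "continuous_on UNIV (\<lambda>(y, s). D2 h (pt s y))" 
    by (intro continuous_on_case_prodI continuous_on_comp_pt[OF c]) (intro continuous_intros)+
  have "((\<lambda>y. integral {0..2*pi} (\<lambda>s. h (pt s y))) has_real_derivative
      integral {0..2*pi} (\<lambda>s. D2 h (pt s b))) (at b)" for b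
    by (rule integral_param_deriv[OF _ c1 c2]) (rule has_real_derivative_D1(2)[OF d])
  from DERIV_cmult[OF this, of "1 / (2*pi)"]
  have 2: "((\<lambda>y. Av1 h (pt a y)) has_real_derivative Av1 (D2 h) (pt a b)) (at b)" for a b
    by (simp add: Av1_def average_z1_def)
  have 1: "((\<lambda>x. Av1 h (pt x b)) has_real_derivative 0) (at a)" for a b
    by (simp add: Av1_def)
  note * = dirderiv_partials_vec2[of "Av1 h" "\<lambda>X. 0" "Av1 (D2 h)", OF 1 2 Av1_continuous[OF c]]
  show "Av1 h differentiable (at X)" "D1 (Av1 h) = (\<lambda>X. 0)" "D2 (Av1 h) = Av1 (D2 h)" using * by auto
qed

lemma Av1_ge:
  assumes "continuous_on UNIV h" "\<And>X. c \<le> h X"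
  shows "c \<le> Av1 h X"
proof -
  have "integral {0..2*pi} (\<lambda>s. c) \<le> integral {0..2*pi} (\<lambda>s. h (pt s (X $ 2)))"
    by (intro integral_le integrable_continuous_real continuous_on_slice assms continuous_on_const)
  then show ?thesis by (simp add: Av1_def average_z1_def field_simps)
qed

lemma Av1_le:
  assumes "continuous_on UNIV h" "\<And>X. h X \<le> c"
  shows "Av1 h X \<le> c"
proof -
  have "integral {0..2*pi} (\<lambda>s. c) \<ge> integral {0..2*pi} (\<lambda>s. h (pt s (X $ 2)))"
    by (intro integral_le integrable_continuous_real continuous_on_slice assms continuous_on_const)
  then show ?thesis by (simp add: Av1_def average_z1_def field_simps)
qed

lemma Av1_bound:
  assumes "continuous_on UNIV h" "\<And>X. \<bar>h X\<bar> \<le> c"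
  shows "\<bar>Av1 h X\<bar> \<le> c"
proof -
  have "h X \<le> c" "- c \<le> h X" for X using assms(2)[of X] by auto
  with Av1_ge[OF assms(1), of "-c" X] Av1_le[OF assms(1), of c X] show ?thesis by auto
qed

lemma Av1_const [simp]: "Av1 (\<lambda>X. c) X = c"
  by (simp add: Av1_def average_z1_def)

lemma Av1_diff:
  assumes "continuous_on UNIV h" "continuous_on UNIV g"
  shows "Av1 (\<lambda>X. h X - g X) X = Av1 h X - Av1 g X"
  unfolding Av1_def average_z1_def right_diff_distrib[symmetric]
  by (subst integral_diff) (auto intro: integrable_continuous_real continuous_on_slice assms)

lemma Qb_Av1:
  assumes L: "1 \<le> L"
  shows "Qb L k A h \<Longrightarrow> Qb L k A (Av1 h)"
proof (induction k arbitrary: A h)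
  case 0
  then show ?case using Av1_bound Av1_continuous by simp
next
  case (Suc k)
  have d: "\<And>X. h differentiable (at X)" using Suc.prems by simp
  have D2: "Qb L k (A * L) (D2 h)" using Suc.prems by (simp add: Basis_vec2)
  note * = Av1_D[OF d Qb_continuous[OF D2]]
  have "0 \<le> A * L" using Qb_nonneg[OF D2] .
  then have "Qb L k (A * L) (\<lambda>X. 0)" by (intro Qb_const[OF L]) simp
  with * Suc.IH[OF D2] show ?case
    using Av1_bound[OF Qb_continuous[OF Suc.prems] Qb_bound[OF Suc.prems]] by (simp add: Basis_vec2)
qed


section \<open>Primitives of odd periodic functions\<close>

definition per1 :: "(real^2 \<Rightarrow> real) \<Rightarrow> bool" where
  "per1 h \<longleftrightarrow> (\<forall>a b. h (pt (a + 2 * pi) b) = h (pt a b))"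

lemma Int1_even:
  assumes "odd1 h" shows "even1 (Int1 h)"
proof -
  have "integral {0..1} (\<lambda>t. h (pt (- (t * a)) b)) = - integral {0..1} (\<lambda>t. h (pt (t * a) b))" for a b
    using assms by (simp add: odd1_def)
  then show ?thesis by (simp add: even1_def Int1_def)
qed

text \<open>By periodicity of \<open>h\<close> the increment of the primitive over a period does not
  depend on the starting point; from \<open>- pi\<close> to \<open>pi\<close> it vanishes because
  the primitive is even. This is the step that excludes a drift of the solutions.\<close>

lemma Int1_per:
  assumes c: "continuous_on UNIV h" and o: "odd1 h" and p: "per1 h"
  shows "per1 (Int1 h)"
  unfolding per1_def
proof (intro allI)
  fix a b
  have d: "((\<lambda>x. Int1 h (pt (x + 2 * pi) b) - Int1 h (pt x b)) has_real_derivative 0) (at x)" for x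
  proof -
    have "((\<lambda>x. Int1 h (pt (x + 2 * pi) b)) has_real_derivative h (pt (x + 2 * pi) b) * 1) (at x)"
      by (rule DERIV_chain2[OF Int1_deriv1[OF c]]) (auto intro!: derivative_eq_intros)
    from DERIV_diff[OF this Int1_deriv1[OF c, of b x]] show ?thesis using p by (simp add: per1_def)
  qed
  have "Int1 h (pt (a + 2 * pi) b) - Int1 h (pt a b) = Int1 h (pt (- pi + 2 * pi) b) - Int1 h (pt (- pi) b)"
    using DERIV_isconst_all[of "\<lambda>x. Int1 h (pt (x + 2 * pi) b) - Int1 h (pt x b)" a "- pi"] d by blast
  also have "\<dots> = 0" using Int1_even[OF o] by (simp add: even1_def)
  finally show "Int1 h (pt (a + 2 * pi) b) = Int1 h (pt a b)" by simp
qed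

lemma per1_int: "per1 h \<Longrightarrow> h (pt (a + 2 * pi * of_int n) b) = h (pt a b)"
proof (induction n rule: int_induct[where k = 0])
  case (step1 i)
  have "a + 2 * pi * of_int (i + 1) = (a + 2 * pi * of_int i) + 2 * pi" by (simp add: algebra_simps)
  with step1 show ?case by (metis per1_def)
next
  case (step2 i)
  have "a + 2 * pi * of_int i = (a + 2 * pi * of_int (i - 1)) + 2 * pi" by (simp add: algebra_simps)
  with step2 show ?case by (metis per1_def)
qed simp

lemma per1_reduce:
  assumes "per1 h" obtains c where "0 \<le> c" "c \<le> 2 * pi" "h (pt a b) = h (pt c b)"
proof
  define n where "n = - \<lfloor>a / (2 * pi)\<rfloor>"
  have "h (pt (a + 2 * pi * of_int n) b) = h (pt a b)" by (rule per1_int[OF assms])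
  then show "h (pt a b) = h (pt (a + 2 * pi * of_int n) b)" by simp
  have "of_int \<lfloor>a / (2 * pi)\<rfloor> \<le> a / (2 * pi)" "a / (2 * pi) \<le> of_int \<lfloor>a / (2 * pi)\<rfloor> + 1" by linarith+
  then show "0 \<le> a + 2 * pi * of_int n" "a + 2 * pi * of_int n \<le> 2 * pi"
    using mult_right_mono[of "of_int \<lfloor>a / (2 * pi)\<rfloor>" "a / (2 * pi)" "2 * pi"]
      mult_right_mono[of "a / (2 * pi)" "of_int \<lfloor>a / (2 * pi)\<rfloor> + 1" "2 * pi"]
    by (auto simp: n_def algebra_simps)
qed

text \<open>Periodicity reduces x_1 to [0, 2 pi], which turns the linear growth of a primitive into
  a uniform bound.\<close>

lemma Int1_bound:
  assumes c: "continuous_on UNIV h" and o: "odd1 h" and p: "per1 h" and b: "\<And>X. \<bar>h X\<bar> \<le> A"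
  shows "\<bar>Int1 h X\<bar> \<le> 2 * pi * A"
proof -
  obtain x where x: "0 \<le> x" "x \<le> 2 * pi" "Int1 h (pt (X $ 1) (X $ 2)) = Int1 h (pt x (X $ 2))"
    using per1_reduce[OF Int1_per[OF c o p]] by metis
  have "norm (integral {0..1} (\<lambda>t. h (pt (t * x) (X $ 2)))) \<le> A * (1 - 0)"
    using b by (intro integral_bound continuous_on_comp_pt[OF c] continuous_on_mult_right continuous_on_id continuous_on_const) auto
  then have "\<bar>Int1 h (pt x (X $ 2))\<bar> \<le> (2 * pi) * A"
    using x b[of X] by (auto simp: Int1_def abs_mult intro!: mult_mono)
  with x(3) show ?thesis by simp
qed

lemma D2_odd1_per1:
  fixes h :: "real^2 \<Rightarrow> real"
  assumes d: "\<And>X. h differentiable (at X)"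
  shows "odd1 h \<Longrightarrow> odd1 (D2 h)" "per1 h \<Longrightarrow> per1 (D2 h)"
proof -
  note D = has_real_derivative_D1(2)[OF d]
  show "odd1 (D2 h)" if "odd1 h"
    unfolding odd1_def
  proof (intro allI)
    fix a b
    have "((\<lambda>y. - h (pt a y)) has_real_derivative D2 h (pt (- a) b)) (at b)"
      using D[of "- a" b] that by (simp add: odd1_def)
    from DERIV_unique[OF this DERIV_minus[OF D[of a b]]] show "D2 h (pt (- a) b) = - D2 h (pt a b)" .
  qed
  show "per1 (D2 h)" if "per1 h"
    unfolding per1_def
  proof (intro allI)
    fix a b
    have "((\<lambda>y. h (pt a y)) has_real_derivative D2 h (pt (a + 2 * pi) b)) (at b)"
      using D[of "a + 2 * pi" b] that by (simp add: per1_def)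
    from DERIV_unique[OF this D[of a b]] show "D2 h (pt (a + 2 * pi) b) = D2 h (pt a b)" .
  qed
qed

text \<open>\<open>D1\<close> undoes the primitive and \<open>D2\<close> passes under it, preserving
  oddness and period in x_1; so no derivative is lost in either direction.\<close>

lemma Qb_Int1:
  assumes L: "1 \<le> L"
  shows "Qb L k A h \<Longrightarrow> odd1 h \<Longrightarrow> per1 h \<Longrightarrow> Qb L k (2 * pi * A) (Int1 h)"
proof (induction k arbitrary: A h)
  case 0
  then show ?case using Int1_bound[of h A] Int1_continuous by simp
next
  case (Suc k)
  have d: "\<And>X. h differentiable (at X)" using Suc.prems by simp
  have D2: "Qb L k (A * L) (D2 h)" using Suc.prems by (simp add: Basis_vec2)
  note * = Int1_D[OF d Qb_continuous[OF D2]]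
  have A: "0 \<le> A" using Qb_nonneg[OF Suc.prems(1)] .
  have "1 \<le> (2 * pi) * L" using L pi_gt3 mult_mono[of 1 "2*pi" 1 L] by simp
  then have "A \<le> 2 * pi * A * L" using A mult_left_mono[of 1 "(2 * pi) * L" A] by (simp add: algebra_simps)
  then have "Qb L k (2 * pi * A * L) h" using Qb_mono[OF L Qb_Suc_lower[OF L Suc.prems(1)]] by blast
  moreover have "Qb L k (2 * pi * A * L) (Int1 (D2 h))"
    using Suc.IH[OF D2 D2_odd1_per1[OF d]] Suc.prems(2,3) by (simp add: mult.assoc)
  moreover have "\<bar>Int1 h X\<bar> \<le> 2 * pi * A" for X
    using Int1_bound[OF Qb_continuous[OF Suc.prems(1)] Suc.prems(2,3) Qb_bound[OF Suc.prems(1)]] .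
  ultimately show ?case using * by (simp add: Basis_vec2)
qed


section \<open>Comparison of solutions of a scalar equation\<close>

lemma integral_periodic_shift:
  fixes h :: "real \<Rightarrow> real"
  assumes c: "continuous_on UNIV h" and p: "\<And>x. h (x + p) = h x" and "0 \<le> p"
  shows "integral {0..p} (\<lambda>s. h (s + d)) = integral {0..p} h"
proof -
  define A where "A x = x * integral {0..1} (\<lambda>t. h (t * x))" for x
  have A: "(A has_real_derivative h x) (at x)" for x
    unfolding A_def[abs_def] by (rule antiderivative_UNIV[OF c])
  have A': "((\<lambda>s. A (s + d)) has_real_derivative h (s + d)) (at s)" for s d
    using A[of "s + d"] by (simp add: DERIV_shift)
  have "((\<lambda>s. h (s + d)) has_integral A (p + d) - A (0 + d)) {0..p}" for d
    using A' \<open>0 \<le> p\<close> by (intro fundamental_theorem_of_calculus)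
      (auto simp: has_real_derivative_iff_has_vector_derivative[symmetric] intro: has_field_derivative_at_within)
  then have I: "integral {0..p} (\<lambda>s. h (s + d)) = A (p + d) - A (0 + d)" for d
    by (rule integral_unique)
  have "((\<lambda>s. A (s + p) - A s) has_real_derivative 0) (at s)" for s
    using DERIV_diff[OF A'[of p s] A[of s]] p by simp
  then have "A (d + p) - A d = A (0 + p) - A 0"
    using DERIV_isconst_all[of "\<lambda>s. A (s + p) - A s" d 0] by blast
  then show ?thesis using I[of d] I[of 0] by (simp add: add.commute)
qed

text \<open>Hadamard's form of the quotient (f(s,u) - f(s,v)) / (u - v). It extends continuously to
  \<open>u = v\<close>, with value \<open>D2 f\<close>, and needs no more than continuity of
  \<open>D2 f\<close>.\<close>

definition slope2 :: "(real^2 \<Rightarrow> real) \<Rightarrow> real \<Rightarrow> real \<Rightarrow> real \<Rightarrow> real" where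
  "slope2 f s u v = integral {0..1} (\<lambda>t. D2 f (pt s (v + t * (u - v))))"

lemma slope2_eq:
  assumes d: "\<And>X. f differentiable (at X)" and c: "continuous_on UNIV (D2 f)"
  shows "f (pt s u) - f (pt s v) = slope2 f s u v * (u - v)"
proof -
  have *: "((\<lambda>t. f (pt s (v + t * (u - v)))) has_real_derivative D2 f (pt s (v + t * (u - v))) * (u - v)) (at t)" for t
    by (rule DERIV_chain2[OF has_real_derivative_D1(2)[OF d]]) (auto intro!: derivative_eq_intros)
  have "((\<lambda>t. D2 f (pt s (v + t * (u - v))) * (u - v)) has_integral
      f (pt s (v + 1 * (u - v))) - f (pt s (v + 0 * (u - v)))) {0..1}"
    using * by (intro fundamental_theorem_of_calculus)
      (auto simp: has_real_derivative_iff_has_vector_derivative[symmetric] intro: has_field_derivative_at_within)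
  then have "integral {0..1} (\<lambda>t. D2 f (pt s (v + t * (u - v))) * (u - v)) = f (pt s u) - f (pt s v)"
    by (rule integral_unique[THEN trans]) simp
  then show ?thesis by (simp add: slope2_def)
qed

lemma slope2_same [simp]: "slope2 f s u u = D2 f (pt s u)"
  by (simp add: slope2_def)

lemma slope2_continuous:
  fixes a b c :: "'a::topological_space \<Rightarrow> real"
  assumes f: "continuous_on UNIV (D2 f)" and "continuous_on UNIV a" "continuous_on UNIV b" "continuous_on UNIV c"
  shows "continuous_on UNIV (\<lambda>x. slope2 f (a x) (b x) (c x))"
proof -
  have fst: "continuous_on UNIV (\<lambda>p :: 'a \<times> real. g (fst p))" if "continuous_on UNIV g" for g :: "'a \<Rightarrow> real"
    by (rule continuous_on_compose2[OF that]) (auto intro: continuous_on_fst continuous_on_id)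
  have "continuous_on UNIV (\<lambda>(x, t). D2 f (pt (a x) (c x + t * (b x - c x))))"
    by (intro continuous_on_case_prodI continuous_on_comp_pt[OF f] continuous_on_add continuous_on_mult
        continuous_on_diff fst assms continuous_on_snd continuous_on_id)
  then show ?thesis unfolding slope2_def by (rule integral_param_continuous)
qed

lemma linear_ode_solution:
  fixes D q :: "real \<Rightarrow> real"
  assumes q: "continuous_on UNIV q" and D: "\<And>x. (D has_real_derivative q x * D x) (at x)"
  shows "D x = D 0 * exp (x * integral {0..1} (\<lambda>t. q (t * x)))"
proof -
  define Q where "Q x = x * integral {0..1} (\<lambda>t. q (t * x))" for x
  have Q: "(Q has_real_derivative q x) (at x)" for x
    unfolding Q_def[abs_def] by (rule antiderivative_UNIV[OF q])
  have "((\<lambda>x. D x * exp (- Q x)) has_real_derivative 0) (at x)" for x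
    by (auto intro!: derivative_eq_intros D Q)
  then have "D x * exp (- Q x) = D 0 * exp (- Q 0)"
    using DERIV_isconst_all[of "\<lambda>x. D x * exp (- Q x)" x 0] by blast
  then show ?thesis by (simp add: Q_def exp_minus field_simps)
qed

text \<open>The difference solves a linear equation with the continuous coefficient
  \<open>slope2\<close>. Being an identity and not an inequality of Gronwall type, the result serves
  both for uniqueness and for the derivative of \<open>Z\<close> in z_2.\<close>

lemma ode_difference:
  fixes y1 y2 :: "real \<Rightarrow> real"
  assumes d: "\<And>X. f differentiable (at X)" and c: "continuous_on UNIV (D2 f)"
    and y1: "\<And>x. (y1 has_real_derivative f (pt x (y1 x))) (at x)"
    and y2: "\<And>x. (y2 has_real_derivative f (pt x (y2 x))) (at x)"
  shows "y1 x - y2 x = (y1 0 - y2 0) * exp (x * integral {0..1} (\<lambda>t. slope2 f (t * x) (y1 (t * x)) (y2 (t * x))))"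
proof -
  have "continuous_on UNIV y1" "continuous_on UNIV y2"
    using DERIV_isCont[OF y1] DERIV_isCont[OF y2] by (auto simp: continuous_on_eq_continuous_at)
  then have "continuous_on UNIV (\<lambda>x. slope2 f x (y1 x) (y2 x))"
    by (intro slope2_continuous c continuous_on_id)
  moreover have "((\<lambda>x. y1 x - y2 x) has_real_derivative slope2 f x (y1 x) (y2 x) * (y1 x - y2 x)) (at x)" for x
    using DERIV_diff[OF y1 y2, of x] slope2_eq[OF d c, of x "y1 x" "y2 x"] by simp
  ultimately show ?thesis by (rule linear_ode_solution)
qed

text \<open>The difference of the solutions is its initial value times a positive function, so equal
  averages force equal initial values. The solutions are not assumed periodic.\<close>

lemma ode_unique_average:
  fixes y1 y2 :: "real \<Rightarrow> real"
  assumes d: "\<And>X. f differentiable (at X)" and c: "continuous_on UNIV (D2 f)"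
    and y1: "\<And>x. (y1 has_real_derivative f (pt x (y1 x))) (at x)"
    and y2: "\<And>x. (y2 has_real_derivative f (pt x (y2 x))) (at x)"
    and avg: "integral {0..2*pi} y1 = integral {0..2*pi} y2"
  shows "y1 = y2"
proof -
  have c1: "continuous_on UNIV y1" and c2: "continuous_on UNIV y2"
    using DERIV_isCont[OF y1] DERIV_isCont[OF y2] by (auto simp: continuous_on_eq_continuous_at)
  then have i: "y1 integrable_on {0..2*pi}" "y2 integrable_on {0..2*pi}"
    by (auto intro: integrable_continuous_real continuous_on_subset)
  define e where "e x = exp (x * integral {0..1} (\<lambda>t. slope2 f (t * x) (y1 (t * x)) (y2 (t * x))))" for x
  have eq: "y1 x - y2 x = (y1 0 - y2 0) * e x" for x
    unfolding e_def by (rule ode_difference[OF d c y1 y2])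
  have "y1 0 = y2 0"
  proof (rule ccontr)
    assume ne: "y1 0 \<noteq> y2 0"
    then have e: "e = (\<lambda>x. (y1 x - y2 x) / (y1 0 - y2 0))" using eq by (auto simp: fun_eq_iff field_simps)
    then have ce: "continuous_on UNIV e" using c1 c2 ne by (auto intro!: continuous_intros)
    have "integral {0..2*pi} e = (integral {0..2*pi} y1 - integral {0..2*pi} y2) / (y1 0 - y2 0)"
      unfolding e using i by (simp add: integral_diff)
    then have z: "integral {0..2*pi} e = 0" using avg by simp
    have "(e has_integral 0) (cbox 0 (2*pi))"
      using z integrable_integral[OF integrable_continuous_real[OF continuous_on_subset[OF ce subset_UNIV], of 0 "2*pi"]]
      by simp
    from has_integral_0_cbox_imp_0[OF continuous_on_subset[OF ce subset_UNIV] _ this, of pi]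
    have "e pi = 0" using pi_gt_zero by (auto simp: e_def box_real simp del: pi_gt_zero)
    then show False by (simp add: e_def)
  qed
  then show ?thesis using eq by (auto simp: fun_eq_iff)
qed

lemma Int1_diff:
  assumes "continuous_on UNIV h" "continuous_on UNIV g"
  shows "Int1 (\<lambda>X. h X - g X) X = Int1 h X - Int1 g X"
  unfolding Int1_def right_diff_distrib[symmetric]
  by (subst integral_diff)
    (auto intro!: integrable_continuous_real continuous_on_comp_pt[OF assms(1)] continuous_on_comp_pt[OF assms(2)] continuous_intros)

lemma Av1_Av1: "Av1 (Av1 h) X = Av1 h X"
  by (simp add: Av1_def average_z1_def)

section \<open>The straightening function for a small slope\<close>

text \<open>\<open>f\<close> stands for V_2/V_1. With the bound 1/16 and pi < 4 the contraction
  factor \<open>4 * pi * F\<close> is below 1, \<open>Z\<close> stays within distance 1 of z_2, and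
  the exponent in \<open>E\<close> is at most 1/2.\<close>

locale shear =
  fixes f :: "real^2 \<Rightarrow> real" and F \<tau> :: real
  assumes tau: "0 < \<tau>"
    and diff: "\<And>X. f differentiable (at X)"
    and cont: "\<And>e. e \<in> Basis \<Longrightarrow> continuous_on UNIV (dirderiv e f)"
    and bd: "\<And>X. \<bar>f X\<bar> \<le> F" "\<And>X. \<bar>D2 f X\<bar> \<le> F" "F \<le> 1 / 16"
    and sym: "odd1 f" "odd2 f" "per1 f"
    and per: "\<And>X. f (X + pt 0 (2 * pi / \<tau>)) = f X" "\<And>X. f (X + pt pi (pi / \<tau>)) = f X"
begin

lemma cont_f: "continuous_on UNIV f"
  by (rule differentiable_continuous_UNIV[OF diff])

lemma cont_D2: "continuous_on UNIV (D2 f)"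
  using cont by (simp add: Basis_vec2)

lemma F_nonneg: "0 \<le> F" using bd(1)[of 0] by linarith

definition along :: "(real^2 \<Rightarrow> real) \<Rightarrow> (real^2 \<Rightarrow> real) \<Rightarrow> real^2 \<Rightarrow> real" where
  "along g Z X = g (pt (X $ 1) (Z X))"

text \<open>The unknown \<open>w\<close> is the deviation of \<open>Z\<close> from z_2. Subtracting
  the average of the primitive puts the normalisation of the average into the fixed point equation,
  in place of an initial value.\<close>

definition step :: "(real^2 \<Rightarrow> real) \<Rightarrow> real^2 \<Rightarrow> real" where
  "step w X = Int1 (along f (\<lambda>X. X $ 2 + w X)) X - Av1 (Int1 (along f (\<lambda>X. X $ 2 + w X))) X"

lemma along_props:
  assumes "continuous_on UNIV w" "even1 w" "per1 w"
  defines "g \<equiv> along f (\<lambda>X. X $ 2 + w X)"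
  shows "continuous_on UNIV g" "odd1 g" "per1 g"
proof -
  show "continuous_on UNIV g" unfolding g_def along_def[abs_def]
    by (rule continuous_on_comp_pt[OF cont_f]) (intro continuous_intros assms)+
  show "odd1 g" using assms(2) sym(1) by (auto simp: g_def along_def odd1_def even1_def)
  show "per1 g" using assms(3) sym(3) by (auto simp: g_def along_def per1_def)
qed

lemma step_props:
  assumes w: "continuous_on UNIV w" "even1 w" "per1 w"
  shows "continuous_on UNIV (step w)" "even1 (step w)" "per1 (step w)" "\<bar>step w X\<bar> \<le> 4 * pi * F"
proof -
  note p = along_props[OF w]
  note c = Int1_continuous[OF p(1)]
  show "continuous_on UNIV (step w)" unfolding step_def[abs_def]
    by (intro continuous_on_diff c Av1_continuous)
  show "even1 (step w)" using Int1_even[OF p(2)] by (simp add: even1_def step_def Av1_def)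
  show "per1 (step w)" using Int1_per[OF p] by (simp add: per1_def step_def Av1_def)
  have b: "\<bar>Int1 (along f (\<lambda>X. X $ 2 + w X)) X\<bar> \<le> 2 * pi * F" for X
    by (rule Int1_bound[OF p]) (simp add: along_def bd)
  have "\<bar>Av1 (Int1 (along f (\<lambda>X. X $ 2 + w X))) X\<bar> \<le> 2 * pi * F"
    by (rule Av1_bound[OF c b])
  with b[of X] show "\<bar>step w X\<bar> \<le> 4 * pi * F" unfolding step_def by linarith
qed

lemma f_lipschitz: "\<bar>f (pt s u) - f (pt s v)\<bar> \<le> F * \<bar>u - v\<bar>"
proof -
  have "norm (slope2 f s u v) \<le> F * (1 - 0)"
    unfolding slope2_def using bd(2) 
    by (intro integral_bound continuous_on_comp_pt[OF cont_D2] continuous_intros) auto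
  then show ?thesis unfolding slope2_eq[OF diff cont_D2] abs_mult
    by (intro mult_right_mono) auto
qed

text \<open>The primitive and its average contribute \<open>2 * pi * F\<close> each.\<close>

lemma step_contraction:
  assumes w: "continuous_on UNIV w" "even1 w" "per1 w" and v: "continuous_on UNIV v" "even1 v" "per1 v"
    and d: "\<And>X. \<bar>w X - v X\<bar> \<le> d"
  shows "\<bar>step w X - step v X\<bar> \<le> 4 * pi * F * d"
proof -
  let ?w = "along f (\<lambda>X. X $ 2 + w X)" and ?v = "along f (\<lambda>X. X $ 2 + v X)"
  note pw = along_props[OF w] note pv = along_props[OF v]
  have c: "continuous_on UNIV (\<lambda>X. ?w X - ?v X)" by (intro continuous_on_diff pw pv)
  have o: "odd1 (\<lambda>X. ?w X - ?v X)" "per1 (\<lambda>X. ?w X - ?v X)"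
    using pw pv by (simp_all add: odd1_def per1_def)
  have "\<bar>?w X - ?v X\<bar> \<le> F * d" for X
    using f_lipschitz[of "X $ 1" "X $ 2 + w X" "X $ 2 + v X"] mult_left_mono[OF d F_nonneg, of X]
    by (simp add: along_def)
  from Int1_bound[OF c o this] have 
    b: "\<bar>Int1 ?w X - Int1 ?v X\<bar> \<le> 2 * pi * (F * d)" for X
    by (simp add: Int1_diff pw pv)
  have "\<bar>Av1 (\<lambda>X. Int1 ?w X - Int1 ?v X) X\<bar> \<le> 2 * pi * (F * d)"
    by (rule Av1_bound[OF _ b]) (intro continuous_on_diff Int1_continuous pw pv)
  then have "\<bar>Av1 (Int1 ?w) X - Av1 (Int1 ?v) X\<bar> \<le> 2 * pi * (F * d)"
    by (simp add: Av1_diff Int1_continuous pw pv)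
  with b[of X] show ?thesis unfolding step_def by (simp add: mult.assoc)
qed

text \<open>Banach's theorem in the closed set of bounded continuous functions that are even and
  periodic in x_1. Evenness keeps the integrand odd, and with periodicity this keeps the primitive
  bounded, so that \<open>step\<close> maps the set into itself.\<close>

lemma fixed_point_exists:
  "\<exists>w. continuous_on UNIV w \<and> even1 w \<and> per1 w \<and> step w = w"
proof -
  let ?S = "{w :: (real^2) \<Rightarrow>\<^sub>C real. even1 (apply_bcontfun w) \<and> per1 (apply_bcontfun w)}"
  let ?\<Phi> = "\<lambda>w :: (real^2) \<Rightarrow>\<^sub>C real. Bcontfun (step (apply_bcontfun w))"
  have app: "apply_bcontfun (?\<Phi> w) = step (apply_bcontfun w)" if "w \<in> ?S" for w
  proof (rule Bcontfun_inverse, rule bcontfun_normI)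
    show "continuous_on UNIV (step (apply_bcontfun w))"
      using that by (intro step_props) auto
    show "norm (step (apply_bcontfun w) x) \<le> 4 * pi * F" for x
      using that step_props(4)[of "apply_bcontfun w"] by auto
  qed
  have ev: "continuous_on UNIV (\<lambda>w :: (real^2) \<Rightarrow>\<^sub>C real. apply_bcontfun w X)" for X
    using dist_bounded by (intro lipschitz_on_continuous_on[of 1] lipschitz_onI) auto
  have S: "?S = (\<Inter>a b. {w. apply_bcontfun w (pt (- a) b) = apply_bcontfun w (pt a b)}) \<inter>
      (\<Inter>a b. {w. apply_bcontfun w (pt (a + 2 * pi) b) = apply_bcontfun w (pt a b)})"
    by (auto simp: even1_def per1_def)
  have "closed ?S" unfolding S by (intro closed_Int closed_INT ballI closed_Collect_eq ev)
  then have "complete ?S" by (simp add: complete_eq_closed)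
  moreover have "?S \<noteq> {}"
  proof -
    have "const_bcontfun 0 \<in> ?S" by (simp add: even1_def per1_def)
    then show ?thesis by blast
  qed
  moreover have "?\<Phi> ` ?S \<subseteq> ?S"
  proof clarify
    fix w :: "(real^2) \<Rightarrow>\<^sub>C real" assume w: "even1 (apply_bcontfun w)" "per1 (apply_bcontfun w)"
    then have "apply_bcontfun (?\<Phi> w) = step (apply_bcontfun w)" by (intro app) auto
    with w show "even1 (apply_bcontfun (?\<Phi> w)) \<and> per1 (apply_bcontfun (?\<Phi> w))"
      using step_props(2,3)[of "apply_bcontfun w"] by auto
  qed
  moreover have "dist (?\<Phi> w) (?\<Phi> v) \<le> (4 * pi * F) * dist w v" if "w \<in> ?S" "v \<in> ?S" for w v
  proof (rule dist_bound)
    fix X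
    have "\<bar>apply_bcontfun w X - apply_bcontfun v X\<bar> \<le> dist w v" for X
      using dist_bounded[of w X v] by (simp add: dist_real_def)
    with that show "dist (apply_bcontfun (?\<Phi> w) X) (apply_bcontfun (?\<Phi> v) X) \<le> (4 * pi * F) * dist w v"
      unfolding app[OF that(1)] app[OF that(2)] dist_real_def by (intro step_contraction) auto
  qed
  moreover have "0 \<le> 4 * pi * F" using F_nonneg by simp
  moreover have "4 * pi * F < 1"
  proof -
    have "4 * pi * F \<le> 4 * pi * (1 / 16)" using bd(3) by (intro mult_left_mono) auto
    also have "\<dots> < 1" using pi_less_4 by simp
    finally show ?thesis .
  qed
  ultimately have "\<exists>!w\<in>?S. ?\<Phi> w = w" by (intro Banach_fix)
  then obtain w where w: "w \<in> ?S" "?\<Phi> w = w" by blast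
  then have "step (apply_bcontfun w) = apply_bcontfun w" using app by metis
  with w(1) show ?thesis by (intro exI[of _ "apply_bcontfun w"]) simp
qed

text \<open>The choice depends on \<open>f\<close> alone. Outside the locale
  \<open>shear.Z f\<close> is therefore the same function for every admissible \<open>F\<close> and
  \<tau>.\<close>

definition W :: "real^2 \<Rightarrow> real" where
  "W = (SOME w. continuous_on UNIV w \<and> even1 w \<and> per1 w \<and> step w = w)"

definition Z :: "real^2 \<Rightarrow> real" where "Z X = X $ 2 + W X"

lemma W: "continuous_on UNIV W" "even1 W" "per1 W" "step W = W"
  using someI_ex[OF fixed_point_exists] by (auto simp: W_def)

lemma Z_cont: "continuous_on UNIV Z"
  unfolding Z_def[abs_def] by (intro continuous_intros W)

lemma Z_even_per: "even1 Z" "per1 Z"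
  using W by (simp_all add: Z_def even1_def per1_def)

lemma along_Z: "along f (\<lambda>X. X $ 2 + W X) = along f Z"
  by (simp add: along_def[abs_def] Z_def)

lemma fZ: "continuous_on UNIV (along f Z)" "odd1 (along f Z)" "per1 (along f Z)"
  using along_props[OF W(1-3)] by (simp_all add: along_Z)

lemma Z_eq: "Z X = X $ 2 + (Int1 (along f Z) X - Av1 (Int1 (along f Z)) X)"
  using fun_cong[OF W(4), of X] Z_def[of X] unfolding step_def along_Z by linarith

lemma Z_near: "\<bar>Z X - X $ 2\<bar> \<le> 4 * pi * F"
  using step_props(4)[OF W(1-3), of X] W(4) by (simp add: Z_def)

lemma Z_deriv1: "((\<lambda>x. Z (pt x b)) has_real_derivative f (pt a (Z (pt a b)))) (at a)"
proof -
  have "((\<lambda>x. b + (Int1 (along f Z) (pt x b) - average_z1 (Int1 (along f Z)) b)) has_real_derivative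
      along f Z (pt a b)) (at a)"
    using Int1_deriv1[OF fZ(1), of b a] by (auto intro!: derivative_eq_intros)
  moreover have "b + (Int1 (along f Z) (pt x b) - average_z1 (Int1 (along f Z)) b) = Z (pt x b)" for x
    using Z_eq[of "pt x b"] by (simp add: Av1_def)
  ultimately show ?thesis by (simp add: along_def)
qed

lemma Z_avg: "average_z1 Z b = b"
proof -
  have c: "continuous_on UNIV (Int1 (along f Z))" by (rule Int1_continuous[OF fZ(1)])
  have W_eq: "W = (\<lambda>X. Int1 (along f Z) X - Av1 (Int1 (along f Z)) X)"
    using Z_eq by (auto simp: fun_eq_iff Z_def)
  have "Av1 W X = 0" for X
    by (subst W_eq) (simp add: Av1_diff c Av1_continuous Av1_Av1)
  from this[of "pt 0 b"] have "integral {0..2*pi} (\<lambda>s. W (pt s b)) = 0"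
    by (simp add: Av1_def average_z1_def)
  moreover have "integral {0..2*pi} (\<lambda>s. b + W (pt s b)) = integral {0..2*pi} (\<lambda>s. b) + integral {0..2*pi} (\<lambda>s. W (pt s b))"
    by (intro integral_add integrable_continuous_real continuous_on_slice W continuous_on_const)
  ultimately show ?thesis by (simp add: average_z1_def Z_def)
qed

lemma solution_unique:
  assumes "\<And>x. (y has_real_derivative f (pt x (y x))) (at x)" "integral {0..2*pi} y = 2 * pi * b"
  shows "y x = Z (pt x b)"
proof -
  have "integral {0..2*pi} (\<lambda>s. Z (pt s b)) = 2 * pi * b"
    using Z_avg[of b] by (simp add: average_z1_def field_simps)
  then have "y = (\<lambda>x. Z (pt x b))"
    using assms by (intro ode_unique_average[OF diff cont_D2 _ Z_deriv1]) auto
  then show ?thesis by simp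
qed

definition hq :: "real^2 \<Rightarrow> real" where "hq = along (D2 f) Z"

definition E :: "real^2 \<Rightarrow> real" where "E X = exp (Int1 hq X)"

lemma hq: "continuous_on UNIV hq" "odd1 hq" "per1 hq" "\<bar>hq X\<bar> \<le> F"
proof -
  show "continuous_on UNIV hq" unfolding hq_def along_def[abs_def]
    by (rule continuous_on_comp_pt[OF cont_D2]) (intro continuous_intros Z_cont)+
  show "odd1 hq" using D2_odd1_per1(1)[OF diff sym(1)] Z_even_per
    by (simp add: hq_def along_def odd1_def even1_def)
  show "per1 hq" using D2_odd1_per1(2)[OF diff sym(3)] Z_even_per
    by (simp add: hq_def along_def per1_def)
  show "\<bar>hq X\<bar> \<le> F" by (simp add: hq_def along_def bd)
qed

lemma E_cont: "continuous_on UNIV E"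
  unfolding E_def[abs_def] by (intro continuous_on_exp Int1_continuous hq)

text \<open>The factor by which the distance of the solutions with averages \<open>a\<close> and
  \<open>b\<close> changes between 0 and \<open>x\<close>. For \<open>a = b\<close> it is
  \<open>E\<close>, the solution of the linearised equation with value 1 at x_1 = 0.\<close>

definition ee :: "real \<Rightarrow> real \<Rightarrow> real \<Rightarrow> real" where
  "ee b a x = exp (x * integral {0..1} (\<lambda>t. slope2 f (t * x) (Z (pt (t * x) a)) (Z (pt (t * x) b))))"

lemma ee_same: "ee b b = (\<lambda>x. E (pt x b))"
  by (simp add: fun_eq_iff ee_def E_def Int1_def hq_def along_def)

lemma ee_cont:
  fixes a s :: "'a::topological_space \<Rightarrow> real"
  assumes "continuous_on UNIV a" "continuous_on UNIV s"
  shows "continuous_on UNIV (\<lambda>p. ee b (a p) (s p))"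
proof -
  have fst: "continuous_on UNIV (\<lambda>p :: 'a \<times> real. g (fst p))" if "continuous_on UNIV g" for g :: "'a \<Rightarrow> real"
    by (rule continuous_on_compose2[OF that]) (auto intro: continuous_on_fst continuous_on_id)
  have "continuous_on UNIV (\<lambda>(p, t). slope2 f (t * s p) (Z (pt (t * s p) (a p))) (Z (pt (t * s p) b)))"
    by (intro continuous_on_case_prodI slope2_continuous cont_D2 continuous_on_comp_pt[OF Z_cont] continuous_on_mult
        fst assms continuous_on_snd continuous_on_id continuous_on_const)
  from integral_param_continuous[OF this, of 0 1] show ?thesis
    unfolding ee_def by (intro continuous_on_exp continuous_on_mult assms)
qed

lemma ee_pos: "0 < ee b a x" by (simp add: ee_def)

text \<open>The averages of the two solutions differ by \<open>a - b\<close>, so integrating the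
  exponential formula over a period determines the difference \<open>D\<close> of the initial
  values. The outcome is an explicit difference quotient in z_2.\<close>

lemma Z_difference: "Z (pt x a) - Z (pt x b) = (a - b) * (ee b a x / ((1 / (2*pi)) * integral {0..2*pi} (ee b a)))"
    and ee_integral_pos: "0 < integral {0..2*pi} (ee b a)"
proof -
  define D where "D = Z (pt 0 a) - Z (pt 0 b)"
  have *: "Z (pt x a) - Z (pt x b) = D * ee b a x" for x
    unfolding ee_def D_def by (rule ode_difference[OF diff cont_D2 Z_deriv1 Z_deriv1])
  have "continuous_on UNIV (ee b a)"
    using ee_cont[of "\<lambda>x. a" "\<lambda>x. x" b] by (simp add: continuous_on_id)
  then have ce: "continuous_on {0..2*pi} (ee b a)" using continuous_on_subset by blast
  have "integral {0..2*pi} (ee b a) \<noteq> 0"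
  proof
    assume "integral {0..2*pi} (ee b a) = 0"
    then have "(ee b a has_integral 0) (cbox 0 (2*pi))"
      using integrable_integral[OF integrable_continuous_real[OF ce]] by simp
    from has_integral_0_cbox_imp_0[OF _ _ this, of pi] ce have "ee b a pi = 0"
      using ee_pos pi_gt_zero by (auto simp: box_real less_imp_le simp del: pi_gt_zero)
    then show False using ee_pos[of b a pi] by simp
  qed
  moreover have "0 \<le> integral {0..2*pi} (ee b a)"
    using ee_pos by (intro integral_nonneg integrable_continuous_real ce) (auto simp: less_imp_le)
  ultimately show pos: "0 < integral {0..2*pi} (ee b a)" by simp
  have i: "(\<lambda>s. Z (pt s c)) integrable_on {0..2*pi}" for c
    by (intro integrable_continuous_real continuous_on_slice Z_cont)
  have "2 * pi * (a - b) = integral {0..2*pi} (\<lambda>s. Z (pt s a)) - integral {0..2*pi} (\<lambda>s. Z (pt s b))"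
    using Z_avg[of a] Z_avg[of b] by (simp add: average_z1_def field_simps)
  also have "\<dots> = integral {0..2*pi} (\<lambda>s. D * ee b a s)"
    by (subst integral_diff[symmetric]) (use i * in auto)
  finally have "D * integral {0..2*pi} (ee b a) = 2 * pi * (a - b)" by simp
  then have "D = 2 * pi * (a - b) / integral {0..2*pi} (ee b a)" using pos by (simp add: field_simps)
  then show "Z (pt x a) - Z (pt x b) = (a - b) * (ee b a x / ((1 / (2*pi)) * integral {0..2*pi} (ee b a)))"
    unfolding * by simp
qed

text \<open>Differentiability in Caratheodory's form: the difference quotient of
  \<open>Z_difference\<close> is continuous in \<open>y\<close>, and its value at
  \<open>y = b\<close> is the derivative.\<close>

lemma Z_deriv2: "((\<lambda>y. Z (pt a y)) has_real_derivative E (pt a b) / Av1 E (pt a b)) (at b)"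
proof -
  let ?m = "\<lambda>y. (1 / (2*pi)) * integral {0..2*pi} (ee b y)"
  have "continuous_on UNIV (\<lambda>(y, s). ee b y s)"
    by (intro continuous_on_case_prodI ee_cont continuous_on_fst continuous_on_snd continuous_on_id)
  from integral_param_continuous[OF this, of 0 "2*pi"]
  have m: "continuous_on UNIV ?m" by (intro continuous_on_mult continuous_on_const)
  have e: "continuous_on UNIV (\<lambda>y. ee b y a)" by (intro ee_cont continuous_on_id continuous_on_const)
  have "isCont (\<lambda>y. ee b y a / ?m y) b"
    using m e ee_integral_pos[of b b] by (intro continuous_divide) (auto simp: continuous_on_eq_continuous_at)
  moreover have "\<forall>y. Z (pt a y) - Z (pt a b) = (ee b y a / ?m y) * (y - b)"
    using Z_difference by (simp add: mult.commute)
  moreover have "ee b b a / ?m b = E (pt a b) / Av1 E (pt a b)"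
    by (simp add: ee_same Av1_def average_z1_def)
  ultimately show ?thesis unfolding CARAT_DERIV by (intro exI[of _ "\<lambda>y. ee b y a / ?m y"] conjI)
qed

lemma E_bounds: "exp (- 1 / 2) \<le> E X" "E X \<le> exp (1 / 2)"
proof -
  have "\<bar>Int1 hq X\<bar> \<le> 2 * pi * F" by (rule Int1_bound[OF hq])
  also have "\<dots> \<le> 2 * pi * (1 / 16)" using bd(3) by (intro mult_left_mono) auto
  also have "\<dots> \<le> 1 / 2" using pi_less_4 by simp
  finally show "exp (- 1 / 2) \<le> E X" "E X \<le> exp (1 / 2)" by (auto simp: E_def)
qed

lemma AvE_bounds: "exp (- 1 / 2) \<le> Av1 E X" "Av1 E X \<le> exp (1 / 2)"
  by (rule Av1_ge[OF E_cont E_bounds(1)] Av1_le[OF E_cont E_bounds(2)])+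

lemma AvE_pos: "0 < Av1 E X"
  using AvE_bounds(1)[of X] by (meson exp_gt_zero less_le_trans)

lemma Z_D: "Z differentiable (at X)" "D1 Z = along f Z" "D2 Z = (\<lambda>X. E X / Av1 E X)"
proof -
  have "continuous_on UNIV (\<lambda>X. E X / Av1 E X)"
    using AvE_pos by (intro continuous_on_divide E_cont Av1_continuous) (auto simp: less_imp_neq[THEN not_sym])
  moreover have "((\<lambda>x. Z (pt x b)) has_real_derivative along f Z (pt a b)) (at a)" for a b
    using Z_deriv1 by (simp add: along_def)
  ultimately show "Z differentiable (at X)" "D1 Z = along f Z" "D2 Z = (\<lambda>X. E X / Av1 E X)"
    using dirderiv_partials_vec2[of Z "along f Z" "\<lambda>X. E X / Av1 E X"] Z_deriv2 by blast+
qed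

text \<open>Numerator and denominator of \<open>D2 Z\<close> both lie between exp(-1/2) and
  exp(1/2). The lower bound makes z_2 a function of \<open>Z\<close>, with constants independent of
  \<open>f\<close>.\<close>

lemma D2Z_bounds: "exp (- 1) \<le> D2 Z X" "D2 Z X \<le> exp 1"
proof -
  have "exp (- 1) = exp (- 1 / 2) / exp (1 / 2 :: real)" by (simp add: exp_diff[symmetric])
  also have "\<dots> \<le> E X / Av1 E X"
    using E_bounds AvE_bounds AvE_pos by (intro frac_le) (auto simp: E_def)
  finally show "exp (- 1) \<le> D2 Z X" by (simp add: Z_D)
  have "E X / Av1 E X \<le> exp (1 / 2) / exp (- 1 / 2)" using E_bounds AvE_bounds by (intro frac_le) auto
  also have "\<dots> = exp 1" by (simp add: exp_diff[symmetric])
  finally show "D2 Z X \<le> exp 1" by (simp add: Z_D)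
qed

lemma Z_odd2: "odd2 Z"
  unfolding odd2_def
proof (intro allI)
  fix a b
  have i: "integral {0..2*pi} (\<lambda>x. Z (pt x (- b))) = 2 * pi * (- b)"
    using Z_avg[of "- b"] by (simp add: average_z1_def field_simps)
  have "- Z (pt a (- b)) = Z (pt a b)"
  proof (rule solution_unique)
    show "((\<lambda>x. - Z (pt x (- b))) has_real_derivative f (pt x (- Z (pt x (- b))))) (at x)" for x
      using DERIV_minus[OF Z_deriv1[of "- b" x]] sym(2) by (simp add: odd2_def)
  qed (simp add: i)
  then show "Z (pt a (- b)) = - Z (pt a b)" by simp
qed

text \<open>The period 2 pi in z_1 is built into the construction. The other two translates of
  \<open>Z\<close> are recognised by \<open>solution_unique\<close>; for the half period the average
  is unchanged because it is taken over a full period.\<close>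

lemma Z_period: "Z (z + pt (2 * pi) 0) = Z z" "Z (z + pt 0 (2 * pi / \<tau>)) = Z z + 2 * pi / \<tau>"
  "Z (z + pt pi (pi / \<tau>)) = Z z + pi / \<tau>"
proof -
  have zs: "z + pt u v = pt (z $ 1 + u) (z $ 2 + v)" for u v by (simp add: vec2_eq_iff)
  have fper: "f (pt x (y + 2 * pi / \<tau>)) = f (pt x y)" "f (pt (x + pi) (y + pi / \<tau>)) = f (pt x y)" for x y
    using per(1)[of "pt x y"] per(2)[of "pt x y"] by simp_all
  have int: "integral {0..2*pi} (\<lambda>x. Z (pt x b)) = 2 * pi * b" for b
    using Z_avg[of b] by (simp add: average_z1_def field_simps)
  have ic: "(\<lambda>x. Z (pt x b)) integrable_on {0..2*pi}" for b
    by (intro integrable_continuous_real continuous_on_slice Z_cont)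
  show "Z (z + pt (2 * pi) 0) = Z z"
    using Z_even_per(2) by (simp add: zs per1_def)
  have "Z (pt (z $ 1) (z $ 2 + 2 * pi / \<tau>)) - 2 * pi / \<tau> = Z (pt (z $ 1) (z $ 2))"
  proof (rule solution_unique)
    show "((\<lambda>x. Z (pt x (z $ 2 + 2 * pi / \<tau>)) - 2 * pi / \<tau>) has_real_derivative
        f (pt x (Z (pt x (z $ 2 + 2 * pi / \<tau>)) - 2 * pi / \<tau>))) (at x)" for x
      using DERIV_diff[OF Z_deriv1[of "z $ 2 + 2 * pi / \<tau>" x] DERIV_const]
        fper(1)[of x "Z (pt x (z $ 2 + 2 * pi / \<tau>)) - 2 * pi / \<tau>"] by simp
    show "integral {0..2*pi} (\<lambda>x. Z (pt x (z $ 2 + 2 * pi / \<tau>)) - 2 * pi / \<tau>) = 2 * pi * z $ 2"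
      by (subst integral_diff[OF ic integrable_const_ivl]) (simp add: int, simp add: algebra_simps)
  qed
  then show "Z (z + pt 0 (2 * pi / \<tau>)) = Z z + 2 * pi / \<tau>" by (simp add: zs)
  have "Z (pt (z $ 1 + pi) (z $ 2 + pi / \<tau>)) - pi / \<tau> = Z (pt (z $ 1) (z $ 2))"
  proof (rule solution_unique)
    have "((\<lambda>x. Z (pt (x + pi) b)) has_real_derivative f (pt (x + pi) (Z (pt (x + pi) b)))) (at x)" for x b
      using Z_deriv1[of b "x + pi"] by (simp add: DERIV_shift)
    note der = DERIV_diff[OF this[of "z $ 2 + pi / \<tau>"] DERIV_const[of "pi / \<tau>"]]
    have e: "f (pt (x + pi) (Z (pt (x + pi) (z $ 2 + pi / \<tau>)))) =
        f (pt x (Z (pt (x + pi) (z $ 2 + pi / \<tau>)) - pi / \<tau>))" for x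
      using fper(2)[of x "Z (pt (x + pi) (z $ 2 + pi / \<tau>)) - pi / \<tau>"] by simp
    show "((\<lambda>x. Z (pt (x + pi) (z $ 2 + pi / \<tau>)) - pi / \<tau>) has_real_derivative
        f (pt x (Z (pt (x + pi) (z $ 2 + pi / \<tau>)) - pi / \<tau>))) (at x)" for x
      using der[of x] unfolding e[symmetric] by (simp only: diff_0_right)
    have "integral {0..2*pi} (\<lambda>x. Z (pt (x + pi) b)) = integral {0..2*pi} (\<lambda>x. Z (pt x b))" for b
      using Z_even_per(2) by (intro integral_periodic_shift continuous_on_slice Z_cont) (auto simp: per1_def)
    moreover have "(\<lambda>x. Z (pt (x + pi) b)) integrable_on {0..2*pi}" for b
      by (intro integrable_continuous_real continuous_on_comp_pt[OF Z_cont] continuous_intros)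
    ultimately show "integral {0..2*pi} (\<lambda>x. Z (pt (x + pi) (z $ 2 + pi / \<tau>)) - pi / \<tau>) = 2 * pi * z $ 2"
      by (subst integral_diff[OF _ integrable_const_ivl]) (simp, simp add: int, simp add: algebra_simps)
  qed
  then show "Z (z + pt pi (pi / \<tau>)) = Z z + pi / \<tau>" by (simp add: zs)
qed

end


section \<open>The period lattice and the inverse map\<close>

text \<open>Pairing \<open>g\<close> with the two generating wave vectors gives integers
  \<open>n\<close> and \<open>k\<close>, and half the sum and half the difference of the two
  equations are the coordinates of \<open>g\<close>; the coefficients are then \<open>n - k\<close>
  and \<open>k\<close>.\<close>

lemma period_lattice_iff:
  assumes "\<tau> \<noteq> 0"
  shows "g \<in> period_lattice \<tau> \<longleftrightarrow> (\<exists>j k :: int. g = of_int j *\<^sub>R pt pi (pi / \<tau>) + of_int k *\<^sub>R pt (2 * pi) 0)"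
proof
  assume g: "g \<in> period_lattice \<tau>"
  have w: "of_int 1 *\<^sub>R pt 1 \<tau> + of_int 0 *\<^sub>R pt 1 (- \<tau>) \<in> wave_lattice \<tau>"
    "of_int 0 *\<^sub>R pt 1 \<tau> + of_int 1 *\<^sub>R pt 1 (- \<tau>) \<in> wave_lattice \<tau>"
    unfolding wave_lattice_def by blast+
  have g': "\<forall>K\<in>wave_lattice \<tau>. \<exists>n::int. K \<bullet> g = 2 * pi * of_int n"
    using g by (simp add: period_lattice_def)
  obtain n :: int where n: "g $ 1 + \<tau> * g $ 2 = 2 * pi * n"
    using bspec[OF g' w(1)] by auto
  obtain k :: int where k: "g $ 1 - \<tau> * g $ 2 = 2 * pi * k"
    using bspec[OF g' w(2)] by auto
  have "g $ 1 = pi * (n + k)" "\<tau> * g $ 2 = pi * (n - k)"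
    using n k by (simp_all add: algebra_simps)
  then have "g = of_int (n - k) *\<^sub>R pt pi (pi / \<tau>) + of_int k *\<^sub>R pt (2 * pi) 0"
    using assms by (simp add: vec2_eq_iff field_simps)
  then show "\<exists>j k :: int. g = of_int j *\<^sub>R pt pi (pi / \<tau>) + of_int k *\<^sub>R pt (2 * pi) 0" by blast
next
  assume "\<exists>j k :: int. g = of_int j *\<^sub>R pt pi (pi / \<tau>) + of_int k *\<^sub>R pt (2 * pi) 0"
  then obtain j k :: int where g: "g = of_int j *\<^sub>R pt pi (pi / \<tau>) + of_int k *\<^sub>R pt (2 * pi) 0" by blast
  show "g \<in> period_lattice \<tau>" unfolding period_lattice_def wave_lattice_def
  proof clarify
    fix a b :: int
    have "(of_int a *\<^sub>R pt 1 \<tau> + of_int b *\<^sub>R pt 1 (- \<tau>)) \<bullet> g = 2 * pi * of_int (a * j + (a + b) * k)"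
      using assms by (simp add: g algebra_simps)
    then show "\<exists>n::int. (of_int a *\<^sub>R pt 1 \<tau> + of_int b *\<^sub>R pt 1 (- \<tau>)) \<bullet> g = 2 * pi * of_int n" by blast
  qed
qed

lemma lattice_equivariant_generator:
  fixes T :: "'a::real_vector \<Rightarrow> 'a"
  assumes "\<And>X. T (X + p) = T X + p"
  shows "T (X + of_int j *\<^sub>R p) = T X + of_int j *\<^sub>R p"
proof (induction j rule: int_induct[where k = 0])
  case (step1 i)
  have "T ((X + of_int i *\<^sub>R p) + p) = T X + of_int i *\<^sub>R p + p" using assms step1 by simp
  then show ?case by (simp add: algebra_simps)
next
  case (step2 i)
  have "T ((X + of_int (i - 1) *\<^sub>R p) + p) = T (X + of_int (i - 1) *\<^sub>R p) + p" using assms by simp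
  with step2 show ?case by (simp add: algebra_simps)
qed simp

context shear
begin

lemma Z_expand: 
  assumes "b \<le> a" shows "exp (- 1) * (a - b) \<le> Z (pt x a) - Z (pt x b)"
proof -
  have d: "((\<lambda>y. Z (pt x y) - exp (- 1) * y) has_real_derivative D2 Z (pt x y) - exp (- 1)) (at y)" for y
    using has_real_derivative_D1(2)[OF Z_D(1)] by (auto intro!: derivative_eq_intros)
  have "Z (pt x b) - exp (- 1) * b \<le> Z (pt x a) - exp (- 1) * a"
  proof (rule DERIV_nonneg_imp_nondecreasing[OF assms])
    fix y
    show "\<exists>D. ((\<lambda>y. Z (pt x y) - exp (- 1) * y) has_real_derivative D) (at y) \<and> 0 \<le> D"
      using D2Z_bounds(1)[of "pt x y"] by (intro exI[of _ "D2 Z (pt x y) - exp (- 1)"] conjI d) simp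
  qed
  then show ?thesis by (simp add: algebra_simps)
qed

lemma Z_expand_abs: "exp (- 1) * \<bar>a - b\<bar> \<le> \<bar>Z (pt x a) - Z (pt x b)\<bar>"
  using Z_expand[of a b x] Z_expand[of b a x] by (cases "a \<le> b") auto

lemma Z_inj: "Z (pt x a) = Z (pt x b) \<Longrightarrow> a = b"
  using Z_expand_abs[of a b x] by (simp add: mult_le_0_iff)

lemma Z_surj: "\<exists>y. Z (pt x y) = c"
proof -
  \<comment> \<open>\<open>Z\<close> is at distance at most 1 from its second argument, so the value
    \<open>c\<close> is taken between \<open>c - 1\<close> and \<open>c + 1\<close>.\<close>
  have F: "4 * pi * F \<le> 1"
  proof -
    have "4 * pi * F \<le> 4 * pi * (1 / 16)" using bd(3) by (intro mult_left_mono) auto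
    also have "\<dots> \<le> 1" using pi_less_4 by simp
    finally show ?thesis .
  qed
  have "Z (pt x (c - 1)) \<le> c" "c \<le> Z (pt x (c + 1))"
    using Z_near[of "pt x (c - 1)"] Z_near[of "pt x (c + 1)"] F by auto
  then have "\<exists>y\<ge>c - 1. y \<le> c + 1 \<and> Z (pt x y) = c"
    by (intro IVT') (auto intro: continuous_on_slice Z_cont)
  then show ?thesis by blast
qed

definition H :: "real^2 \<Rightarrow> real" where "H X = (THE y. Z (pt (X $ 1) y) = X $ 2)"

lemma Z_H: "Z (pt (X $ 1) (H X)) = X $ 2"
proof -
  obtain y where y: "Z (pt (X $ 1) y) = X $ 2" using Z_surj by blast
  show ?thesis unfolding H_def by (rule theI[where a = y], rule y) (rule Z_inj[of "X $ 1"], simp add: y)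
qed

lemma H_eqI: "Z (pt a y) = b \<Longrightarrow> H (pt a b) = y"
  by (rule Z_inj[of a]) (simp add: Z_H[of "pt a b", simplified])

text \<open>In the notation of the statement \<open>T\<close> is the inverse of \<U>_1 and
  \<open>U\<close> is \<U>_1; inside the locale \<open>U\<close> does not denote the pair (\<psi>,
  \<eta>).\<close>

definition T :: "real^2 \<Rightarrow> real^2" where "T X = pt (X $ 1) (Z X)"
definition U :: "real^2 \<Rightarrow> real^2" where "U X = pt (X $ 1) (H X)"

lemma T_U [simp]: "T (U X) = X"
  by (simp add: T_def U_def Z_H)

lemma U_T [simp]: "U (T X) = X"
proof -
  have "H (pt (X $ 1) (Z X)) = X $ 2" by (rule H_eqI) simp
  then show ?thesis by (simp add: T_def U_def)
qed

lemma bij_T: "bij T" and bij_U: "bij U" and inv_T: "inv T = U" and inv_U: "inv U = T"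
proof -
  show "bij T" "bij U" by (auto intro: o_bij[of U T] o_bij[of T U] simp: fun_eq_iff)
  show "inv T = U" "inv U = T" by (rule inv_equality; simp)+
qed

text \<open>At fixed second argument \<open>Z\<close> moves by at most \<open>F\<close> times the
  change of x_1, and in the second argument it expands by at least exp(-1). Continuity of the
  inverse is needed before its differentiability can be obtained.\<close>

lemma H_lipschitz: "\<bar>H X - H Y\<bar> \<le> exp 1 * (\<bar>X $ 2 - Y $ 2\<bar> + F * \<bar>X $ 1 - Y $ 1\<bar>)"
proof -
  have "norm (Z (pt (Y $ 1) (H Y)) - Z (pt (X $ 1) (H Y))) \<le> F * norm (Y $ 1 - X $ 1)"
  proof (rule field_differentiable_bound[where S = UNIV])
    show "((\<lambda>x. Z (pt x (H Y))) has_field_derivative f (pt z (Z (pt z (H Y))))) (at z within UNIV)" for z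
      using Z_deriv1 by simp
    show "norm (f (pt z (Z (pt z (H Y))))) \<le> F" for z using bd(1) by simp
  qed auto
  then have "\<bar>Z (pt (X $ 1) (H X)) - Z (pt (X $ 1) (H Y))\<bar> \<le> \<bar>X $ 2 - Y $ 2\<bar> + F * \<bar>X $ 1 - Y $ 1\<bar>"
    unfolding Z_H real_norm_def by (simp add: abs_minus_commute)
  with Z_expand_abs[of "H X" "H Y" "X $ 1"]
  have "exp (- 1) * \<bar>H X - H Y\<bar> \<le> \<bar>X $ 2 - Y $ 2\<bar> + F * \<bar>X $ 1 - Y $ 1\<bar>" by linarith
  from mult_left_mono[OF this, of "exp 1"] show ?thesis
    by (simp add: exp_minus divide_simps mult.commute)
qed

lemma H_near: "\<bar>H X - X $ 2\<bar> \<le> 4 * pi * F"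
  using Z_near[of "pt (X $ 1) (H X)"] by (simp add: Z_H abs_minus_commute)

lemma H_cont: "continuous_on UNIV H"
proof -
  have "((\<lambda>Y. H Y) \<longlongrightarrow> H X) (at X)" for X
  proof (rule Lim_transform_bound[of "\<lambda>Y. H Y - H X" "\<lambda>Y. exp 1 * (\<bar>Y $ 2 - X $ 2\<bar> + F * \<bar>Y $ 1 - X $ 1\<bar>)" "at X", THEN LIM_zero_cancel])
    show "\<forall>\<^sub>F Y in at X. norm (H Y - H X) \<le> norm (exp 1 * (\<bar>Y $ 2 - X $ 2\<bar> + F * \<bar>Y $ 1 - X $ 1\<bar>))"
      using H_lipschitz F_nonneg by (intro always_eventually allI) (simp add: abs_mult)
    have "((\<lambda>Y. exp 1 * (\<bar>Y $ 2 - X $ 2\<bar> + F * \<bar>Y $ 1 - X $ 1\<bar>)) \<longlongrightarrow>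
        exp 1 * (\<bar>X $ 2 - X $ 2\<bar> + F * \<bar>X $ 1 - X $ 1\<bar>)) (at X)"
      by (intro tendsto_intros)
    then show "((\<lambda>Y. exp 1 * (\<bar>Y $ 2 - X $ 2\<bar> + F * \<bar>Y $ 1 - X $ 1\<bar>)) \<longlongrightarrow> 0) (at X)" by simp
  qed
  then show ?thesis by (simp add: continuous_on_def continuous_on_eq_continuous_at continuous_within)
qed

lemma D2Z_pos: "0 < D2 Z X"
  using D2Z_bounds(1)[of X] by (meson exp_gt_zero less_le_trans)

text \<open>The inverse function rule is applied to the whole map \<open>T\<close>, whose Jacobian
  is triangular with diagonal entries 1 and \<open>D2 Z > 0\<close>; \<open>H\<close> is the second
  component of the inverse.\<close>

lemma H_has_derivative:
  "(H has_derivative (\<lambda>k. (k $ 2 - k $ 1 * D1 Z (U X)) / D2 Z (U X))) (at X)"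
proof -
  let ?a = "D1 Z (U X)" and ?b = "D2 Z (U X)"
  let ?T' = "\<lambda>h. pt (h $ 1) (h $ 1 * ?a + h $ 2 * ?b)" and ?U' = "\<lambda>k. pt (k $ 1) ((k $ 2 - k $ 1 * ?a) / ?b)"
  have b: "?b \<noteq> 0" using D2Z_pos[of "U X"] by simp
  have "(U has_derivative ?U') (at X)"
  proof (rule has_derivative_inverse_basic[where f = T and T = UNIV and f' = ?T'])
    show "(T has_derivative ?T') (at (U X))"
      unfolding T_def[abs_def] using has_derivative_D12[OF Z_D(1), of "U X"]
      by (intro derivative_intros) auto
    show "bounded_linear ?U'"
      unfolding linear_conv_bounded_linear[symmetric] by (rule linearI) (auto simp: field_simps add_divide_distrib diff_divide_distrib)
    show "?U' \<circ> ?T' = id" using b by (auto simp: fun_eq_iff vec2_eq_iff)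
    have "continuous_on UNIV U" unfolding U_def[abs_def] by (intro continuous_intros H_cont)
    then show "continuous (at X) U" by (simp add: continuous_on_eq_continuous_at)
  qed auto
  from has_derivative_nth[OF this, of 2] show ?thesis by (simp add: U_def)
qed

lemma H_D: "H differentiable (at X)" "D1 H = (\<lambda>X. - (D1 Z (U X) / D2 Z (U X)))" "D2 H = (\<lambda>X. 1 / D2 Z (U X))"
  using H_has_derivative dirderiv_eqI[OF H_has_derivative] by (auto simp: differentiable_def fun_eq_iff)

lemma H_even1: "even1 H" and H_odd2: "odd2 H"
proof -
  show "even1 H" unfolding even1_def
  proof (intro allI H_eqI)
    fix a b show "Z (pt (- a) (H (pt a b))) = b"
      using Z_even_per(1) Z_H[of "pt a b"] by (simp add: even1_def)
  qed
  show "odd2 H" unfolding odd2_def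
  proof (intro allI H_eqI)
    fix a b show "Z (pt a (- H (pt a b))) = - b"
      using Z_odd2 Z_H[of "pt a b"] by (simp add: odd2_def)
  qed
qed

lemma T_lattice: "g \<in> period_lattice \<tau> \<Longrightarrow> T (X + g) = T X + g"
proof -
  assume "g \<in> period_lattice \<tau>"
  then obtain j k :: int where g: "g = of_int j *\<^sub>R pt pi (pi / \<tau>) + of_int k *\<^sub>R pt (2 * pi) 0"
    using tau by (auto simp: period_lattice_iff)
  have "T (X + pt pi (pi / \<tau>)) = T X + pt pi (pi / \<tau>)" "T (X + pt (2 * pi) 0) = T X + pt (2 * pi) 0" for X
    using Z_period by (simp_all add: T_def vec2_eq_iff)
  note e = lattice_equivariant_generator[of T, OF this(1)] lattice_equivariant_generator[of T, OF this(2)]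
  show "T (X + g) = T X + g" unfolding g add.assoc[symmetric] e(2) e(1) ..
qed

lemma U_lattice: "g \<in> period_lattice \<tau> \<Longrightarrow> U (X + g) = U X + g"
  using T_lattice[of g "U X"] by (metis T_U U_T)

lemma T_lattice_iff: "X - Y \<in> period_lattice \<tau> \<longleftrightarrow> T X - T Y \<in> period_lattice \<tau>"
proof
  assume "X - Y \<in> period_lattice \<tau>"
  with T_lattice[OF this, of Y] show "T X - T Y \<in> period_lattice \<tau>" by simp
next
  assume "T X - T Y \<in> period_lattice \<tau>"
  from this U_lattice[OF this, of "T Y"] show "X - Y \<in> period_lattice \<tau>"
    by (metis U_T add.commute diff_add_cancel add_diff_cancel_left')
qed

end


section \<open>Tame bounds for the straightening and its inverse\<close>

lemma abs_exp_minus_1_le: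
  assumes "\<bar>t\<bar> \<le> a" shows "\<bar>exp t - 1\<bar> \<le> exp a * \<bar>t :: real\<bar>"
proof (cases "0 \<le> t")
  case True
  have "exp t * (1 - t) \<le> exp t * exp (- t)" using exp_ge_add_one_self[of "- t"] by (intro mult_left_mono) auto
  then have "exp t - 1 \<le> exp t * t" by (simp add: exp_minus algebra_simps)
  also have "\<dots> \<le> exp a * t" using True assms by (intro mult_right_mono) auto
  finally show ?thesis using True by simp
next
  case False
  have "1 * \<bar>t\<bar> \<le> exp a * \<bar>t\<bar>" using assms by (intro mult_right_mono) auto
  moreover have "\<bar>exp t - 1\<bar> \<le> \<bar>t\<bar>"
  proof -
    have "exp t \<le> 1" "1 + t \<le> exp t" using False exp_ge_add_one_self[of t] by auto
    with False show ?thesis by linarith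
  qed
  ultimately show ?thesis by simp
qed

text \<open>In contrast to \<open>Qb_exp\<close> the bound is linear in \<open>A\<close>, as the
  tame estimate requires; \<open>A0\<close> enters only the constant.\<close>

lemma Qb_exp_minus_1:
  "\<exists>C\<ge>0. \<forall>L A u. 1 \<le> L \<longrightarrow> A \<le> A0 \<longrightarrow> Qb L k A u \<longrightarrow> Qb L k (C * A) (\<lambda>X. exp (u X) - 1)"
proof (cases k)
  case 0
  have "Qb L 0 (exp A0 * A) (\<lambda>X. exp (u X) - 1)" if "A \<le> A0" and u: "Qb L 0 A u" for L A u
  proof -
    have "\<bar>exp (u X) - 1\<bar> \<le> exp A0 * A" for X
    proof -
      have "\<bar>exp (u X) - 1\<bar> \<le> exp A0 * \<bar>u X\<bar>"
        using abs_exp_minus_1_le[of "u X" A0] Qb_bound[OF u, of X] \<open>A \<le> A0\<close> by linarith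
      also have "\<dots> \<le> exp A0 * A" using Qb_bound[OF u, of X] by (intro mult_left_mono) auto
      finally show ?thesis .
    qed
    then show ?thesis using u by (auto intro: continuous_on_diff continuous_on_exp)
  qed
  then show ?thesis using 0 by (intro exI[of _ "exp A0"]) auto
next
  case (Suc n)
  obtain C where C: "0 \<le> C" "\<forall>L u. 1 \<le> L \<longrightarrow> Qb L n A0 u \<longrightarrow> Qb L n C (\<lambda>X. exp (u X))"
    using Qb_exp by blast
  define C' where "C' = max (exp A0) (2^n * C)"
  have "Qb L k (C' * A) (\<lambda>X. exp (u X) - 1)" if L: "1 \<le> L" and A: "A \<le> A0" and u: "Qb L k A u" for L A u
  proof -
    have A0: "0 \<le> A" using Qb_nonneg[OF u] .
    have u': "Qb L (Suc n) A u" using u Suc by simp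
    have df: "u differentiable (at X)" for X using u' by auto
    have dr: "((\<lambda>t. exp t - 1) has_real_derivative exp (u X)) (at (u X))" for X
      by (auto intro!: derivative_eq_intros)
    have d: "dirderiv e (\<lambda>X. exp (u X) - 1) = (\<lambda>X. dirderiv e u X * exp (u X))" for e
      using dirderiv_real_comp(1)[OF df dr] by (intro ext) simp
    have "Qb L n C (\<lambda>X. exp (u X))"
      using C(2) L Qb_mono[OF L Qb_Suc_lower[OF L u'] A] by blast
    then have "Qb L n (2^n * (A * L) * C) (dirderiv e (\<lambda>X. exp (u X) - 1))" if "e \<in> Basis" for e
      unfolding d using u' that by (intro Qb_mult L) auto
    moreover have "2^n * (A * L) * C \<le> C' * A * L"
    proof -
      have "2^n * (A * L) * C = (2^n * C) * (A * L)" by simp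
      also have "\<dots> \<le> C' * (A * L)" using L A0 by (intro mult_right_mono) (auto simp: C'_def)
      finally show ?thesis by (simp add: mult.assoc)
    qed
    ultimately have D: "Qb L n (C' * A * L) (dirderiv e (\<lambda>X. exp (u X) - 1))" if "e \<in> Basis" for e
      using Qb_mono[OF L] that by blast
    have B: "\<bar>exp (u X) - 1\<bar> \<le> C' * A" for X
    proof -
      have "\<bar>exp (u X) - 1\<bar> \<le> exp A0 * \<bar>u X\<bar>"
        using abs_exp_minus_1_le[of "u X" A0] Qb_bound[OF u, of X] A by linarith
      also have "\<dots> \<le> C' * A" using Qb_bound[OF u, of X] by (intro mult_mono) (auto simp: C'_def le_max_iff_disj)
      finally show ?thesis .
    qed
    show ?thesis unfolding Suc Qb.simps using B D dirderiv_real_comp(2)[OF df dr] by blast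
  qed
  moreover have "0 \<le> C'" by (simp add: C'_def le_max_iff_disj)
  ultimately show ?thesis by blast
qed

text \<open>For \<open>h = hq\<close> the function is \<open>D2 Z - 1\<close>. Writing it as ((E -
  1) - Av(E - 1)) / Av(E) leaves a numerator that is linear in \<open>A\<close> and a denominator
  bounded below.\<close>

lemma Qb_exp_ratio_minus_1:
  "\<exists>C\<ge>0. \<forall>L A h. 1 \<le> L \<longrightarrow> A \<le> A0 \<longrightarrow> Qb L k A h \<longrightarrow> odd1 h \<longrightarrow> per1 h \<longrightarrow>
     Qb L k (C * A) (\<lambda>X. exp (Int1 h X) / Av1 (\<lambda>X. exp (Int1 h X)) X - 1)"
proof -
  define a where "a = max 0 A0"
  obtain C1 where C1: "0 \<le> C1" "\<forall>L A u. 1 \<le> L \<longrightarrow> A \<le> 2 * pi * a \<longrightarrow> Qb L k A u \<longrightarrow> Qb L k (C1 * A) (\<lambda>X. exp (u X) - 1)"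
    using Qb_exp_minus_1 by blast
  obtain C2 where C2: "0 \<le> C2" "\<forall>L u. 1 \<le> L \<longrightarrow> Qb L k (2 * pi * a) u \<longrightarrow> Qb L k C2 (\<lambda>X. exp (u X))"
    using Qb_exp by blast
  obtain C3 where C3: "0 \<le> C3" "\<forall>L f. 1 \<le> L \<longrightarrow> Qb L k C2 f \<longrightarrow> (\<forall>X. exp (- (2 * pi * a)) \<le> f X) \<longrightarrow> Qb L k C3 (\<lambda>X. 1 / f X)"
    using Qb_inverse[of "exp (- (2 * pi * a))" k C2] by auto
  define C where "C = 2^k * (2 * (C1 * (2 * pi))) * C3"
  have "Qb L k (C * A) (\<lambda>X. exp (Int1 h X) / Av1 (\<lambda>X. exp (Int1 h X)) X - 1)"
    if L: "1 \<le> L" and A: "A \<le> A0" and h: "Qb L k A h" and o: "odd1 h" "per1 h" for L A h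
  proof -
    define E where "E X = exp (Int1 h X)" for X
    have i: "Qb L k (2 * pi * A) (Int1 h)" by (rule Qb_Int1[OF L h o])
    have Aa: "2 * pi * A \<le> 2 * pi * a" using A by (simp add: a_def le_max_iff_disj)
    have e1: "Qb L k (C1 * (2 * pi * A)) (\<lambda>X. E X - 1)"
      using C1(2) L Aa i unfolding E_def by blast
    have e2: "Qb L k C2 E" using C2(2) L Qb_mono[OF L i Aa] unfolding E_def[abs_def] by blast
    note ec = Qb_continuous[OF e2]
    have b: "exp (- (2 * pi * a)) \<le> E X" for X
    proof -
      have "\<bar>Int1 h X\<bar> \<le> 2 * pi * a" using Qb_bound[OF i] Aa by (rule order_trans)
      then show ?thesis by (simp add: E_def)
    qed
    have b': "exp (- (2 * pi * a)) \<le> Av1 E X" for X by (rule Av1_ge[OF ec b])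
    have e3: "Qb L k C3 (\<lambda>X. 1 / Av1 E X)" using C3(2) L Qb_Av1[OF L e2] b' by blast
    have m: "Av1 (\<lambda>X. E X - 1) X = Av1 E X - 1" for X
      using Av1_diff[OF ec, of "\<lambda>X. 1"] by (simp add: continuous_on_const)
    have "Qb L k (2^k * (C1 * (2 * pi * A) + C1 * (2 * pi * A)) * C3)
        (\<lambda>X. ((E X - 1) - Av1 (\<lambda>X. E X - 1) X) * (1 / Av1 E X))"
      by (intro Qb_mult Qb_diff L e1 Qb_Av1 e3)
    moreover have "2^k * (C1 * (2 * pi * A) + C1 * (2 * pi * A)) * C3 = C * A"
      by (simp add: C_def)
    moreover have "((E X - 1) - Av1 (\<lambda>X. E X - 1) X) * (1 / Av1 E X) = E X / Av1 E X - 1" for X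
    proof -
      have "Av1 E X > 0" using b'[of X] by (meson exp_gt_zero less_le_trans)
      then show ?thesis by (simp add: m field_simps)
    qed
    ultimately have "Qb L k (C * A) (\<lambda>X. E X / Av1 E X - 1)" by (simp only:)
    then show ?thesis by (simp only: E_def[abs_def])
  qed
  moreover have "0 \<le> C" using C1(1) C3(1) by (simp add: C_def)
  ultimately show ?thesis by blast
qed

text \<open>
  Bootstrap: a bound on the derivatives of \<open>Z\<close> up to order \<open>j\<close> gives bounds on \<open>f(z\<^sub>1, Z)\<close> and
  \<open>D2 f(z\<^sub>1, Z)\<close> up to order \<open>j + 1\<close>, and these determine \<open>D1 Z\<close> and \<open>D2 Z\<close>.
\<close>

lemma straightening_along_bound:
  assumes G0_nonneg: "0 \<le> G0"
  shows "\<exists>C\<ge>0. \<forall>L G f F \<tau>. 1 \<le> L \<longrightarrow> G \<le> G0 \<longrightarrow> SS L k G f \<longrightarrow> shear f F \<tau> \<longrightarrow>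
    Qb L k (C * G) (\<lambda>X. f (pt (X $ 1) (shear.Z f X))) \<and> Qb L k (C * G) (\<lambda>X. D2 f (pt (X $ 1) (shear.Z f X)))"
proof (induction k)
  case 0
  have "Qb L 0 (1 * G) (\<lambda>X. f (pt (X $ 1) (shear.Z f X))) \<and> Qb L 0 (1 * G) (\<lambda>X. D2 f (pt (X $ 1) (shear.Z f X)))"
    if f: "SS L 0 G f" and s: "shear f F \<tau>" for L G f F \<tau>
  proof -
    interpret shear f F \<tau> by (rule s)
    have "\<bar>D2 f X\<bar> \<le> G" for X using Qb_bound[OF SSD(3)[OF f]] by (simp add: Basis_vec2)
    then show ?thesis
      using fZ(1) hq(1) SSD(1)[OF f] by (simp add: along_def[abs_def] hq_def)
  qed
  then show ?case by (intro exI[of _ 1]) auto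
next
  case (Suc k)
  then obtain C where C: "0 \<le> C" "\<forall>L G f F \<tau>. 1 \<le> L \<longrightarrow> G \<le> G0 \<longrightarrow> SS L k G f \<longrightarrow> shear f F \<tau> \<longrightarrow>
    Qb L k (C * G) (\<lambda>X. f (pt (X $ 1) (shear.Z f X))) \<and> Qb L k (C * G) (\<lambda>X. D2 f (pt (X $ 1) (shear.Z f X)))"
    by blast
  obtain C1 where C1: "0 \<le> C1" "\<forall>L A h. 1 \<le> L \<longrightarrow> A \<le> C * G0 \<longrightarrow> Qb L k A h \<longrightarrow> odd1 h \<longrightarrow> per1 h \<longrightarrow>
     Qb L k (C1 * A) (\<lambda>X. exp (Int1 h X) / Av1 (\<lambda>X. exp (Int1 h X)) X - 1)"
    using Qb_exp_ratio_minus_1 by blast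
  \<comment> \<open>A common bound for \<open>D1 Z\<close>, controlled by \<open>C * G0\<close>, and
    for \<open>D2 Z\<close>, which is 1 plus a term controlled by
    \<open>C1 * (C * G0)\<close>.\<close>
  define B where "B = max (C * G0) (C1 * (C * G0) + 1)"
  have "0 \<le> B" using C(1) G0_nonneg by (simp add: B_def le_max_iff_disj)
  from Qb_graph_comp[OF this, of "Suc k"]
  obtain C2 where C2: "0 \<le> C2" "\<forall>L A f Z. 1 \<le> L \<longrightarrow> Qb L (Suc k) A f \<longrightarrow> (\<forall>X. Z differentiable (at X)) \<longrightarrow>
    (\<forall>e\<in>Basis. Qb L k B (dirderiv e Z)) \<longrightarrow> Qb L (Suc k) (C2 * A) (\<lambda>X. f (pt (X $ 1) (Z X)))"
    unfolding diff_Suc_1 by blast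
  have "Qb L (Suc k) (C2 * G) (\<lambda>X. f (pt (X $ 1) (shear.Z f X))) \<and> Qb L (Suc k) (C2 * G) (\<lambda>X. D2 f (pt (X $ 1) (shear.Z f X)))"
    if L: "1 \<le> L" and G: "G \<le> G0" and f: "SS L (Suc k) G f" and s: "shear f F \<tau>" for L G f F \<tau>
  proof -
    interpret shear f F \<tau> by (rule s)
    have G0: "0 \<le> G" using SSD(4)[OF f] .
    have CG: "C * G \<le> C * G0" using C(1) G by (simp add: mult_left_mono)
    have *: "Qb L k (C * G) (along f Z)" "Qb L k (C * G) hq"
      using C(2)[rule_format, OF L G SS_lower[OF L f] s] by (simp_all add: along_def[abs_def] hq_def)
    have d1: "Qb L k B (D1 Z)"
      unfolding Z_D by (rule Qb_mono[OF L *(1)]) (use CG in \<open>auto simp: B_def\<close>)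
    have "Qb L k (C1 * (C * G)) (\<lambda>X. E X / Av1 E X - 1)"
      using C1(2) L CG *(2) hq(2,3) unfolding E_def[abs_def] by blast
    from Qb_add[OF this Qb_const[OF L, of 1 1]]
    have "Qb L k (C1 * (C * G) + 1) (D2 Z)" unfolding Z_D by simp
    moreover have "C1 * (C * G) + 1 \<le> B" using mult_left_mono[OF CG C1(1)] by (simp add: B_def)
    ultimately have d2: "Qb L k B (D2 Z)" using Qb_mono[OF L] by blast
    have dZ: "\<forall>e\<in>Basis. Qb L k B (dirderiv e Z)" using d1 d2 by (simp add: Basis_vec2)
    have f1: "Qb L (Suc k) G f" using SS_imp_Qb[OF L f] .
    have f2: "Qb L (Suc k) G (D2 f)" using SSD(3)[OF f] by (simp add: Basis_vec2)
    show ?thesis using C2(2) L f1 f2 dZ Z_D(1) by blast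
  qed
  then show ?case using C2(1) by blast
qed

text \<open>The derivatives of the inverse are \<open>- (D1 Z / D2 Z)\<close> and
  \<open>1 / D2 Z\<close> at the point \<open>U X\<close>. The ratios are bounded first, with bounds
  linear in \<open>G\<close>, and are then composed with \<open>U\<close>.\<close>

lemma tame_straightening:
  assumes G0_nonneg: "0 \<le> G0"
  shows "\<exists>C\<ge>0. \<forall>L G f F \<tau>. 1 \<le> L \<longrightarrow> G \<le> G0 \<longrightarrow> SS L k G f \<longrightarrow> shear f F \<tau> \<longrightarrow>
    SS L k (C * G) (\<lambda>X. X $ 2 - shear.Z f X) \<and> SS L k (C * G) (\<lambda>X. shear.H f X - X $ 2)"
proof -
  obtain C where C: "0 \<le> C" "\<forall>L G f F \<tau>. 1 \<le> L \<longrightarrow> G \<le> G0 \<longrightarrow> SS L k G f \<longrightarrow> shear f F \<tau> \<longrightarrow>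
    Qb L k (C * G) (\<lambda>X. f (pt (X $ 1) (shear.Z f X))) \<and> Qb L k (C * G) (\<lambda>X. D2 f (pt (X $ 1) (shear.Z f X)))"
    using straightening_along_bound[OF G0_nonneg, of k] by blast
  obtain C1 where C1: "0 \<le> C1" "\<forall>L A h. 1 \<le> L \<longrightarrow> A \<le> C * G0 \<longrightarrow> Qb L k A h \<longrightarrow> odd1 h \<longrightarrow> per1 h \<longrightarrow>
     Qb L k (C1 * A) (\<lambda>X. exp (Int1 h X) / Av1 (\<lambda>X. exp (Int1 h X)) X - 1)"
    using Qb_exp_ratio_minus_1 by blast
  obtain C2 where C2: "0 \<le> C2" "\<forall>L f. 1 \<le> L \<longrightarrow> Qb L k (C1 * (C * G0) + 1) f \<longrightarrow> (\<forall>X. exp (-1) \<le> f X) \<longrightarrow> Qb L k C2 (\<lambda>X. 1 / f X)"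
    using Qb_inverse[of "exp (-1)" k "C1 * (C * G0) + 1"] by auto
  define CP where "CP = max (2^k * C * C2) (2^k * (C1 * C) * C2)"
  have CP: "0 \<le> CP" using C(1) C2(1) by (simp add: CP_def le_max_iff_disj)
  have ratio: "Qb L k (CP * G) (\<lambda>X. - (D1 (shear.Z f) X / D2 (shear.Z f) X))"
      "Qb L k (CP * G) (\<lambda>X. 1 / D2 (shear.Z f) X - 1)"
      "Qb L k (C * G) (D1 (shear.Z f))" "Qb L k (C1 * (C * G)) (\<lambda>X. D2 (shear.Z f) X - 1)"
    if L: "1 \<le> L" and G: "G \<le> G0" and f: "SS L k G f" and s: "shear f F \<tau>" for L G f F \<tau>
  proof -
    interpret shear f F \<tau> by (rule s)
    have G0: "0 \<le> G" using SSD(4)[OF f] .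
    have CG: "C * G \<le> C * G0" using C(1) G by (simp add: mult_left_mono)
    have *: "Qb L k (C * G) (along f Z)" "Qb L k (C * G) hq"
      using C(2)[rule_format, OF L G f s] by (simp_all add: along_def[abs_def] hq_def)
    show 1: "Qb L k (C * G) (D1 Z)" unfolding Z_D by (rule *)
    have "Qb L k (C1 * (C * G)) (\<lambda>X. E X / Av1 E X - 1)"
      using C1(2) L CG *(2) hq(2,3) unfolding E_def[abs_def] by blast
    then show 2: "Qb L k (C1 * (C * G)) (\<lambda>X. D2 Z X - 1)" by (simp add: Z_D)
    from Qb_add[OF this Qb_const[OF L, of 1 1]] have "Qb L k (C1 * (C * G) + 1) (D2 Z)" by simp
    then have "Qb L k (C1 * (C * G0) + 1) (D2 Z)"
      by (rule Qb_mono[OF L]) (use mult_left_mono[OF CG C1(1)] in simp)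
    then have 3: "Qb L k C2 (\<lambda>X. 1 / D2 Z X)" using C2(2) L D2Z_bounds(1) by blast
    have "Qb L k (2^k * (C * G) * C2) (\<lambda>X. - (D1 Z X * (1 / D2 Z X)))"
      by (intro Qb_uminus Qb_mult L 1 3)
    then have "Qb L k (2^k * (C * G) * C2) (\<lambda>X. - (D1 Z X / D2 Z X))" by simp
    moreover have "2^k * (C * G) * C2 \<le> CP * G"
      using G0 mult_right_mono[of "2^k * C * C2" CP G] by (simp add: CP_def mult_ac)
    ultimately show "Qb L k (CP * G) (\<lambda>X. - (D1 Z X / D2 Z X))" using Qb_mono[OF L] by blast
    have "Qb L k (2^k * (C1 * (C * G)) * C2) (\<lambda>X. - ((D2 Z X - 1) * (1 / D2 Z X)))"
      by (intro Qb_uminus Qb_mult L 2 3)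
    moreover have "- ((D2 Z X - 1) * (1 / D2 Z X)) = 1 / D2 Z X - 1" for X
      using D2Z_pos[of X] by (simp add: field_simps)
    ultimately have "Qb L k (2^k * (C1 * (C * G)) * C2) (\<lambda>X. 1 / D2 Z X - 1)" by simp
    moreover have "2^k * (C1 * (C * G)) * C2 \<le> CP * G"
      using G0 mult_right_mono[of "2^k * (C1 * C) * C2" CP G] by (simp add: CP_def mult_ac)
    ultimately show "Qb L k (CP * G) (\<lambda>X. 1 / D2 Z X - 1)" using Qb_mono[OF L] by blast
  qed
  \<comment> \<open>A second bootstrap: bounds of order \<open>j\<close> on \<open>D1 H\<close> and
    \<open>D2 H\<close> allow composition with \<open>U\<close> at order \<open>j + 1\<close>, and
    this yields \<open>D1 H\<close> and \<open>D2 H\<close> at order \<open>j + 1\<close>.\<close>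
  have inverse: "\<exists>B\<ge>0. \<forall>L G f F \<tau>. 1 \<le> L \<longrightarrow> G \<le> G0 \<longrightarrow> SS L k G f \<longrightarrow> shear f F \<tau> \<longrightarrow>
      Qb L j (B * G) (D1 (shear.H f)) \<and> Qb L j (B * G) (\<lambda>X. D2 (shear.H f) X - 1)" if "j \<le> k" for j
    using that
  proof (induction j)
    case 0
    have "Qb L 0 (CP * G) (D1 (shear.H f)) \<and> Qb L 0 (CP * G) (\<lambda>X. D2 (shear.H f) X - 1)"
      if L: "1 \<le> L" and G: "G \<le> G0" and f: "SS L k G f" and s: "shear f F \<tau>" for L G f F \<tau>
    proof -
      interpret shear f F \<tau> by (rule s)
      have "continuous_on UNIV U" unfolding U_def[abs_def] by (intro continuous_intros H_cont)
      then have cU: "continuous_on UNIV (\<lambda>X. g (U X))" if "continuous_on UNIV g" for g :: "real^2 \<Rightarrow> real"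
        using continuous_on_compose2[OF that] by blast
      then show ?thesis
        using cU[OF Qb_continuous[OF ratio(1)[OF that]]] cU[OF Qb_continuous[OF ratio(2)[OF that]]]
          Qb_bound[OF ratio(1)[OF that]] Qb_bound[OF ratio(2)[OF that]] by (simp add: H_D)
    qed
    then show ?case using CP by blast
  next
    case (Suc j)
    then obtain B where B: "0 \<le> B" "\<forall>L G f F \<tau>. 1 \<le> L \<longrightarrow> G \<le> G0 \<longrightarrow> SS L k G f \<longrightarrow> shear f F \<tau> \<longrightarrow>
      Qb L j (B * G) (D1 (shear.H f)) \<and> Qb L j (B * G) (\<lambda>X. D2 (shear.H f) X - 1)" using Suc_leD by blast
    have "0 \<le> B * G0 + 1" using B(1) G0_nonneg by simp
    from Qb_graph_comp[OF this, of "Suc j"]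
    obtain C3 where C3: "0 \<le> C3" "\<forall>L A f Z. 1 \<le> L \<longrightarrow> Qb L (Suc j) A f \<longrightarrow> (\<forall>X. Z differentiable (at X)) \<longrightarrow>
      (\<forall>e\<in>Basis. Qb L j (B * G0 + 1) (dirderiv e Z)) \<longrightarrow> Qb L (Suc j) (C3 * A) (\<lambda>X. f (pt (X $ 1) (Z X)))"
      unfolding diff_Suc_1 by blast
    have "Qb L (Suc j) (C3 * CP * G) (D1 (shear.H f)) \<and> Qb L (Suc j) (C3 * CP * G) (\<lambda>X. D2 (shear.H f) X - 1)"
      if L: "1 \<le> L" and G: "G \<le> G0" and f: "SS L k G f" and s: "shear f F \<tau>" for L G f F \<tau>
    proof -
      interpret shear f F \<tau> by (rule s)
      have G0: "0 \<le> G" using SSD(4)[OF f] .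
      have BG: "B * G \<le> B * G0" using B(1) G by (simp add: mult_left_mono)
      have b: "Qb L j (B * G) (D1 H)" "Qb L j (B * G) (\<lambda>X. D2 H X - 1)" using B(2)[rule_format, OF that] by auto
      from Qb_add[OF b(2) Qb_const[OF L, of 1 1]] have "Qb L j (B * G + 1) (D2 H)" by simp
      with b(1) BG have dH: "\<forall>e\<in>Basis. Qb L j (B * G0 + 1) (dirderiv e H)"
        using Qb_mono[OF L] by (fastforce simp: Basis_vec2)
      have "Qb L (Suc j) (C3 * (CP * G)) (\<lambda>X. - (D1 Z (pt (X $ 1) (H X)) / D2 Z (pt (X $ 1) (H X))))"
        using C3(2)[rule_format, OF L Qb_lower[OF L ratio(1)[OF that] Suc.prems] H_D(1)] dH by simp
      moreover have "Qb L (Suc j) (C3 * (CP * G)) (\<lambda>X. 1 / D2 Z (pt (X $ 1) (H X)) - 1)"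
        using C3(2)[rule_format, OF L Qb_lower[OF L ratio(2)[OF that] Suc.prems] H_D(1)] dH by simp
      ultimately show ?thesis by (simp add: H_D U_def mult.assoc del: Qb.simps)
    qed
    moreover have "0 \<le> C3 * CP" using C3(1) CP by simp
    ultimately show ?case by blast
  qed
  obtain B where B: "0 \<le> B" "\<forall>L G f F \<tau>. 1 \<le> L \<longrightarrow> G \<le> G0 \<longrightarrow> SS L k G f \<longrightarrow> shear f F \<tau> \<longrightarrow>
      Qb L k (B * G) (D1 (shear.H f)) \<and> Qb L k (B * G) (\<lambda>X. D2 (shear.H f) X - 1)"
    using inverse[of k] by blast
  define R where "R = max (4 * pi) (max (max C (C1 * C)) B)"
  have "SS L k (R * G) (\<lambda>X. X $ 2 - shear.Z f X) \<and> SS L k (R * G) (\<lambda>X. shear.H f X - X $ 2)"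
    if L: "1 \<le> L" and G: "G \<le> G0" and f: "SS L k G f" and s: "shear f F \<tau>" for L G f F \<tau>
  proof -
    interpret shear f F \<tau> by (rule s)
    have G0: "0 \<le> G" using SSD(4)[OF f] .
    \<comment> \<open>The distance of \<open>Z\<close> from z_2 is at most
      \<open>4 * pi * F\<close>, but a bound linear in \<open>G\<close> is wanted. Since
      \<open>Z\<close> and \<open>H\<close> do not depend on \<open>F\<close>, the locale is entered
      again with the smaller bound.\<close>
    have s': "shear f (min F G) \<tau>"
    proof
      have "\<bar>D2 f X\<bar> \<le> G" for X using Qb_bound[OF SSD(3)[OF f]] by (simp add: Basis_vec2)
      then show "\<bar>D2 f X\<bar> \<le> min F G" for X using bd(2) by simp
    qed (use tau diff cont bd sym per SSD(1)[OF f] in \<open>auto simp: min_le_iff_disj\<close>)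
    have "4 * pi * min F G \<le> 4 * pi * G" by (intro mult_left_mono) auto
    also have "\<dots> \<le> R * G" using G0 by (intro mult_right_mono) (auto simp: R_def)
    finally have near: "\<bar>X $ 2 - Z X\<bar> \<le> R * G" "\<bar>H X - X $ 2\<bar> \<le> R * G" for X
      using shear.Z_near[OF s', of X] shear.H_near[OF s', of X] by auto
    have R: "C * G \<le> R * G" "C1 * (C * G) \<le> R * G" "B * G \<le> R * G"
      using mult_right_mono[of C R G] mult_right_mono[of "C1 * C" R G] mult_right_mono[of B R G] G0
      by (auto simp: R_def mult_ac)
    have d: "(\<lambda>X :: real^2. X $ 2) differentiable (at X)" for X by (rule dirderiv_nth)
    have "Qb L k (R * G) (\<lambda>X. - (D1 Z X))" "Qb L k (R * G) (\<lambda>X. - (D2 Z X - 1))"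
      by (rule Qb_uminus[OF Qb_mono[OF L ratio(3)[OF that] R(1)]]
          Qb_uminus[OF Qb_mono[OF L ratio(4)[OF that] R(2)]])+
    then have "Qb L k (R * G) (dirderiv e (\<lambda>X. X $ 2 - Z X))" if "e \<in> Basis" for e
      using that by (auto simp: Basis_vec2 dirderiv_diff[OF d Z_D(1), abs_def] dirderiv_nth)
    moreover have "Qb L k (R * G) (D1 H)" "Qb L k (R * G) (\<lambda>X. D2 H X - 1)"
      using B(2)[rule_format, OF that] Qb_mono[OF L _ R(3)] by auto
    then have "Qb L k (R * G) (dirderiv e (\<lambda>X. H X - X $ 2))" if "e \<in> Basis" for e
      using that by (auto simp: Basis_vec2 dirderiv_diff[OF H_D(1) d, abs_def] dirderiv_nth)
    ultimately show ?thesis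
      using near Z_D(1) H_D(1) d by (simp add: SS_def differentiable_diff)
  qed
  moreover have "0 \<le> R" by (simp add: R_def le_max_iff_disj)
  ultimately show ?thesis by blast
qed


section \<open>Means over the torus and uniqueness of Fourier coefficients\<close>

abbreviation cell :: "real \<Rightarrow> (real^2) set" where
  "cell \<tau> \<equiv> cbox (pt 0 0) (pt (2 * pi) (2 * pi / \<tau>))"

lemma mem_cbox_vec2: "X \<in> cbox (pt a b) (pt c d) \<longleftrightarrow> a \<le> X $ 1 \<and> X $ 1 \<le> c \<and> b \<le> X $ 2 \<and> X $ 2 \<le> d"
  and mem_box_vec2: "X \<in> box (pt a b) (pt c d) \<longleftrightarrow> a < X $ 1 \<and> X $ 1 < c \<and> b < X $ 2 \<and> X $ 2 < d"
  unfolding mem_box_cart forall_2 vector_2 by auto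

lemma content_cbox_vec2: "a \<le> c \<Longrightarrow> b \<le> d \<Longrightarrow> measure lborel (cbox (pt a b) (pt c d)) = (c - a) * (d - b)"
proof -
  assume "a \<le> c" "b \<le> d"
  then have "pt a b \<in> cbox (pt a b) (pt c d)" by (simp only: mem_cbox_vec2 vector_2) simp
  then have "cbox (pt a b) (pt c d) \<noteq> {}" by blast
  from content_cbox_cart[OF this] show ?thesis by (simp add: UNIV_2)
qed

text \<open>The coordinate map to pairs takes boxes to boxes of equal content, so Fubini's theorem
  for pairs carries over.\<close>

lemma integral_vec2_iterated:
  fixes f :: "real^2 \<Rightarrow> 'b::banach"
  assumes "continuous_on UNIV f"
  shows "integral (cbox (pt a b) (pt c d)) f = integral {a..c} (\<lambda>x. integral {b..d} (\<lambda>y. f (pt x y)))"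
proof -
  let ?g = "\<lambda>p :: real \<times> real. pt (fst p) (snd p)" and ?h = "\<lambda>X :: real^2. (X $ 1, X $ 2)"
  have cf: "continuous_on S f" for S using assms continuous_on_subset by blast
  have gi: "?g ` cbox u v = cbox (?g u) (?g v)" for u v
  proof -
    have "?g ` cbox u v = {X. ?h X \<in> cbox u v}" by (force simp: image_iff)
    then show ?thesis by (cases u; cases v) (auto simp: mem_cbox_vec2 cbox_Pair_eq)
  qed
  have hi: "?h ` cbox u v = cbox (?h u) (?h v)" for u v :: "real^2"
  proof -
    have "?h ` cbox u v = {p. ?g p \<in> cbox u v}" by (force simp: image_iff)
    also have "\<dots> = cbox (?h u) (?h v)"
      using mem_cbox_vec2[of _ "u $ 1" "u $ 2" "v $ 1" "v $ 2"] by (auto simp: cbox_Pair_eq)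
    finally show ?thesis .
  qed
  have "((\<lambda>p. f (?g p)) has_integral (1 / 1) *\<^sub>R integral (cbox (pt a b) (pt c d)) f) (?h ` cbox (pt a b) (pt c d))"
  proof (rule has_integral_twiddle)
    show "continuous (at p) ?g" for p
      by (intro continuous_on_interior[of UNIV] continuous_intros) auto
    show "measure lborel (?g ` cbox u v) = 1 * measure lborel (cbox u v)" for u v
    proof (cases u, cases v)
      fix u1 u2 v1 v2 assume uv: "u = (u1, u2)" "v = (v1, v2)"
      show ?thesis
      proof (cases "u1 \<le> v1 \<and> u2 \<le> v2")
        case True
        then show ?thesis unfolding gi by (simp add: uv content_cbox_vec2 content_Pair)
      next
        case False
        then have "cbox u v = {}" by (auto simp: uv cbox_Pair_eq)
        then show ?thesis by simp
      qed
    qed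
    show "(f has_integral integral (cbox (pt a b) (pt c d)) f) (cbox (pt a b) (pt c d))"
      by (intro integrable_integral integrable_continuous cf)
  qed (use gi hi in auto)
  then have "integral (cbox (pt a b) (pt c d)) f = integral (cbox (a, b) (c, d)) (\<lambda>p. f (?g p))"
    unfolding hi by (simp add: integral_unique)
  also have "\<dots> = integral (cbox a c) (\<lambda>x. integral (cbox b d) (\<lambda>y. f (?g (x, y))))"
    by (intro integral_prod_continuous continuous_on_compose2[OF cf] continuous_intros) auto
  finally show ?thesis by simp
qed

lemma torus_mean_linear:
  fixes f g :: "real^2 \<Rightarrow> 'b::banach"
  assumes "continuous_on UNIV f" "continuous_on UNIV g"
  shows torus_mean_add: "torus_mean \<tau> (\<lambda>X. f X + g X) = torus_mean \<tau> f + torus_mean \<tau> g"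
    and torus_mean_diff: "torus_mean \<tau> (\<lambda>X. f X - g X) = torus_mean \<tau> f - torus_mean \<tau> g"
proof -
  have "f integrable_on cell \<tau>" "g integrable_on cell \<tau>"
    using assms continuous_on_subset by (blast intro: integrable_continuous)+
  then show "torus_mean \<tau> (\<lambda>X. f X + g X) = torus_mean \<tau> f + torus_mean \<tau> g"
    "torus_mean \<tau> (\<lambda>X. f X - g X) = torus_mean \<tau> f - torus_mean \<tau> g"
    by (simp_all add: torus_mean_def integral_add integral_diff scaleR_add_right scaleR_diff_right)
qed

lemma torus_mean_mult: "torus_mean \<tau> (\<lambda>X. c * f X) = c * torus_mean \<tau> f" for f :: "real^2 \<Rightarrow> complex"
  by (simp add: torus_mean_def)

lemma torus_mean_bounded_linear:
  assumes "continuous_on UNIV f" "bounded_linear h"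
  shows "torus_mean \<tau> (\<lambda>X. h (f X)) = h (torus_mean \<tau> f)"
proof -
  have "f integrable_on cell \<tau>" using assms continuous_on_subset by (blast intro: integrable_continuous)
  from integral_linear[OF this assms(2)] show ?thesis
    by (simp add: torus_mean_def o_def linear_scale bounded_linear.linear[OF assms(2)])
qed

lemma cis_add: "cis (a + b) = cis a * cis b" by (simp add: cis_mult)

lemma expwave_add: "expwave (K + L) X = expwave K X * expwave L X"
  by (simp add: expwave_def inner_add_left cis_add)

lemma expwave_0 [simp]: "expwave 0 = (\<lambda>X. 1)" by (simp add: expwave_def fun_eq_iff)

lemma norm_expwave [simp]: "cmod (expwave K X) = 1" by (simp add: expwave_def)

lemma continuous_on_expwave [continuous_intros]: "continuous_on S (expwave K)"
  unfolding expwave_def[abs_def] by (intro continuous_intros)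

lemma wave_lattice_iff: "K \<in> wave_lattice \<tau> \<longleftrightarrow> (\<exists>i j :: int. K = pt (of_int (i + j)) (\<tau> * of_int (i - j)))"
proof -
  have "of_int i *\<^sub>R pt 1 \<tau> + of_int j *\<^sub>R pt 1 (- \<tau>) = pt (of_int (i + j)) (\<tau> * of_int (i - j))" for i j :: int
    by (simp add: vec2_eq_iff algebra_simps)
  then show ?thesis unfolding wave_lattice_def by simp
qed

lemma wave_lattice_add: "K \<in> wave_lattice \<tau> \<Longrightarrow> L \<in> wave_lattice \<tau> \<Longrightarrow> K + L \<in> wave_lattice \<tau>"
proof -
  assume "K \<in> wave_lattice \<tau>" "L \<in> wave_lattice \<tau>"
  then obtain i j i' j' :: int where "K = pt (of_int (i + j)) (\<tau> * of_int (i - j))"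
    "L = pt (of_int (i' + j')) (\<tau> * of_int (i' - j'))" by (auto simp: wave_lattice_iff)
  then have "K + L = pt (of_int ((i + i') + (j + j'))) (\<tau> * of_int ((i + i') - (j + j')))"
    by (simp add: vec2_eq_iff algebra_simps)
  then show ?thesis unfolding wave_lattice_iff by blast
qed

lemma wave_lattice_uminus: "K \<in> wave_lattice \<tau> \<Longrightarrow> - K \<in> wave_lattice \<tau>"
proof -
  assume "K \<in> wave_lattice \<tau>"
  then obtain i j :: int where "K = pt (of_int (i + j)) (\<tau> * of_int (i - j))" by (auto simp: wave_lattice_iff)
  then have "- K = pt (of_int ((- i) + (- j))) (\<tau> * of_int ((- i) - (- j)))"
    by (simp add: vec2_eq_iff algebra_simps)
  then show ?thesis unfolding wave_lattice_iff by blast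
qed

lemma wave_lattice_gen: "pt 1 \<tau> \<in> wave_lattice \<tau>" "pt 1 (- \<tau>) \<in> wave_lattice \<tau>" "0 \<in> wave_lattice \<tau>"
proof -
  have "pt 1 \<tau> = pt (of_int (1 + 0)) (\<tau> * of_int (1 - 0))" "pt 1 (- \<tau>) = pt (of_int (0 + 1)) (\<tau> * of_int (0 - 1))"
    "0 = pt (of_int (0 + 0)) (\<tau> * of_int (0 - 0))" by (simp_all add: vec2_eq_iff)
  then show "pt 1 \<tau> \<in> wave_lattice \<tau>" "pt 1 (- \<tau>) \<in> wave_lattice \<tau>" "0 \<in> wave_lattice \<tau>"
    unfolding wave_lattice_iff by blast+
qed

lemma periodic_expwave: "K \<in> wave_lattice \<tau> \<Longrightarrow> periodic \<tau> (expwave K)"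
proof -
  assume K: "K \<in> wave_lattice \<tau>"
  have "expwave K (X + g) = expwave K X" if "g \<in> period_lattice \<tau>" for X g
  proof -
    obtain n :: int where "K \<bullet> g = 2 * pi * of_int n" using K \<open>g \<in> _\<close> by (auto simp: period_lattice_def)
    then have "cis (K \<bullet> g) = 1" by (simp add: cis_multiple_2pi)
    then show ?thesis by (simp add: expwave_def inner_add_right cis_add)
  qed
  then show ?thesis by (simp add: periodic_def)
qed

lemma integral_cis_period:
  assumes "k \<noteq> 0" "0 \<le> p" "k * p = 2 * pi * of_int n"
  shows "integral {0..p} (\<lambda>x. cis (k * x)) = 0"
proof -
  have "((\<lambda>x. cis (k * x)) has_integral (cis (k * p) / (\<i> * k) - cis (k * 0) / (\<i> * k))) {0..p}"
  proof (rule fundamental_theorem_of_calculus)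
    fix x
    show "((\<lambda>x. cis (k * x) / (\<i> * k)) has_vector_derivative cis (k * x)) (at x within {0..p})"
    proof -
      have "((\<lambda>z. exp (\<i> * (k * z)) / (\<i> * k)) has_field_derivative exp (\<i> * (k * x))) (at (complex_of_real x))"
        using assms(1) by (auto intro!: derivative_eq_intros simp: mult_ac)
      from has_vector_derivative_real_field[OF this] show ?thesis
        by (simp add: cis_conv_exp has_vector_derivative_at_within)
    qed
  qed (use assms in auto)
  moreover have "cis (k * p) = 1" using assms(3) by (simp add: cis_multiple_2pi)
  ultimately show ?thesis by (simp add: integral_unique)
qed

text \<open>The sides of the rectangle are periods of every wave, so the integral splits into two
  one-dimensional ones, and a nonzero component of \<open>K\<close> annihilates its factor.\<close>

lemma torus_mean_expwave:
  assumes t: "0 < \<tau>" and K: "K \<in> wave_lattice \<tau>"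
  shows "torus_mean \<tau> (expwave K) = (if K = 0 then 1 else 0)"
proof (cases "K = 0")
  case True
  have "measure lborel (cell \<tau>) = (2 * pi) * (2 * pi / \<tau>)"
    using t content_cbox_vec2[of 0 "2 * pi" 0 "2 * pi / \<tau>"] by (simp del: pt_arith(7))
  then have "torus_mean \<tau> (expwave 0) = (\<tau> / (4 * pi^2) * ((2 * pi) * (2 * pi / \<tau>))) *\<^sub>R 1"
    by (simp add: torus_mean_def)
  also have "\<dots> = 1" using t by (simp add: power2_eq_square)
  finally show ?thesis using True by simp
next
  case False
  from K obtain i j :: int where Kij: "K = pt (of_int (i + j)) (\<tau> * of_int (i - j))" by (auto simp: wave_lattice_iff)
  define a where "a = K $ 1" define b where "b = K $ 2"
  have ab: "a * (2 * pi) = 2 * pi * of_int (i + j)" "b * (2 * pi / \<tau>) = 2 * pi * of_int (i - j)"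
    using t by (simp_all add: a_def b_def Kij field_simps)
  have "expwave K (pt x y) = cis (a * x) * cis (b * y)" for x y
    by (simp add: expwave_def inner_vec2 a_def b_def cis_add)
  then have "integral (cell \<tau>) (expwave K) =
      integral {0..2*pi} (\<lambda>x. cis (a * x)) * integral {0..2*pi/\<tau>} (\<lambda>y. cis (b * y))"
    unfolding integral_vec2_iterated[OF continuous_on_expwave] by simp
  also have "\<dots> = 0"
  proof (cases "a = 0")
    case True
    with False have "b \<noteq> 0" by (auto simp: a_def b_def vec2_eq_iff)
    with integral_cis_period[OF this _ ab(2)] t show ?thesis by simp
  next
    case False
    with integral_cis_period[OF this _ ab(1)] show ?thesis by simp
  qed
  finally show ?thesis using False by (simp add: torus_mean_def)
qed

lemma periodic_reduce:
  assumes t: "0 < \<tau>"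
  obtains g where "g \<in> period_lattice \<tau>" "X + g \<in> cell \<tau>"
proof
  define k where "k = - \<lfloor>X $ 1 / (2 * pi)\<rfloor>"
  define j where "j = - \<lfloor>X $ 2 / (2 * pi / \<tau>)\<rfloor>"
  let ?g = "pt (2 * pi * of_int k) (2 * pi / \<tau> * of_int j)"
  have "?g = of_int (2 * j) *\<^sub>R pt pi (pi / \<tau>) + of_int (k - j) *\<^sub>R pt (2 * pi) 0"
    by (simp add: vec2_eq_iff algebra_simps)
  then show "?g \<in> period_lattice \<tau>" using t period_lattice_iff[of \<tau> ?g] by blast
  have *: "0 \<le> x - p * of_int \<lfloor>x / p\<rfloor> \<and> x - p * of_int \<lfloor>x / p\<rfloor> \<le> p" if "0 < p" for x p :: real
  proof -
    have "of_int \<lfloor>x / p\<rfloor> \<le> x / p" "x / p \<le> of_int \<lfloor>x / p\<rfloor> + 1" by linarith+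
    then have "p * of_int \<lfloor>x / p\<rfloor> \<le> p * (x / p)" "p * (x / p) \<le> p * (of_int \<lfloor>x / p\<rfloor> + 1)"
      using that by (intro mult_left_mono; simp)+
    then show ?thesis using that by (simp add: algebra_simps)
  qed
  show "X + ?g \<in> cell \<tau>"
    using *[of "2 * pi" "X $ 1"] *[of "2 * pi / \<tau>" "X $ 2"] t
    by (simp add: mem_cbox_vec2 k_def j_def del: pt_arith(7))
qed

text \<open>
  If \<open>f X0 = 1\<close>, the trigonometric polynomials
  \<open>q\<^sup>2\<^sup>N\<close>, where \<open>q X = (cos (K1\<bullet>(X - X0)) + cos (K2\<bullet>(X - X0))) / 2 + e\<close> and \<open>K1\<close>, \<open>K2\<close> generate the
  lattice, blow up near \<open>X0\<close> and stay bounded where \<open>f \<le> 1/2\<close>, so they cannot all be orthogonal to \<open>f\<close>.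
\<close>

lemma fourier_zero_interior:
  fixes f :: "real^2 \<Rightarrow> real"
  assumes t: "0 < \<tau>" and c: "continuous_on UNIV f" and p: "periodic \<tau> f"
    and z: "\<And>K. K \<in> wave_lattice \<tau> \<Longrightarrow> torus_mean \<tau> (\<lambda>X. complex_of_real (f X) * expwave K X) = 0"
    and X0: "X0 \<in> box (pt 0 0) (pt (2 * pi) (2 * pi / \<tau>))"
  shows "f X0 = 0"
proof (rule ccontr)
  assume nz: "f X0 \<noteq> 0"
  define F where "F X = f X / f X0" for X
  have cF: "continuous_on S F" for S
    unfolding F_def[abs_def] using continuous_on_subset[OF c] nz by (intro continuous_intros) auto
  have pF: "F (X + g) = F X" if "g \<in> period_lattice \<tau>" for X g
    using p that by (simp add: F_def periodic_def)
  define q0 where "q0 X = (cos (pt 1 \<tau> \<bullet> (X - X0)) + cos (pt 1 (- \<tau>) \<bullet> (X - X0))) / 2" for X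
  have cq0: "continuous_on S q0" for S unfolding q0_def[abs_def] by (intro continuous_intros) auto
  have q0_lower: "- 1 \<le> q0 X" for X
  proof -
    have *: "- 1 \<le> (c + d) / 2" if "- 1 \<le> c" "- 1 \<le> d" for c d :: real using that by simp
    show ?thesis unfolding q0_def by (rule *) (rule cos_ge_minus_one)+
  qed
  have q0_upper: "q0 X \<le> 1" for X
  proof -
    have *: "(c + d) / 2 \<le> 1" if "c \<le> 1" "d \<le> 1" for c d :: real using that by simp
    show ?thesis unfolding q0_def by (rule *) (rule cos_le_one)+
  qed
  note q0b = q0_lower q0_upper
  have q0_1: "F X = 1" if "q0 X = 1" for X
  proof -
    have *: "c = 1 \<and> d = 1" if "(c + d) / 2 = 1" "c \<le> 1" "d \<le> 1" for c d :: real using that by auto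
    have "cos (pt 1 \<tau> \<bullet> (X - X0)) = 1 \<and> cos (pt 1 (- \<tau>) \<bullet> (X - X0)) = 1"
      by (rule *) (use that in \<open>simp only: q0_def\<close>, (rule cos_le_one)+)
    then obtain n k :: int where n: "pt 1 \<tau> \<bullet> (X - X0) = of_int n * 2 * pi" and k: "pt 1 (- \<tau>) \<bullet> (X - X0) = of_int k * 2 * pi"
      by (auto simp: cos_one_2pi_int simp del: pt_arith)
    have "X - X0 = of_int (n - k) *\<^sub>R pt pi (pi / \<tau>) + of_int k *\<^sub>R pt (2 * pi) 0"
      using n k t by (simp add: vec2_eq_iff field_simps)
    then have "X - X0 \<in> period_lattice \<tau>" using t period_lattice_iff[of \<tau> "X - X0"] by blast
    from pF[OF this, of X0] show ?thesis using nz by (simp add: F_def)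
  qed
  define S where "S = {X \<in> cell \<tau>. F X \<le> 1 / 2}"
  have "S = {X. F X \<le> 1 / 2} \<inter> cell \<tau>" by (auto simp: S_def)
  then have "compact S"
    by (simp only:) (intro closed_Int_compact closed_Collect_le cF continuous_on_const compact_cbox)
  obtain M where M: "M < 1" "- 1 \<le> M" "\<And>X. X \<in> S \<Longrightarrow> q0 X \<le> M"
  proof (cases "S = {}")
    case True then show ?thesis using that[of 0] by auto
  next
    case False
    from continuous_attains_sup[OF \<open>compact S\<close> this cq0] obtain Y where Y: "Y \<in> S" "\<forall>X\<in>S. q0 X \<le> q0 Y" by blast
    have "q0 Y \<noteq> 1" using q0_1[of Y] Y(1) by (auto simp: S_def)
    then have "q0 Y < 1" using q0b(2)[of Y] by simp
    then show ?thesis using that[of "q0 Y"] Y q0b(1)[of Y] by blast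
  qed
  \<comment> \<open>\<open>q0\<close> equals 1 only on the lattice translates of \<open>X0\<close>,
    so its maximum \<open>M\<close> on \<open>S\<close> is below 1. Adding half the gap keeps the
    modulus of \<open>q\<close> at most 1 on \<open>S\<close>, while \<open>q X0 = 1 + e\<close>
    exceeds 1.\<close>
  define e where "e = (1 - M) / 2"
  have e: "0 < e" "e \<le> 1" using M by (simp_all add: e_def)
  define q where "q X = q0 X + e" for X
  have cq: "continuous_on S q" for S unfolding q_def[abs_def] by (intro continuous_intros cq0)
  have qS: "\<bar>q X\<bar> \<le> 1" if "X \<in> S" for X
    using M(3)[OF that] q0b(1)[of X] e M by (auto simp: q_def e_def field_simps)
  \<comment> \<open>Multiplication by \<open>q\<close> shifts the frequency by the generators and
    their negatives, hence stays inside the wave lattice.\<close>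
  have orth: "torus_mean \<tau> (\<lambda>X. complex_of_real (f X * q X ^ N) * expwave K X) = 0" if "K \<in> wave_lattice \<tau>" for N K
    using that
  proof (induction N arbitrary: K)
    case 0 then show ?case using z by simp
  next
    case (Suc N)
    let ?g = "\<lambda>K X. complex_of_real (f X * q X ^ N) * expwave K X"
    let ?K1 = "pt 1 \<tau>" and ?K2 = "pt 1 (- \<tau>)"
    have cg: "continuous_on UNIV (\<lambda>X. a * ?g K X)" for a K
      by (intro continuous_intros c cq)
    have cosf: "complex_of_real (cos (L \<bullet> (X - X0))) =
        (cis (- (L \<bullet> X0)) * expwave L X + cis (L \<bullet> X0) * expwave (- L) X) / 2" for L X
    proof -
      have "complex_of_real (cos x) = (cis x + cis (- x)) / 2" for x by (simp add: complex_eq_iff)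
      then show ?thesis by (simp add: expwave_def inner_diff_right cis_mult)
    qed
    have eq: "complex_of_real (f X * q X ^ Suc N) * expwave K X =
      cis (- (?K1 \<bullet> X0)) / 4 * ?g (?K1 + K) X + (cis (?K1 \<bullet> X0) / 4 * ?g (- ?K1 + K) X +
      (cis (- (?K2 \<bullet> X0)) / 4 * ?g (?K2 + K) X + (cis (?K2 \<bullet> X0) / 4 * ?g (- ?K2 + K) X + complex_of_real e * ?g K X)))" for X
      unfolding expwave_add q_def q0_def power_Suc of_real_mult of_real_add of_real_divide cosf
      by (simp add: field_simps del: pt_arith)
    have "torus_mean \<tau> (?g L) = 0" if "L \<in> wave_lattice \<tau>" for L using Suc.IH[OF that] .
    then have 0: "torus_mean \<tau> (\<lambda>X. a * ?g L X) = 0" if "L \<in> wave_lattice \<tau>" for a L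
      using that by (simp only: torus_mean_mult) simp
    have L: "?K1 + K \<in> wave_lattice \<tau>" "- ?K1 + K \<in> wave_lattice \<tau>" "?K2 + K \<in> wave_lattice \<tau>" "- ?K2 + K \<in> wave_lattice \<tau>"
      using Suc.prems wave_lattice_gen wave_lattice_uminus by (blast intro: wave_lattice_add)+
    show ?case unfolding eq
      by (subst torus_mean_add, (intro cg continuous_on_add)+)+
        (simp only: 0[OF L(1)] 0[OF L(2)] 0[OF L(3)] 0[OF L(4)] 0[OF Suc.prems], simp)
  qed
  have zero: "integral (cell \<tau>) (\<lambda>X. F X * q X ^ (2 * N)) = 0" for N
  proof -
    have "torus_mean \<tau> (\<lambda>X. complex_of_real (f X * q X ^ (2 * N))) = 0"
      using orth[OF wave_lattice_gen(3), of "2 * N"] by simp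
    then have "complex_of_real (torus_mean \<tau> (\<lambda>X. f X * q X ^ (2 * N))) = 0"
      by (subst (asm) torus_mean_bounded_linear) (intro continuous_intros c cq bounded_linear_of_real)+
    then have "integral (cell \<tau>) (\<lambda>X. f X * q X ^ (2 * N)) = 0" using t by (simp add: torus_mean_def)
    then show ?thesis by (simp add: F_def)
  qed
  have "isCont F X0" "isCont q X0" using cF[of UNIV] cq[of UNIV] by (auto simp: continuous_on_eq_continuous_at)
  then have lim: "(F \<longlongrightarrow> F X0) (nhds X0)" "(q \<longlongrightarrow> q X0) (nhds X0)"
    by (simp_all add: isCont_def tendsto_at_iff_tendsto_nhds)
  have gt: "F X0 > 1 / 2" "q X0 > 1 + e / 2" using nz e by (auto simp: F_def q_def q0_def)
  have "\<forall>\<^sub>F X in nhds X0. F X > 1 / 2 \<and> q X > 1 + e / 2"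
    by (intro eventually_conj order_tendstoD(1)[OF lim(1) gt(1)] order_tendstoD(1)[OF lim(2) gt(2)])
  then obtain O1 where O1: "open O1" "X0 \<in> O1" "\<And>X. X \<in> O1 \<Longrightarrow> F X > 1 / 2 \<and> q X > 1 + e / 2"
    unfolding eventually_nhds by blast
  obtain a b where ab: "\<forall>i\<in>Basis. a \<bullet> i < b \<bullet> i" "cbox a b \<subseteq> O1 \<inter> box (pt 0 0) (pt (2 * pi) (2 * pi / \<tau>))"
    by (rule open_contains_cbox[of "O1 \<inter> box (pt 0 0) (pt (2 * pi) (2 * pi / \<tau>))" X0])
      (use O1 X0 in \<open>auto intro: open_Int open_box\<close>)
  have Bsub: "cbox a b \<subseteq> cell \<tau>" using ab(2) box_subset_cbox by blast
  have Bpos: "0 < measure lborel (cbox a b)" by (rule content_pos_lt[OF ab(1)])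
  obtain A where A: "0 \<le> A" "\<And>X. X \<in> cell \<tau> \<Longrightarrow> \<bar>F X\<bar> \<le> A"
  proof -
    have "bounded (F ` cell \<tau>)" by (intro compact_imp_bounded compact_continuous_image cF compact_cbox)
    then obtain A where "\<forall>y \<in> F ` cell \<tau>. norm y \<le> A" unfolding bounded_iff by blast
    then show ?thesis using that[of "\<bar>A\<bar>"] by fastforce
  qed
  \<comment> \<open>Even powers make the integrand nonnegative wherever \<open>F\<close> is; on
    \<open>S\<close> it is at least \<open>- A\<close>, and on the small box around
    \<open>X0\<close> it grows geometrically. As the total integral is 0, the growth would have to
    be bounded.\<close>
  have key: "1 / 2 * (1 + e / 2) ^ (2 * N) * measure lborel (cbox a b) \<le> A * measure lborel (cell \<tau>)" for N
  proof -
    let ?k = "1 / 2 * (1 + e / 2) ^ (2 * N)"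
    have pw: "(if X \<in> cbox a b then ?k else 0) - A \<le> F X * q X ^ (2 * N)" if X: "X \<in> cell \<tau>" for X
    proof -
      consider "X \<in> cbox a b" | "X \<notin> cbox a b" "X \<in> S" | "X \<notin> cbox a b" "X \<notin> S" by blast
      then show ?thesis
      proof cases
        case 1
        then have "1 / 2 \<le> F X" "1 + e / 2 \<le> q X" using ab(2) O1(3)[of X] by auto
        moreover have "(1 + e / 2) ^ (2 * N) \<le> q X ^ (2 * N)" using calculation e by (intro power_mono) auto
        ultimately have "?k \<le> F X * q X ^ (2 * N)" using e by (intro mult_mono) auto
        with 1 A(1) show ?thesis by simp
      next
        case 2
        have "\<bar>q X\<bar> ^ (2 * N) \<le> 1" using qS[OF 2(2)] by (intro power_le_one) auto
        then have "\<bar>F X * q X ^ (2 * N)\<bar> \<le> A * 1"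
          unfolding abs_mult power_abs using A X by (intro mult_mono) auto
        with 2 show ?thesis by simp
      next
        case 3
        then have "0 \<le> F X" using X by (auto simp: S_def)
        then have "0 \<le> F X * q X ^ (2 * N)" by (simp add: power_mult)
        with 3 A(1) show ?thesis by simp
      qed
    qed
    have i1: "((\<lambda>X. if X \<in> cbox a b then ?k else 0) has_integral ?k * measure lborel (cbox a b)) (cell \<tau>)"
      using has_integral_restrict[OF Bsub, of "\<lambda>X. ?k"] has_integral_const[of ?k a b] by (simp add: mult.commute)
    have i2: "((\<lambda>X. A) has_integral A * measure lborel (cell \<tau>)) (cell \<tau>)"
      using has_integral_const[of A "pt 0 0" "pt (2 * pi) (2 * pi / \<tau>)"] by (simp add: mult.commute)
    have "?k * measure lborel (cbox a b) - A * measure lborel (cell \<tau>) \<le> integral (cell \<tau>) (\<lambda>X. F X * q X ^ (2 * N))"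
      by (intro has_integral_le[OF has_integral_diff[OF i1 i2] integrable_integral] integrable_continuous
          continuous_intros cF cq pw)
    then show ?thesis unfolding zero by simp
  qed
  obtain n where n: "A * measure lborel (cell \<tau>) / (1 / 2 * measure lborel (cbox a b)) < (1 + e / 2) ^ n"
    using real_arch_pow[of "1 + e / 2"] e by auto
  have "(1 + e / 2) ^ n \<le> (1 + e / 2) ^ (2 * n)" using e by (intro power_increasing) auto
  with n have "A * measure lborel (cell \<tau>) / (1 / 2 * measure lborel (cbox a b)) < (1 + e / 2) ^ (2 * n)" by linarith
  then have "A * measure lborel (cell \<tau>) < (1 + e / 2) ^ (2 * n) * (1 / 2 * measure lborel (cbox a b))"
    using Bpos by (simp add: divide_less_eq)
  with key[of n] show False by (simp add: mult_ac)
qed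

text \<open>The interior case leaves room for a box around the point; closure of the open cell and
  periodicity give the rest of the plane.\<close>

lemma fourier_zero:
  fixes f :: "real^2 \<Rightarrow> real"
  assumes t: "0 < \<tau>" and c: "continuous_on UNIV f" and p: "periodic \<tau> f"
    and z: "\<And>K. K \<in> wave_lattice \<tau> \<Longrightarrow> torus_mean \<tau> (\<lambda>X. complex_of_real (f X) * expwave K X) = 0"
  shows "f X = 0"
proof -
  have ne: "box (pt 0 0) (pt (2 * pi) (2 * pi / \<tau>)) \<noteq> {}"
  proof -
    have "pt pi (pi / \<tau>) \<in> box (pt 0 0) (pt (2 * pi) (2 * pi / \<tau>))" using t by (simp add: mem_box_vec2 field_simps del: pt_arith(7))
    then show ?thesis by blast
  qed
  have "f Y = 0" if "Y \<in> cell \<tau>" for Y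
  proof (rule continuous_constant_on_closure[of "box (pt 0 0) (pt (2 * pi) (2 * pi / \<tau>))"])
    show "continuous_on (closure (box (pt 0 0) (pt (2 * pi) (2 * pi / \<tau>)))) f" using c continuous_on_subset by blast
    show "f X = 0" if "X \<in> box (pt 0 0) (pt (2 * pi) (2 * pi / \<tau>))" for X
      by (rule fourier_zero_interior[OF t c p z that])
    show "Y \<in> closure (box (pt 0 0) (pt (2 * pi) (2 * pi / \<tau>)))" using that closure_box[OF ne] by simp
  qed
  moreover obtain g where "g \<in> period_lattice \<tau>" "X + g \<in> cell \<tau>" using periodic_reduce[OF t] by blast
  moreover from this p have "f (X + g) = f X" by (simp add: periodic_def)
  ultimately show ?thesis by simp
qed


section \<open>Absolutely convergent Fourier series\<close>

text \<open>An enumeration turns sums over the lattice into ordinary series, to which Weierstrass'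
  test and termwise differentiation apply.\<close>

definition kap :: "real \<Rightarrow> nat \<Rightarrow> real^2" where "kap \<tau> = from_nat_into (wave_lattice \<tau>)"

definition wt :: "real \<Rightarrow> nat \<Rightarrow> real" where "wt \<tau> n = 1 + (norm (kap \<tau> n))^2"

definition wave :: "real \<Rightarrow> int \<times> int \<Rightarrow> real^2" where
  "wave \<tau> p = pt (of_int (fst p + snd p)) (\<tau> * of_int (fst p - snd p))"

lemma wave_lattice_eq_range: "wave_lattice \<tau> = range (wave \<tau>)"
proof (intro set_eqI iffI)
  fix K assume "K \<in> wave_lattice \<tau>"
  then obtain i j :: int where "K = pt (of_int (i + j)) (\<tau> * of_int (i - j))" unfolding wave_lattice_iff by blast
  then show "K \<in> range (wave \<tau>)" by (intro range_eqI[of _ _ "(i, j)"]) (simp only: wave_def fst_conv snd_conv)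
next
  fix K assume "K \<in> range (wave \<tau>)"
  then show "K \<in> wave_lattice \<tau>" unfolding wave_lattice_iff wave_def by blast
qed

lemma bij_wave_lattice:
  assumes "0 < \<tau>"
  shows "bij_betw (wave \<tau>) UNIV (wave_lattice \<tau>)"
proof -
  have "p = q" if eq: "wave \<tau> p = wave \<tau> q" for p q
  proof -
    have "real_of_int (fst p + snd p) = of_int (fst q + snd q)" "\<tau> * of_int (fst p - snd p) = \<tau> * of_int (fst q - snd q)"
      using arg_cong[OF eq, of "\<lambda>X. X $ 1"] arg_cong[OF eq, of "\<lambda>X. X $ 2"] unfolding wave_def vector_2 .
    then have "fst p + snd p = fst q + snd q" "fst p - snd p = fst q - snd q"
      using assms by (simp_all only: mult_cancel_left of_int_eq_iff) auto
    then have "fst p = fst q \<and> snd p = snd q" by presburger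
    then show ?thesis by (simp add: prod_eq_iff)
  qed
  then have "inj (wave \<tau>)" by (rule injI)
  then show ?thesis unfolding wave_lattice_eq_range by (rule inj_on_imp_bij_betw)
qed

lemma bij_kap: "0 < \<tau> \<Longrightarrow> bij_betw (kap \<tau>) UNIV (wave_lattice \<tau>)"
proof -
  assume t: "0 < \<tau>"
  have "infinite (UNIV :: (int \<times> int) set)" by (simp add: finite_prod)
  then have "infinite (wave_lattice \<tau>)" using bij_betw_finite[OF bij_wave_lattice[OF t]] by blast
  moreover have "countable (wave_lattice \<tau>)" unfolding wave_lattice_eq_range by (intro countable_image) auto
  ultimately show ?thesis unfolding kap_def by (intro bij_betw_from_nat_into)
qed

lemma kap_in: "0 < \<tau> \<Longrightarrow> kap \<tau> n \<in> wave_lattice \<tau>"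
  using bij_kap by (auto simp: bij_betw_def)

lemma wt_ge1: "1 \<le> wt \<tau> n" by (simp add: wt_def)

lemma summable_on_int_inverse_square: "(\<lambda>i :: int. 1 / (1 + (of_int i)^2) :: real) summable_on UNIV"
proof -
  let ?f = "\<lambda>i :: int. 1 / (1 + (of_int i)^2) :: real"
  have "summable (\<lambda>n. 1 / (1 + (real n)^2))"
  proof (rule summable_comparison_test'[where N = 1])
    show "summable (\<lambda>n. inverse (real n ^ 2))" by (rule inverse_power_summable) simp
    show "norm (1 / (1 + (real n)^2)) \<le> inverse (real n ^ 2)" if "1 \<le> n" for n
    proof -
      have "1 / (1 + (real n)^2) \<le> 1 / (real n)^2" using that by (intro frac_le) auto
      then show ?thesis by (simp add: inverse_eq_divide)
    qed
  qed
  then have s: "(\<lambda>n. 1 / (1 + (real n)^2)) summable_on UNIV" by (intro summable_nonneg_imp_summable_on) auto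
  have "?f summable_on range int" "?f summable_on range (\<lambda>n. - int n)"
    using s by (subst summable_on_reindex; auto simp: inj_def o_def)+
  then have "?f summable_on (range int \<union> range (\<lambda>n. - int n))" by (rule summable_on_union)
  moreover have "range int \<union> range (\<lambda>n. - int n) = UNIV"
  proof -
    have "i \<in> range int \<union> range (\<lambda>n. - int n)" for i by (cases i rule: int_cases2) auto
    then show ?thesis by blast
  qed
  ultimately show ?thesis by simp
qed

text \<open>This is the sum behind the Sobolev embedding in dimension two. With
  \<open>c = min 1 (\<tau>^2)\<close> the weight dominates c (1 + i^2 + j^2), whose square dominates
  c^2 (1 + i^2)(1 + j^2), so the double sum is compared with a product of two convergent
  ones.\<close>

lemma summable_wt:
  assumes t: "0 < \<tau>"
  shows "summable (\<lambda>n. (1 / wt \<tau> n)^2)"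
proof -
  define c where "c = min 1 (\<tau>^2)"
  have c: "0 < c" "c \<le> 1" "c \<le> \<tau>^2" using t by (auto simp: c_def)
  let ?h = "\<lambda>i :: int. 1 / (1 + (of_int i)^2) :: real"
  obtain S where S: "(?h has_sum S) UNIV" using summable_on_int_inverse_square by (auto simp: summable_on_def)
  have "(\<lambda>(i, j). ?h i * ?h j) summable_on (UNIV \<times> UNIV)"
  proof (rule summable_on_SigmaI[where g = "\<lambda>i. ?h i * S"])
    show "((\<lambda>j. case (i, j) of (i, j) \<Rightarrow> ?h i * ?h j) has_sum ?h i * S) UNIV" for i
      using has_sum_cmult_right[OF S, of "?h i"] by simp
    show "(\<lambda>i. ?h i * S) summable_on UNIV"
      using summable_on_cmult_left[OF summable_on_int_inverse_square] by simp
  qed auto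
  then have s: "(\<lambda>p. 1 / c^2 * (\<lambda>(i, j). ?h i * ?h j) p) summable_on UNIV"
    by (intro summable_on_cmult_right) simp
  have le: "(1 / (1 + (norm (wave \<tau> p))^2))^2 \<le> 1 / c^2 * (\<lambda>(i, j). ?h i * ?h j) p" for p
  proof -
    define a b where "a = real_of_int (fst p)" and "b = real_of_int (snd p)"
    let ?N = "1 + (norm (pt (a + b) (\<tau> * (a - b))))^2"
    have n: "(norm (pt (a + b) (\<tau> * (a - b))))^2 = (a + b)^2 + \<tau>^2 * (a - b)^2"
      by (simp add: norm_vec2 power_mult_distrib)
    have "c * (1 + a^2 + b^2) \<le> c * 1 + c * ((a + b)^2 + (a - b)^2)"
    proof -
      have "0 \<le> c * (a^2 + b^2)" using c by simp
      then show ?thesis by (simp add: algebra_simps power2_eq_square)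
    qed
    also have "\<dots> \<le> 1 + (1 * (a + b)^2 + \<tau>^2 * (a - b)^2)"
      unfolding distrib_left[of c "(a + b)^2"] using c by (intro add_mono mult_right_mono) auto
    finally have "c * (1 + a^2 + b^2) \<le> ?N" by (simp add: n)
    moreover have pos: "0 < c * (1 + a^2 + b^2)" using c by (intro mult_pos_pos) (auto simp: add_pos_nonneg)
    ultimately have "(c * (1 + a^2 + b^2))^2 \<le> ?N^2" by (intro power_mono) auto
    moreover have "c^2 * ((1 + a^2) * (1 + b^2)) \<le> (c * (1 + a^2 + b^2))^2"
    proof -
      have "(1 + x) * (1 + y) \<le> (1 + x + y)^2" if "0 \<le> x" "0 \<le> y" for x y :: real
        using that mult_nonneg_nonneg[OF that] mult_nonneg_nonneg[OF that(1) that(1)] mult_nonneg_nonneg[OF that(2) that(2)]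
        by (simp add: algebra_simps power2_eq_square)
      then show ?thesis unfolding power_mult_distrib by (intro mult_left_mono) auto
    qed
    ultimately have "c^2 * ((1 + a^2) * (1 + b^2)) \<le> ?N^2" by linarith
    moreover have "0 < c^2 * ((1 + a^2) * (1 + b^2))"
      using c by (intro mult_pos_pos) (auto simp: add_pos_nonneg)
    ultimately have "1 / ?N^2 \<le> 1 / (c^2 * ((1 + a^2) * (1 + b^2)))" by (intro frac_le) auto
    then show ?thesis by (simp add: a_def b_def wave_def power_divide case_prod_unfold)
  qed
  have "(\<lambda>p. (1 / (1 + (norm (wave \<tau> p))^2))^2) summable_on UNIV"
    by (rule summable_on_comparison_test[OF s le]) simp
  then have "(\<lambda>K. (1 / (1 + (norm K)^2))^2) summable_on wave_lattice \<tau>"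
    using summable_on_reindex_bij_betw[OF bij_wave_lattice[OF t], of "\<lambda>K. (1 / (1 + (norm K)^2))^2"] by simp
  then have "(\<lambda>n. (1 / wt \<tau> n)^2) summable_on UNIV"
    unfolding wt_def using summable_on_reindex_bij_betw[OF bij_kap[OF t], of "\<lambda>K. (1 / (1 + (norm K)^2))^2"] by simp
  then show ?thesis by (rule summable_on_imp_summable)
qed

lemma cauchy_schwarz_series:
  fixes a b :: "nat \<Rightarrow> real"
  assumes "summable (\<lambda>n. (a n)^2)" "summable (\<lambda>n. (b n)^2)"
  shows "summable (\<lambda>n. \<bar>a n * b n\<bar>)" "(\<Sum>n. \<bar>a n * b n\<bar>) \<le> sqrt (\<Sum>n. (a n)^2) * sqrt (\<Sum>n. (b n)^2)"
proof -
  have le: "(\<Sum>i<n. \<bar>a i * b i\<bar>) \<le> sqrt (\<Sum>n. (a n)^2) * sqrt (\<Sum>n. (b n)^2)" for n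
  proof -
    have "(\<Sum>i<n. \<bar>a i * b i\<bar>) \<le> L2_set a {..<n} * L2_set b {..<n}"
      unfolding abs_mult by (rule L2_set_mult_ineq)
    also have "\<dots> \<le> sqrt (\<Sum>n. (a n)^2) * sqrt (\<Sum>n. (b n)^2)"
      unfolding L2_set_def using assms
      by (intro mult_mono real_sqrt_le_mono sum_le_suminf) (auto intro: sum_nonneg suminf_nonneg)
    finally show ?thesis .
  qed
  show "summable (\<lambda>n. \<bar>a n * b n\<bar>)"
    by (rule bounded_imp_summable[OF _ le[of "Suc n" for n, unfolded lessThan_Suc_atMost]]) auto
  then show "(\<Sum>n. \<bar>a n * b n\<bar>) \<le> sqrt (\<Sum>n. (a n)^2) * sqrt (\<Sum>n. (b n)^2)"
    using le by (intro suminf_le_const) auto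
qed

text \<open>Summing real parts yields a real function without a symmetry condition on the
  coefficients.\<close>

definition fser :: "real \<Rightarrow> (nat \<Rightarrow> complex) \<Rightarrow> real^2 \<Rightarrow> real" where
  "fser \<tau> a X = (\<Sum>n. Re (a n * expwave (kap \<tau> n) X))"

lemma fser_term_bound: "\<bar>Re (a n * expwave K X)\<bar> \<le> cmod (a n)"
  using abs_Re_le_cmod[of "a n * expwave K X"] by (simp add: norm_mult)

lemma fser_bound:
  assumes "summable (\<lambda>n. cmod (a n))"
  shows "\<bar>fser \<tau> a X\<bar> \<le> (\<Sum>n. cmod (a n))"
proof -
  have s: "summable (\<lambda>n. \<bar>Re (a n * expwave (kap \<tau> n) X)\<bar>)"
    by (rule summable_comparison_test'[OF assms, of 0]) (use fser_term_bound in auto)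
  have "\<bar>fser \<tau> a X\<bar> \<le> (\<Sum>n. \<bar>Re (a n * expwave (kap \<tau> n) X)\<bar>)"
    unfolding fser_def by (rule summable_rabs[OF s])
  also have "\<dots> \<le> (\<Sum>n. cmod (a n))" by (intro suminf_le fser_term_bound s assms)
  finally show ?thesis .
qed

lemma fser_continuous:
  assumes "summable (\<lambda>n. cmod (a n))"
  shows "continuous_on UNIV (fser \<tau> a)"
proof -
  have "uniform_limit UNIV (\<lambda>N X. \<Sum>n<N. Re (a n * expwave (kap \<tau> n) X)) (\<lambda>X. \<Sum>n. Re (a n * expwave (kap \<tau> n) X)) sequentially"
    by (rule Weierstrass_m_test[OF _ assms]) (use fser_term_bound in auto)
  then have "continuous_on UNIV (\<lambda>X. \<Sum>n. Re (a n * expwave (kap \<tau> n) X))"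
    by (rule uniform_limit_theorem[rotated])
      (auto intro!: always_eventually continuous_intros)
  then show ?thesis by (simp add: fser_def[abs_def])
qed

text \<open>Termwise differentiation: the tail of the differentiated series is at most
  \<open>norm h\<close> times a tail of the first moment of the coefficients, uniformly in the
  point.\<close>

lemma fser_has_derivative:
  assumes s0: "summable (\<lambda>n. cmod (a n))" and s1: "summable (\<lambda>n. cmod (a n) * norm (kap \<tau> n))"
  shows "(fser \<tau> a has_derivative (\<lambda>v. fser \<tau> (\<lambda>n. \<i> * complex_of_real (kap \<tau> n \<bullet> v) * a n) X)) (at X)"
proof -
  define f where "f n X = Re (a n * expwave (kap \<tau> n) X)" for n X
  define f' where "f' n X v = Re (\<i> * complex_of_real (kap \<tau> n \<bullet> v) * a n * expwave (kap \<tau> n) X)" for n X v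
  have d: "(f n has_derivative f' n X) (at X within UNIV)" for n X
  proof -
    have "((\<lambda>X. \<i> * complex_of_real (kap \<tau> n \<bullet> X)) has_derivative (\<lambda>v. \<i> * of_real (kap \<tau> n \<bullet> v))) (at X)"
      by (intro has_derivative_mult_right has_derivative_of_real has_derivative_inner_right has_derivative_ident)
    from has_derivative_mult_right[OF has_derivative_compose[OF this DERIV_exp[unfolded has_field_derivative_def]], of "a n"]
    have "((\<lambda>X. a n * exp (\<i> * of_real (kap \<tau> n \<bullet> X))) has_derivative
        (\<lambda>v. a n * (exp (\<i> * of_real (kap \<tau> n \<bullet> X)) * (\<i> * of_real (kap \<tau> n \<bullet> v))))) (at X)" .
    from bounded_linear.has_derivative[OF bounded_linear_Re this] show ?thesis
      by (simp add: f_def[abs_def] f'_def[abs_def] expwave_def cis_conv_exp mult_ac)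
  qed
  have b: "\<bar>f' n X v\<bar> \<le> norm v * (cmod (a n) * norm (kap \<tau> n))" for n X v
  proof -
    have "\<bar>f' n X v\<bar> \<le> cmod (\<i> * complex_of_real (kap \<tau> n \<bullet> v) * a n)"
      unfolding f'_def by (rule fser_term_bound)
    also have "\<dots> = \<bar>kap \<tau> n \<bullet> v\<bar> * cmod (a n)" by (simp add: norm_mult)
    also have "\<dots> \<le> (norm (kap \<tau> n) * norm v) * cmod (a n)" by (intro mult_right_mono Cauchy_Schwarz_ineq2) auto
    finally show ?thesis by (simp add: mult_ac)
  qed
  have sf': "summable (\<lambda>n. f' n X v)" for X v
    by (rule summable_comparison_test'[OF summable_mult[OF s1, of "norm v"], of 0]) (use b in auto)
  define g' where "g' X v = (\<Sum>n. f' n X v)" for X v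
  have "\<exists>g. \<forall>x\<in>UNIV. (\<lambda>n. f n x) sums g x \<and> (g has_derivative g' x) (at x within UNIV)"
  proof (rule has_derivative_series[where x = 0 and f = f and f' = f' and g' = g' and S = UNIV
        and l = "suminf (\<lambda>n. f n 0)", OF convex_UNIV d])
    fix e :: real assume "0 < e"
    from suminf_exist_split[OF this s1] obtain N where
      N: "\<And>n. n \<ge> N \<Longrightarrow> norm (\<Sum>i. cmod (a (i + n)) * norm (kap \<tau> (i + n))) < e" by blast
    show "\<forall>\<^sub>F n in sequentially. \<forall>x\<in>UNIV. \<forall>h :: real^2. norm ((\<Sum>i<n. f' i x h) - g' x h) \<le> e * norm h"
    proof (rule eventually_sequentiallyI[of N], intro ballI allI)
      fix n X and h :: "real^2" assume "N \<le> n"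
      have s1': "summable (\<lambda>i. norm h * (cmod (a (i + n)) * norm (kap \<tau> (i + n))))"
        using s1 by (intro summable_mult) (simp add: summable_iff_shift[where f = "\<lambda>n. cmod (a n) * norm (kap \<tau> n)"])
      have ab: "summable (\<lambda>i. \<bar>f' (i + n) X h\<bar>)"
        by (rule summable_comparison_test'[OF s1', of 0]) (use b in auto)
      have "norm ((\<Sum>i<n. f' i X h) - g' X h) = \<bar>\<Sum>i. f' (i + n) X h\<bar>"
        unfolding g'_def using suminf_minus_initial_segment[OF sf', of n X h] by simp
      also have "\<dots> \<le> (\<Sum>i. \<bar>f' (i + n) X h\<bar>)" by (rule summable_rabs[OF ab])
      also have "\<dots> \<le> (\<Sum>i. norm h * (cmod (a (i + n)) * norm (kap \<tau> (i + n))))"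
        by (intro suminf_le b ab s1')
      also have "\<dots> = norm h * (\<Sum>i. cmod (a (i + n)) * norm (kap \<tau> (i + n)))"
        using s1 by (intro suminf_mult) (simp add: summable_iff_shift[where f = "\<lambda>n. cmod (a n) * norm (kap \<tau> n)"])
      also have "\<dots> \<le> norm h * e" using N[OF \<open>N \<le> n\<close>] by (intro mult_left_mono) auto
      finally show "norm ((\<Sum>i<n. f' i X h) - g' X h) \<le> e * norm h" by (simp add: mult.commute)
    qed
  next
    have "summable (\<lambda>n. f n 0)"
      unfolding f_def by (rule summable_comparison_test'[OF s0, of 0]) (use fser_term_bound in auto)
    then show "(\<lambda>n. f n 0) sums suminf (\<lambda>n. f n 0)" by (rule summable_sums)
  qed simp
  then obtain g where g: "\<And>x. (\<lambda>n. f n x) sums g x" "\<And>x. (g has_derivative g' x) (at x)" by auto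
  have "g = fser \<tau> a" using sums_unique[OF g(1)] by (auto simp: fser_def f_def fun_eq_iff)
  moreover have "g' X = (\<lambda>v. fser \<tau> (\<lambda>n. \<i> * complex_of_real (kap \<tau> n \<bullet> v) * a n) X)"
    by (simp add: g'_def f'_def fser_def fun_eq_iff)
  ultimately show ?thesis using g(2)[of X] by simp
qed

lemma fser_deriv:
  assumes "summable (\<lambda>n. cmod (a n))" "summable (\<lambda>n. cmod (a n) * norm (kap \<tau> n))"
  shows "dirderiv v (fser \<tau> a) = fser \<tau> (\<lambda>n. \<i> * complex_of_real (kap \<tau> n \<bullet> v) * a n)"
    and "fser \<tau> a differentiable (at X)"
  using fser_has_derivative[OF assms] by (auto simp: fun_eq_iff differentiable_def intro: dirderiv_eqI)

lemma cmod_deriv_coeff: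
  assumes "e \<in> Basis"
  shows "cmod (\<i> * complex_of_real (kap \<tau> n \<bullet> e) * a n) * norm (kap \<tau> n) ^ j \<le> cmod (a n) * norm (kap \<tau> n) ^ Suc j"
proof -
  have "\<bar>kap \<tau> n \<bullet> e\<bar> \<le> norm (kap \<tau> n)" using Basis_le_norm[OF assms] by simp
  then have "\<bar>kap \<tau> n \<bullet> e\<bar> * (cmod (a n) * norm (kap \<tau> n) ^ j) \<le> norm (kap \<tau> n) * (cmod (a n) * norm (kap \<tau> n) ^ j)"
    by (intro mult_right_mono) auto
  then show ?thesis by (simp add: norm_mult mult_ac)
qed

lemma deriv_coeff_summable:
  assumes "e \<in> Basis" "summable (\<lambda>n. cmod (a n) * norm (kap \<tau> n) ^ Suc j)"
  shows "summable (\<lambda>n. cmod (\<i> * complex_of_real (kap \<tau> n \<bullet> e) * a n) * norm (kap \<tau> n) ^ j)"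
    and "(\<Sum>n. cmod (\<i> * complex_of_real (kap \<tau> n \<bullet> e) * a n) * norm (kap \<tau> n) ^ j) \<le> (\<Sum>n. cmod (a n) * norm (kap \<tau> n) ^ Suc j)"
proof -
  show s: "summable (\<lambda>n. cmod (\<i> * complex_of_real (kap \<tau> n \<bullet> e) * a n) * norm (kap \<tau> n) ^ j)"
    by (rule summable_comparison_test'[OF assms(2), of 0]) (use cmod_deriv_coeff[OF assms(1)] in auto)
  show "(\<Sum>n. cmod (\<i> * complex_of_real (kap \<tau> n \<bullet> e) * a n) * norm (kap \<tau> n) ^ j) \<le> (\<Sum>n. cmod (a n) * norm (kap \<tau> n) ^ Suc j)"
    by (intro suminf_le cmod_deriv_coeff assms s)
qed

text \<open>A derivative multiplies the coefficients by a component of the wave vector and so raises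
  the moment by one; moment bounds \<open>A * L^j\<close> are \<open>Qb\<close> seen on the Fourier
  side.\<close>

lemma Qb_fser:
  assumes "\<And>j. j \<le> k \<Longrightarrow> summable (\<lambda>n. cmod (a n) * norm (kap \<tau> n) ^ j)"
    and "\<And>j. j \<le> k \<Longrightarrow> (\<Sum>n. cmod (a n) * norm (kap \<tau> n) ^ j) \<le> A * L ^ j"
  shows "Qb L k A (fser \<tau> a)"
  using assms
proof (induction k arbitrary: a A)
  case 0
  then have "summable (\<lambda>n. cmod (a n))" "(\<Sum>n. cmod (a n)) \<le> A" using 0[of 0] by simp_all
  then show ?case using fser_bound[of a \<tau>] fser_continuous[of a \<tau>] order_trans by fastforce
next
  case (Suc k)
  have s: "summable (\<lambda>n. cmod (a n))" "(\<Sum>n. cmod (a n)) \<le> A" using Suc.prems[of 0] by simp_all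
  have s1: "summable (\<lambda>n. cmod (a n) * norm (kap \<tau> n))" using Suc.prems(1)[of 1] by simp
  have "Qb L k (A * L) (fser \<tau> (\<lambda>n. \<i> * complex_of_real (kap \<tau> n \<bullet> e) * a n))" if e: "e \<in> Basis" for e
  proof (rule Suc.IH)
    fix j assume j: "j \<le> k"
    have sj: "summable (\<lambda>n. cmod (a n) * norm (kap \<tau> n) ^ Suc j)"
      and bj: "(\<Sum>n. cmod (a n) * norm (kap \<tau> n) ^ Suc j) \<le> A * L ^ Suc j"
      using Suc.prems[of "Suc j"] j by simp_all
    show "summable (\<lambda>n. cmod (\<i> * complex_of_real (kap \<tau> n \<bullet> e) * a n) * norm (kap \<tau> n) ^ j)"
      by (rule deriv_coeff_summable[OF e sj])
    show "(\<Sum>n. cmod (\<i> * complex_of_real (kap \<tau> n \<bullet> e) * a n) * norm (kap \<tau> n) ^ j) \<le> A * L * L ^ j"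
      using deriv_coeff_summable(2)[OF e sj] bj by (simp add: mult.assoc)
  qed
  moreover have "\<bar>fser \<tau> a X\<bar> \<le> A" for X using fser_bound[OF s(1), of \<tau> X] s(2) by linarith
  ultimately show ?case using fser_deriv[OF s(1) s1] by simp
qed

text \<open>Uniform convergence lets the coefficients of the complex sum \<open>S\<close> be
  computed termwise. They agree with those of \<open>u\<close>, so \<open>u - S\<close> is
  orthogonal to every wave, and \<open>fourier_zero\<close> applies to its real part.\<close>

lemma fourier_inversion:
  assumes t: "0 < \<tau>" and c: "continuous_on UNIV u" and p: "periodic \<tau> u"
    and s: "summable (\<lambda>n. cmod (fourier_coeff \<tau> u (kap \<tau> n)))"
  shows "u = fser \<tau> (\<lambda>n. fourier_coeff \<tau> u (kap \<tau> n))"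
proof -
  define a where "a n = fourier_coeff \<tau> u (kap \<tau> n)" for n
  define S where "S X = (\<Sum>n. a n * expwave (kap \<tau> n) X)" for X
  have s': "summable (\<lambda>n. cmod (a n))" using s by (simp add: a_def)
  have ul: "uniform_limit UNIV (\<lambda>N X. \<Sum>n<N. a n * expwave (kap \<tau> n) X) S sequentially"
    unfolding S_def by (rule Weierstrass_m_test[OF _ s']) (simp add: norm_mult)
  have cS: "continuous_on UNIV S"
    by (rule uniform_limit_theorem[OF _ ul]) (auto intro!: always_eventually continuous_intros)
  have pS: "periodic \<tau> S"
    using periodic_expwave[OF kap_in[OF t]] by (simp add: periodic_def S_def)
  have mean: "torus_mean \<tau> (\<lambda>X. S X * expwave K X) = fourier_coeff \<tau> u (- K)" if K: "K \<in> wave_lattice \<tau>" for K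
  proof -
    have "uniform_limit UNIV (\<lambda>N X. (\<Sum>n<N. a n * expwave (kap \<tau> n) X) * expwave K X) (\<lambda>X. S X * expwave K X) sequentially"
      unfolding sum_distrib_right S_def suminf_mult2[OF summable_norm_cancel, symmetric]
    proof -
      have sn: "summable (\<lambda>n. a n * expwave (kap \<tau> n) X)" for X
        by (rule summable_comparison_test'[OF s', of 0]) (simp add: norm_mult)
      have "uniform_limit UNIV (\<lambda>N X. \<Sum>n<N. a n * expwave (kap \<tau> n) X * expwave K X)
          (\<lambda>X. \<Sum>n. a n * expwave (kap \<tau> n) X * expwave K X) sequentially"
        by (rule Weierstrass_m_test[OF _ s']) (simp add: norm_mult)
      then show "uniform_limit UNIV (\<lambda>N X. \<Sum>n<N. a n * expwave (kap \<tau> n) X * expwave K X)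
          (\<lambda>X. (\<Sum>n. a n * expwave (kap \<tau> n) X) * expwave K X) sequentially"
        by (simp add: suminf_mult2[OF sn])
    qed
    then have ul: "uniform_limit (cell \<tau>) (\<lambda>N X. (\<Sum>n<N. a n * expwave (kap \<tau> n) X) * expwave K X) (\<lambda>X. S X * expwave K X) sequentially"
      using uniform_limit_on_subset by blast
    obtain I J where I: "\<And>N. ((\<lambda>X. (\<Sum>n<N. a n * expwave (kap \<tau> n) X) * expwave K X) has_integral I N) (cell \<tau>)"
      and J: "((\<lambda>X. S X * expwave K X) has_integral J) (cell \<tau>)" and IJ: "I \<longlonglongrightarrow> J"
      by (rule uniform_limit_integral_cbox[OF ul]) (auto intro!: continuous_intros)
    have "(\<lambda>N. torus_mean \<tau> (\<lambda>X. (\<Sum>n<N. a n * expwave (kap \<tau> n) X) * expwave K X)) \<longlonglongrightarrow> torus_mean \<tau> (\<lambda>X. S X * expwave K X)"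
      unfolding torus_mean_def integral_unique[OF I] integral_unique[OF J] by (intro tendsto_intros IJ)
    moreover have "torus_mean \<tau> (\<lambda>X. (\<Sum>n<N. a n * expwave (kap \<tau> n) X) * expwave K X) =
        (\<Sum>n<N. if kap \<tau> n = - K then a n else 0)" for N
    proof (induction N)
      case 0 then show ?case by (simp add: torus_mean_def)
    next
      case (Suc N)
      have "torus_mean \<tau> (\<lambda>X. (\<Sum>n<Suc N. a n * expwave (kap \<tau> n) X) * expwave K X) =
        torus_mean \<tau> (\<lambda>X. (\<Sum>n<N. a n * expwave (kap \<tau> n) X) * expwave K X + a N * expwave (kap \<tau> N + K) X)"
        by (simp add: expwave_add algebra_simps)
      also have "\<dots> = torus_mean \<tau> (\<lambda>X. (\<Sum>n<N. a n * expwave (kap \<tau> n) X) * expwave K X) + a N * torus_mean \<tau> (expwave (kap \<tau> N + K))"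
        by (subst torus_mean_add) (auto intro!: continuous_intros simp: torus_mean_mult)
      also have "a N * torus_mean \<tau> (expwave (kap \<tau> N + K)) = (if kap \<tau> N = - K then a N else 0)"
        using torus_mean_expwave[OF t wave_lattice_add[OF kap_in[OF t] K]] by (simp add: eq_neg_iff_add_eq_0)
      finally show ?case using Suc by simp
    qed
    moreover have "(\<lambda>N. \<Sum>n<N. if kap \<tau> n = - K then a n else 0) \<longlonglongrightarrow> fourier_coeff \<tau> u (- K)"
    proof -
      obtain m where m: "kap \<tau> m = - K"
        using bij_kap[OF t] wave_lattice_uminus[OF K] by (metis bij_betw_def rangeE)
      have inj: "kap \<tau> n = - K \<longleftrightarrow> n = m" for n
        using bij_kap[OF t] m by (metis bij_betw_def injD)
      have "(\<lambda>n. if n = m then a n else 0) sums a m" by (rule sums_single)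
      then show ?thesis by (simp add: inj sums_def a_def m)
    qed
    ultimately show ?thesis using LIMSEQ_unique by auto
  qed
  define g where "g X = complex_of_real (u X) - S X" for X
  have cg: "continuous_on UNIV g" unfolding g_def[abs_def] by (intro continuous_intros c cS)
  have gz: "torus_mean \<tau> (\<lambda>X. g X * expwave K X) = 0" if K: "K \<in> wave_lattice \<tau>" for K
  proof -
    have "torus_mean \<tau> (\<lambda>X. g X * expwave K X) =
        torus_mean \<tau> (\<lambda>X. complex_of_real (u X) * expwave K X) - torus_mean \<tau> (\<lambda>X. S X * expwave K X)"
      unfolding g_def left_diff_distrib by (intro torus_mean_diff continuous_intros c cS)
    then show ?thesis using mean[OF K] by (simp add: fourier_coeff_def)
  qed
  have "Re (g X) = 0" for X
  proof (rule fourier_zero[OF t])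
    show "continuous_on UNIV (\<lambda>X. Re (g X))" by (intro continuous_intros cg)
    show "periodic \<tau> (\<lambda>X. Re (g X))" using p pS by (simp add: periodic_def g_def)
    fix K assume K: "K \<in> wave_lattice \<tau>"
    \<comment> \<open>\<open>fourier_zero\<close> treats real functions, so the coefficients of the
      real part are needed: they are half the sum of a coefficient of \<open>g\<close> and the
      conjugate of the one at the opposite frequency.\<close>
    have eq: "complex_of_real (Re (g X)) * expwave K X = 1 / 2 * (g X * expwave K X) + 1 / 2 * cnj (g X * expwave (- K) X)" for X
    proof -
      have "cnj (expwave (- K) X) = expwave K X" by (simp add: expwave_def cis_cnj)
      moreover have "complex_of_real (Re z) = 1 / 2 * z + 1 / 2 * cnj z" for z by (simp add: complex_eq_iff)
      ultimately show ?thesis by (simp add: algebra_simps)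
    qed
    have cn: "torus_mean \<tau> (\<lambda>X. cnj (g X * expwave (- K) X)) = cnj (torus_mean \<tau> (\<lambda>X. g X * expwave (- K) X))"
      by (rule torus_mean_bounded_linear[OF _ bounded_linear_cnj]) (intro continuous_intros cg)
    have "torus_mean \<tau> (\<lambda>X. complex_of_real (Re (g X)) * expwave K X) =
        torus_mean \<tau> (\<lambda>X. 1 / 2 * (g X * expwave K X)) + torus_mean \<tau> (\<lambda>X. 1 / 2 * cnj (g X * expwave (- K) X))"
      unfolding eq by (intro torus_mean_add continuous_intros cg)
    also have "\<dots> = 1 / 2 * torus_mean \<tau> (\<lambda>X. g X * expwave K X) + 1 / 2 * cnj (torus_mean \<tau> (\<lambda>X. g X * expwave (- K) X))"
      by (simp only: torus_mean_mult cn)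
    finally show "torus_mean \<tau> (\<lambda>X. complex_of_real (Re (g X)) * expwave K X) = 0"
      using gz[OF K] gz[OF wave_lattice_uminus[OF K]] by simp
  qed
  then have "u X = Re (S X)" for X by (simp add: g_def)
  moreover have "Re (S X) = fser \<tau> a X" for X
  proof -
    have "summable (\<lambda>n. a n * expwave (kap \<tau> n) X)"
      by (rule summable_comparison_test'[OF s', of 0]) (simp add: norm_mult)
    then show ?thesis unfolding S_def fser_def by (rule Re_suminf)
  qed
  ultimately show ?thesis by (auto simp: fun_eq_iff a_def[abs_def])
qed


section \<open>Sobolev embedding and interpolation\<close>

abbreviation fc :: "real \<Rightarrow> (real^2 \<Rightarrow> real) \<Rightarrow> nat \<Rightarrow> complex" where
  "fc \<tau> u n \<equiv> fourier_coeff \<tau> u (kap \<tau> n)"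

lemma sobolev_series:
  assumes t: "0 < \<tau>" and u: "u \<in> sobolev \<tau> m"
  shows "summable (\<lambda>n. wt \<tau> n ^ m * (cmod (fc \<tau> u n))^2)"
    and "(sobolev_norm \<tau> m u)^2 = (\<Sum>n. wt \<tau> n ^ m * (cmod (fc \<tau> u n))^2)"
proof -
  let ?w = "\<lambda>n. sobolev_weight \<tau> m u (kap \<tau> n)"
  have w: "?w n = wt \<tau> n ^ m * (cmod (fc \<tau> u n))^2" for n by (simp add: sobolev_weight_def wt_def)
  have "sobolev_weight \<tau> m u summable_on wave_lattice \<tau>" using u by (simp add: sobolev_def)
  then have "?w summable_on UNIV" using summable_on_reindex_bij_betw[OF bij_kap[OF t]] by blast
  then have s: "summable ?w" by (rule summable_on_imp_summable)
  then show "summable (\<lambda>n. wt \<tau> n ^ m * (cmod (fc \<tau> u n))^2)" by (simp add: w)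
  have nn: "0 \<le> ?w n" for n unfolding w using wt_ge1[of \<tau> n] by simp
  have "infsum (sobolev_weight \<tau> m u) (wave_lattice \<tau>) = infsum ?w UNIV"
    using infsum_reindex_bij_betw[OF bij_kap[OF t]] by metis
  also have "\<dots> = suminf ?w" by (rule infsumI[OF sums_nonneg_imp_has_sum[OF summable_sums[OF s] nn]])
  finally have "(sobolev_norm \<tau> m u)^2 = suminf ?w"
    using suminf_nonneg[OF s nn] by (simp add: sobolev_norm_def)
  then show "(sobolev_norm \<tau> m u)^2 = (\<Sum>n. wt \<tau> n ^ m * (cmod (fc \<tau> u n))^2)" by (simp add: w)
qed

lemma sobolev_norm_nonneg: "0 \<le> sobolev_norm \<tau> m u"
  unfolding sobolev_norm_def sobolev_weight_def by (intro real_sqrt_ge_zero infsum_nonneg) auto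

lemma sobolev_mono: "0 < \<tau> \<Longrightarrow> j \<le> m \<Longrightarrow> u \<in> sobolev \<tau> m \<Longrightarrow> u \<in> sobolev \<tau> j"
proof -
  assume "j \<le> m" and u: "u \<in> sobolev \<tau> m"
  have le: "sobolev_weight \<tau> j u K \<le> sobolev_weight \<tau> m u K" for K
    unfolding sobolev_weight_def using \<open>j \<le> m\<close> by (intro mult_right_mono power_increasing) auto
  have "sobolev_weight \<tau> m u summable_on wave_lattice \<tau>" using u by (simp add: sobolev_def)
  then have "sobolev_weight \<tau> j u summable_on wave_lattice \<tau>"
    by (rule summable_on_comparison_test[OF _ le]) (simp add: sobolev_weight_def)
  then show ?thesis using u by (simp add: sobolev_def)
qed

lemma sobolev_norm_mono:
  assumes t: "0 < \<tau>" and "j \<le> m" and u: "u \<in> sobolev \<tau> m"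
  shows "sobolev_norm \<tau> j u \<le> sobolev_norm \<tau> m u"
proof -
  have "wt \<tau> n ^ j * (cmod (fc \<tau> u n))^2 \<le> wt \<tau> n ^ m * (cmod (fc \<tau> u n))^2" for n
    using wt_ge1 \<open>j \<le> m\<close> by (intro mult_right_mono power_increasing) auto
  then have "(sobolev_norm \<tau> j u)^2 \<le> (sobolev_norm \<tau> m u)^2"
    unfolding sobolev_series(2)[OF t u] sobolev_series(2)[OF t sobolev_mono[OF t assms(2) u]]
    by (intro suminf_le sobolev_series(1)[OF t] u sobolev_mono[OF t assms(2) u])
  then show ?thesis using power2_le_imp_le sobolev_norm_nonneg by blast
qed

text \<open>Cauchy-Schwarz against \<open>1 / wt\<close>, which is square summable. Two orders of
  the Sobolev scale pay for this factor.\<close>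

lemma sobolev_coeff_sum:
  assumes t: "0 < \<tau>" and u: "u \<in> sobolev \<tau> m" and j: "j + 2 \<le> m"
  shows "summable (\<lambda>n. cmod (fc \<tau> u n) * norm (kap \<tau> n) ^ j)"
    and "(\<Sum>n. cmod (fc \<tau> u n) * norm (kap \<tau> n) ^ j) \<le> sqrt (\<Sum>n. (1 / wt \<tau> n)^2) * sobolev_norm \<tau> (j + 2) u"
proof -
  have u': "u \<in> sobolev \<tau> (j + 2)" by (rule sobolev_mono[OF t j u])
  define a where "a n = cmod (fc \<tau> u n) * sqrt (wt \<tau> n) ^ (j + 2)" for n
  have w: "0 \<le> wt \<tau> n" "0 < wt \<tau> n" for n using wt_ge1[of \<tau> n] by auto
  have a2: "(a n)^2 = wt \<tau> n ^ (j + 2) * (cmod (fc \<tau> u n))^2" for n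
  proof -
    have "(sqrt (wt \<tau> n) ^ (j + 2))^2 = ((sqrt (wt \<tau> n))^2) ^ (j + 2)" by (simp only: power_mult[symmetric] mult.commute)
    then show ?thesis using w by (simp only: a_def power_mult_distrib real_sqrt_pow2) simp
  qed
  have sa: "summable (\<lambda>n. (a n)^2)" unfolding a2 by (rule sobolev_series(1)[OF t u'])
  have sb: "summable (\<lambda>n. (1 / wt \<tau> n)^2)" by (rule summable_wt[OF t])
  note cs = cauchy_schwarz_series[OF sa sb]
  have le: "cmod (fc \<tau> u n) * norm (kap \<tau> n) ^ j \<le> \<bar>a n * (1 / wt \<tau> n)\<bar>" for n
  proof -
    have "norm (kap \<tau> n) \<le> sqrt (wt \<tau> n)" by (rule real_le_rsqrt) (simp add: wt_def)
    then have "norm (kap \<tau> n) ^ j \<le> sqrt (wt \<tau> n) ^ j" by (intro power_mono) auto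
    moreover have "a n * (1 / wt \<tau> n) = cmod (fc \<tau> u n) * sqrt (wt \<tau> n) ^ j"
    proof -
      have "sqrt (wt \<tau> n) ^ (j + 2) = sqrt (wt \<tau> n) ^ j * wt \<tau> n"
        using w[of n] by (simp only: power_add real_sqrt_pow2)
      then have "a n = cmod (fc \<tau> u n) * (sqrt (wt \<tau> n) ^ j * wt \<tau> n)" by (simp only: a_def)
      then show ?thesis using w(2)[of n] by simp
    qed
    ultimately show ?thesis using w[of n] by (simp add: mult_left_mono)
  qed
  show s: "summable (\<lambda>n. cmod (fc \<tau> u n) * norm (kap \<tau> n) ^ j)"
    by (rule summable_comparison_test'[OF cs(1), of 0]) (use le in auto)
  have "(\<Sum>n. cmod (fc \<tau> u n) * norm (kap \<tau> n) ^ j) \<le> (\<Sum>n. \<bar>a n * (1 / wt \<tau> n)\<bar>)"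
    by (intro suminf_le le s cs)
  also have "\<dots> \<le> sqrt (\<Sum>n. (a n)^2) * sqrt (\<Sum>n. (1 / wt \<tau> n)^2)" by (rule cs)
  also have "(\<Sum>n. (a n)^2) = (sobolev_norm \<tau> (j + 2) u)^2"
    unfolding a2 by (rule sobolev_series(2)[OF t u', symmetric])
  finally show "(\<Sum>n. cmod (fc \<tau> u n) * norm (kap \<tau> n) ^ j) \<le> sqrt (\<Sum>n. (1 / wt \<tau> n)^2) * sobolev_norm \<tau> (j + 2) u"
    using sobolev_norm_nonneg by (simp add: mult.commute)
qed

text \<open>For positive \<open>l\<close> this is l^(n-j) t^j \<le> l^n + t^n, multiplied by
  \<open>l^j\<close> to avoid a subtraction of exponents.\<close>

lemma power_interpolation:
  fixes l t :: real
  assumes "j \<le> n" "0 \<le> l" "0 \<le> t"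
  shows "l ^ n * t ^ j \<le> l ^ j * (l ^ n + t ^ n)"
proof (cases "t \<le> l")
  case True
  then have "l ^ n * t ^ j \<le> l ^ n * l ^ j" using assms by (intro mult_left_mono power_mono) auto
  also have "\<dots> \<le> l ^ j * (l ^ n + t ^ n)" using assms by (simp add: algebra_simps)
  finally show ?thesis .
next
  case False
  have "l ^ n * t ^ j = l ^ j * (l ^ (n - j) * t ^ j)" using assms by (simp add: power_add[symmetric] mult.assoc[symmetric])
  also have "\<dots> \<le> l ^ j * (t ^ (n - j) * t ^ j)" using False assms by (intro mult_left_mono mult_right_mono power_mono) auto
  also have "\<dots> = l ^ j * t ^ n" using assms by (simp add: power_add[symmetric])
  also have "\<dots> \<le> l ^ j * (l ^ n + t ^ n)" using assms by (intro mult_left_mono) auto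
  finally show ?thesis .
qed

text \<open>
  Interpolation between \<open>H\<^sup>4\<close> and \<open>H\<^sup>m\<close>: the weight \<open>L\<close> with \<open>L^(m-4) = \<parallel>U\<parallel>\<^sub>m / \<parallel>U\<parallel>\<^sub>4\<close> makes the
  tame estimates homogeneous.
\<close>

lemma sobolev_interpolation:
  assumes t: "0 < \<tau>" and u: "u \<in> sobolev \<tau> (4 + n)" and L: "1 \<le> L" and j: "j \<le> n"
    and s: "sobolev_norm \<tau> 4 u \<le> s" "sobolev_norm \<tau> (4 + n) u \<le> L ^ n * s"
  shows "sobolev_norm \<tau> (4 + j) u \<le> sqrt 2 * L ^ j * s"
proof -
  have s0: "0 \<le> s" using s(1) sobolev_norm_nonneg[of \<tau> 4 u] by linarith
  let ?c = "\<lambda>n. (cmod (fc \<tau> u n))^2"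
  have u4: "u \<in> sobolev \<tau> 4" by (rule sobolev_mono[OF t _ u]) simp
  have uj: "u \<in> sobolev \<tau> (4 + j)" by (rule sobolev_mono[OF t _ u]) (use j in simp)
  \<comment> \<open>Squared norms carry the weight \<open>wt\<close>, so \<open>L^2\<close> is the
    parameter to compare with it. Each of the two resulting terms is at most
    \<open>(L^n * s)^2\<close>, whence the factor \<open>sqrt 2\<close>.\<close>
  have le: "(L^2) ^ n * (wt \<tau> k ^ (4 + j) * ?c k) \<le> (L^2) ^ j * ((L^2) ^ n * (wt \<tau> k ^ 4 * ?c k) + wt \<tau> k ^ (4 + n) * ?c k)" for k
  proof -
    have w: "0 \<le> wt \<tau> k" using wt_ge1[of \<tau> k] by simp
    have "(L^2) ^ n * wt \<tau> k ^ j \<le> (L^2) ^ j * ((L^2) ^ n + wt \<tau> k ^ n)"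
      by (rule power_interpolation[OF j _ w]) simp
    then have "((L^2) ^ n * wt \<tau> k ^ j) * (wt \<tau> k ^ 4 * ?c k) \<le> ((L^2) ^ j * ((L^2) ^ n + wt \<tau> k ^ n)) * (wt \<tau> k ^ 4 * ?c k)"
      using w by (intro mult_right_mono) auto
    then show ?thesis by (simp add: power_add algebra_simps)
  qed
  have Ln: "0 < (L^2) ^ n" using L by simp
  have "(L^2) ^ n * (sobolev_norm \<tau> (4 + j) u)^2 = (\<Sum>k. (L^2) ^ n * (wt \<tau> k ^ (4 + j) * ?c k))"
    unfolding sobolev_series(2)[OF t uj] by (rule suminf_mult[OF sobolev_series(1)[OF t uj], symmetric])
  also have "\<dots> \<le> (\<Sum>k. (L^2) ^ j * ((L^2) ^ n * (wt \<tau> k ^ 4 * ?c k) + wt \<tau> k ^ (4 + n) * ?c k))"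
    by (intro suminf_le le summable_mult summable_add sobolev_series(1)[OF t] uj u4 u)
  also have "\<dots> = (L^2) ^ j * ((L^2) ^ n * (sobolev_norm \<tau> 4 u)^2 + (sobolev_norm \<tau> (4 + n) u)^2)"
    unfolding sobolev_series(2)[OF t u4] sobolev_series(2)[OF t u]
    by (simp only: suminf_mult suminf_add[symmetric] summable_mult summable_add sobolev_series(1)[OF t u4] sobolev_series(1)[OF t u])
  also have "\<dots> \<le> (L^2) ^ j * ((L^2) ^ n * s^2 + (L ^ n * s)^2)"
    using s sobolev_norm_nonneg s0 L by (intro mult_left_mono add_mono power_mono) auto
  also have "\<dots> = (L^2) ^ n * (sqrt 2 * L ^ j * s)^2"
  proof -
    have "(L ^ k)^2 = (L^2) ^ k" for k by (simp add: power_mult[symmetric] mult.commute)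
    then show ?thesis by (simp add: power_mult_distrib)
  qed
  finally have "(sobolev_norm \<tau> (4 + j) u)^2 \<le> (sqrt 2 * L ^ j * s)^2" using Ln by (simp only: mult_le_cancel_left_pos)
  then show ?thesis by (rule power2_le_imp_le) (use L s0 in simp)
qed

text \<open>Derivatives of \<open>u\<close> of order \<open>j + 2\<close> are controlled by H^(4+j),
  which interpolation bounds by a multiple of \<open>L^j * s\<close>. Seen from the gradient these
  have order \<open>j + 1\<close>, which is exactly what \<open>SS\<close> asks for.\<close>

lemma sobolev_gradient_SS:
  assumes t: "0 < \<tau>"
  shows "\<exists>C>0. \<forall>n u L s i. u \<in> sobolev \<tau> (4 + n) \<longrightarrow> 1 \<le> L \<longrightarrow> sobolev_norm \<tau> 4 u \<le> s \<longrightarrow>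
    sobolev_norm \<tau> (4 + n) u \<le> L ^ n * s \<longrightarrow> i \<in> Basis \<longrightarrow>
    (\<forall>X. u differentiable (at X)) \<and> SS L n (C * s) (dirderiv i u)"
proof -
  define B where "B = sqrt (\<Sum>n. (1 / wt \<tau> n)^2)"
  have B: "0 \<le> B" unfolding B_def by (intro real_sqrt_ge_zero suminf_nonneg summable_wt t) auto
  define C where "C = B * sqrt 2 + 1"
  have sqrt2: "1 \<le> sqrt 2" by simp
  have "(\<forall>X. u differentiable (at X)) \<and> SS L n (C * s) (dirderiv i u)"
    if u: "u \<in> sobolev \<tau> (4 + n)" and L: "1 \<le> L" and s: "sobolev_norm \<tau> 4 u \<le> s" "sobolev_norm \<tau> (4 + n) u \<le> L ^ n * s"
      and i: "i \<in> Basis" for n u L s i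
  proof -
    have s0: "0 \<le> s" using s(1) sobolev_norm_nonneg[of \<tau> 4 u] by linarith
    define a where "a n = fc \<tau> u n" for n
    define a1 where "a1 n = \<i> * complex_of_real (kap \<tau> n \<bullet> i) * a n" for n
    have sum: "summable (\<lambda>k. cmod (a k) * norm (kap \<tau> k) ^ j)" if "j \<le> n + 2" for j
      using sobolev_coeff_sum(1)[OF t u, of j] that by (simp add: a_def)
    have sum_le: "(\<Sum>k. cmod (a k) * norm (kap \<tau> k) ^ (j + 2)) \<le> C * s * L ^ j" if "j \<le> n" for j
    proof -
      have "(\<Sum>k. cmod (a k) * norm (kap \<tau> k) ^ (j + 2)) \<le> B * sobolev_norm \<tau> (4 + j) u"
      proof -
        have e: "4 + j = (j + 2) + 2" by simp
        show ?thesis unfolding e a_def B_def by (rule sobolev_coeff_sum(2)[OF t u]) (use that in simp)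
      qed
      also have "\<dots> \<le> B * (sqrt 2 * L ^ j * s)"
        by (intro mult_left_mono sobolev_interpolation[OF t u L that s] B)
      also have "\<dots> = (B * sqrt 2) * (s * L ^ j)" by simp
      also have "\<dots> \<le> C * (s * L ^ j)" using s0 L by (intro mult_right_mono) (auto simp: C_def)
      finally show ?thesis by (simp add: mult.assoc)
    qed
    \<comment> \<open>Order 1 corresponds to H^3, below the range of the interpolation; monotonicity
      of the norms replaces it.\<close>
    have sum1_le: "(\<Sum>k. cmod (a k) * norm (kap \<tau> k) ^ 1) \<le> C * s"
    proof -
      have "(\<Sum>k. cmod (a k) * norm (kap \<tau> k) ^ 1) \<le> B * sobolev_norm \<tau> 3 u"
      proof -
        have e: "3 = 1 + (2 :: nat)" by simp
        show ?thesis unfolding e a_def B_def by (rule sobolev_coeff_sum(2)[OF t u]) simp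
      qed
      also have "\<dots> \<le> B * s"
        using sobolev_norm_mono[OF t, of 3 "4 + n" u] sobolev_norm_mono[OF t _ sobolev_mono[OF t _ u], of 3 4] u s(1) B
        by (intro mult_left_mono) auto
      also have "\<dots> \<le> C * s" using s0 sqrt2 B mult_left_mono[of 1 "sqrt 2" B] by (intro mult_right_mono) (auto simp: C_def)
      finally show ?thesis .
    qed
    have c: "continuous_on UNIV u" "periodic \<tau> u" using u by (auto simp: sobolev_def)
    have u_eq: "u = fser \<tau> a"
      using fourier_inversion[OF t c] sum[of 0] by (simp add: a_def[abs_def])
    have sa: "summable (\<lambda>k. cmod (a k))" "summable (\<lambda>k. cmod (a k) * norm (kap \<tau> k))"
      using sum[of 0] sum[of 1] by simp_all
    have d1: "dirderiv i u = fser \<tau> a1" and du: "u differentiable (at X)" for X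
      using fser_deriv[OF sa] by (simp_all add: u_eq a1_def[abs_def])
    have s1: "summable (\<lambda>k. cmod (a1 k) * norm (kap \<tau> k) ^ j)"
      and s1_le: "(\<Sum>k. cmod (a1 k) * norm (kap \<tau> k) ^ j) \<le> (\<Sum>k. cmod (a k) * norm (kap \<tau> k) ^ Suc j)"
      if "Suc j \<le> n + 2" for j
      using deriv_coeff_summable[OF i sum[OF that]] by (simp_all add: a1_def)
    have sa1: "summable (\<lambda>k. cmod (a1 k))" "summable (\<lambda>k. cmod (a1 k) * norm (kap \<tau> k))"
      using s1[of 0] s1[of 1] by simp_all
    have bd: "\<bar>fser \<tau> a1 X\<bar> \<le> C * s" for X
      using fser_bound[OF sa1(1), of \<tau> X] s1_le[of 0] sum1_le by simp
    have "Qb L n (C * s) (dirderiv e (fser \<tau> a1))" if e: "e \<in> Basis" for e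
      unfolding fser_deriv(1)[OF sa1]
    proof (rule Qb_fser)
      fix j assume j: "j \<le> n"
      have sj: "summable (\<lambda>k. cmod (a1 k) * norm (kap \<tau> k) ^ Suc j)" using s1[of "Suc j"] j by simp
      show "summable (\<lambda>k. cmod (\<i> * complex_of_real (kap \<tau> k \<bullet> e) * a1 k) * norm (kap \<tau> k) ^ j)"
        by (rule deriv_coeff_summable[OF e sj])
      show "(\<Sum>k. cmod (\<i> * complex_of_real (kap \<tau> k \<bullet> e) * a1 k) * norm (kap \<tau> k) ^ j) \<le> C * s * L ^ j"
        using deriv_coeff_summable(2)[OF e sj] s1_le[of "Suc j"] sum_le[OF j] j by simp
    qed
    then have "SS L n (C * s) (fser \<tau> a1)" using bd fser_deriv(2)[OF sa1] by (simp add: SS_def)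
    then show ?thesis using d1 du by simp
  qed
  moreover have "0 < C" using B by (simp add: C_def add_nonneg_pos)
  ultimately show ?thesis by blast
qed

text \<open>\<open>L\<close> is the \<open>n\<close>-th root of the quotient of the norms, at least
  1 by monotonicity. For \<open>n = 0\<close> any \<open>L\<close> works, and so it does for a
  vanishing H^4 norm, since then all coefficients and hence all norms vanish.\<close>

lemma pair_norm_weight:
  assumes t: "0 < \<tau>" and U: "(\<psi>, \<eta>) \<in> sobolev_S \<tau> (4 + n)"
  shows "\<exists>L\<ge>1. pair_norm \<tau> (4 + n) (\<psi>, \<eta>) = L ^ n * pair_norm \<tau> 4 (\<psi>, \<eta>)"
proof -
  have u: "\<psi> \<in> sobolev \<tau> (4 + n)" "\<eta> \<in> sobolev \<tau> (4 + n)" using U by (auto simp: sobolev_S_def)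
  define s where "s = pair_norm \<tau> 4 (\<psi>, \<eta>)"
  define s' where "s' = pair_norm \<tau> (4 + n) (\<psi>, \<eta>)"
  have le: "s \<le> s'" unfolding s_def s'_def pair_norm_def using u by (auto intro!: add_mono sobolev_norm_mono t)
  have s0: "0 \<le> s" using sobolev_norm_nonneg by (simp add: s_def pair_norm_def)
  consider "s = 0" | "n = 0" | "0 < s" "0 < n" using s0 by fastforce
  then show ?thesis
  proof cases
    case 1
    have z: "sobolev_norm \<tau> (4 + n) v = 0" if v: "v \<in> sobolev \<tau> (4 + n)" and z: "sobolev_norm \<tau> 4 v = 0" for v
    proof -
      have v4: "v \<in> sobolev \<tau> 4" by (rule sobolev_mono[OF t _ v]) simp
      have "(\<Sum>k. wt \<tau> k ^ 4 * (cmod (fc \<tau> v k))^2) = 0" using sobolev_series(2)[OF t v4] z by simp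
      then have "wt \<tau> k ^ 4 * (cmod (fc \<tau> v k))^2 = 0" for k
        using suminf_eq_zero_iff[OF sobolev_series(1)[OF t v4]] wt_ge1 by simp
      moreover have "wt \<tau> k \<noteq> 0" for k using wt_ge1[of \<tau> k] by simp
      ultimately have "fc \<tau> v k = 0" for k by simp
      then have "(sobolev_norm \<tau> (4 + n) v)^2 = 0" unfolding sobolev_series(2)[OF t v] by simp
      then show ?thesis by simp
    qed
    have "sobolev_norm \<tau> 4 \<psi> = 0" "sobolev_norm \<tau> 4 \<eta> = 0"
      using 1 sobolev_norm_nonneg[of \<tau> 4 \<psi>] sobolev_norm_nonneg[of \<tau> 4 \<eta>] by (auto simp: s_def pair_norm_def)
    then have "s' = 0" using z u by (simp add: s'_def pair_norm_def)
    then show ?thesis using 1 by (intro exI[of _ 1]) (simp add: s_def s'_def)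
  next
    case 2
    then show ?thesis by (intro exI[of _ 1]) simp
  next
    case 3
    define L where "L = root n (s' / s)"
    have "1 \<le> L" using 3 le by (simp add: L_def)
    moreover have "L ^ n = s' / s" using 3 le by (simp add: L_def real_root_pow_pos2)
    ultimately show ?thesis using 3 by (intro exI[of _ L]) (simp add: s_def s'_def)
  qed
qed


section \<open>The coefficients of the linearised problem for small data\<close>

lemma bcoef_eq: "bcoef (\<psi>, \<eta>) X = (D1 \<eta> X * (1 + D1 \<psi> X) + D2 \<eta> X * D2 \<psi> X) * (1 / (1 + (D1 \<eta> X * D1 \<eta> X + D2 \<eta> X * D2 \<eta> X)))"
  by (simp add: bcoef_def grad_def u0_def norm_vec2 power2_eq_square algebra_simps add_divide_distrib)

lemma Vfield_eq:
  "Vfield (\<psi>, \<eta>) X $ 1 = 1 + (D1 \<psi> X - bcoef (\<psi>, \<eta>) X * D1 \<eta> X)"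
  "Vfield (\<psi>, \<eta>) X $ 2 = D2 \<psi> X - bcoef (\<psi>, \<eta>) X * D2 \<eta> X"
  by (simp_all add: Vfield_def grad_def u0_def)

lemma SS_diff: "1 \<le> L \<Longrightarrow> SS L k A f \<Longrightarrow> SS L k B g \<Longrightarrow> SS L k (A + B) (\<lambda>X. f X - g X)"
  using SS_add[OF _ SS_uminus, of L k A f B g] by simp

text \<open>The expression is \<open>bcoef\<close>, with \<open>p1\<close>, \<open>p2\<close> and
  \<open>e1\<close>, \<open>e2\<close> in the roles of the partials of \<psi> and \<eta>. Its
  numerator vanishes with \<open>e1\<close> and \<open>e2\<close>, which gives a bound linear in
  \<open>M\<close>.\<close>

lemma SS_quadratic_quotient:
  assumes M0: "0 \<le> M0"
  shows "\<exists>C\<ge>0. \<forall>L M p1 p2 e1 e2. 1 \<le> L \<longrightarrow> M \<le> M0 \<longrightarrow> SS L k M p1 \<longrightarrow> SS L k M p2 \<longrightarrow> SS L k M e1 \<longrightarrow> SS L k M e2 \<longrightarrow>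
    SS L k (C * M) (\<lambda>X. (e1 X * (1 + p1 X) + e2 X * p2 X) * (1 / (1 + (e1 X * e1 X + e2 X * e2 X))))"
proof -
  define q where "q = (2 ^ Suc k :: real)"
  have q: "0 \<le> q" by (simp add: q_def)
  define A where "A = 1 + (q * M0 * M0 + q * M0 * M0)"
  obtain C1 where C1: "0 \<le> C1" "\<forall>L f. 1 \<le> L \<longrightarrow> SS L k A f \<longrightarrow> (\<forall>X. 1 \<le> f X) \<longrightarrow> SS L k C1 (\<lambda>X. 1 / f X)"
    using SS_inverse[of 1 k A] by auto
  define C where "C = q * (q * (1 + M0) + q * M0) * C1"
  have "SS L k (C * M) (\<lambda>X. (e1 X * (1 + p1 X) + e2 X * p2 X) * (1 / (1 + (e1 X * e1 X + e2 X * e2 X))))"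
    if L: "1 \<le> L" and M: "M \<le> M0" and s: "SS L k M p1" "SS L k M p2" "SS L k M e1" "SS L k M e2" for L M p1 p2 e1 e2
  proof -
    have m: "0 \<le> M" using SSD(4)[OF s(1)] .
    have "SS L k (1 + (q * M * M + q * M * M)) (\<lambda>X. 1 + (e1 X * e1 X + e2 X * e2 X))"
      unfolding q_def by (intro SS_add SS_mult L s SS_const) simp
    moreover have "1 + (q * M * M + q * M * M) \<le> A"
      unfolding A_def using M m q by (intro add_mono mult_mono order_refl) auto
    ultimately have d: "SS L k A (\<lambda>X. 1 + (e1 X * e1 X + e2 X * e2 X))" using SS_mono[OF L] by blast
    have "SS L k C1 (\<lambda>X. 1 / (1 + (e1 X * e1 X + e2 X * e2 X)))"
      using C1(2)[rule_format, OF L d] by simp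
    then have "SS L k (q * (q * M * (1 + M) + q * M * M) * C1)
        (\<lambda>X. (e1 X * (1 + p1 X) + e2 X * p2 X) * (1 / (1 + (e1 X * e1 X + e2 X * e2 X))))"
      unfolding q_def by (intro SS_mult[OF L] SS_add s SS_const L) simp_all
    moreover have "q * (q * M * (1 + M) + q * M * M) * C1 \<le> C * M"
    proof -
      have "q * (q * M * (1 + M) + q * M * M) * C1 = (q * (q * (1 + M) + q * M) * C1) * M"
        by (simp add: algebra_simps)
      also have "\<dots> \<le> C * M"
        unfolding C_def using M m q C1(1) by (intro mult_right_mono mult_left_mono add_mono) auto
      finally show ?thesis .
    qed
    ultimately show ?thesis using SS_mono[OF L] by blast
  qed
  moreover have "0 \<le> C" using q M0 C1(1) by (simp add: C_def)
  ultimately show ?thesis by blast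
qed

text \<open>The lower bound on the first component of V is left as a premise of the last part,
  because \<open>C * s\<close> need not be small at level \<open>n\<close>. It is supplied once and
  for all from level 0, where \<epsilon> is chosen.\<close>

lemma Vfield_tame:
  assumes t: "0 < \<tau>"
  shows "\<exists>C\<ge>0. \<forall>L s \<psi> \<eta>. 1 \<le> L \<longrightarrow> s \<le> 1 \<longrightarrow> \<psi> \<in> sobolev \<tau> (4 + n) \<longrightarrow> \<eta> \<in> sobolev \<tau> (4 + n) \<longrightarrow>
    pair_norm \<tau> 4 (\<psi>, \<eta>) \<le> s \<longrightarrow> pair_norm \<tau> (4 + n) (\<psi>, \<eta>) \<le> L ^ n * s \<longrightarrow>
    (\<forall>X. \<psi> differentiable (at X)) \<and> (\<forall>X. \<eta> differentiable (at X)) \<and>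
    (\<forall>i\<in>Basis. SS L n (C * s) (dirderiv i \<psi>) \<and> SS L n (C * s) (dirderiv i \<eta>)) \<and>
    SS L n (C * s) (bcoef (\<psi>, \<eta>)) \<and>
    SS L n (C * s) (\<lambda>X. Vfield (\<psi>, \<eta>) X $ 1 - 1) \<and> SS L n (C * s) (\<lambda>X. Vfield (\<psi>, \<eta>) X $ 2) \<and>
    ((\<forall>X. 1 / 2 \<le> Vfield (\<psi>, \<eta>) X $ 1) \<longrightarrow> SS L n (C * s) (\<lambda>X. Vfield (\<psi>, \<eta>) X $ 2 / Vfield (\<psi>, \<eta>) X $ 1))"
proof -
  obtain C0 where C0: "0 < C0" "\<forall>n u L s i. u \<in> sobolev \<tau> (4 + n) \<longrightarrow> 1 \<le> L \<longrightarrow> sobolev_norm \<tau> 4 u \<le> s \<longrightarrow>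
    sobolev_norm \<tau> (4 + n) u \<le> L ^ n * s \<longrightarrow> i \<in> Basis \<longrightarrow>
    (\<forall>X. u differentiable (at X)) \<and> SS L n (C0 * s) (dirderiv i u)"
    using sobolev_gradient_SS[OF t] by blast
  have C0': "0 \<le> C0" using C0(1) by simp
  obtain C1 where C1: "0 \<le> C1" "\<forall>L M p1 p2 e1 e2. 1 \<le> L \<longrightarrow> M \<le> C0 \<longrightarrow> SS L n M p1 \<longrightarrow> SS L n M p2 \<longrightarrow> SS L n M e1 \<longrightarrow> SS L n M e2 \<longrightarrow>
    SS L n (C1 * M) (\<lambda>X. (e1 X * (1 + p1 X) + e2 X * p2 X) * (1 / (1 + (e1 X * e1 X + e2 X * e2 X))))"
    using SS_quadratic_quotient[OF C0', of n] by blast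
  define q where "q = (2 ^ Suc n :: real)"
  define CV where "CV = C0 + q * (C1 * C0) * C0"
  obtain C2 where C2: "0 \<le> C2" "\<forall>L f. 1 \<le> L \<longrightarrow> SS L n (1 + CV) f \<longrightarrow> (\<forall>X. 1 / 2 \<le> f X) \<longrightarrow> SS L n C2 (\<lambda>X. 1 / f X)"
    using SS_inverse[of "1 / 2" n "1 + CV"] by auto
  define C where "C = max (max C0 (C1 * C0)) (max CV (q * CV * C2))"
  have C: "0 \<le> C" "C0 \<le> C" "C1 * C0 \<le> C" "CV \<le> C" "q * CV * C2 \<le> C"
    using C0' by (auto simp: C_def le_max_iff_disj)
  have main: "(\<forall>X. \<psi> differentiable (at X)) \<and> (\<forall>X. \<eta> differentiable (at X)) \<and>
    (\<forall>i\<in>Basis. SS L n (C * s) (dirderiv i \<psi>) \<and> SS L n (C * s) (dirderiv i \<eta>)) \<and>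
    SS L n (C * s) (bcoef (\<psi>, \<eta>)) \<and>
    SS L n (C * s) (\<lambda>X. Vfield (\<psi>, \<eta>) X $ 1 - 1) \<and> SS L n (C * s) (\<lambda>X. Vfield (\<psi>, \<eta>) X $ 2) \<and>
    ((\<forall>X. 1 / 2 \<le> Vfield (\<psi>, \<eta>) X $ 1) \<longrightarrow> SS L n (C * s) (\<lambda>X. Vfield (\<psi>, \<eta>) X $ 2 / Vfield (\<psi>, \<eta>) X $ 1))"
    if L: "1 \<le> L" and s1: "s \<le> 1" and u: "\<psi> \<in> sobolev \<tau> (4 + n)" "\<eta> \<in> sobolev \<tau> (4 + n)"
      and s: "pair_norm \<tau> 4 (\<psi>, \<eta>) \<le> s" "pair_norm \<tau> (4 + n) (\<psi>, \<eta>) \<le> L ^ n * s" for L s \<psi> \<eta>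
  proof -
    note nn = sobolev_norm_nonneg[of \<tau> _ \<psi>] sobolev_norm_nonneg[of \<tau> _ \<eta>]
    have N: "sobolev_norm \<tau> 4 \<psi> \<le> s" "sobolev_norm \<tau> 4 \<eta> \<le> s"
      "sobolev_norm \<tau> (4 + n) \<psi> \<le> L ^ n * s" "sobolev_norm \<tau> (4 + n) \<eta> \<le> L ^ n * s"
      using s nn(1)[of 4] nn(2)[of 4] nn(1)[of "4 + n"] nn(2)[of "4 + n"] by (auto simp: pair_norm_def)
    have s0: "0 \<le> s" using N(1) nn(1)[of 4] by linarith
    have g: "(\<forall>X. \<psi> differentiable (at X)) \<and> SS L n (C0 * s) (dirderiv i \<psi>)"
      "(\<forall>X. \<eta> differentiable (at X)) \<and> SS L n (C0 * s) (dirderiv i \<eta>)" if "i \<in> Basis" for i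
      using C0(2)[rule_format, OF u(1) L N(1) N(3) that] C0(2)[rule_format, OF u(2) L N(2) N(4) that] by auto
    have B: "pt 1 0 \<in> Basis" "pt 0 1 \<in> Basis" by (auto simp: Basis_vec2)
    note p1 = conjunct2[OF g(1)[OF B(1)]] and p2 = conjunct2[OF g(1)[OF B(2)]]
      and e1 = conjunct2[OF g(2)[OF B(1)]] and e2 = conjunct2[OF g(2)[OF B(2)]]
    have C0s: "C0 * s \<le> C0" using s1 C0' mult_left_mono[of s 1 C0] by simp
    have b: "SS L n (C1 * (C0 * s)) (bcoef (\<psi>, \<eta>))"
      unfolding bcoef_eq[abs_def] using C1(2)[rule_format, OF L C0s p1 p2 e1 e2] .
    have q0: "0 \<le> q" by (simp add: q_def)
    have cv: "C0 * s + q * (C1 * (C0 * s)) * (C0 * s) \<le> CV * s"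
    proof -
      have "C0 * s + q * (C1 * (C0 * s)) * (C0 * s) = (C0 + q * (C1 * C0) * (C0 * s)) * s" by (simp add: algebra_simps)
      also have "\<dots> \<le> CV * s" unfolding CV_def
        using C0s s0 C1(1) C0' q0 by (intro mult_right_mono add_mono mult_left_mono) auto
      finally show ?thesis .
    qed
    have v1: "SS L n (CV * s) (\<lambda>X. Vfield (\<psi>, \<eta>) X $ 1 - 1)"
    proof (rule SS_mono[OF L _ cv])
      have "SS L n (C0 * s + q * (C1 * (C0 * s)) * (C0 * s)) (\<lambda>X. D1 \<psi> X - bcoef (\<psi>, \<eta>) X * D1 \<eta> X)"
        unfolding q_def by (intro SS_diff SS_mult L p1 b e1)
      then show "SS L n (C0 * s + q * (C1 * (C0 * s)) * (C0 * s)) (\<lambda>X. Vfield (\<psi>, \<eta>) X $ 1 - 1)"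
        unfolding Vfield_eq by simp
    qed
    have v2: "SS L n (CV * s) (\<lambda>X. Vfield (\<psi>, \<eta>) X $ 2)"
    proof (rule SS_mono[OF L _ cv])
      show "SS L n (C0 * s + q * (C1 * (C0 * s)) * (C0 * s)) (\<lambda>X. Vfield (\<psi>, \<eta>) X $ 2)"
        unfolding Vfield_eq q_def by (intro SS_diff SS_mult L p2 b e2)
    qed
    have CV: "0 \<le> CV" using C0' C1(1) q0 by (simp add: CV_def)
    have f: "SS L n (C * s) (\<lambda>X. Vfield (\<psi>, \<eta>) X $ 2 / Vfield (\<psi>, \<eta>) X $ 1)"
      if h: "\<forall>X. 1 / 2 \<le> Vfield (\<psi>, \<eta>) X $ 1"
    proof -
      have "SS L n (CV * s + 1) (\<lambda>X. (Vfield (\<psi>, \<eta>) X $ 1 - 1) + 1)"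
        by (intro SS_add v1 SS_const L) simp
      then have "SS L n (CV * s + 1) (\<lambda>X. Vfield (\<psi>, \<eta>) X $ 1)" by simp
      then have "SS L n (1 + CV) (\<lambda>X. Vfield (\<psi>, \<eta>) X $ 1)"
        by (rule SS_mono[OF L]) (use mult_left_mono[OF s1 CV] in simp)
      then have "SS L n C2 (\<lambda>X. 1 / Vfield (\<psi>, \<eta>) X $ 1)" using C2(2) L h by blast
      then have "SS L n (q * (CV * s) * C2) (\<lambda>X. Vfield (\<psi>, \<eta>) X $ 2 * (1 / Vfield (\<psi>, \<eta>) X $ 1))"
        unfolding q_def by (intro SS_mult L v2)
      then have "SS L n (q * (CV * s) * C2) (\<lambda>X. Vfield (\<psi>, \<eta>) X $ 2 / Vfield (\<psi>, \<eta>) X $ 1)" by simp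
      then show ?thesis
        by (rule SS_mono[OF L]) (use mult_right_mono[OF C(5) s0] in \<open>simp add: mult_ac\<close>)
    qed
    show ?thesis
      using g f SS_mono[OF L b] SS_mono[OF L v1] SS_mono[OF L v2] SS_mono[OF L _ mult_right_mono[OF C(2) s0]]
        mult_right_mono[OF C(3) s0] mult_right_mono[OF C(4) s0] B by (simp add: mult.assoc)
  qed
  from C(1) main show ?thesis by blast
qed

lemma dirderiv_reflect:
  fixes g :: "real^2 \<Rightarrow> real"
  assumes d: "\<And>X. g differentiable (at X)" and r: "\<And>X. g (pt (\<sigma> * X $ 1) (\<rho> * X $ 2)) = s * g X"
    and sq: "s * s = 1"
  shows "D1 g (pt (\<sigma> * X $ 1) (\<rho> * X $ 2)) * \<sigma> = s * D1 g X" "D2 g (pt (\<sigma> * X $ 1) (\<rho> * X $ 2)) * \<rho> = s * D2 g X"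
proof -
  have "((\<lambda>X. pt (\<sigma> * X $ 1) (\<rho> * X $ 2)) has_derivative (\<lambda>v. pt (\<sigma> * v $ 1) (\<rho> * v $ 2))) (at X)"
    by (intro derivative_intros)
  from has_derivative_compose[OF this has_derivative_D12[OF d]]
  have "((\<lambda>X. s * g X) has_derivative
      (\<lambda>v. \<sigma> * v $ 1 * D1 g (pt (\<sigma> * X $ 1) (\<rho> * X $ 2)) + \<rho> * v $ 2 * D2 g (pt (\<sigma> * X $ 1) (\<rho> * X $ 2)))) (at X)"
    by (simp add: r)
  from dirderiv_eqI[OF this, of "pt 1 0"] dirderiv_eqI[OF this, of "pt 0 1"]
  show "D1 g (pt (\<sigma> * X $ 1) (\<rho> * X $ 2)) * \<sigma> = s * D1 g X" "D2 g (pt (\<sigma> * X $ 1) (\<rho> * X $ 2)) * \<rho> = s * D2 g X"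
    by (simp_all add: dirderiv_cmult[OF d] mult.commute)
qed

lemma D12_symmetry:
  fixes g :: "real^2 \<Rightarrow> real"
  assumes d: "\<And>X. g differentiable (at X)"
  shows "even1 g \<Longrightarrow> odd1 (D1 g) \<and> even1 (D2 g)" "odd1 g \<Longrightarrow> even1 (D1 g) \<and> odd1 (D2 g)"
    and "even2 g \<Longrightarrow> even2 (D1 g) \<and> odd2 (D2 g)"
proof -
  show "odd1 (D1 g) \<and> even1 (D2 g)" if "even1 g"
  proof -
    have "g (pt (- 1 * X $ 1) (1 * X $ 2)) = 1 * g X" for X
      using that[unfolded even1_def, rule_format, of "X $ 1" "X $ 2"] by simp
    note r = dirderiv_reflect[where g = g and \<sigma> = "- 1" and \<rho> = "1" and s = "1", OF d this]
    show ?thesis unfolding odd1_def even1_def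
    proof (intro conjI allI)
      fix a b
      show "D1 g (pt (- a) b) = - D1 g (pt a b)" "D2 g (pt (- a) b) = D2 g (pt a b)"
        using r[of "pt a b"] by simp_all
    qed
  qed
  show "even1 (D1 g) \<and> odd1 (D2 g)" if "odd1 g"
  proof -
    have "g (pt (- 1 * X $ 1) (1 * X $ 2)) = - 1 * g X" for X
      using that[unfolded odd1_def, rule_format, of "X $ 1" "X $ 2"] by simp
    note r = dirderiv_reflect[where g = g and \<sigma> = "- 1" and \<rho> = "1" and s = "- 1", OF d this]
    show ?thesis unfolding odd1_def even1_def
    proof (intro conjI allI)
      fix a b
      show "D1 g (pt (- a) b) = D1 g (pt a b)" "D2 g (pt (- a) b) = - D2 g (pt a b)"
        using r[of "pt a b"] by simp_all
    qed
  qed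
  show "even2 (D1 g) \<and> odd2 (D2 g)" if "even2 g"
  proof -
    have "g (pt (1 * X $ 1) (- 1 * X $ 2)) = 1 * g X" for X
      using that[unfolded even2_def, rule_format, of "X $ 1" "X $ 2"] by simp
    note r = dirderiv_reflect[where g = g and \<sigma> = "1" and \<rho> = "- 1" and s = "1", OF d this]
    show ?thesis unfolding odd2_def even2_def
    proof (intro conjI allI)
      fix a b
      show "D1 g (pt a (- b)) = D1 g (pt a b)" "D2 g (pt a (- b)) = - D2 g (pt a b)"
        using r[of "pt a b"] by simp_all
    qed
  qed
qed

lemma periodic_dirderiv:
  assumes d: "\<And>X. g differentiable (at X)" and p: "periodic \<tau> g"
  shows "periodic \<tau> (dirderiv v g)"
  unfolding periodic_def
proof (intro allI ballI)
  fix X h assume "h \<in> period_lattice \<tau>"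
  then have "(\<lambda>X. g (X + h)) = g" using p by (auto simp: periodic_def)
  then show "dirderiv v g (X + h) = dirderiv v g X" using dirderiv_shift(1)[where f = g and x = X and c = h and v = v, OF d] by simp
qed

text \<open>Collects the facts about \<open>U\<close> on which the symbol and the bicharacteristics
  depend. The clause with \<open>SS 1 0 E\<close> bounds the first and second derivatives of \<eta>,
  which enter the barrier for the Dirichlet-Neumann problem.\<close>

definition admissible :: "real \<Rightarrow> real \<Rightarrow> (real^2 \<Rightarrow> real) \<times> (real^2 \<Rightarrow> real) \<Rightarrow> bool" where
  "admissible \<tau> \<mu> U \<longleftrightarrow>
    (\<forall>X. 1 / 2 \<le> Vfield U X $ 1 \<and> Vfield U X $ 1 \<le> 2 \<and> \<bar>Vfield U X $ 2\<bar> \<le> 1) \<and>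
    (\<forall>i X. (\<lambda>X. Vfield U X $ i) differentiable (at X)) \<and>
    (\<forall>i. \<forall>e\<in>Basis. continuous_on UNIV (dirderiv e (\<lambda>X. Vfield U X $ i))) \<and>
    continuous_on UNIV (acoef \<mu> U) \<and> (\<forall>X. \<mu> / 2 \<le> acoef \<mu> U X) \<and>
    periodic \<tau> (Vfield U) \<and> periodic \<tau> (acoef \<mu> U) \<and>
    periodic \<tau> (snd U) \<and> (\<forall>X. snd U differentiable (at X)) \<and>
    (\<exists>E. \<forall>e\<in>Basis. SS 1 0 E (dirderiv e (snd U)))"

lemma periodic_gens:
  assumes "0 < \<tau>"
  shows "pt (2 * pi) 0 \<in> period_lattice \<tau>" "pt 0 (2 * pi / \<tau>) \<in> period_lattice \<tau>" "pt pi (pi / \<tau>) \<in> period_lattice \<tau>"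
proof -
  have e: "pt (2 * pi) 0 = of_int 0 *\<^sub>R pt pi (pi / \<tau>) + of_int 1 *\<^sub>R pt (2 * pi) 0"
    "pt 0 (2 * pi / \<tau>) = of_int 2 *\<^sub>R pt pi (pi / \<tau>) + of_int (- 1) *\<^sub>R pt (2 * pi) 0"
    "pt pi (pi / \<tau>) = of_int 1 *\<^sub>R pt pi (pi / \<tau>) + of_int 0 *\<^sub>R pt (2 * pi) 0"
    by (simp_all add: vec2_eq_iff)
  have "\<tau> \<noteq> 0" using assms by simp
  note iff = period_lattice_iff[OF this]
  show "pt (2 * pi) 0 \<in> period_lattice \<tau>" unfolding iff using e(1) by blast
  show "pt 0 (2 * pi / \<tau>) \<in> period_lattice \<tau>" unfolding iff using e(2) by blast
  show "pt pi (pi / \<tau>) \<in> period_lattice \<tau>" unfolding iff using e(3) by blast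
qed

text \<open>\<epsilon> is determined by \<open>K 0\<close> and \<mu>, hence is the same for all
  \<open>n\<close>; the levels above 0 contribute only their constants \<open>K n\<close>.\<close>

lemma flow_setup:
  assumes t: "0 < \<tau>" and mu: "0 < \<mu>"
  shows "\<exists>\<epsilon>>0. \<exists>K :: nat \<Rightarrow> real. (\<forall>n. 0 \<le> K n) \<and> (\<forall>n. \<forall>U \<in> sobolev_S \<tau> (4 + n). pair_norm \<tau> 4 U < \<epsilon> \<longrightarrow>
    admissible \<tau> \<mu> U \<and> shear (\<lambda>X. Vfield U X $ 2 / Vfield U X $ 1) (1 / 16) \<tau> \<and> pair_norm \<tau> 4 U \<le> 1 \<and>
    (\<exists>L\<ge>1. pair_norm \<tau> (4 + n) U = L ^ n * pair_norm \<tau> 4 U \<and>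
       SS L n (K n * pair_norm \<tau> 4 U) (\<lambda>X. Vfield U X $ 2 / Vfield U X $ 1)))"
proof -
  obtain K where K': "\<forall>n. 0 \<le> K n \<and> (\<forall>L s \<psi> \<eta>. 1 \<le> L \<longrightarrow> s \<le> 1 \<longrightarrow> \<psi> \<in> sobolev \<tau> (4 + n) \<longrightarrow> \<eta> \<in> sobolev \<tau> (4 + n) \<longrightarrow>
    pair_norm \<tau> 4 (\<psi>, \<eta>) \<le> s \<longrightarrow> pair_norm \<tau> (4 + n) (\<psi>, \<eta>) \<le> L ^ n * s \<longrightarrow>
    (\<forall>X. \<psi> differentiable (at X)) \<and> (\<forall>X. \<eta> differentiable (at X)) \<and>
    (\<forall>i\<in>Basis. SS L n (K n * s) (dirderiv i \<psi>) \<and> SS L n (K n * s) (dirderiv i \<eta>)) \<and>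
    SS L n (K n * s) (bcoef (\<psi>, \<eta>)) \<and>
    SS L n (K n * s) (\<lambda>X. Vfield (\<psi>, \<eta>) X $ 1 - 1) \<and> SS L n (K n * s) (\<lambda>X. Vfield (\<psi>, \<eta>) X $ 2) \<and>
    ((\<forall>X. 1 / 2 \<le> Vfield (\<psi>, \<eta>) X $ 1) \<longrightarrow> SS L n (K n * s) (\<lambda>X. Vfield (\<psi>, \<eta>) X $ 2 / Vfield (\<psi>, \<eta>) X $ 1)))"
    using choice[OF allI[OF Vfield_tame[OF t]]] ..
  note K = spec[OF K', THEN conjunct1] spec[OF K', THEN conjunct2]
  define k where "k = K 0 + 1"
  have k: "0 < k" using K(1)[of 0] by (simp add: k_def)
  \<comment> \<open>The bound \<open>1 / (16 * k)\<close> brings the slope below 1/16. With the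
    components of V at most 2 and 1, the term V . grad b is at most \<open>3 * k * s\<close>, so
    \<open>\<mu> / (6 * k)\<close> keeps the coefficient \<aa> above
    \<open>\<mu> / 2\<close>.\<close>
  define \<epsilon> where "\<epsilon> = min 1 (min (1 / (16 * k)) (\<mu> / (6 * k)))"
  have eps: "0 < \<epsilon>" using k mu by (simp add: \<epsilon>_def)
  have main: "admissible \<tau> \<mu> U \<and> shear (\<lambda>X. Vfield U X $ 2 / Vfield U X $ 1) (1 / 16) \<tau> \<and> pair_norm \<tau> 4 U \<le> 1 \<and>
    (\<exists>L\<ge>1. pair_norm \<tau> (4 + n) U = L ^ n * pair_norm \<tau> 4 U \<and>
       SS L n (K n * pair_norm \<tau> 4 U) (\<lambda>X. Vfield U X $ 2 / Vfield U X $ 1))"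
    if U: "U \<in> sobolev_S \<tau> (4 + n)" and small: "pair_norm \<tau> 4 U < \<epsilon>" for n U
  proof -
    obtain \<psi> \<eta> where U_eq: "U = (\<psi>, \<eta>)" by (cases U)
    define s where "s = pair_norm \<tau> 4 U"
    have s0: "0 \<le> s" using sobolev_norm_nonneg by (simp add: s_def pair_norm_def)
    have s: "s \<le> 1" "k * s \<le> 1 / 16" "k * s \<le> \<mu> / 6"
    proof -
      have "s \<le> 1 / (16 * k)" "s \<le> \<mu> / (6 * k)" "s \<le> 1" using small by (simp_all add: s_def \<epsilon>_def)
      then show "s \<le> 1" "k * s \<le> 1 / 16" "k * s \<le> \<mu> / 6" using k by (simp_all add: field_simps)
    qed
    have K0s: "K 0 * s \<le> k * s" using s0 by (simp add: k_def mult_right_mono)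
    have u: "\<psi> \<in> sobolev \<tau> (4 + n)" "\<eta> \<in> sobolev \<tau> (4 + n)" and u4: "\<psi> \<in> sobolev \<tau> (4 + 0)" "\<eta> \<in> sobolev \<tau> (4 + 0)"
      and sym: "odd1 \<psi>" "even2 \<psi>" "even1 \<eta>" "even2 \<eta>" and per: "periodic \<tau> \<psi>" "periodic \<tau> \<eta>"
      using U sobolev_mono[OF t, of 4 "4 + n"] by (auto simp: U_eq sobolev_S_def sobolev_def)
    have K0: "(\<forall>X. \<psi> differentiable (at X)) \<and> (\<forall>X. \<eta> differentiable (at X)) \<and>
      (\<forall>i\<in>Basis. SS 1 0 (K 0 * s) (dirderiv i \<psi>) \<and> SS 1 0 (K 0 * s) (dirderiv i \<eta>)) \<and>
      SS 1 0 (K 0 * s) (bcoef U) \<and>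
      SS 1 0 (K 0 * s) (\<lambda>X. Vfield U X $ 1 - 1) \<and> SS 1 0 (K 0 * s) (\<lambda>X. Vfield U X $ 2) \<and>
      ((\<forall>X. 1 / 2 \<le> Vfield U X $ 1) \<longrightarrow> SS 1 0 (K 0 * s) (\<lambda>X. Vfield U X $ 2 / Vfield U X $ 1))"
      using K(2)[of 0, rule_format, OF order_refl s(1) u4] by (simp add: s_def U_eq)
    then have d: "\<And>X. \<psi> differentiable (at X)" "\<And>X. \<eta> differentiable (at X)"
      and b: "SS 1 0 (K 0 * s) (bcoef U)" and v1: "SS 1 0 (K 0 * s) (\<lambda>X. Vfield U X $ 1 - 1)"
      and v2: "SS 1 0 (K 0 * s) (\<lambda>X. Vfield U X $ 2)"
      and eta: "\<And>i. i \<in> Basis \<Longrightarrow> SS 1 0 (K 0 * s) (dirderiv i \<eta>)" by blast+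
    have V1: "1 / 2 \<le> Vfield U X $ 1" "Vfield U X $ 1 \<le> 2" "\<bar>Vfield U X $ 2\<bar> \<le> 1" for X
      using SSD(1)[OF v1, of X] SSD(1)[OF v2, of X] K0s s by linarith+
    have f: "SS 1 0 (K 0 * s) (\<lambda>X. Vfield U X $ 2 / Vfield U X $ 1)" using K0 V1 by blast
    have v1': "SS 1 0 (K 0 * s + 1) (\<lambda>X. Vfield U X $ 1)"
      using SS_add[OF v1 SS_const[of 1 1 1 0]] by simp
    have Vd: "\<forall>i X. (\<lambda>X. Vfield U X $ i) differentiable (at X)"
      "\<forall>i. \<forall>e\<in>Basis. continuous_on UNIV (dirderiv e (\<lambda>X. Vfield U X $ i))"
      using SSD(2)[OF v1'] SSD(2)[OF v2] Qb_continuous[OF SSD(3)[OF v1']] Qb_continuous[OF SSD(3)[OF v2]]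
      by (simp_all add: forall_2)
    have Vc: "continuous_on UNIV (\<lambda>X. Vfield U X $ i)" for i
      using Vd(1) by (intro differentiable_continuous_UNIV) auto
    have bB: "\<bar>D1 (bcoef U) X\<bar> \<le> K 0 * s" "\<bar>D2 (bcoef U) X\<bar> \<le> K 0 * s" for X
      using Qb_bound[OF SSD(3)[OF b]] by (simp_all add: Basis_vec2)
    have bc: "continuous_on UNIV (D1 (bcoef U))" "continuous_on UNIV (D2 (bcoef U))"
      using Qb_continuous[OF SSD(3)[OF b]] by (simp_all add: Basis_vec2)
    have a_eq: "acoef \<mu> U = (\<lambda>X. Vfield U X $ 1 * D1 (bcoef U) X + Vfield U X $ 2 * D2 (bcoef U) X + \<mu>)"
      by (simp add: acoef_def fun_eq_iff grad_def mult.commute)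
    have ac: "continuous_on UNIV (acoef \<mu> U)" unfolding a_eq by (intro continuous_intros Vc bc)
    have apos: "\<mu> / 2 \<le> acoef \<mu> U X" for X
    proof -
      have "\<bar>Vfield U X $ 1 * D1 (bcoef U) X\<bar> \<le> 2 * (K 0 * s)" "\<bar>Vfield U X $ 2 * D2 (bcoef U) X\<bar> \<le> 1 * (K 0 * s)"
        unfolding abs_mult using V1[of X] bB[of X] by (intro mult_mono; simp)+
      then show ?thesis using K0s s(3) unfolding a_eq by linarith
    qed
    have sy: "even1 (D1 \<psi>)" "odd1 (D2 \<psi>)" "even2 (D1 \<psi>)" "odd2 (D2 \<psi>)"
      "odd1 (D1 \<eta>)" "even1 (D2 \<eta>)" "even2 (D1 \<eta>)" "odd2 (D2 \<eta>)"
      using D12_symmetry(2,3)[OF d(1)] D12_symmetry(1,3)[OF d(2)] sym by blast+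
    have bs: "odd1 (bcoef U)" "even2 (bcoef U)"
      using sy by (simp_all add: U_eq bcoef_eq odd1_def even1_def odd2_def even2_def divide_simps)
    have Vs: "odd1 (\<lambda>X. Vfield U X $ 2 / Vfield U X $ 1)" "odd2 (\<lambda>X. Vfield U X $ 2 / Vfield U X $ 1)"
      using sy bs by (simp_all add: U_eq Vfield_eq odd1_def even1_def odd2_def even2_def minus_divide_left)
    have pd: "periodic \<tau> (dirderiv v \<psi>)" "periodic \<tau> (dirderiv v \<eta>)" for v
      by (rule periodic_dirderiv d per)+
    have pb: "periodic \<tau> (bcoef U)" using pd by (simp add: U_eq bcoef_eq[abs_def] periodic_def)
    have pV: "periodic \<tau> (Vfield U)"
      using pd pb by (simp add: U_eq periodic_def vec2_eq_iff Vfield_eq)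
    have pdb: "periodic \<tau> (dirderiv v (bcoef U))" for v by (rule periodic_dirderiv[OF SSD(2)[OF b] pb])
    have pa: "periodic \<tau> (acoef \<mu> U)" using pV pdb unfolding a_eq by (simp add: periodic_def)
    have eta': "\<exists>E. \<forall>i\<in>Basis. SS 1 0 E (dirderiv i \<eta>)" using eta by blast
    have adm: "admissible \<tau> \<mu> U"
      unfolding admissible_def using V1 Vd ac apos pV pa per d eta' by (simp add: U_eq)
    have sh: "shear (\<lambda>X. Vfield U X $ 2 / Vfield U X $ 1) (1 / 16) \<tau>"
    proof
      show "\<bar>Vfield U X $ 2 / Vfield U X $ 1\<bar> \<le> 1 / 16" for X using SSD(1)[OF f, of X] K0s s(2) by linarith
      show "\<bar>D2 (\<lambda>X. Vfield U X $ 2 / Vfield U X $ 1) X\<bar> \<le> 1 / 16" for X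
        using Qb_bound[OF SSD(3)[OF f], of "pt 0 1" X] K0s s(2) by (simp add: Basis_vec2)
      show "per1 (\<lambda>X. Vfield U X $ 2 / Vfield U X $ 1)"
        unfolding per1_def
      proof (intro allI)
        fix a b
        have "Vfield U (pt a b + pt (2 * pi) 0) = Vfield U (pt a b)"
          using pV periodic_gens(1)[OF t] unfolding periodic_def by blast
        then show "Vfield U (pt (a + 2 * pi) b) $ 2 / Vfield U (pt (a + 2 * pi) b) $ 1 = Vfield U (pt a b) $ 2 / Vfield U (pt a b) $ 1"
          by simp
      qed
    qed (use t SSD(2)[OF f] Qb_continuous[OF SSD(3)[OF f]] Vs pV periodic_gens[OF t] in \<open>auto simp: periodic_def\<close>)
    obtain L where L: "1 \<le> L" "pair_norm \<tau> (4 + n) U = L ^ n * pair_norm \<tau> 4 U"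
      using pair_norm_weight[OF t, of \<psi> \<eta> n] U by (auto simp: U_eq)
    have "SS L n (K n * s) (\<lambda>X. Vfield U X $ 2 / Vfield U X $ 1)"
      using K(2)[of n, rule_format, OF L(1) s(1) u] L(2) V1 by (simp add: s_def U_eq)
    then show ?thesis using adm sh L s(1) unfolding s_def by blast
  qed
  from eps K(1) main show ?thesis by blast
qed


section \<open>Integral curves and the foliation by leaves\<close>

text \<open>As \<open>l\<close> is continuous on \<open>I\<close> only, each \<open>t\<close> is
  joined to the base point \<open>t0\<close> inside a compact subinterval of \<open>I\<close>, where
  the scaled integral is compared with a local antiderivative.\<close>

lemma open_interval_antiderivative:
  fixes l :: "real \<Rightarrow> real"
  assumes I: "open_interval I" and c: "continuous_on I l"
  obtains s where "\<And>t. t \<in> I \<Longrightarrow> (s has_real_derivative l t) (at t)"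
proof -
  have oI: "open I" and iI: "is_interval I" and ne: "I \<noteq> {}" using I by (auto simp: open_interval_def)
  obtain t0 where t0: "t0 \<in> I" using ne by blast
  define s where "s u = (u - t0) * integral {0..1} (\<lambda>\<theta>. l (t0 + \<theta> * (u - t0)))" for u
  have "(s has_real_derivative l t) (at t)" if t: "t \<in> I" for t
  proof -
    have "min t t0 \<in> I" "max t t0 \<in> I" using t t0 by (auto simp: min_def max_def)
    then obtain d1 d2 where d: "0 < d1" "cball (min t t0) d1 \<subseteq> I" "0 < d2" "cball (max t t0) d2 \<subseteq> I"
      using oI by (meson open_contains_cball)
    define a b where "a = min t t0 - d1" and "b = max t t0 + d2"
    have "a \<in> cball (min t t0) d1" "b \<in> cball (max t t0) d2" using d by (simp_all add: a_def b_def dist_real_def)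
    then have abI: "a \<in> I" "b \<in> I" using subsetD[OF d(2)] subsetD[OF d(4)] by simp_all
    then have sub: "{a..b} \<subseteq> I" using iI unfolding is_interval_1 by (meson atLeastAtMost_iff subsetI)
    have ab: "a < t" "t < b" "a < t0" "t0 < b" using d by (auto simp: a_def b_def)
    obtain g where g0: "\<And>u. u \<in> {a..b} \<Longrightarrow> (g has_vector_derivative l u) (at u within {a..b})"
      using antiderivative_continuous[OF continuous_on_subset[OF c sub]] by blast
    have s_eq: "g u - g t0 = s u" if u: "u \<in> {a<..<b}" for u
    proof -
      have "((\<lambda>\<theta>. g (t0 + \<theta> * (u - t0))) has_vector_derivative (u - t0) *\<^sub>R l (t0 + \<theta> * (u - t0))) (at \<theta> within {0..1})"
        if th: "\<theta> \<in> {0..1}" for \<theta>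
      proof -
        have conv: "t0 + \<theta> * (u - t0) \<in> {a<..<b}" if "\<theta> \<in> {0..1}" for \<theta>
        proof -
          have "t0 + \<theta> * (u - t0) = (1 - \<theta>) *\<^sub>R t0 + \<theta> *\<^sub>R u" by (simp add: algebra_simps)
          then show ?thesis using convexD[of "{a<..<b}" t0 u "1 - \<theta>" \<theta>] that u ab by (simp add: convex_real_interval)
        qed
        have "(g has_vector_derivative l (t0 + \<theta> * (u - t0))) (at (t0 + \<theta> * (u - t0)) within {a..b})"
          using g0 conv[OF th] by auto
        moreover have "at (t0 + \<theta> * (u - t0)) within {a..b} = at (t0 + \<theta> * (u - t0))"
          using conv[OF th] by (intro at_within_interior) auto
        ultimately have "(g has_real_derivative l (t0 + \<theta> * (u - t0))) (at (t0 + \<theta> * (u - t0)))"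
          by (simp add: has_real_derivative_iff_has_vector_derivative)
        then have "((\<lambda>\<theta>. g (t0 + \<theta> * (u - t0))) has_real_derivative l (t0 + \<theta> * (u - t0)) * (u - t0)) (at \<theta>)"
          by (rule DERIV_chain2) (auto intro!: derivative_eq_intros)
        then show ?thesis
          by (auto simp: has_real_derivative_iff_has_vector_derivative mult.commute intro: has_vector_derivative_at_within)
      qed
      from fundamental_theorem_of_calculus[OF _ this]
      have "((\<lambda>\<theta>. (u - t0) * l (t0 + \<theta> * (u - t0))) has_integral g (t0 + 1 * (u - t0)) - g (t0 + 0 * (u - t0))) {0..1}"
        by simp
      then have "integral {0..1} (\<lambda>\<theta>. (u - t0) * l (t0 + \<theta> * (u - t0))) = g u - g t0"
        by (rule integral_unique[THEN trans]) simp
      then show ?thesis by (simp add: s_def)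
    qed
    have "at t within {a..b} = at t" using ab by (intro at_within_interior) auto
    then have "(g has_real_derivative l t) (at t)"
      using g0[of t] ab by (simp add: has_real_derivative_iff_has_vector_derivative)
    then have "((\<lambda>u. g u - g t0) has_real_derivative l t) (at t)"
      using DERIV_diff[OF _ DERIV_const] by fastforce
    then show ?thesis
      by (rule has_field_derivative_transform_within_open[where S = "{a<..<b}"]) (use ab s_eq in auto)
  qed
  then show ?thesis by (rule that)
qed

text \<open>The new time is a primitive \<open>s\<close> of \<open>l\<close>: it is injective by the
  mean value theorem and has an open image, and its inverse has derivative 1/l. Negative
  \<open>l\<close> is covered too, since arcs carry no orientation.\<close>

lemma integral_curve_reparam:
  fixes x :: "real \<Rightarrow> real^2"
  assumes I: "open_interval I" and l: "continuous_on I l" "\<And>t. t \<in> I \<Longrightarrow> l t \<noteq> 0"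
    and x: "\<And>t. t \<in> I \<Longrightarrow> (x has_vector_derivative l t *\<^sub>R V (x t)) (at t)"
  shows "x ` I \<in> integral_curves V"
proof -
  have oI: "open I" and iI: "is_interval I" and ne: "I \<noteq> {}" using I by (auto simp: open_interval_def)
  obtain s where s: "\<And>t. t \<in> I \<Longrightarrow> (s has_real_derivative l t) (at t)"
    using open_interval_antiderivative[OF I l(1)] by blast
  have cs: "continuous_on I s"
    by (rule DERIV_continuous_on) (rule has_field_derivative_at_within[OF s])
  have less: "s a \<noteq> s b" if "a \<in> I" "b \<in> I" "a < b" for a b
  proof
    assume eq: "s a = s b"
    have sub: "{a..b} \<subseteq> I" using iI that unfolding is_interval_1 by (meson atLeastAtMost_iff subsetI)
    have "\<exists>z. a < z \<and> z < b \<and> s b - s a = (b - a) * l z"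
      by (rule MVT2[OF that(3)]) (use s sub in auto)
    then obtain z where z: "a < z" "z < b" "(b - a) * l z = 0" using eq by auto
    then have "z \<in> {a..b}" by simp
    then have "l z \<noteq> 0" using sub l(2) by blast
    with z show False by simp
  qed
  have inj: "inj_on s I"
  proof (rule inj_onI)
    fix a b assume "a \<in> I" "b \<in> I" "s a = s b"
    then show "a = b" using less[of a b] less[of b a] by (cases a b rule: linorder_cases) auto
  qed
  have pI: "path_connected I" using iI is_interval_path_connected_1 by blast
  have oJ: "open (s ` I)" by (rule injective_into_1d_imp_open_map_UNIV[OF oI cs inj]) simp
  obtain r where r: "homeomorphism I (s ` I) s r"
    using injective_into_1d_eq_homeomorphism[OF cs pI] inj by blast
  have J: "open_interval (s ` I)"
    using oJ ne connected_continuous_image[OF cs] iI by (simp add: open_interval_def is_interval_connected_1)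
  have rI: "r u \<in> I" "s (r u) = u" if "u \<in> s ` I" for u using r that by (auto simp: homeomorphism_def)
  have dr: "(r has_real_derivative inverse (l (r u))) (at u)" if u: "u \<in> s ` I" for u
  proof (rule has_field_derivative_inverse_basic[where t = "s ` I"])
    show "(s has_real_derivative l (r u)) (at (r u))" using s rI[OF u] by blast
    show "continuous (at u) r" using r u oJ by (auto simp: homeomorphism_def continuous_on_eq_continuous_at)
  qed (use l rI u oJ in auto)
  have "((\<lambda>u. x (r u)) has_vector_derivative V (x (r u))) (at u)" if u: "u \<in> s ` I" for u
  proof -
    have "(r has_vector_derivative inverse (l (r u))) (at u)"
      using dr[OF u] by (simp add: has_real_derivative_iff_has_vector_derivative)
    from vector_diff_chain_at[OF this x[OF rI(1)[OF u]]] show ?thesis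
      using l(2)[OF rI(1)[OF u]] by (simp add: o_def)
  qed
  moreover have "x ` I = (\<lambda>u. x (r u)) ` s ` I"
    using r by (force simp: homeomorphism_def image_image)
  ultimately show ?thesis using J unfolding integral_curves_def by blast
qed

locale flow = shear "\<lambda>X. V X $ 2 / V X $ 1" F \<tau> for V :: "real^2 \<Rightarrow> real^2" and F \<tau> +
  assumes V1: "\<And>X. 1 / 2 \<le> V X $ 1" and contV: "continuous_on UNIV V"
begin

lemma V1_pos: "0 < V X $ 1" using V1[of X] by simp

definition leaf :: "real \<Rightarrow> (real^2) set" where "leaf a = range (\<lambda>z. T (pt z a))"

lemma leaf_iff: "X \<in> leaf a \<longleftrightarrow> H X = a"
proof
  assume "X \<in> leaf a"
  then obtain z where "X = T (pt z a)" by (auto simp: leaf_def)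
  then have "U X = pt z a" by simp
  from arg_cong[OF this, of "\<lambda>Y. Y $ 2"] show "H X = a" by (simp add: U_def)
next
  assume "H X = a"
  then have "X = T (pt (X $ 1) a)" using T_U[of X] by (simp add: U_def)
  then show "X \<in> leaf a" unfolding leaf_def by blast
qed

lemma leaf_nonempty: "T (pt z a) \<in> leaf a" by (auto simp: leaf_def)

text \<open>\<open>H\<close> is a first integral: its derivative along V is (V_2 - V_1 D1 Z) / D2 Z,
  and \<open>D1 Z\<close> is V_2/V_1 at the corresponding point.\<close>

lemma integral_curve_in_leaf:
  assumes "L \<in> integral_curves V" shows "\<exists>a. L \<subseteq> leaf a"
proof -
  obtain x I where L: "L = x ` I" and I: "open_interval I"
    and x: "\<And>t. t \<in> I \<Longrightarrow> (x has_vector_derivative V (x t)) (at t)"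
    using assms unfolding integral_curves_def by blast
  have conv: "convex I" using I by (simp add: open_interval_def is_interval_convex_1)
  have "((\<lambda>t. H (x t)) has_real_derivative 0) (at t within I)" if t: "t \<in> I" for t
  proof -
    have "((\<lambda>t. H (x t)) has_derivative (\<lambda>h. ((h *\<^sub>R V (x t)) $ 2 - (h *\<^sub>R V (x t)) $ 1 * D1 Z (U (x t))) / D2 Z (U (x t)))) (at t)"
      by (rule has_derivative_compose[OF x[OF t, unfolded has_vector_derivative_def] H_has_derivative])
    moreover have "D1 Z (U (x t)) = V (x t) $ 2 / V (x t) $ 1"
      using Z_H[of "x t"] by (simp add: Z_D along_def U_def)
    ultimately have "((\<lambda>t. H (x t)) has_derivative (\<lambda>h. h * 0)) (at t)"
      using V1_pos[of "x t"] by (simp add: field_simps)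
    then have "((\<lambda>t. H (x t)) has_real_derivative 0) (at t)"
      by (simp add: has_field_derivative_def lambda_zero)
    then show ?thesis by (rule has_field_derivative_at_within)
  qed
  from has_field_derivative_zero_constant[OF conv this] obtain c where "\<forall>t\<in>I. H (x t) = c" by blast
  then have "L \<subseteq> leaf c" unfolding L using leaf_iff by blast
  then show ?thesis by blast
qed

text \<open>Parametrised by z_1 a leaf has velocity V/V_1, a nonvanishing multiple of V, and a
  change of time removes the factor.\<close>

lemma leaf_integral_curve: "leaf a \<in> integral_curves V"
proof -
  have "range (\<lambda>z. T (pt z a)) \<in> integral_curves V"
  proof (rule integral_curve_reparam[where l = "\<lambda>z. 1 / V (T (pt z a)) $ 1"])
    show "open_interval UNIV" by (simp add: open_interval_def)
    have "continuous_on UNIV T" unfolding T_def[abs_def] by (intro continuous_intros Z_cont)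
    then have "continuous_on UNIV (\<lambda>z. T (pt z a))"
      by (rule continuous_on_comp_pt) (intro continuous_intros)+
    then have "continuous_on UNIV (\<lambda>z. V (T (pt z a)))" using continuous_on_compose2[OF contV] by blast
    then show "continuous_on UNIV (\<lambda>z. 1 / V (T (pt z a)) $ 1)"
      using V1_pos by (intro continuous_intros) (auto simp: less_imp_neq[THEN not_sym])
    show "1 / V (T (pt z a)) $ 1 \<noteq> 0" for z using V1_pos[of "T (pt z a)"] by simp
    fix z
    have "((\<lambda>z. pt z (Z (pt z a))) has_vector_derivative pt 1 (V (pt z (Z (pt z a))) $ 2 / V (pt z (Z (pt z a))) $ 1)) (at z)"
      by (intro has_vector_derivative_pt Z_deriv1 DERIV_ident)
    moreover have "pt 1 (V (pt z (Z (pt z a))) $ 2 / V (pt z (Z (pt z a))) $ 1) =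
        (1 / V (pt z (Z (pt z a))) $ 1) *\<^sub>R V (pt z (Z (pt z a)))"
      using V1_pos[of "pt z (Z (pt z a))"] by (simp add: vec2_eq_iff)
    ultimately show "((\<lambda>z. T (pt z a)) has_vector_derivative (1 / V (T (pt z a)) $ 1) *\<^sub>R V (T (pt z a))) (at z)"
      by (simp add: T_def)
  qed
  then show ?thesis by (simp add: leaf_def)
qed

lemma maximal_integral_curves: "maximal_arcs (integral_curves V) = range leaf"
proof (intro set_eqI iffI)
  fix L assume L: "L \<in> maximal_arcs (integral_curves V)"
  have ic: "L \<in> integral_curves V" and mx: "\<forall>L'\<in>integral_curves V. L \<subseteq> L' \<longrightarrow> L' = L"
    by (rule L[unfolded maximal_arcs_def mem_Collect_eq, THEN conjunct1]
        L[unfolded maximal_arcs_def mem_Collect_eq, THEN conjunct2])+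
  obtain a where "L \<subseteq> leaf a" using integral_curve_in_leaf[OF ic] ..
  then have "leaf a = L" using bspec[OF mx leaf_integral_curve[of a]] by (rule rev_mp)
  then show "L \<in> range leaf" by (intro range_eqI[of _ _ a]) simp
next
  fix L assume "L \<in> range leaf"
  then obtain a where a: "L = leaf a" by (rule rangeE)
  have "L' = leaf a" if L': "L' \<in> integral_curves V" "leaf a \<subseteq> L'" for L'
  proof -
    obtain b where b: "L' \<subseteq> leaf b" using integral_curve_in_leaf[OF L'(1)] by blast
    have "T (pt 0 a) \<in> leaf b" using leaf_nonempty[of 0 a] L'(2) b by blast
    then have "a = b" using leaf_nonempty[of 0 a] by (simp add: leaf_iff)
    then show ?thesis using L'(2) b by (intro subset_antisym) simp_all
  qed
  then show "L \<in> maximal_arcs (integral_curves V)"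
    unfolding maximal_arcs_def a mem_Collect_eq by (intro conjI leaf_integral_curve ballI impI)
qed

lemma U_leaf: "U ` leaf a = {z. z $ 2 = a}"
proof (intro set_eqI iffI)
  fix z assume "z \<in> U ` leaf a"
  then show "z \<in> {z. z $ 2 = a}" by (auto simp: leaf_iff U_def)
next
  fix z :: "real^2" assume "z \<in> {z. z $ 2 = a}"
  then have "T z \<in> leaf a" using leaf_nonempty[of "z $ 1" a] pt_eta[of z] by simp
  then show "z \<in> U ` leaf a" by (intro image_eqI[of _ _ "T z"]) simp_all
qed

lemma straightened: "(`) U ` maximal_arcs (integral_curves V) = range (\<lambda>a. {z. z $ 2 = a})"
  unfolding maximal_integral_curves image_image U_leaf ..

lemma T_cont: "continuous_on UNIV T" and U_cont: "continuous_on UNIV U"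
  unfolding T_def[abs_def] U_def[abs_def] by (intro continuous_intros Z_cont H_cont)+

lemma foliation: "torus_foliation \<tau> (range leaf)"
  unfolding torus_foliation_def
proof (intro conjI)
  show "partition_on UNIV (range leaf)"
  proof (rule partition_onI)
    show "\<Union> (range leaf) = UNIV" by (auto simp: leaf_iff)
    show "disjnt p q" if "p \<in> range leaf" "q \<in> range leaf" "p \<noteq> q" for p q
    proof -
      obtain a b where ab: "p = leaf a" "q = leaf b" using \<open>p \<in> range leaf\<close> \<open>q \<in> range leaf\<close> by auto
      then have "a \<noteq> b" using \<open>p \<noteq> q\<close> by auto
      then show ?thesis by (auto simp: ab disjnt_iff leaf_iff)
    qed
    have "leaf a \<noteq> {}" for a using leaf_nonempty[of 0 a] by blast
    then show "{} \<notin> range leaf" by auto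
  qed
  show "\<forall>L\<in>range leaf. \<forall>g\<in>period_lattice \<tau>. (+) g ` L \<in> range leaf"
  proof clarify
    fix a g assume g: "g \<in> period_lattice \<tau>"
    have H_g: "H (X + g) = H X + g $ 2" for X
      using arg_cong[OF U_lattice[OF g, of X], of "\<lambda>Y. Y $ 2"] by (simp add: U_def)
    have "(+) g ` leaf a = leaf (a + g $ 2)"
    proof (intro set_eqI iffI)
      fix X assume "X \<in> (+) g ` leaf a"
      then show "X \<in> leaf (a + g $ 2)" using H_g by (auto simp: leaf_iff add.commute)
    next
      fix X assume "X \<in> leaf (a + g $ 2)"
      then have "X - g \<in> leaf a" using H_g[of "X - g"] by (simp add: leaf_iff)
      then show "X \<in> (+) g ` leaf a" by (intro image_eqI[of _ _ "X - g"]) simp_all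
    qed
    then show "(+) g ` leaf a \<in> range leaf" by blast
  qed
  show "\<forall>X. \<exists>N h k. open N \<and> X \<in> N \<and> homeomorphism N (box 0 (1::real^2)) h k \<and>
         (\<forall>L\<in>range leaf. \<forall>C \<in> components (L \<inter> N). \<exists>c. h ` C = {z \<in> box 0 1. z $ 2 = c})"
  proof
    fix X0
    \<comment> \<open>The straightened point is moved to the centre of the unit box.\<close>
    define p where "p = U X0 - pt (1 / 2) (1 / 2)"
    define h where "h X = U X - p" for X
    define k where "k z = T (z + p)" for z
    define N where "N = h -` box 0 (1 :: real^2)"
    have kh [simp]: "k (h X) = X" "h (k z) = z" for X z by (simp_all add: h_def k_def)
    have ch: "continuous_on UNIV h" unfolding h_def[abs_def] by (intro continuous_intros U_cont)
    have ck: "continuous_on UNIV k" unfolding k_def[abs_def]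
      by (rule continuous_on_compose2[OF T_cont]) (auto intro!: continuous_intros)
    have N1: "open N" unfolding N_def using open_vimage[OF open_box ch] .
    have N2: "X0 \<in> N" by (simp add: N_def h_def p_def mem_box_cart forall_2)
    have N3: "homeomorphism N (box 0 (1::real^2)) h k"
    proof (rule homeomorphismI)
      show "continuous_on N h" "continuous_on (box 0 1) k"
        by (rule continuous_on_subset[OF ch] continuous_on_subset[OF ck], simp)+
      show "h ` N \<subseteq> box 0 1" "k ` box 0 1 \<subseteq> N" by (auto simp: N_def)
    qed simp_all
    have N4: "\<exists>c. h ` C = {z \<in> box 0 1. z $ 2 = c}" if C: "C \<in> components (leaf a \<inter> N)" for a C
    proof -
      define S where "S = {z \<in> box 0 (1 :: real^2). z $ 2 = a - p $ 2}"
      have hX: "h X $ 2 = H X - p $ 2" for X by (simp add: h_def U_def)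
      have img: "leaf a \<inter> N = k ` S"
      proof (intro set_eqI iffI)
        fix X assume "X \<in> leaf a \<inter> N"
        then have "h X \<in> S" by (simp add: S_def N_def hX leaf_iff)
        then show "X \<in> k ` S" by (intro image_eqI[of _ _ "h X"]) simp_all
      next
        fix X assume "X \<in> k ` S"
        then obtain z where z: "z \<in> S" "X = k z" by blast
        then show "X \<in> leaf a \<inter> N" using hX[of X] by (simp add: S_def N_def leaf_iff)
      qed
      have "S = box 0 1 \<inter> {z. pt 0 1 \<bullet> z = a - p $ 2}" by (auto simp: S_def)
      then have "convex S" by (simp only:) (intro convex_Int convex_box convex_hyperplane)
      then have "connected (leaf a \<inter> N)"
        unfolding img by (intro connected_continuous_image continuous_on_subset[OF ck] convex_connected) auto
      moreover have "leaf a \<inter> N \<noteq> {}" using C by auto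
      ultimately have "components (leaf a \<inter> N) = {leaf a \<inter> N}" by (simp add: components_eq_sing_iff)
      then have "C = leaf a \<inter> N" using C by simp
      then have "h ` C = S" unfolding img by (simp add: image_image)
      then show ?thesis unfolding S_def by blast
    qed
    show "\<exists>N h k. open N \<and> X0 \<in> N \<and> homeomorphism N (box 0 (1::real^2)) h k \<and>
         (\<forall>L\<in>range leaf. \<forall>C \<in> components (L \<inter> N). \<exists>c. h ` C = {z \<in> box 0 1. z $ 2 = c})"
      using N1 N2 N3 N4 by blast
  qed
qed

text \<open>On a leaf x_2 stays within \<open>4 * pi * F\<close> of the constant \<open>a\<close>,
  so dividing by x_1 gives 0 in the limit; x_1 is unbounded because a leaf is a graph over the whole
  line.\<close>

lemma rotation: "rotation_number (range leaf) 0"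
  unfolding rotation_number_def
proof clarify
  fix a
  define G where "G = inf (filtercomap (\<lambda>X :: real^2. \<bar>X $ 1\<bar>) at_top) (principal (leaf a))"
  have ev: "eventually P G \<longleftrightarrow> (\<exists>N. \<forall>X. N \<le> \<bar>X $ 1\<bar> \<longrightarrow> X \<in> leaf a \<longrightarrow> P X)" for P
    by (auto simp: G_def eventually_inf_principal eventually_filtercomap_at_top_linorder)
  have "G \<noteq> bot"
  proof
    assume "G = bot"
    then have "eventually (\<lambda>X. False) G" by simp
    then obtain N where N: "\<And>X. N \<le> \<bar>X $ 1\<bar> \<Longrightarrow> X \<in> leaf a \<Longrightarrow> False" unfolding ev by blast
    have "N \<le> \<bar>T (pt N a) $ 1\<bar>" by (simp add: T_def)
    with N leaf_nonempty show False by blast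
  qed
  moreover have "((\<lambda>X. X $ 2 / X $ 1) \<longlongrightarrow> 0) G"
  proof (rule tendstoI)
    fix e :: real assume e: "0 < e"
    define N where "N = (\<bar>a\<bar> + 4 * pi * F + 1) / e"
    have "dist (X $ 2 / X $ 1) 0 < e" if X: "N \<le> \<bar>X $ 1\<bar>" "X \<in> leaf a" for X
    proof -
      have pos: "0 < \<bar>a\<bar> + 4 * pi * F + 1" using F_nonneg by (simp add: add_nonneg_pos)
      then have "0 < N" using e by (simp add: N_def)
      then have X1: "0 < \<bar>X $ 1\<bar>" using X(1) by linarith
      have "\<bar>X $ 2\<bar> < \<bar>a\<bar> + 4 * pi * F + 1" using H_near[of X] X(2) by (simp add: leaf_iff)
      also have "\<dots> = N * e" using e by (simp add: N_def)
      also have "\<dots> \<le> \<bar>X $ 1\<bar> * e" using X(1) e by (intro mult_right_mono) auto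
      finally have "\<bar>X $ 2\<bar> < e * \<bar>X $ 1\<bar>" by (simp add: mult.commute)
      then show ?thesis using X1 by (simp add: divide_less_eq)
    qed
    then show "\<forall>\<^sub>F X in G. dist (X $ 2 / X $ 1) 0 < e" unfolding ev by blast
  qed
  ultimately show "let G = inf (filtercomap (\<lambda>X. \<bar>X $ 1\<bar>) at_top) (principal (leaf a))
       in G \<noteq> bot \<and> ((\<lambda>X. X $ 2 / X $ 1) \<longlongrightarrow> 0) G"
    unfolding Let_def G_def by blast
qed

end


section \<open>A barrier for the Dirichlet-Neumann problem\<close>

lemma second_derivative_local_max:
  fixes w w' :: "real \<Rightarrow> real"
  assumes d: "0 < d" and w: "\<And>t. \<bar>t\<bar> < d \<Longrightarrow> (w has_real_derivative w' t) (at t)"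
    and w'': "(w' has_real_derivative c) (at 0)" and max: "\<And>t. \<bar>t\<bar> < d \<Longrightarrow> w t \<le> w 0"
  shows "c \<le> 0"
proof (rule ccontr)
  assume "\<not> c \<le> 0"
  then have "0 < c" by simp
  have z: "w' 0 = 0"
    by (rule DERIV_local_max[OF w[of 0] d]) (use d max in auto)
  from DERIV_pos_inc_right[OF w'' \<open>0 < c\<close>] obtain d' where
    d': "0 < d'" "\<And>h. 0 < h \<Longrightarrow> h < d' \<Longrightarrow> w' 0 < w' (0 + h)" by blast
  define h where "h = min d d' / 2"
  have h: "0 < h" "h < d" "h < d'" using d d'(1) by (auto simp: h_def)
  have "\<exists>\<xi>. 0 < \<xi> \<and> \<xi> < h \<and> w h - w 0 = (h - 0) * w' \<xi>"
    by (rule MVT2[OF h(1)]) (use w h in auto)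
  then obtain \<xi> where x: "0 < \<xi>" "\<xi> < h" "w h - w 0 = h * w' \<xi>" by auto
  have "0 < w' \<xi>" using d'(2)[of \<xi>] x h z by simp
  then have "0 < w h - w 0" using x(3) h(1) by simp
  then show False using max[of h] h by simp
qed

lemma has_vector_derivative_line:
  fixes f :: "'a::real_normed_vector \<Rightarrow> 'b::real_normed_vector"
  assumes "f differentiable (at (x + t *\<^sub>R e))"
  shows "((\<lambda>t. f (x + t *\<^sub>R e)) has_vector_derivative dirderiv e f (x + t *\<^sub>R e)) (at t)"
proof -
  have "((\<lambda>t. x + t *\<^sub>R e) has_derivative (\<lambda>h. h *\<^sub>R e)) (at t)" by (auto intro!: derivative_eq_intros)
  from has_derivative_compose[OF this has_derivative_dirderiv[OF assms]]
  have "((\<lambda>t. f (x + t *\<^sub>R e)) has_derivative (\<lambda>h. dirderiv (h *\<^sub>R e) f (x + t *\<^sub>R e))) (at t)" .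
  moreover have "dirderiv (h *\<^sub>R e) f (x + t *\<^sub>R e) = h *\<^sub>R dirderiv e f (x + t *\<^sub>R e)" for h
    using has_derivative_linear[OF has_derivative_dirderiv[OF assms]] by (rule linear_scale)
  ultimately show ?thesis by (simp add: has_vector_derivative_def)
qed

lemma has_real_derivative_line:
  fixes f :: "'a::real_normed_vector \<Rightarrow> real"
  assumes "f differentiable (at (x + t *\<^sub>R e))"
  shows "((\<lambda>t. f (x + t *\<^sub>R e)) has_real_derivative dirderiv e f (x + t *\<^sub>R e)) (at t)"
  using has_vector_derivative_line[OF assms] by (simp add: has_real_derivative_iff_has_vector_derivative)

lemma has_real_derivative_line_Re:
  fixes f :: "'a::real_normed_vector \<Rightarrow> complex"
  assumes "f differentiable (at (x + t *\<^sub>R e))"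
  shows "((\<lambda>t. Re (c * f (x + t *\<^sub>R e))) has_real_derivative Re (c * dirderiv e f (x + t *\<^sub>R e))) (at t)"
proof -
  have "((\<lambda>t. c * f (x + t *\<^sub>R e)) has_vector_derivative c * dirderiv e f (x + t *\<^sub>R e)) (at t)"
    by (intro has_vector_derivative_mult_right has_vector_derivative_line assms)
  from bounded_linear.has_vector_derivative[OF bounded_linear_Re this]
  show ?thesis by (simp add: has_real_derivative_iff_has_vector_derivative)
qed

lemma periodic_bounded:
  fixes h :: "real^2 \<Rightarrow> 'b::real_normed_vector"
  assumes t: "0 < \<tau>" and c: "continuous_on UNIV h" and p: "periodic \<tau> h"
  obtains M where "0 \<le> M" "\<And>X. norm (h X) \<le> M"
proof -
  have "bounded (h ` cell \<tau>)"
    by (intro compact_imp_bounded compact_continuous_image continuous_on_subset[OF c] compact_cbox) simp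
  then obtain M where M: "\<And>X. X \<in> cell \<tau> \<Longrightarrow> norm (h X) \<le> M" unfolding bounded_iff by blast
  have "norm (h X) \<le> \<bar>M\<bar>" for X
  proof -
    obtain g where g: "g \<in> period_lattice \<tau>" "X + g \<in> cell \<tau>" using periodic_reduce[OF t] by blast
    have "h (X + g) = h X" using p g(1) by (simp add: periodic_def)
    then show ?thesis using M[OF g(2)] by simp
  qed
  then show ?thesis using that[of "\<bar>M\<bar>"] by simp
qed

text \<open>One solution \<phi> of the boundary value problem is fixed. Bounds on pure second
  derivatives of \<eta> along the axes are enough, because the Laplacian contains no mixed
  ones.\<close>

locale dn_problem =
  fixes \<tau> E :: real and \<eta> :: "real^2 \<Rightarrow> real" and \<phi> :: "(real^2) \<times> real \<Rightarrow> complex"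
  assumes tau: "0 < \<tau>" and E: "0 \<le> E"
    and eta_per: "periodic \<tau> \<eta>" and eta_d: "\<And>X. \<eta> differentiable (at X)"
    and eta_dd: "\<And>e X. e \<in> Basis \<Longrightarrow> dirderiv e \<eta> differentiable (at X)"
    and eta_b: "\<And>e X. e \<in> Basis \<Longrightarrow> \<bar>dirderiv e \<eta> X\<bar> \<le> E"
    and eta_bb: "\<And>e X. e \<in> Basis \<Longrightarrow> \<bar>dirderiv e (dirderiv e \<eta>) X\<bar> \<le> E"
    and phi_per: "\<And>X s p. p \<in> period_lattice \<tau> \<Longrightarrow> s \<le> \<eta> X \<Longrightarrow> \<phi> (X + p, s) = \<phi> (X, s)"
    and phi_C2: "Ck_on 2 (fluid_domain \<eta>) \<phi>"
    and harmonic: "\<And>x. x \<in> fluid_domain \<eta> \<Longrightarrow> (\<Sum>e\<in>Basis. dirderiv e (dirderiv e \<phi>) x) = 0"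
    and phi_cont: "continuous_on {(X, s). s \<le> \<eta> X} \<phi>"
    and phi_decay: "(dirderiv (0, 1) \<phi> \<longlongrightarrow> 0) (filtercomap snd at_bot)"
begin

lemma eta_cont: "continuous_on UNIV \<eta>"
  by (rule differentiable_continuous_UNIV[OF eta_d])

lemma phi_d: "x \<in> fluid_domain \<eta> \<Longrightarrow> \<phi> differentiable (at x)"
  and phi_dd: "x \<in> fluid_domain \<eta> \<Longrightarrow> dirderiv v \<phi> differentiable (at x)"
  using phi_C2 unfolding numeral_2_eq_2 Ck_on.simps by blast+

lemma eta_cont_comp: "continuous_on S (\<lambda>p :: (real^2) \<times> real. \<eta> (fst p))"
  by (rule continuous_on_compose2[OF eta_cont]) (auto intro!: continuous_intros)

lemma open_fluid: "open (fluid_domain \<eta>)"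
proof -
  have "fluid_domain \<eta> = {p. snd p < \<eta> (fst p)}" by (auto simp: fluid_domain_def)
  then show ?thesis by (simp only:) (intro open_Collect_less continuous_intros eta_cont_comp)
qed

lemma laplacian_split:
  assumes "x \<in> fluid_domain \<eta>"
  shows "dirderiv (pt 1 0, 0) (dirderiv (pt 1 0, 0) \<phi>) x + dirderiv (pt 0 1, 0) (dirderiv (pt 0 1, 0) \<phi>) x
    + dirderiv (0, 1) (dirderiv (0, 1) \<phi>) x = 0"
proof -
  have B: "(Basis :: ((real^2) \<times> real) set) = {(pt 1 0, 0), (pt 0 1, 0), (0, 1)}"
    by (auto simp: Basis_prod_def Basis_vec2)
  have "pt 1 0 \<noteq> 0" "pt 0 1 \<noteq> 0" "pt 1 0 \<noteq> pt 0 1" by (auto simp: vec2_eq_iff)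
  then have "(\<Sum>e\<in>Basis. dirderiv e (dirderiv e \<phi>) x) = dirderiv (pt 1 0, 0) (dirderiv (pt 1 0, 0) \<phi>) x
    + (dirderiv (pt 0 1, 0) (dirderiv (pt 0 1, 0) \<phi>) x + dirderiv (0, 1) (dirderiv (0, 1) \<phi>) x)"
    unfolding B by (subst sum.insert; simp)+
  with harmonic[OF assms] show ?thesis by (simp add: add.assoc)
qed

text \<open>
  The function \<open>2 - e\<^sup>\<kappa>\<^sup>(\<^sup>s\<^sup>-\<^sup>\<eta>\<^sup>)(2 - u)\<close> is superharmonic for \<open>\<kappa>\<close> of the order of the frequency of the
  boundary values \<open>u\<close>, hence an upper barrier.  The term \<open>\<epsilon> s\<close> makes the comparison function tend to
  \<open>-\<infinity>\<close> at infinite depth, where only \<open>\<phi> = o(s)\<close> is known.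
\<close>

lemma barrier:
  fixes u :: "real^2 \<Rightarrow> real"
  assumes u_eq: "\<And>X. u X = Re (c * \<phi> (X, \<eta> X))" and u_b: "\<And>X. \<bar>u X\<bar> \<le> 1"
    and u_d: "\<And>X. u differentiable (at X)" and u_dd: "\<And>e X. e \<in> Basis \<Longrightarrow> dirderiv e u differentiable (at X)"
    and u_b1: "\<And>e X. e \<in> Basis \<Longrightarrow> \<bar>dirderiv e u X\<bar> \<le> N"
    and u_b2: "\<And>e X. e \<in> Basis \<Longrightarrow> \<bar>dirderiv e (dirderiv e u) X\<bar> \<le> N^2"
    and N: "1 \<le> N" and kap: "\<kappa> = (6 * E + 3) * N" and s: "s \<le> \<eta> X"
  shows "Re (c * \<phi> (X, s)) \<le> 2 - exp (\<kappa> * (s - \<eta> X)) * (2 - u X)"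
proof -
  note [simp del] = times_complex.sel
  have kpos: "0 < \<kappa>" "3 * N \<le> \<kappa>" using E N by (auto simp: kap intro: mult_pos_pos add_nonneg_pos mult_right_mono)
  \<comment> \<open>In terms of \<open>q\<close> the barrier is
    \<open>2 - exp (\<kappa> * s) * q X\<close>, with depth and horizontal variables
    separated.\<close>
  define q where "q X = (2 - u X) * exp (- \<kappa> * \<eta> X)" for X
  have q_s: "exp (\<kappa> * s) * q X = exp (\<kappa> * (s - \<eta> X)) * (2 - u X)" for X s
    by (simp add: q_def exp_diff exp_minus right_diff_distrib divide_inverse mult_ac)
  define W where "W \<epsilon> p = Re (c * \<phi> p) - 2 + exp (\<kappa> * snd p) * q (fst p) + \<epsilon> * snd p" for \<epsilon> p
  obtain M where M: "0 \<le> M" "\<And>X. \<bar>\<eta> X\<bar> \<le> M" using periodic_bounded[OF tau eta_cont eta_per] by (auto simp: real_norm_def)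
  have uper: "u (X + g) = u X" if "g \<in> period_lattice \<tau>" for X g
    using phi_per[OF that, of "\<eta> X" X] eta_per that by (simp add: u_eq periodic_def)
  have W_per: "W \<epsilon> (X + g, s) = W \<epsilon> (X, s)" if "g \<in> period_lattice \<tau>" "s \<le> \<eta> X" for \<epsilon> X s g
    using phi_per[OF that] uper[OF that(1)] eta_per that(1) by (simp add: W_def q_def periodic_def)
  have u_cont: "continuous_on UNIV u" by (rule differentiable_continuous_UNIV[OF u_d])
  have u_cont_comp: "continuous_on S (\<lambda>p :: (real^2) \<times> real. u (fst p))" for S
    by (rule continuous_on_compose2[OF u_cont]) (auto intro!: continuous_intros)
  have W_cont: "continuous_on {(X, s). s \<le> \<eta> X} (W \<epsilon>)" for \<epsilon>
    unfolding W_def[abs_def] q_def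
    by (intro continuous_intros phi_cont eta_cont_comp u_cont_comp)
  \<comment> \<open>On the surface \<open>W \<epsilon>\<close> equals
    \<open>\<epsilon> * \<eta>\<close>, hence the bound \<open>\<epsilon> * M\<close>. A larger
    value would lead to an interior maximum, where the second derivatives contradict harmonicity of
    \<phi>.\<close>
  have key: "W \<epsilon> (X, s) \<le> \<epsilon> * M" if eps: "0 < \<epsilon>" and s: "s \<le> \<eta> X" for \<epsilon> X s
  proof (rule ccontr)
    assume "\<not> W \<epsilon> (X, s) \<le> \<epsilon> * M"
    then have big: "\<epsilon> * M < W \<epsilon> (X, s)" by simp
    have "\<forall>\<^sub>F x in filtercomap snd at_bot. dist (dirderiv (0, 1) \<phi> x) 0 < \<epsilon> / (2 * (cmod c + 1))"
      using tendstoD[OF phi_decay] eps by (auto simp: add_nonneg_pos)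
    then obtain S1 where S1_all: "\<forall>x. snd x \<le> S1 \<longrightarrow> dist (dirderiv (0, 1) \<phi> x) 0 < \<epsilon> / (2 * (cmod c + 1))"
      unfolding eventually_filtercomap_at_bot_linorder by blast
    have S1: "cmod (dirderiv (0, 1) \<phi> x) < \<epsilon> / (2 * (cmod c + 1))" if "snd x \<le> S1" for x
    proof -
      have "dist (dirderiv (0, 1) \<phi> x) 0 < \<epsilon> / (2 * (cmod c + 1))" using S1_all that by blast
      then show ?thesis by simp
    qed
    \<comment> \<open>At great depth \<phi> grows at most at rate \<open>\<epsilon> / 2\<close>, so
      half of the linear term \<open>\<epsilon> * s\<close> survives and carries
      \<open>W \<epsilon>\<close> to minus infinity.\<close>
    have S1': "\<bar>Re (c * dirderiv (0, 1) \<phi> x)\<bar> \<le> \<epsilon> / 2" if "snd x \<le> S1" for x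
    proof -
      have "\<bar>Re (c * dirderiv (0, 1) \<phi> x)\<bar> \<le> cmod c * cmod (dirderiv (0, 1) \<phi> x)"
        using abs_Re_le_cmod[of "c * dirderiv (0, 1) \<phi> x"] by (simp add: norm_mult)
      also have "\<dots> \<le> (cmod c + 1) * (\<epsilon> / (2 * (cmod c + 1)))"
        using S1[OF that] by (intro mult_mono) auto
      also have "\<dots> = \<epsilon> / 2"
      proof -
        have "cmod c + 1 \<noteq> 0" using norm_ge_zero[of c] by linarith
        then show ?thesis by (simp add: field_simps)
      qed
      finally show ?thesis .
    qed
    define S0 where "S0 = min S1 (- M - 1)"
    have S0: "S0 \<le> S1" "S0 < \<eta> X" for X using M(2)[of X] by (auto simp: S0_def)
    have cS0: "continuous_on UNIV (\<lambda>X. Re (c * \<phi> (X, S0)))"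
      by (intro continuous_intros continuous_on_compose2[OF phi_cont]) (use S0(2) in \<open>auto intro: less_imp_le\<close>)
    have pS0: "periodic \<tau> (\<lambda>X. Re (c * \<phi> (X, S0)))"
      using phi_per S0(2) by (auto simp: periodic_def less_imp_le)
    obtain B where B: "0 \<le> B" "\<And>X. \<bar>Re (c * \<phi> (X, S0))\<bar> \<le> B"
      using periodic_bounded[OF tau cS0 pS0] by (auto simp: real_norm_def)
    have low: "W \<epsilon> (Y, r) \<le> B + 3 + \<epsilon> * \<bar>S0\<bar> + \<epsilon> / 2 * r" if r: "r \<le> S0" for Y r
    proof -
      have "((\<lambda>t. Re (c * \<phi> (Y, t))) has_real_derivative Re (c * dirderiv (0, 1) \<phi> (Y, t))) (at t)" if "t \<le> S0" for t
      proof -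
        have "(Y, 0) + t *\<^sub>R (0, 1) \<in> fluid_domain \<eta>" using that S0(2)[of Y] by (simp add: fluid_domain_def)
        from has_real_derivative_line_Re[OF phi_d[OF this], of c] show ?thesis by simp
      qed
      note dt = this
      have "norm (Re (c * \<phi> (Y, r)) - Re (c * \<phi> (Y, S0))) \<le> \<epsilon> / 2 * norm (r - S0)"
      proof (rule field_differentiable_bound[where S = "{..S0}" and f = "\<lambda>t. Re (c * \<phi> (Y, t))"
            and f' = "\<lambda>t. Re (c * dirderiv (0, 1) \<phi> (Y, t))" and x = r and y = S0 and B = "\<epsilon> / 2"])
        show "convex {..S0}" by (rule convex_real_interval)
        show "r \<in> {..S0}" "S0 \<in> {..S0}" using r by simp_all
        show "((\<lambda>t. Re (c * \<phi> (Y, t))) has_field_derivative Re (c * dirderiv (0, 1) \<phi> (Y, z))) (at z within {..S0})"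
          if "z \<in> {..S0}" for z
          by (rule has_field_derivative_at_within, rule dt) (use that in simp)
        show "norm (Re (c * dirderiv (0, 1) \<phi> (Y, z))) \<le> \<epsilon> / 2" if "z \<in> {..S0}" for z
          using S1'[of "(Y, z)"] that S0(1) by simp
      qed
      then have "Re (c * \<phi> (Y, r)) - Re (c * \<phi> (Y, S0)) \<le> \<epsilon> / 2 * (S0 - r)"
        using r abs_ge_self[of "Re (c * \<phi> (Y, r)) - Re (c * \<phi> (Y, S0))"] by simp
      then have 1: "Re (c * \<phi> (Y, r)) \<le> B + \<epsilon> / 2 * (S0 - r)"
        using abs_ge_self[of "Re (c * \<phi> (Y, S0))"] B(2)[of Y] by linarith
      have 2: "exp (\<kappa> * (r - \<eta> Y)) * (2 - u Y) \<le> 1 * 3"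
      proof (intro mult_mono)
        have "\<kappa> * (r - \<eta> Y) \<le> 0" using kpos r S0(2)[of Y] by (intro mult_nonneg_nonpos) auto
        then show "exp (\<kappa> * (r - \<eta> Y)) \<le> 1" by simp
      qed (use u_b[of Y] in auto)
      have "\<epsilon> / 2 * S0 \<le> \<epsilon> / 2 * \<bar>S0\<bar>" using eps by (intro mult_left_mono) auto
      also have "\<dots> \<le> \<epsilon> * \<bar>S0\<bar>" using eps by (intro mult_right_mono) auto
      finally have "\<epsilon> / 2 * S0 \<le> \<epsilon> * \<bar>S0\<bar>" .
      moreover have "W \<epsilon> (Y, r) = Re (c * \<phi> (Y, r)) - 2 + exp (\<kappa> * (r - \<eta> Y)) * (2 - u Y) + \<epsilon> * r"
        by (simp only: W_def fst_conv snd_conv q_s)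
      moreover have "\<epsilon> / 2 * (S0 - r) = \<epsilon> / 2 * S0 - \<epsilon> / 2 * r" by (rule right_diff_distrib)
      moreover have "\<epsilon> * r = \<epsilon> / 2 * r + \<epsilon> / 2 * r" by simp
      ultimately show ?thesis using 1 2 by linarith
    qed
    \<comment> \<open>Below depth \<open>- R\<close> the function \<open>W \<epsilon>\<close> is at
      most 0; together with periodicity this places the maximum in the compact set
      \<open>K\<close>.\<close>
    define R where "R = max (- S0) (max M (2 * (B + 3 + \<epsilon> * \<bar>S0\<bar>) / \<epsilon>))"
    have R: "- R \<le> S0" "M \<le> R" by (auto simp: R_def)
    have lowR: "W \<epsilon> (Y, r) \<le> 0" if "r \<le> - R" for Y r
    proof -
      have "2 * (B + 3 + \<epsilon> * \<bar>S0\<bar>) / \<epsilon> \<le> - r" using that by (simp add: R_def)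
      then have "2 * (B + 3 + \<epsilon> * \<bar>S0\<bar>) \<le> - r * \<epsilon>" using eps by (simp add: divide_le_eq)
      moreover have "W \<epsilon> (Y, r) \<le> B + 3 + \<epsilon> * \<bar>S0\<bar> + \<epsilon> / 2 * r" using that R by (intro low) simp
      ultimately show ?thesis by (simp add: algebra_simps)
    qed
    define K where "K = {p. snd p \<le> \<eta> (fst p)} \<inter> (cell \<tau> \<times> {- R..M})"
    have "compact K" unfolding K_def
      by (intro closed_Int_compact closed_Collect_le continuous_intros eta_cont_comp compact_Times compact_cbox compact_Icc)
    have eM: "0 \<le> \<epsilon> * M" using eps M(1) by simp
    have inK: "\<exists>p\<in>K. W \<epsilon> (Y, r) = W \<epsilon> p \<and> snd p = r" if "r \<le> \<eta> Y" "- R \<le> r" for Y r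
    proof -
      obtain g where g: "g \<in> period_lattice \<tau>" "Y + g \<in> cell \<tau>" using periodic_reduce[OF tau] by blast
      have "\<eta> (Y + g) = \<eta> Y" using eta_per g(1) by (simp add: periodic_def)
      then have "(Y + g, r) \<in> K" using that g(2) M(2)[of Y] by (simp add: K_def abs_le_iff)
      moreover have "W \<epsilon> (Y + g, r) = W \<epsilon> (Y, r)" by (rule W_per[OF g(1) that(1)])
      ultimately show ?thesis by (intro bexI[of _ "(Y + g, r)"]) simp_all
    qed
    have "- R \<le> s" using lowR[of s X] big eM by force
    then obtain p0 where p0: "p0 \<in> K" "W \<epsilon> (X, s) = W \<epsilon> p0" using inK[OF s] by blast
    have KW: "continuous_on K (W \<epsilon>)" by (rule continuous_on_subset[OF W_cont]) (auto simp: K_def)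
    from continuous_attains_sup[OF \<open>compact K\<close> _ KW] p0(1)
    obtain p where p: "p \<in> K" "\<And>p'. p' \<in> K \<Longrightarrow> W \<epsilon> p' \<le> W \<epsilon> p" by blast
    obtain X1 s1 where p_eq: "p = (X1, s1)" by (cases p)
    have Wp: "\<epsilon> * M < W \<epsilon> (X1, s1)" using p(2)[OF p0(1)] p0(2) big p_eq by simp
    have "s1 \<noteq> \<eta> X1"
    proof
      assume "s1 = \<eta> X1"
      then have "W \<epsilon> (X1, s1) = \<epsilon> * \<eta> X1" by (simp add: W_def q_s u_eq[symmetric])
      also have "\<dots> \<le> \<epsilon> * M" using M(2)[of X1] eps by (intro mult_left_mono) auto
      finally show False using Wp by simp
    qed
    moreover have "\<not> s1 \<le> - R" using lowR[of s1 X1] Wp eM by force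
    ultimately have s1: "s1 < \<eta> X1" "- R < s1" using p(1) by (auto simp: K_def p_eq)
    have p_in: "p \<in> fluid_domain \<eta> \<inter> {p. - R < snd p}" using s1 by (simp add: fluid_domain_def p_eq)
    have "open (fluid_domain \<eta> \<inter> {p. - R < snd p})"
      by (intro open_Int open_fluid open_Collect_less continuous_intros)
    then obtain \<delta> where delta: "0 < \<delta>" "ball p \<delta> \<subseteq> fluid_domain \<eta> \<inter> {p. - R < snd p}"
      using p_in open_contains_ball by blast
    have line_in: "p + t *\<^sub>R e \<in> fluid_domain \<eta>" "W \<epsilon> (p + t *\<^sub>R e) \<le> W \<epsilon> p" if "\<bar>t\<bar> < \<delta>" "norm e = 1" for t e
    proof -
      have "p + t *\<^sub>R e \<in> ball p \<delta>" using that by (simp add: dist_norm)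
      then have *: "p + t *\<^sub>R e \<in> fluid_domain \<eta>" "- R < snd (p + t *\<^sub>R e)" using delta(2) by auto
      then show "p + t *\<^sub>R e \<in> fluid_domain \<eta>" by simp
      obtain Y r where Yr: "p + t *\<^sub>R e = (Y, r)" by (cases "p + t *\<^sub>R e")
      then have "r \<le> \<eta> Y" "- R \<le> r" using * by (auto simp: fluid_domain_def)
      from inK[OF this] show "W \<epsilon> (p + t *\<^sub>R e) \<le> W \<epsilon> p" unfolding Yr using p(2) by auto
    qed
    have pf: "p \<in> fluid_domain \<eta>" using p_in by simp
    have z0: "p + 0 *\<^sub>R v = p" for v by (simp only: scaleR_zero_left add_0_right)
    have nB: "norm e = 1" if "e \<in> Basis" for e :: "real^2" using that by (rule norm_Basis)
    define b where "b = 2 - u X1"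
    have horizontal: "Re (c * dirderiv (e, 0) (dirderiv (e, 0) \<phi>) p) + exp (\<kappa> * s1) * (exp (- \<kappa> * \<eta> X1) *
        (- dirderiv e (dirderiv e u) X1 - \<kappa> * dirderiv e (dirderiv e \<eta>) X1 * b
         + 2 * \<kappa> * dirderiv e \<eta> X1 * dirderiv e u X1 + \<kappa>^2 * (dirderiv e \<eta> X1)^2 * b)) \<le> 0"
      if e: "e \<in> Basis" for e
    proof -
      define qe where "qe t = (- dirderiv e u (X1 + t *\<^sub>R e) - \<kappa> * dirderiv e \<eta> (X1 + t *\<^sub>R e) * (2 - u (X1 + t *\<^sub>R e))) * exp (- \<kappa> * \<eta> (X1 + t *\<^sub>R e))" for t
      note lines = has_real_derivative_line[OF u_d] has_real_derivative_line[OF eta_d]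
        has_real_derivative_line[OF u_dd[OF e]] has_real_derivative_line[OF eta_dd[OF e]]
      have q1: "((\<lambda>t. q (X1 + t *\<^sub>R e)) has_real_derivative qe t) (at t)" for t
        unfolding q_def qe_def by (auto intro!: derivative_eq_intros lines simp: algebra_simps)
      have q2: "(qe has_real_derivative exp (- \<kappa> * \<eta> X1) *
        (- dirderiv e (dirderiv e u) X1 - \<kappa> * dirderiv e (dirderiv e \<eta>) X1 * b
         + 2 * \<kappa> * dirderiv e \<eta> X1 * dirderiv e u X1 + \<kappa>^2 * (dirderiv e \<eta> X1)^2 * b)) (at 0)"
        unfolding qe_def[abs_def] b_def
        by (auto intro!: derivative_eq_intros lines simp: algebra_simps power2_eq_square)
      have ne: "norm (e, 0 :: real) = 1" using nB[OF e] by simp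
      have W_line: "W \<epsilon> (p + t *\<^sub>R (e, 0)) = Re (c * \<phi> (p + t *\<^sub>R (e, 0))) - 2 + exp (\<kappa> * s1) * q (X1 + t *\<^sub>R e) + \<epsilon> * s1" for t
        by (simp add: W_def p_eq)
      show ?thesis
      proof (rule second_derivative_local_max[OF delta(1), where w = "\<lambda>t. W \<epsilon> (p + t *\<^sub>R (e, 0))"
            and w' = "\<lambda>t. Re (c * dirderiv (e, 0) \<phi> (p + t *\<^sub>R (e, 0))) + exp (\<kappa> * s1) * qe t"])
        show "((\<lambda>t. W \<epsilon> (p + t *\<^sub>R (e, 0))) has_real_derivative
            Re (c * dirderiv (e, 0) \<phi> (p + t *\<^sub>R (e, 0))) + exp (\<kappa> * s1) * qe t) (at t)" if "\<bar>t\<bar> < \<delta>" for t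
          unfolding W_line
          by (rule derivative_eq_intros has_real_derivative_line_Re[OF phi_d[OF line_in(1)[OF that ne]]] q1 refl)+ simp
        have "p + 0 *\<^sub>R (e, 0) \<in> fluid_domain \<eta>" using pf by (simp only: z0)
        from DERIV_add[OF has_real_derivative_line_Re[OF phi_dd[OF this], of c] DERIV_cmult[OF q2]]
        show "((\<lambda>t. Re (c * dirderiv (e, 0) \<phi> (p + t *\<^sub>R (e, 0))) + exp (\<kappa> * s1) * qe t) has_real_derivative
          Re (c * dirderiv (e, 0) (dirderiv (e, 0) \<phi>) p) + exp (\<kappa> * s1) * (exp (- \<kappa> * \<eta> X1) *
          (- dirderiv e (dirderiv e u) X1 - \<kappa> * dirderiv e (dirderiv e \<eta>) X1 * b
           + 2 * \<kappa> * dirderiv e \<eta> X1 * dirderiv e u X1 + \<kappa>^2 * (dirderiv e \<eta> X1)^2 * b))) (at 0)" by (simp only: z0)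
        show "W \<epsilon> (p + t *\<^sub>R (e, 0)) \<le> W \<epsilon> (p + 0 *\<^sub>R (e, 0))" if "\<bar>t\<bar> < \<delta>" for t
          using line_in(2)[OF that ne] by (simp only: z0)
      qed
    qed
    have vertical: "Re (c * dirderiv (0, 1) (dirderiv (0, 1) \<phi>) p) + exp (\<kappa> * s1) * (exp (- \<kappa> * \<eta> X1) * (\<kappa>^2 * b)) \<le> 0"
    proof -
      have ne: "norm (0 :: real^2, 1 :: real) = 1" by simp
      have W_line: "W \<epsilon> (p + t *\<^sub>R (0, 1)) = Re (c * \<phi> (p + t *\<^sub>R (0, 1))) - 2 + exp (\<kappa> * (s1 + t)) * q X1 + \<epsilon> * (s1 + t)" for t
        by (simp add: W_def p_eq)
      show ?thesis
      proof (rule second_derivative_local_max[OF delta(1), where w = "\<lambda>t. W \<epsilon> (p + t *\<^sub>R (0, 1))"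
            and w' = "\<lambda>t. Re (c * dirderiv (0, 1) \<phi> (p + t *\<^sub>R (0, 1))) + (\<kappa> * exp (\<kappa> * (s1 + t)) * q X1 + \<epsilon>)"])
        show "((\<lambda>t. W \<epsilon> (p + t *\<^sub>R (0, 1))) has_real_derivative
            Re (c * dirderiv (0, 1) \<phi> (p + t *\<^sub>R (0, 1))) + (\<kappa> * exp (\<kappa> * (s1 + t)) * q X1 + \<epsilon>)) (at t)" if "\<bar>t\<bar> < \<delta>" for t
          unfolding W_line
          by (rule derivative_eq_intros has_real_derivative_line_Re[OF phi_d[OF line_in(1)[OF that ne]]] refl)+ simp
        have "p + 0 *\<^sub>R (0, 1) \<in> fluid_domain \<eta>" using pf by (simp only: z0)
        note d2 = has_real_derivative_line_Re[OF phi_dd[OF this], of c]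
        have "((\<lambda>t. \<kappa> * exp (\<kappa> * (s1 + t)) * q X1 + \<epsilon>) has_real_derivative
            exp (\<kappa> * s1) * (exp (- \<kappa> * \<eta> X1) * (\<kappa>^2 * b))) (at 0)"
          by (auto intro!: derivative_eq_intros simp: q_def b_def power2_eq_square)
        from DERIV_add[OF d2 this]
        show "((\<lambda>t. Re (c * dirderiv (0, 1) \<phi> (p + t *\<^sub>R (0, 1))) + (\<kappa> * exp (\<kappa> * (s1 + t)) * q X1 + \<epsilon>)) has_real_derivative
          Re (c * dirderiv (0, 1) (dirderiv (0, 1) \<phi>) p) + exp (\<kappa> * s1) * (exp (- \<kappa> * \<eta> X1) * (\<kappa>^2 * b))) (at 0)" by (simp only: z0)
        show "W \<epsilon> (p + t *\<^sub>R (0, 1)) \<le> W \<epsilon> (p + 0 *\<^sub>R (0, 1))" if "\<bar>t\<bar> < \<delta>" for t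
          using line_in(2)[OF that ne] by (simp only: z0)
      qed
    qed
    have B12: "pt 1 0 \<in> Basis" "pt 0 1 \<in> Basis" by (auto simp: Basis_vec2)
    let ?Q = "\<lambda>e. - dirderiv e (dirderiv e u) X1 - \<kappa> * dirderiv e (dirderiv e \<eta>) X1 * b
         + 2 * \<kappa> * dirderiv e \<eta> X1 * dirderiv e u X1 + \<kappa>^2 * (dirderiv e \<eta> X1)^2 * b"
    have "Re (c * (dirderiv (pt 1 0, 0) (dirderiv (pt 1 0, 0) \<phi>) p + dirderiv (pt 0 1, 0) (dirderiv (pt 0 1, 0) \<phi>) p
        + dirderiv (0, 1) (dirderiv (0, 1) \<phi>) p)) = 0"
      by (subst laplacian_split[OF pf]) simp
    then have "exp (\<kappa> * s1) * (exp (- \<kappa> * \<eta> X1) * (?Q (pt 1 0) + ?Q (pt 0 1) + \<kappa>^2 * b)) \<le> 0"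
      using horizontal[OF B12(1)] horizontal[OF B12(2)] vertical
      by (simp only: distrib_left) (simp only: plus_complex.sel)
    moreover have "y \<le> 0" if "exp x1 * (exp x2 * y) \<le> 0" for x1 x2 y :: real
      using that by (simp add: mult_le_0_iff)
    ultimately have le0: "?Q (pt 1 0) + ?Q (pt 0 1) + \<kappa>^2 * b \<le> 0" by blast
    have b: "1 \<le> b" "b \<le> 3" using u_b[of X1] by (auto simp: b_def)
    have Qlow: "- (N^2) - \<kappa> * E * b - 2 * \<kappa> * E * N \<le> ?Q e" if e: "e \<in> Basis" for e
    proof -
      have 1: "- (N^2) \<le> - dirderiv e (dirderiv e u) X1" using u_b2[OF e, of X1] by linarith
      have "\<kappa> * dirderiv e (dirderiv e \<eta>) X1 * b \<le> \<kappa> * E * b"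
        using eta_bb[OF e, of X1] kpos b by (intro mult_right_mono mult_left_mono) auto
      moreover have "\<bar>dirderiv e \<eta> X1 * dirderiv e u X1\<bar> \<le> E * N"
        unfolding abs_mult using eta_b[OF e, of X1] u_b1[OF e, of X1] E by (intro mult_mono) auto
      then have "2 * \<kappa> * (- (E * N)) \<le> 2 * \<kappa> * (dirderiv e \<eta> X1 * dirderiv e u X1)"
        using kpos by (intro mult_left_mono) auto
      moreover have "0 \<le> \<kappa>^2 * (dirderiv e \<eta> X1)^2 * b" using b by simp
      ultimately show ?thesis using 1 by (simp add: algebra_simps)
    qed
    \<comment> \<open>Here \<open>\<kappa> = (6 * E + 3) * N\<close> is used: as
      \<open>N \<ge> 1\<close>, the part \<open>6 * E * N\<close> absorbs \<open>2 * E\<close> and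
      \<open>4 * E * N\<close>, and the part \<open>3 * N\<close> yields \<open>9 * N^2\<close>,
      which exceeds \<open>2 * N^2\<close>.\<close>
    have "0 < (\<kappa>^2 - 2 * \<kappa> * E) * b - 4 * \<kappa> * E * N - 2 * N^2"
    proof -
      have k1: "\<kappa> * (\<kappa> - 2 * E) \<ge> 0"
        using kpos E N mult_left_mono[OF N, of E] by (intro mult_nonneg_nonneg) (auto simp: kap algebra_simps)
      then have "\<kappa> * (\<kappa> - 2 * E) * 1 \<le> \<kappa> * (\<kappa> - 2 * E) * b" using b by (intro mult_left_mono) auto
      moreover have "\<kappa> * (6 * E * N) \<ge> \<kappa> * (2 * E + 4 * E * N)"
        using kpos mult_left_mono[OF N, of E] E by (intro mult_left_mono) auto
      moreover have "\<kappa> * \<kappa> = \<kappa> * (6 * E * N) + \<kappa> * (3 * N)" by (simp add: kap algebra_simps)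
      moreover have "\<kappa> * (3 * N) \<ge> (3 * N) * (3 * N)" using kpos N by (intro mult_right_mono) auto
      moreover have "0 < N * N" using N by simp
      ultimately show ?thesis by (simp add: power2_eq_square algebra_simps)
    qed
    then show False using le0 Qlow[OF B12(1)] Qlow[OF B12(2)] by (simp add: algebra_simps)
  qed
  have "W 0 (X, s) \<le> 0"
  proof (rule ccontr)
    assume "\<not> W 0 (X, s) \<le> 0"
    then have pos: "0 < W 0 (X, s)" by simp
    \<comment> \<open>The passage \<epsilon> \<rightarrow> 0 in \<open>key\<close> is done in one
      stroke: with this \<epsilon> the bound is at most half of the positive value it should
      dominate.\<close>
    define \<epsilon> where "\<epsilon> = W 0 (X, s) / (2 * (M + \<bar>s\<bar> + 1))"
    have den: "0 < M + \<bar>s\<bar> + 1" using M(1) by (simp add: add_nonneg_pos)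
    have eps: "0 < \<epsilon>" using pos den by (simp add: \<epsilon>_def)
    have "W 0 (X, s) \<le> \<epsilon> * (M - s)" using key[OF eps s] by (simp add: W_def algebra_simps)
    also have "\<dots> \<le> \<epsilon> * (M + \<bar>s\<bar> + 1)" using eps by (intro mult_left_mono) auto
    also have "\<dots> = W 0 (X, s) / 2" using den by (simp add: \<epsilon>_def field_simps)
    finally show False using pos by simp
  qed
  then show ?thesis by (simp add: W_def q_s)
qed

end


section \<open>Bicharacteristic strips of the hypersurface V . \<xi> = 0\<close>

context
  fixes V :: "real^2 \<Rightarrow> real^2" and p :: "(real^2) \<times> (real^2) \<Rightarrow> complex"
  assumes Vd: "\<And>i X. (\<lambda>X. V X $ i) differentiable (at X)"
    and V1: "\<And>X. 0 < V X $ 1"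
    and p: "\<And>X \<xi>. p (X, \<xi>) = 0 \<longleftrightarrow> V X \<bullet> \<xi> = 0"
begin

lemma has_derivative_field_comp:
  assumes x: "(x has_vector_derivative v) (at t)"
  shows "((\<lambda>t. V (x t) $ i) has_real_derivative (v $ 1 * D1 (\<lambda>X. V X $ i) (x t) + v $ 2 * D2 (\<lambda>X. V X $ i) (x t))) (at t)"
proof -
  have "((\<lambda>t. V (x t) $ i) has_derivative (\<lambda>h. dirderiv (h *\<^sub>R v) (\<lambda>X. V X $ i) (x t))) (at t)"
    using has_derivative_compose[OF x[unfolded has_vector_derivative_def] has_derivative_dirderiv[OF Vd]] .
  moreover have "(\<lambda>h. dirderiv (h *\<^sub>R v) (\<lambda>X. V X $ i) (x t)) =
      (*) (v $ 1 * D1 (\<lambda>X. V X $ i) (x t) + v $ 2 * D2 (\<lambda>X. V X $ i) (x t))"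
    by (rule ext, subst dirderiv_linear[OF Vd]) (simp add: algebra_simps)
  ultimately show ?thesis by (simp add: has_field_derivative_def)
qed

text \<open>The straight line with velocity \<open>(a, b)\<close> leaves the hypersurface only to
  second order. Subtracting \<open>r\<close>, with \<open>r 0 = 0\<close> and zero derivative at 0,
  from the first component of \<xi> puts it back without changing the velocity; V_1 > 0 makes this
  correction possible.\<close>

lemma tangent_vector_char_setI:
  assumes xi: "\<xi> \<noteq> 0" "V X \<bullet> \<xi> = 0"
    and ab: "(a $ 1 * D1 (\<lambda>X. V X $ 1) X + a $ 2 * D2 (\<lambda>X. V X $ 1) X) * \<xi> $ 1 +
      (a $ 1 * D1 (\<lambda>X. V X $ 2) X + a $ 2 * D2 (\<lambda>X. V X $ 2) X) * \<xi> $ 2 + V X \<bullet> b = 0"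
  shows "(a, b) \<in> tangent_vectors (char_set p) (X, \<xi>)"
proof -
  define x where "x t = X + t *\<^sub>R a" for t
  define q where "q t = V (x t) $ 1 * (\<xi> $ 1 + t * b $ 1) + V (x t) $ 2 * (\<xi> $ 2 + t * b $ 2)" for t
  define r where "r t = q t / V (x t) $ 1" for t
  define k where "k t = (x t, pt (\<xi> $ 1 + t * b $ 1 - r t) (\<xi> $ 2 + t * b $ 2))" for t
  have x0: "x 0 = X" by (simp add: x_def)
  have xd: "(x has_vector_derivative a) (at 0)" unfolding x_def[abs_def] by (auto intro!: derivative_eq_intros)
  note Vx = has_derivative_field_comp[OF xd, unfolded x0]
  have q0: "q 0 = 0" using xi(2) by (simp add: q_def x0 inner_vec2)
  have qd: "(q has_real_derivative 0) (at 0)"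
    unfolding q_def[abs_def] using ab x0
    by (auto intro!: derivative_eq_intros Vx simp: inner_vec2 algebra_simps)
  have rd: "(r has_real_derivative 0) (at 0)"
    using DERIV_divide[OF qd Vx[of 1]] V1[of X] by (simp add: x0 q0 r_def[abs_def])
  have k2: "((\<lambda>t. pt (\<xi> $ 1 + t * b $ 1 - r t) (\<xi> $ 2 + t * b $ 2)) has_vector_derivative pt (b $ 1) (b $ 2)) (at 0)"
    by (rule has_vector_derivative_pt) (auto intro!: derivative_eq_intros rd)
  have kd: "(k has_vector_derivative (a, b)) (at 0)"
    unfolding k_def[abs_def] using has_vector_derivative_Pair[OF xd k2] by simp
  have k0: "k 0 = (X, \<xi>)" by (simp add: k_def r_def x0 q0)
  have "isCont (\<lambda>t. snd (k t)) 0"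
    using has_vector_derivative_continuous[OF kd] by (intro continuous_intros)
  then have "((\<lambda>t. snd (k t)) \<longlongrightarrow> \<xi>) (at 0)" using k0 by (simp add: isCont_def)
  then have "\<forall>\<^sub>F t in at 0. snd (k t) \<noteq> 0" by (rule tendsto_imp_eventually_ne) (rule xi(1))
  then have "\<forall>\<^sub>F t in at 0. k t \<in> char_set p"
  proof eventually_elim
    case (elim t)
    have "V (x t) \<bullet> snd (k t) = 0" using V1[of "x t"] by (simp add: k_def r_def inner_vec2 q_def field_simps)
    then show ?case using elim by (simp add: char_set_def k_def p)
  qed
  then show ?thesis using k0 kd by (auto simp: tangent_vectors_def)
qed

lemma tangent_vector_char_setD:
  assumes "(a, b) \<in> tangent_vectors (char_set p) (X, \<xi>)" and xi: "V X \<bullet> \<xi> = 0"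
  shows "(a $ 1 * D1 (\<lambda>X. V X $ 1) X + a $ 2 * D2 (\<lambda>X. V X $ 1) X) * \<xi> $ 1 +
      (a $ 1 * D1 (\<lambda>X. V X $ 2) X + a $ 2 * D2 (\<lambda>X. V X $ 2) X) * \<xi> $ 2 + V X \<bullet> b = 0"
    (is "?d = 0")
proof -
  obtain k where k: "k 0 = (X, \<xi>)" "\<forall>\<^sub>F t in at 0. k t \<in> char_set p" "(k has_vector_derivative (a, b)) (at 0)"
    using assms(1) unfolding tangent_vectors_def by blast
  have k1: "((\<lambda>t. fst (k t)) has_vector_derivative a) (at 0)" and k2: "((\<lambda>t. snd (k t)) has_vector_derivative b) (at 0)"
    using bounded_linear.has_vector_derivative[OF bounded_linear_fst k(3)]
      bounded_linear.has_vector_derivative[OF bounded_linear_snd k(3)] by simp_all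
  have k2i: "((\<lambda>t. snd (k t) $ i) has_real_derivative b $ i) (at 0)" for i
    using bounded_linear.has_vector_derivative[OF bounded_linear_vec_nth k2]
    by (simp add: has_real_derivative_iff_has_vector_derivative)
  note Vk = has_derivative_field_comp[OF k1]
  define q where "q t = V (fst (k t)) $ 1 * snd (k t) $ 1 + V (fst (k t)) $ 2 * snd (k t) $ 2" for t
  have "(q has_real_derivative ?d) (at 0)"
    unfolding q_def[abs_def]
    by (auto intro!: derivative_eq_intros Vk k2i simp: k(1) inner_vec2 algebra_simps)
  moreover have "(q has_real_derivative 0) (at 0)"
  proof -
    have "\<forall>\<^sub>F t in at 0. q t = 0"
      using k(2)
    proof eventually_elim
      case (elim t)
      then have "p (fst (k t), snd (k t)) = 0" by (auto simp: char_set_def)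
      then have "V (fst (k t)) \<bullet> snd (k t) = 0" by (simp only: p)
      then show ?case by (simp add: q_def inner_vec2)
    qed
    moreover have "q 0 = 0" using xi by (simp add: q_def k(1) inner_vec2)
    ultimately have "\<forall>\<^sub>F t in nhds 0. q t = 0" by (simp add: eventually_nhds_conv_at)
    from DERIV_cong_ev[OF refl this refl] show ?thesis by simp
  qed
  ultimately show ?thesis by (rule DERIV_unique)
qed

text \<open>Orthogonality to the tangent vector (0, (-V_2, V_1)) makes the horizontal velocity a
  multiple \<open>l\<close> of V. If \<open>l\<close> vanished, pairing with lifts of arbitrary
  \<open>a\<close> would annihilate the remaining component and hence the whole velocity. The factor
  \<open>l\<close> is then removed by a change of time.\<close>

lemma strip_projection:
  assumes I: "open_interval I" and s: "bichar_strip p I \<gamma>"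
  shows "(\<lambda>t. fst (\<gamma> t)) ` I \<in> integral_curves V"
proof -
  obtain \<gamma>' where c: "continuous_on I \<gamma>'" and d: "\<And>t. t \<in> I \<Longrightarrow> (\<gamma> has_vector_derivative \<gamma>' t) (at t)"
    and nz: "\<And>t. t \<in> I \<Longrightarrow> \<gamma>' t \<noteq> 0" and ch: "\<And>t. t \<in> I \<Longrightarrow> \<gamma> t \<in> char_set p"
    and sy: "\<And>t v. t \<in> I \<Longrightarrow> v \<in> tangent_vectors (char_set p) (\<gamma> t) \<Longrightarrow> symp (\<gamma>' t) v = 0"
    using s unfolding bichar_strip_def by blast
  define x where "x t = fst (\<gamma> t)" for t
  define l where "l t = fst (\<gamma>' t) $ 1 / V (x t) $ 1" for t
  have xd: "(x has_vector_derivative fst (\<gamma>' t)) (at t)" if "t \<in> I" for t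
    unfolding x_def[abs_def] by (rule bounded_linear.has_vector_derivative[OF bounded_linear_fst d[OF that]])
  have cVx: "continuous_on I (\<lambda>t. V (x t) $ 1)"
    by (rule DERIV_continuous_on) (rule has_field_derivative_at_within[OF has_derivative_field_comp[OF xd]])
  have key: "fst (\<gamma>' t) = l t *\<^sub>R V (x t) \<and> l t \<noteq> 0" if t: "t \<in> I" for t
  proof -
    define \<xi> where "\<xi> = snd (\<gamma> t)"
    define \<alpha> where "\<alpha> = fst (\<gamma>' t)"
    define \<beta> where "\<beta> = snd (\<gamma>' t)"
    have v1: "V (x t) $ 1 \<noteq> 0" using V1[of "x t"] by simp
    have g: "\<gamma> t = (x t, \<xi>)" "\<gamma>' t = (\<alpha>, \<beta>)" by (simp_all add: x_def \<xi>_def \<alpha>_def \<beta>_def)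
    have xi: "\<xi> \<noteq> 0" "V (x t) \<bullet> \<xi> = 0" using ch[OF t] by (auto simp: g char_set_def p)
    note tv = tangent_vector_char_setI[OF xi]
    have ab: "\<beta> \<bullet> a - b \<bullet> \<alpha> = 0" if "(a, b) \<in> tangent_vectors (char_set p) (x t, \<xi>)" for a b
      using sy[OF t, of "(a, b)"] that by (simp add: g symp_def)
    have "\<beta> \<bullet> 0 - pt (- (V (x t) $ 2)) (V (x t) $ 1) \<bullet> \<alpha> = 0" by (rule ab, rule tv) (simp add: inner_vec2)
    then have al: "\<alpha> = l t *\<^sub>R V (x t)" using v1 by (simp add: vec2_eq_iff l_def \<alpha>_def[symmetric] inner_vec2 field_simps)
    have "l t \<noteq> 0"
    proof
      assume "l t = 0"
      then have a0: "\<alpha> = 0" using al by simp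
      have "\<beta> \<bullet> a = 0" for a
      proof -
        define r where "r = (a $ 1 * D1 (\<lambda>X. V X $ 1) (x t) + a $ 2 * D2 (\<lambda>X. V X $ 1) (x t)) * \<xi> $ 1 +
          (a $ 1 * D1 (\<lambda>X. V X $ 2) (x t) + a $ 2 * D2 (\<lambda>X. V X $ 2) (x t)) * \<xi> $ 2"
        have "(a, pt (- r / V (x t) $ 1) 0) \<in> tangent_vectors (char_set p) (x t, \<xi>)"
          by (rule tv) (use v1 in \<open>simp add: inner_vec2 r_def[symmetric]\<close>)
        from ab[OF this] show ?thesis by (simp add: a0)
      qed
      then have "\<beta> = 0" using inner_eq_zero_iff by blast
      then show False using nz[OF t] a0 by (simp add: g zero_prod_def)
    qed
    then show ?thesis using al by (simp add: \<alpha>_def)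
  qed
  have "x ` I \<in> integral_curves V"
  proof (rule integral_curve_reparam[OF I])
    have "continuous_on I (\<lambda>t. fst (\<gamma>' t) $ 1)" by (intro continuous_intros c)
    moreover have "\<forall>t\<in>I. V (x t) $ 1 \<noteq> 0" using V1 by (simp add: less_imp_neq[symmetric])
    ultimately show "continuous_on I l" unfolding l_def[abs_def] by (rule continuous_on_divide[OF _ cVx])
    show "l t \<noteq> 0" if "t \<in> I" for t using key[OF that] by simp
    show "(x has_vector_derivative l t *\<^sub>R V (x t)) (at t)" if "t \<in> I" for t
      using xd[OF that] key[OF that] by simp
  qed
  then show ?thesis by (simp add: x_def[abs_def])
qed

text \<open>The conormal \<open>(-V\<^sub>2, V\<^sub>1)\<close> is transported to a bicharacteristic strip by the factor
  \<open>exp (- \<integral> div V)\<close>.\<close>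

lemma integral_curve_lift:
  assumes cDV: "\<And>i v. continuous_on UNIV (dirderiv v (\<lambda>X. V X $ i))"
    and I: "open_interval I" and x: "\<And>t. t \<in> I \<Longrightarrow> (x has_vector_derivative V (x t)) (at t)"
  shows "x ` I \<in> bicharacteristics p"
proof -
  have cx: "continuous_on I x"
    by (rule continuous_at_imp_continuous_on) (use has_vector_derivative_continuous[OF x] in blast)
  have cDx: "continuous_on I (\<lambda>t. dirderiv v (\<lambda>X. V X $ i) (x t))" for v i
    by (rule continuous_on_compose2[OF cDV cx]) simp
  note Vx = has_derivative_field_comp[OF x]
  have cVx: "continuous_on I (\<lambda>t. V (x t) $ i)" for i
    by (rule DERIV_continuous_on) (rule has_field_derivative_at_within[OF Vx])
  have "continuous_on I (\<lambda>t. D1 (\<lambda>X. V X $ 1) (x t) + D2 (\<lambda>X. V X $ 2) (x t))"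
    by (intro continuous_intros cDx)
  from open_interval_antiderivative[OF I this] obtain s where
    s: "\<And>t. t \<in> I \<Longrightarrow> (s has_real_derivative (D1 (\<lambda>X. V X $ 1) (x t) + D2 (\<lambda>X. V X $ 2) (x t))) (at t)" by blast
  have cs: "continuous_on I s"
    by (rule DERIV_continuous_on) (rule has_field_derivative_at_within[OF s])
  define \<gamma> where "\<gamma> t = (x t, pt (- (exp (- s t) * V (x t) $ 2)) (exp (- s t) * V (x t) $ 1))" for t
  \<comment> \<open>\<open>b i\<close> is minus the derivative of V . \<xi> in direction
    \<open>i\<close> at fixed \<xi>, so \<gamma> solves Hamilton's equations for V . \<xi>. The
    derivative of \<open>exp (- s)\<close> cancels precisely the surplus divergence terms.\<close>
  define b where "b i t = exp (- s t) * (V (x t) $ 2 * dirderiv i (\<lambda>X. V X $ 1) (x t) - V (x t) $ 1 * dirderiv i (\<lambda>X. V X $ 2) (x t))" for i t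
  define \<gamma>' where "\<gamma>' t = (V (x t), pt (b (pt 1 0) t) (b (pt 0 1) t))" for t
  have cV: "continuous_on I (\<lambda>t. V (x t))" using continuous_on_pt[OF cVx[of 1] cVx[of 2]] by simp
  have cb: "continuous_on I (b i)" for i unfolding b_def[abs_def] by (intro continuous_intros cs cVx cDx)
  have "continuous_on I \<gamma>'" unfolding \<gamma>'_def[abs_def] by (intro continuous_on_Pair cV continuous_on_pt cb)
  moreover have "(\<gamma> has_vector_derivative \<gamma>' t) (at t) \<and> \<gamma>' t \<noteq> 0 \<and> \<gamma> t \<in> char_set p \<and>
      (\<forall>v \<in> tangent_vectors (char_set p) (\<gamma> t). symp (\<gamma>' t) v = 0)" if t: "t \<in> I" for t
  proof (intro conjI ballI)
    have "((\<lambda>t. - (exp (- s t) * V (x t) $ 2)) has_real_derivative b (pt 1 0) t) (at t)"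
      "((\<lambda>t. exp (- s t) * V (x t) $ 1) has_real_derivative b (pt 0 1) t) (at t)"
      by (auto intro!: derivative_eq_intros s[OF t] Vx[OF t] simp: b_def algebra_simps)
    then show "(\<gamma> has_vector_derivative \<gamma>' t) (at t)"
      unfolding \<gamma>_def[abs_def] \<gamma>'_def by (intro has_vector_derivative_Pair x[OF t] has_vector_derivative_pt)
    show "\<gamma>' t \<noteq> 0" using V1[of "x t"] by (auto simp: \<gamma>'_def zero_prod_def vec2_eq_iff)
    have orth: "V (x t) \<bullet> snd (\<gamma> t) = 0" by (simp add: \<gamma>_def inner_vec2)
    then show "\<gamma> t \<in> char_set p"
      using V1[of "x t"] by (auto simp: \<gamma>_def char_set_def p vec2_eq_iff)
    show "symp (\<gamma>' t) v = 0" if v: "v \<in> tangent_vectors (char_set p) (\<gamma> t)" for v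
    proof -
      have "(fst v, snd v) \<in> tangent_vectors (char_set p) (x t, snd (\<gamma> t))" using v by (simp add: \<gamma>_def)
      from tangent_vector_char_setD[OF this orth] show ?thesis
        by (simp add: symp_def \<gamma>_def \<gamma>'_def b_def inner_vec2 algebra_simps)
    qed
  qed
  ultimately have "bichar_strip p I \<gamma>" unfolding bichar_strip_def by blast
  moreover have "x ` I = (\<lambda>t. fst (\<gamma> t)) ` I" by (simp add: \<gamma>_def)
  ultimately show ?thesis using I unfolding bicharacteristics_def by blast
qed

lemma bicharacteristics_eq_integral_curves:
  assumes "\<And>i v. continuous_on UNIV (dirderiv v (\<lambda>X. V X $ i))"
  shows "bicharacteristics p = integral_curves V"
proof (intro equalityI subsetI)
  fix L assume "L \<in> bicharacteristics p"
  then show "L \<in> integral_curves V" using strip_projection by (auto simp: bicharacteristics_def)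
next
  fix L assume "L \<in> integral_curves V"
  then show "L \<in> bicharacteristics p" using integral_curve_lift[OF assms] by (auto simp: integral_curves_def)
qed

end


section \<open>Plane waves and the principal symbol\<close>

lemma Re_expwave_deriv:
  shows "dirderiv e (\<lambda>X. Re (c * expwave L X)) = (\<lambda>X. Re ((c * \<i> * of_real (L \<bullet> e)) * expwave L X))"
    and "(\<lambda>X. Re (c * expwave L X)) differentiable (at X)"
    and expwave_deriv: "dirderiv e (expwave L) X = \<i> * of_real (L \<bullet> e) * expwave L X"
    and expwave_diff: "expwave L differentiable (at X)"
proof -
  have ew: "(expwave L has_derivative (\<lambda>v. \<i> * of_real (L \<bullet> v) * expwave L X)) (at X)" for X
  proof -
    have "((\<lambda>X. \<i> * complex_of_real (L \<bullet> X)) has_derivative (\<lambda>v. \<i> * of_real (L \<bullet> v))) (at X)"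
      by (intro has_derivative_mult_right has_derivative_of_real has_derivative_inner_right has_derivative_ident)
    from has_derivative_compose[OF this DERIV_exp[unfolded has_field_derivative_def]]
    show ?thesis by (simp add: expwave_def[abs_def] cis_conv_exp mult_ac)
  qed
  show "dirderiv e (expwave L) X = \<i> * of_real (L \<bullet> e) * expwave L X" by (rule dirderiv_eqI[OF ew])
  show "expwave L differentiable (at X)" using ew by (auto simp: differentiable_def)
  have "((\<lambda>X. Re (c * expwave L X)) has_derivative (\<lambda>v. Re (c * (\<i> * of_real (L \<bullet> v) * expwave L X)))) (at X)" for X
    by (rule bounded_linear.has_derivative[OF bounded_linear_Re has_derivative_mult_right[OF ew]])
  then show "dirderiv e (\<lambda>X. Re (c * expwave L X)) = (\<lambda>X. Re ((c * \<i> * of_real (L \<bullet> e)) * expwave L X))"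
    "(\<lambda>X. Re (c * expwave L X)) differentiable (at X)"
    using dirderiv_eqI by (fastforce simp: fun_eq_iff mult.assoc, auto simp: differentiable_def)
qed

lemma cmod_cis_diff: "cmod (cis a - cis b) \<le> 2 * \<bar>a - b\<bar>"
proof -
  have "norm (cos a - cos b) \<le> 1 * norm (a - b)"
    by (rule field_differentiable_bound[where S = UNIV and f = cos and f' = "\<lambda>x. - sin x"])
      (auto intro!: derivative_eq_intros)
  moreover have "norm (sin a - sin b) \<le> 1 * norm (a - b)"
    by (rule field_differentiable_bound[where S = UNIV and f = sin and f' = cos])
      (auto intro!: derivative_eq_intros)
  moreover have "cmod (cis a - cis b) \<le> \<bar>cos a - cos b\<bar> + \<bar>sin a - sin b\<bar>"
    using cmod_le[of "cis a - cis b"] by simp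
  ultimately show ?thesis by simp
qed

context dn_problem
begin

text \<open>The barrier bounds the real part of a multiple \<open>c\<close> of \<phi> from one side;
  c = 1, -1, \<i>, -\<i> give both sides for the real and imaginary parts,
  \<open>3 * \<kappa>\<close> each. The added 1 in \<open>norm L + 1\<close> keeps
  \<open>N \<ge> 1\<close> for low frequencies.\<close>

lemma boundary_distance:
  assumes bdry: "\<And>X. \<phi> (X, \<eta> X) = expwave L X" and s: "s \<le> \<eta> X"
  shows "cmod (\<phi> (X, s) - expwave L X) \<le> 6 * ((6 * E + 3) * (norm L + 1)) * (\<eta> X - s)"
proof -
  define N where "N = norm L + 1"
  define \<kappa> where "\<kappa> = (6 * E + 3) * N"
  define z where "z = \<phi> (X, s) - expwave L X"
  have N: "1 \<le> N" by (simp add: N_def)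
  have kpos: "0 \<le> \<kappa>" using E N by (simp add: \<kappa>_def)
  have one: "Re (c * z) \<le> 3 * \<kappa> * (\<eta> X - s)" if c: "cmod c = 1" for c
  proof -
    define u where "u Y = Re (c * expwave L Y)" for Y
    have ub: "\<bar>Re (d * expwave L Y)\<bar> \<le> cmod d" for d Y
      using abs_Re_le_cmod[of "d * expwave L Y"] by (simp add: norm_mult)
    have Le: "\<bar>L \<bullet> e\<bar> \<le> N" if "e \<in> Basis" for e using Basis_le_norm[OF that, of L] by (simp add: N_def)
    have "Re (c * \<phi> (X, s)) \<le> 2 - exp (\<kappa> * (s - \<eta> X)) * (2 - u X)"
    proof (rule barrier[where N = N])
      show "u Y = Re (c * \<phi> (Y, \<eta> Y))" for Y by (simp only: u_def bdry)
      show "\<bar>u Y\<bar> \<le> 1" for Y using ub[of c Y] c by (simp only: u_def)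
      show "u differentiable (at Y)" "dirderiv e u differentiable (at Y)" for e Y
        unfolding u_def[abs_def] Re_expwave_deriv(1) by (rule Re_expwave_deriv)+
      show "\<bar>dirderiv e u Y\<bar> \<le> N" if "e \<in> Basis" for e Y
        unfolding u_def[abs_def] Re_expwave_deriv(1)
        by (rule order_trans[OF ub]) (use c Le[OF that] in \<open>simp add: norm_mult\<close>)
      show "\<bar>dirderiv e (dirderiv e u) Y\<bar> \<le> N^2" if "e \<in> Basis" for e Y
      proof -
        have "\<bar>L \<bullet> e\<bar> * \<bar>L \<bullet> e\<bar> \<le> N * N" using Le[OF that] N by (intro mult_mono) auto
        then show ?thesis unfolding u_def[abs_def] Re_expwave_deriv(1)
          by (intro order_trans[OF ub]) (use c in \<open>simp add: norm_mult power2_eq_square\<close>)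
      qed
    qed (use N s \<kappa>_def in auto)
    moreover have "(1 - exp (\<kappa> * (s - \<eta> X))) * (2 - u X) \<le> (\<kappa> * (\<eta> X - s)) * 3"
    proof (intro mult_mono)
      have "1 + \<kappa> * (s - \<eta> X) \<le> exp (\<kappa> * (s - \<eta> X))" by (rule exp_ge_add_one_self)
      then show "1 - exp (\<kappa> * (s - \<eta> X)) \<le> \<kappa> * (\<eta> X - s)" by (simp add: algebra_simps)
      show "0 \<le> \<kappa> * (\<eta> X - s)" using kpos s by simp
      have "\<bar>u X\<bar> \<le> 1" using ub[of c X] c by (simp only: u_def)
      then show "2 - u X \<le> 3" "0 \<le> 2 - u X" by auto
    qed
    moreover have "Re (c * z) = Re (c * \<phi> (X, s)) - u X" by (simp only: z_def u_def right_diff_distrib minus_complex.sel)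
    ultimately show ?thesis by (simp add: algebra_simps)
  qed
  have "\<bar>Re z\<bar> \<le> 3 * \<kappa> * (\<eta> X - s)" "\<bar>Im z\<bar> \<le> 3 * \<kappa> * (\<eta> X - s)"
    using one[of 1] one[of "- 1"] one[of "\<i>"] one[of "- \<i>"] by (simp_all add: abs_le_iff)
  then have "cmod z \<le> 6 * \<kappa> * (\<eta> X - s)" using cmod_le[of z] by linarith
  then show ?thesis by (simp only: z_def \<kappa>_def N_def)
qed

text \<open>The flux is known only as a limit from inside. The derivative of \<phi> along the inward
  direction \<nu> = (grad \<eta>, -1) is minus the flux, hence close to \<open>- g\<close> on a
  short segment; the increment of \<phi> over the segment is of order \<open>N * t\<close> by
  \<open>boundary_distance\<close>.\<close>

lemma normal_derivative_bound:
  assumes bdry: "\<And>X. \<phi> (X, \<eta> X) = expwave L X"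
    and trace: "((\<lambda>x. dirderiv (0, 1) \<phi> x - (grad \<eta> X $ 1 *\<^sub>R dirderiv (pt 1 0, 0) \<phi> x
           + grad \<eta> X $ 2 *\<^sub>R dirderiv (pt 0 1, 0) \<phi> x)) \<longlongrightarrow> g) (at (X, \<eta> X) within fluid_domain \<eta>)"
  shows "cmod g \<le> (6 * (6 * E + 3) * (2 * E^2 + 2) + 4 * E + 1) * (norm L + 1)"
proof -
  define N where "N = norm L + 1"
  define \<kappa> where "\<kappa> = (6 * E + 3) * N"
  have N: "1 \<le> N" by (simp add: N_def)
  have kpos: "0 \<le> \<kappa>" using E N by (simp add: \<kappa>_def)
  define v where "v = grad \<eta> X"
  define x0 where "x0 = (X, \<eta> X)"
  define \<nu> where "\<nu> = (v, - 1 :: real)"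
  define h where "h t = \<eta> (X + t *\<^sub>R v)" for t
  define D where "D = v $ 1 * v $ 1 + v $ 2 * v $ 2"
  have vb: "\<bar>v $ 1\<bar> \<le> E" "\<bar>v $ 2\<bar> \<le> E" using eta_b[of _ X] by (auto simp: v_def grad_def Basis_vec2)
  have D: "0 \<le> D" "D \<le> 2 * E^2"
  proof -
    show "0 \<le> D" by (simp add: D_def)
    have "\<bar>v $ 1\<bar> * \<bar>v $ 1\<bar> \<le> E * E" "\<bar>v $ 2\<bar> * \<bar>v $ 2\<bar> \<le> E * E" using vb E by (intro mult_mono; simp)+
    then show "D \<le> 2 * E^2" by (simp add: D_def power2_eq_square)
  qed
  have "(h has_real_derivative D) (at 0)"
    using has_real_derivative_line[OF eta_d, where e = v and t = 0 and x = X] dirderiv_linear[OF eta_d, where v = v and x = X]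
    by (simp add: h_def[abs_def] D_def v_def grad_def)
  then have "((\<lambda>t. (h t - h 0) / t) \<longlongrightarrow> D) (at 0)" by (simp add: has_field_derivative_iff)
  \<comment> \<open>With accuracy 1/2 the surface sinks by less than \<open>t\<close> along the
    segment, which keeps the segment in the fluid, and rises by at most
    \<open>(D + 1 / 2) * t\<close>; the descent by \<open>t\<close> gives the depth
    \<open>(D + 3 / 2) * t\<close> used below.\<close>
  from tendstoD[OF this, of "1 / 2"] obtain d1 where d1: "0 < d1" "\<And>t. t \<noteq> 0 \<Longrightarrow> \<bar>t\<bar> < d1 \<Longrightarrow> \<bar>(h t - h 0) / t - D\<bar> < 1 / 2"
    by (auto simp: eventually_at dist_real_def)
  have hb: "- t < h t - h 0" "h t - h 0 \<le> (D + 1 / 2) * t" if "0 < t" "t < d1" for t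
  proof -
    have "\<bar>(h t - h 0) / t - D\<bar> < 1 / 2" using d1(2)[of t] that by simp
    then have "D - 1 / 2 < (h t - h 0) / t" "(h t - h 0) / t < D + 1 / 2" by linarith+
    then have "(D - 1 / 2) * t < h t - h 0" "h t - h 0 < (D + 1 / 2) * t" using that by (simp_all add: field_simps)
    moreover have "- 1 * t \<le> (D - 1 / 2) * t" using D(1) that by (intro mult_right_mono) auto
    ultimately show "- t < h t - h 0" "h t - h 0 \<le> (D + 1 / 2) * t" by simp_all
  qed
  have h0: "h 0 = \<eta> X" by (simp add: h_def)
  have pt_eq: "x0 + t *\<^sub>R \<nu> = (X + t *\<^sub>R v, \<eta> X - t)" for t by (simp add: x0_def \<nu>_def)
  have dom: "x0 + t *\<^sub>R \<nu> \<in> fluid_domain \<eta>" if "0 < t" "t < d1" for t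
    using hb(1)[OF that] h0 by (simp add: pt_eq fluid_domain_def h_def)
  have flux: "dirderiv \<nu> \<phi> x = - (dirderiv (0, 1) \<phi> x - (v $ 1 *\<^sub>R dirderiv (pt 1 0, 0) \<phi> x + v $ 2 *\<^sub>R dirderiv (pt 0 1, 0) \<phi> x))"
    if x: "x \<in> fluid_domain \<eta>" for x
  proof -
    have lin: "linear (\<lambda>v. dirderiv v \<phi> x)" by (rule has_derivative_linear[OF has_derivative_dirderiv[OF phi_d[OF x]]])
    have "\<nu> = v $ 1 *\<^sub>R (pt 1 0, 0) + v $ 2 *\<^sub>R (pt 0 1, 0) - (0, 1)" by (simp add: \<nu>_def vec2_eq_iff)
    then show ?thesis by (simp only: linear_add[OF lin] linear_diff[OF lin] linear_scale[OF lin]) simp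
  qed
  from tendstoD[OF trace, of 1] obtain d2 where d2: "0 < d2" "\<And>x. x \<in> fluid_domain \<eta> \<Longrightarrow> x \<noteq> x0 \<Longrightarrow> dist x x0 < d2 \<Longrightarrow>
      dist (dirderiv (0, 1) \<phi> x - (v $ 1 *\<^sub>R dirderiv (pt 1 0, 0) \<phi> x + v $ 2 *\<^sub>R dirderiv (pt 0 1, 0) \<phi> x)) g < 1"
    unfolding eventually_at v_def x0_def by auto
  define q where "q = d2 / (norm \<nu> + 1)"
  define t where "t = min d1 q / 2"
  have nu1: "0 < norm \<nu> + 1" by (simp add: add_nonneg_pos)
  have t: "0 < t" "t < d1" "t * (norm \<nu> + 1) < d2"
  proof -
    have q: "0 < q" using d2(1) nu1 by (simp add: q_def)
    show "0 < t" unfolding t_def using d1(1) q by (simp add: min_def)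
    show "t < d1" unfolding t_def using d1(1) q by (simp add: min_def)
    have "t < q" unfolding t_def using d1(1) q by (simp add: min_def)
    then show "t * (norm \<nu> + 1) < d2" using nu1 unfolding q_def by (simp add: less_divide_eq)
  qed
  have flux_near: "cmod (dirderiv \<nu> \<phi> (x0 + r *\<^sub>R \<nu>) + g) < 1" if r: "0 < r" "r \<le> t" for r
  proof -
    have "r < d1" using r t by simp
    note x = dom[OF r(1) this]
    have "x0 \<notin> fluid_domain \<eta>" by (simp add: x0_def fluid_domain_def)
    then have "x0 + r *\<^sub>R \<nu> \<noteq> x0" using x by metis
    moreover have "dist (x0 + r *\<^sub>R \<nu>) x0 < d2"
    proof -
      have "dist (x0 + r *\<^sub>R \<nu>) x0 = r * norm \<nu>" using r by (simp add: dist_norm)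
      also have "\<dots> \<le> t * (norm \<nu> + 1)" using r t by (intro mult_mono) auto
      finally show ?thesis using t by simp
    qed
    ultimately have "dist (- dirderiv \<nu> \<phi> (x0 + r *\<^sub>R \<nu>)) g < 1" using d2(2)[OF x] unfolding flux[OF x] by simp
    then show ?thesis by (simp add: dist_norm norm_minus_commute[of _ g] add.commute)
  qed
  \<comment> \<open>The term \<open>r *\<^sub>R g\<close> compensates the expected derivative, so
    the derivative of \<open>G\<close> has norm below 1 and \<open>G\<close> changes by at most
    \<open>t\<close>.\<close>
  define G where "G r = \<phi> (x0 + r *\<^sub>R \<nu>) + r *\<^sub>R g" for r
  have "continuous_on {0..t} G"
  proof -
    have "x0 + r *\<^sub>R \<nu> \<in> {(X, s). s \<le> \<eta> X}" if "r \<in> {0..t}" for r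
    proof (cases "r = 0")
      case False
      then have "x0 + r *\<^sub>R \<nu> \<in> fluid_domain \<eta>" using that t by (intro dom) auto
      then show ?thesis by (auto simp: fluid_domain_def)
    qed (simp add: x0_def)
    then have sub: "(\<lambda>r. x0 + r *\<^sub>R \<nu>) ` {0..t} \<subseteq> {(X, s). s \<le> \<eta> X}" by (rule image_subsetI)
    have "continuous_on {0..t} (\<lambda>r. x0 + r *\<^sub>R \<nu>)" by (intro continuous_intros)
    from continuous_on_compose2[OF phi_cont this sub] have "continuous_on {0..t} (\<lambda>r. \<phi> (x0 + r *\<^sub>R \<nu>))" .
    then show ?thesis unfolding G_def[abs_def] by (intro continuous_intros)
  qed
  moreover have "(G has_derivative (\<lambda>k. k *\<^sub>R (dirderiv \<nu> \<phi> (x0 + r *\<^sub>R \<nu>) + g))) (at r)" if r: "0 < r" "r < t" for r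
  proof -
    have "r < d1" using r t by simp
    from has_vector_derivative_add[OF has_vector_derivative_line[OF phi_d[OF dom[OF r(1) this]]]
        has_vector_derivative_scaleR[OF DERIV_ident has_vector_derivative_const[of g]]]
    show ?thesis by (simp add: G_def[abs_def] has_vector_derivative_def)
  qed
  ultimately obtain r where r: "0 < r" "r < t" "norm (G t - G 0) \<le> norm ((t - 0) *\<^sub>R (dirderiv \<nu> \<phi> (x0 + r *\<^sub>R \<nu>) + g))"
    using mvt_general[OF t(1), of G "\<lambda>r k. k *\<^sub>R (dirderiv \<nu> \<phi> (x0 + r *\<^sub>R \<nu>) + g)"] by auto
  have "t * cmod (dirderiv \<nu> \<phi> (x0 + r *\<^sub>R \<nu>) + g) \<le> t * 1"
    using flux_near[of r] r t(1) by (intro mult_left_mono) auto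
  moreover have "norm (G t - G 0) \<le> t * cmod (dirderiv \<nu> \<phi> (x0 + r *\<^sub>R \<nu>) + g)" using r(3) t(1) by simp
  ultimately have "norm (G t - G 0) \<le> t" by linarith
  moreover have "G t - G 0 = (\<phi> (x0 + t *\<^sub>R \<nu>) - expwave L X) + t *\<^sub>R g"
    using bdry[of X] by (simp add: G_def x0_def)
  ultimately have "norm (t *\<^sub>R g) \<le> t + cmod (\<phi> (x0 + t *\<^sub>R \<nu>) - expwave L X)"
    using norm_triangle_ineq4[of "(\<phi> (x0 + t *\<^sub>R \<nu>) - expwave L X) + t *\<^sub>R g" "\<phi> (x0 + t *\<^sub>R \<nu>) - expwave L X"] by simp
  also have "cmod (\<phi> (x0 + t *\<^sub>R \<nu>) - expwave L X) \<le> 6 * \<kappa> * ((D + 3 / 2) * t) + 4 * E * N * t"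
  proof -
    have le: "\<eta> X - t \<le> \<eta> (X + t *\<^sub>R v)" "\<eta> (X + t *\<^sub>R v) - (\<eta> X - t) \<le> (D + 3 / 2) * t"
      using hb[OF t(1,2)] h0 by (simp_all add: h_def algebra_simps)
    have "cmod (\<phi> (x0 + t *\<^sub>R \<nu>) - expwave L (X + t *\<^sub>R v)) \<le> 6 * \<kappa> * (\<eta> (X + t *\<^sub>R v) - (\<eta> X - t))"
      unfolding pt_eq \<kappa>_def N_def by (rule boundary_distance[OF bdry le(1)])
    also have "\<dots> \<le> 6 * \<kappa> * ((D + 3 / 2) * t)" using le(2) kpos by (intro mult_left_mono) auto
    finally have 1: "cmod (\<phi> (x0 + t *\<^sub>R \<nu>) - expwave L (X + t *\<^sub>R v)) \<le> 6 * \<kappa> * ((D + 3 / 2) * t)" .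
    have "cmod (expwave L (X + t *\<^sub>R v) - expwave L X) \<le> 2 * \<bar>L \<bullet> (X + t *\<^sub>R v) - L \<bullet> X\<bar>"
      unfolding expwave_def by (rule cmod_cis_diff)
    also have "\<dots> = 2 * (t * \<bar>L \<bullet> v\<bar>)" using t(1) by (simp add: inner_add_right abs_mult)
    also have "\<dots> \<le> 2 * (t * (N * (2 * E)))"
    proof -
      have "\<bar>L \<bullet> v\<bar> \<le> norm L * norm v" by (rule Cauchy_Schwarz_ineq2)
      also have "\<dots> \<le> N * (2 * E)"
      proof (intro mult_mono)
        have "norm v \<le> \<bar>v $ 1\<bar> + \<bar>v $ 2\<bar>" using norm_le_l1_cart[of v] by (simp add: sum_2)
        then show "norm v \<le> 2 * E" using vb by simp
      qed (use E in \<open>auto simp: N_def\<close>)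
      finally show ?thesis using t(1) by (intro mult_left_mono) auto
    qed
    finally have 2: "cmod (expwave L (X + t *\<^sub>R v) - expwave L X) \<le> 4 * E * N * t" by (simp add: mult_ac)
    show ?thesis
      using norm_triangle_ineq[of "\<phi> (x0 + t *\<^sub>R \<nu>) - expwave L (X + t *\<^sub>R v)" "expwave L (X + t *\<^sub>R v) - expwave L X"] 1 2 by simp
  qed
  finally have "t * cmod g \<le> t * (1 + 6 * \<kappa> * (D + 3 / 2) + 4 * E * N)" using t(1) by (simp add: algebra_simps)
  then have "cmod g \<le> 1 + 6 * \<kappa> * (D + 3 / 2) + 4 * E * N" using t(1) by simp
  also have "\<dots> \<le> N + 6 * \<kappa> * (2 * E^2 + 2) + 4 * E * N"
    using D(2) kpos N E by (intro add_mono mult_left_mono) auto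
  also have "\<dots> = (6 * (6 * E + 3) * (2 * E^2 + 2) + 4 * E + 1) * N" by (simp add: \<kappa>_def algebra_simps)
  finally show ?thesis by (simp only: N_def)
qed

end

lemma DN_expwave_bound:
  assumes t: "0 < \<tau>" and a: "admissible \<tau> \<mu> U"
  shows "\<exists>C\<ge>0. \<forall>L g X. is_DN \<tau> (snd U) (expwave L) g \<longrightarrow> cmod (g X) \<le> C * (norm L + 1)"
proof -
  obtain E where E: "\<And>e. e \<in> Basis \<Longrightarrow> SS 1 0 E (dirderiv e (snd U))"
    and eta: "periodic \<tau> (snd U)" "\<And>X. snd U differentiable (at X)" using a unfolding admissible_def by blast
  have B1: "pt 1 0 \<in> Basis" by (simp add: Basis_vec2)
  have E0: "0 \<le> E" by (rule SSD(4)[OF E[OF B1]])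
  define C where "C = 6 * (6 * E + 3) * (2 * E^2 + 2) + 4 * E + 1"
  have "cmod (g X) \<le> C * (norm L + 1)" if dn: "is_DN \<tau> (snd U) (expwave L) g" for L g X
  proof -
    obtain \<phi> :: "(real^2) \<times> real \<Rightarrow> complex" where
      per: "\<forall>X s. \<forall>p \<in> period_lattice \<tau>. s \<le> snd U X \<longrightarrow> \<phi> (X + p, s) = \<phi> (X, s)" and
      C2: "Ck_on 2 (fluid_domain (snd U)) \<phi>" and
      har: "\<forall>x \<in> fluid_domain (snd U). (\<Sum>e\<in>Basis. dirderiv e (dirderiv e \<phi>) x) = 0" and
      co: "continuous_on {(X, s). s \<le> snd U X} \<phi>" and
      bd: "\<forall>X. \<phi> (X, snd U X) = expwave L X" and
      dec: "\<forall>v. (dirderiv v \<phi> \<longlongrightarrow> 0) (filtercomap snd at_bot)" and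
      tr: "\<forall>X. ((\<lambda>x. dirderiv (0, 1) \<phi> x
                  - (grad (snd U) X $ 1 *\<^sub>R dirderiv (pt 1 0, 0) \<phi> x
                     + grad (snd U) X $ 2 *\<^sub>R dirderiv (pt 0 1, 0) \<phi> x))
             \<longlongrightarrow> g X) (at (X, snd U X) within fluid_domain (snd U))"
      using dn unfolding is_DN_def by blast
    interpret dn_problem \<tau> E "snd U" \<phi>
    proof
      show "\<bar>dirderiv e (dirderiv e (snd U)) X\<bar> \<le> E" if "e \<in> Basis" for e X
        using Qb_bound[OF SSD(3)[OF E[OF that] that]] .
    qed (use t E0 eta SSD(1,2)[OF E] per C2 har co dec in auto)
    show ?thesis unfolding C_def by (rule normal_derivative_bound[of L X "g X"]) (use bd tr in auto)
  qed
  moreover have "0 \<le> C" using E0 by (simp add: C_def)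
  ultimately show ?thesis by blast
qed

text \<open>Integrability of the flux \<open>g\<close> is not known. A non-integrable function has
  integral 0 by convention, and the bound holds for it as well.\<close>

lemma torus_mean_bound:
  fixes h :: "real^2 \<Rightarrow> 'b::banach"
  assumes t: "0 < \<tau>" and B: "0 \<le> B" "\<And>X. norm (h X) \<le> B"
  shows "norm (torus_mean \<tau> h) \<le> B"
proof (cases "h integrable_on cell \<tau>")
  case True
  have c: "measure lborel (cell \<tau>) = (2 * pi) * (2 * pi / \<tau>)"
    using t content_cbox_vec2[of 0 "2 * pi" 0 "2 * pi / \<tau>"] by (simp del: pt_arith(7))
  have "norm (integral (cell \<tau>) h) \<le> B * measure lborel (cell \<tau>)"
    by (rule integrable_bound[OF B(1) True]) (rule B(2))
  from mult_left_mono[OF this, of "\<tau> / (4 * pi^2)"]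
  have "norm (torus_mean \<tau> h) \<le> \<tau> / (4 * pi^2) * (B * ((2 * pi) * (2 * pi / \<tau>)))"
    using t unfolding c torus_mean_def norm_scaleR by (simp del: pt_arith(7) times_divide_eq_right times_divide_eq_left)
  also have "\<dots> = B" using t by (simp add: power2_eq_square)
  finally show ?thesis .
next
  case False
  then show ?thesis using B(1) by (simp add: torus_mean_def not_integrable_integral)
qed

definition symbol :: "real \<Rightarrow> (real^2 \<Rightarrow> real) \<times> (real^2 \<Rightarrow> real) \<Rightarrow> (real^2) \<times> (real^2) \<Rightarrow> complex" where
  "symbol \<mu> U = (\<lambda>(X, \<xi>). complex_of_real (- ((Vfield U X \<bullet> \<xi>)^2 / acoef \<mu> U X)))"

text \<open>With the adjoint acting on the test function the exponentials cancel, and the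
  second-order part becomes exactly \<open>n^2 * m2 + \<i> * n * m1\<close>. The Dirichlet-Neumann
  part grows linearly in \<open>n\<close>, so division by \<open>n^2\<close> leaves
  \<open>- m2\<close> alone.\<close>

lemma principal_symbol_lin_op:
  assumes t: "0 < \<tau>" and mu: "0 < \<mu>" and a: "admissible \<tau> \<mu> U"
  shows "principal_symbol \<tau> 2 (lin_op \<tau> \<mu> U) (symbol \<mu> U)"
proof -
  let ?V = "Vfield U" and ?a = "acoef \<mu> U"
  have Vd: "\<And>i X. (\<lambda>X. ?V X $ i) differentiable (at X)" and ca: "continuous_on UNIV ?a"
    and apos: "\<And>X. \<mu> / 2 \<le> ?a X" and pV: "periodic \<tau> ?V" and pa: "periodic \<tau> ?a"
    using a unfolding admissible_def by blast+
  have a0: "?a X \<noteq> 0" for X using apos[of X] mu by auto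
  have cVi: "continuous_on UNIV (\<lambda>X. ?V X $ i)" for i by (rule differentiable_continuous_UNIV[OF Vd])
  have cV: "continuous_on UNIV ?V" using continuous_on_pt[OF cVi[of 1] cVi[of 2]] by simp
  have fst: "continuous_on UNIV (\<lambda>p :: (real^2) \<times> (real^2). h (fst p))" if "continuous_on UNIV h" for h :: "real^2 \<Rightarrow> 'c::topological_space"
    by (rule continuous_on_compose2[OF that]) (auto intro!: continuous_intros)
  have cp: "continuous_on UNIV (symbol \<mu> U)"
    unfolding symbol_def case_prod_unfold by (intro continuous_intros fst cV ca) (simp add: a0)
  have pp: "periodic \<tau> (\<lambda>X. symbol \<mu> U (X, \<xi>))" for \<xi>
    using pV pa by (simp add: periodic_def symbol_def)
  have hom: "symbol \<mu> U (X, r *\<^sub>R \<xi>) = r^2 *\<^sub>R symbol \<mu> U (X, \<xi>)" for X \<xi> and r :: real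
    unfolding symbol_def case_prod_conv inner_scaleR_right power_mult_distrib by (simp add: scaleR_conv_of_real)
  obtain C where C: "0 \<le> C" "\<And>L g X. is_DN \<tau> (snd U) (expwave L) g \<Longrightarrow> cmod (g X) \<le> C * (norm L + 1)"
    using DN_expwave_bound[OF t a] by blast
  have lim: "(\<lambda>n. T n (\<lambda>X. expwave (- (real n *\<^sub>R K)) X * w X) / of_nat n ^ 2) \<longlonglongrightarrow> distr_of \<tau> (\<lambda>X. symbol \<mu> U (X, K)) w"
    if K: "K \<in> wave_lattice \<tau>" and T: "\<And>n. lin_op \<tau> \<mu> U (expwave (real n *\<^sub>R K)) (T n)"
      and w: "periodic \<tau> w" "\<And>j. Ck j w" for K T w
  proof -
    have wd: "w differentiable (at X)" and cw: "continuous_on UNIV w" and cDw: "continuous_on UNIV (dirderiv v w)" for X v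
      using w(2)[of 1] w(2)[of 0] by (simp_all add: One_nat_def)
    obtain Mw where Mw: "0 \<le> Mw" "\<And>X. cmod (w X) \<le> Mw"
    proof (rule periodic_bounded[OF t cw w(1)])
      fix M assume "0 \<le> M" "\<And>X. cmod (w X) \<le> M"
      then show thesis by (rule that)
    qed
    obtain g where dn: "\<And>n. is_DN \<tau> (snd U) (expwave (real n *\<^sub>R K)) (g n)"
      and T_eq: "\<And>n. T n = (\<lambda>w. distr_of \<tau> (g n) w
               - Jadj \<tau> ?V (\<lambda>X. (1 / ?a X) *\<^sub>R Jop ?V (expwave (real n *\<^sub>R K)) X) w)"
    proof -
      have "\<forall>n. \<exists>g. is_DN \<tau> (snd U) (expwave (real n *\<^sub>R K)) g \<and> T n = (\<lambda>w. distr_of \<tau> g w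
          - Jadj \<tau> ?V (\<lambda>X. (1 / ?a X) *\<^sub>R Jop ?V (expwave (real n *\<^sub>R K)) X) w)"
        using T unfolding lin_op_def by (rule allI)
      from choice[OF this] show thesis using that by (elim exE) blast
    qed
    let ?Jw = "Jop ?V w"
    define m2 where "m2 = torus_mean \<tau> (\<lambda>X. complex_of_real ((?V X \<bullet> K)^2 / ?a X) * w X)"
    define m1 where "m1 = torus_mean \<tau> (\<lambda>X. complex_of_real ((?V X \<bullet> K) / ?a X) * ?Jw X)"
    define d where "d n = distr_of \<tau> (g n) (\<lambda>X. expwave (- (real n *\<^sub>R K)) X * w X)" for n
    have cJ: "continuous_on UNIV ?Jw" unfolding Jop_def[abs_def] by (intro continuous_intros cVi cDw)
    have c2: "continuous_on UNIV (\<lambda>X. complex_of_real ((?V X \<bullet> K)^2 / ?a X) * w X)"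
      and c1: "continuous_on UNIV (\<lambda>X. complex_of_real ((?V X \<bullet> K) / ?a X) * ?Jw X)"
      by (intro continuous_intros cV ca cw cJ; simp add: a0)+
    have J1: "Jop ?V (expwave L) X = \<i> * of_real (?V X \<bullet> L) * expwave L X" for L X
      by (simp add: Jop_def expwave_deriv inner_vec2 scaleR_conv_of_real algebra_simps)
    have J2: "Jop ?V (\<lambda>X. expwave L X * w X) X = expwave L X * (\<i> * of_real (?V X \<bullet> L) * w X + ?Jw X)" for L X
    proof -
      have "dirderiv v (\<lambda>X. expwave L X * w X) X = expwave L X * dirderiv v w X + dirderiv v (expwave L) X * w X" for v
        by (rule dirderiv_eqI[OF has_derivative_mult[OF has_derivative_dirderiv[OF expwave_diff] has_derivative_dirderiv[OF wd]]])
      then show ?thesis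
        by (simp add: Jop_def expwave_deriv inner_vec2 scaleR_conv_of_real algebra_simps)
    qed
    have T_n: "T n (\<lambda>X. expwave (- (real n *\<^sub>R K)) X * w X) = d n - (of_nat n ^ 2 * m2 + (\<i> * of_nat n) * m1)" for n
    proof -
      have e1: "expwave L X * expwave (- L) X = 1" for L X
        using expwave_add[of L "- L" X] by simp
      have eq: "(1 / ?a X) *\<^sub>R Jop ?V (expwave (real n *\<^sub>R K)) X * Jop ?V (\<lambda>X. expwave (- (real n *\<^sub>R K)) X * w X) X =
        of_nat n ^ 2 * (complex_of_real ((?V X \<bullet> K)^2 / ?a X) * w X) + (\<i> * of_nat n) * (complex_of_real ((?V X \<bullet> K) / ?a X) * ?Jw X)" for X
      proof -
        define L where "L = real n *\<^sub>R K"
        define b where "b = complex_of_real (?V X \<bullet> L)"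
        have b: "b = of_nat n * complex_of_real (?V X \<bullet> K)" by (simp add: b_def L_def)
        have "(1 / ?a X) *\<^sub>R Jop ?V (expwave L) X * Jop ?V (\<lambda>X. expwave (- L) X * w X) X
          = (1 / complex_of_real (?a X)) * (\<i> * b * (- \<i> * b * w X + ?Jw X)) * (expwave L X * expwave (- L) X)"
          unfolding J1 J2 b_def by (simp add: scaleR_conv_of_real mult_ac)
        also have "\<dots> = (1 / complex_of_real (?a X)) * (b * b * w X + \<i> * b * ?Jw X)"
          unfolding e1 by (simp add: algebra_simps)
        also have "\<dots> = of_nat n ^ 2 * (complex_of_real ((?V X \<bullet> K)^2 / ?a X) * w X) + (\<i> * of_nat n) * (complex_of_real ((?V X \<bullet> K) / ?a X) * ?Jw X)"
          unfolding b by (simp add: power2_eq_square add_divide_distrib mult_ac)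
        finally show ?thesis by (simp only: L_def)
      qed
      have "Jadj \<tau> ?V (\<lambda>X. (1 / ?a X) *\<^sub>R Jop ?V (expwave (real n *\<^sub>R K)) X) (\<lambda>X. expwave (- (real n *\<^sub>R K)) X * w X)
        = torus_mean \<tau> (\<lambda>X. of_nat n ^ 2 * (complex_of_real ((?V X \<bullet> K)^2 / ?a X) * w X)) +
          torus_mean \<tau> (\<lambda>X. (\<i> * of_nat n) * (complex_of_real ((?V X \<bullet> K) / ?a X) * ?Jw X))"
        unfolding Jadj_def eq by (intro torus_mean_add continuous_on_mult continuous_on_const c1 c2)
      then show ?thesis unfolding T_eq d_def m1_def m2_def by (simp only: torus_mean_mult)
    qed
    have db: "cmod (d n) \<le> C * Mw * (real n * norm K + 1)" for n
      unfolding d_def distr_of_def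
    proof (rule torus_mean_bound[OF t])
      fix X
      have "cmod (g n X * (expwave (- (real n *\<^sub>R K)) X * w X)) = cmod (g n X) * cmod (w X)" by (simp add: norm_mult)
      also have "\<dots> \<le> (C * (norm (real n *\<^sub>R K) + 1)) * Mw"
        using C(1) by (intro mult_mono C(2)[OF dn] Mw) auto
      finally show "cmod (g n X * (expwave (- (real n *\<^sub>R K)) X * w X)) \<le> C * Mw * (real n * norm K + 1)"
        by (simp add: mult_ac)
    qed (use C(1) Mw(1) in simp)
    have lim1: "(\<lambda>n. C * Mw * (norm K * (1 / real n) + (1 / real n) * (1 / real n))) \<longlonglongrightarrow> C * Mw * (norm K * 0 + 0 * 0)"
      by (intro tendsto_intros lim_1_over_n)
    have "(\<lambda>n. d n / of_nat n ^ 2) \<longlonglongrightarrow> 0"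
    proof (rule Lim_null_comparison)
      show "(\<lambda>n. C * Mw * (norm K * (1 / real n) + (1 / real n) * (1 / real n))) \<longlonglongrightarrow> 0" using lim1 by simp
      show "\<forall>\<^sub>F n in sequentially. norm (d n / of_nat n ^ 2) \<le> C * Mw * (norm K * (1 / real n) + (1 / real n) * (1 / real n))"
        using eventually_gt_at_top[of 0]
      proof eventually_elim
        case (elim n)
        have "norm (d n / of_nat n ^ 2) \<le> C * Mw * (real n * norm K + 1) / real n ^ 2"
          using db[of n] elim by (simp add: norm_divide norm_power divide_right_mono)
        also have "\<dots> = C * Mw * (norm K * (1 / real n) + (1 / real n) * (1 / real n))"
          using elim by (simp add: field_simps power2_eq_square)
        finally show ?case .
      qed
    qed
    moreover have "(\<lambda>n. \<i> * m1 * complex_of_real (1 / real n)) \<longlonglongrightarrow> \<i> * m1 * complex_of_real 0"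
      by (intro tendsto_intros lim_1_over_n)
    ultimately have "(\<lambda>n. d n / of_nat n ^ 2 - m2 - \<i> * m1 * complex_of_real (1 / real n)) \<longlonglongrightarrow> 0 - m2 - \<i> * m1 * complex_of_real 0"
      by (intro tendsto_intros)
    moreover have "\<forall>\<^sub>F n in sequentially. d n / of_nat n ^ 2 - m2 - \<i> * m1 * complex_of_real (1 / real n) = T n (\<lambda>X. expwave (- (real n *\<^sub>R K)) X * w X) / of_nat n ^ 2"
      using eventually_gt_at_top[of 0]
    proof eventually_elim
      case (elim n)
      then show ?case unfolding T_n by (simp add: field_simps power2_eq_square)
    qed
    ultimately have "(\<lambda>n. T n (\<lambda>X. expwave (- (real n *\<^sub>R K)) X * w X) / of_nat n ^ 2) \<longlonglongrightarrow> 0 - m2 - \<i> * m1 * complex_of_real 0"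
      by (rule Lim_transform_eventually)
    moreover have "distr_of \<tau> (\<lambda>X. symbol \<mu> U (X, K)) w = - m2"
    proof -
      have "distr_of \<tau> (\<lambda>X. symbol \<mu> U (X, K)) w = torus_mean \<tau> (\<lambda>X. (- 1) * (complex_of_real ((?V X \<bullet> K)^2 / ?a X) * w X))"
        by (simp add: distr_of_def symbol_def)
      then show ?thesis by (simp only: torus_mean_mult m2_def) simp
    qed
    ultimately show ?thesis by simp
  qed
  show ?thesis
    unfolding principal_symbol_def using cp pp hom lim by blast
qed


section \<open>C^k norms, automorphisms and uniqueness of the straightening\<close>

lemma Qb_funpow:
  assumes e: "e \<in> Basis"
  shows "Qb L (n + k) A f \<Longrightarrow> Qb L k (A * L ^ n) ((dirderiv e ^^ n) f)"
proof (induction n arbitrary: A f)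
  case (Suc n)
  then have "Qb L (n + k) (A * L) (dirderiv e f)" using e by simp
  from Suc.IH[OF this] show ?case by (simp add: funpow_Suc_right mult.assoc del: funpow.simps)
qed simp

lemma Qb_partial_bound:
  assumes f: "Qb L k A f" and le: "i + j \<le> k" and L: "1 \<le> L"
  shows "\<bar>(D1 ^^ i) ((D2 ^^ j) f) X\<bar> \<le> A * L ^ k"
proof -
  have "Qb L (j + (i + 0)) A f" using Qb_lower[OF L f] le by (simp add: add.commute)
  then have "Qb L (i + 0) (A * L ^ j) ((D2 ^^ j) f)" by (rule Qb_funpow[rotated]) (simp add: Basis_vec2)
  then have "Qb L 0 (A * L ^ j * L ^ i) ((D1 ^^ i) ((D2 ^^ j) f))" by (rule Qb_funpow[rotated]) (simp add: Basis_vec2)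
  then have "\<bar>(D1 ^^ i) ((D2 ^^ j) f) X\<bar> \<le> A * L ^ (i + j)" by (simp add: power_add mult_ac)
  also have "\<dots> \<le> A * L ^ k" using Qb_nonneg[OF f] L le by (intro mult_left_mono power_increasing) auto
  finally show ?thesis .
qed

text \<open>The innermost derivative is the free one of \<open>SS\<close>; at most \<open>n\<close>
  more follow, each costing a factor \<open>L\<close>. The remaining factor is the number of partial
  derivatives in the norm.\<close>

lemma ck_norm_le:
  assumes L: "1 \<le> L" and g: "SS L n B g"
  shows "ck_norm (Suc n) g \<le> ennreal (real (card {(i :: nat, j :: nat). i + j \<le> Suc n}) * (B * L ^ n))"
proof -
  have B: "0 \<le> B" by (rule SSD(4)[OF g])
  have e: "pt 1 0 \<in> Basis" "pt 0 1 \<in> Basis" by (simp_all add: Basis_vec2)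
  have bd: "\<bar>(D1 ^^ i) ((D2 ^^ j) g) X\<bar> \<le> B * L ^ n" if ij: "i + j \<le> Suc n" for i j X
  proof (cases j)
    case (Suc j')
    then have "(D2 ^^ j) g = (D2 ^^ j') (D2 g)" by (simp add: funpow_Suc_right del: funpow.simps)
    with Qb_partial_bound[OF SSD(3)[OF g e(2)], of i j'] ij Suc L show ?thesis by simp
  next
    case 0
    show ?thesis
    proof (cases i)
      case (Suc i')
      then have "(D1 ^^ i) g = (D1 ^^ i') ((D2 ^^ 0) (D1 g))" by (simp add: funpow_Suc_right del: funpow.simps(2))
      with Qb_partial_bound[OF SSD(3)[OF g e(1)], of i' 0] ij Suc 0 L show ?thesis by simp
    next
      assume "i = 0"
      moreover have "B * 1 \<le> B * L ^ n" using B L by (intro mult_left_mono) auto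
      ultimately show ?thesis using 0 SSD(1)[OF g, of X] by simp
    qed
  qed
  have "ck_norm (Suc n) g \<le> of_nat (card {(i :: nat, j :: nat). i + j \<le> Suc n}) * ennreal (B * L ^ n)"
    unfolding ck_norm_def
  proof (rule sum_bounded_above)
    fix q :: "nat \<times> nat" assume "q \<in> {(i, j). i + j \<le> Suc n}"
    then show "(case q of (i, j) \<Rightarrow> SUP X. ennreal \<bar>(D1 ^^ i) ((D2 ^^ j) g) X\<bar>) \<le> ennreal (B * L ^ n)"
      by (cases q) (auto intro!: SUP_least ennreal_leI bd)
  qed
  also have "\<dots> = ennreal (real (card {(i :: nat, j :: nat). i + j \<le> Suc n}) * (B * L ^ n))"
    using B L by (simp add: ennreal_mult ennreal_of_nat_eq_real_of_nat)
  finally show ?thesis .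
qed

lemma Ck_pt:
  fixes f g :: "real^2 \<Rightarrow> real"
  shows "Ck k f \<Longrightarrow> Ck k g \<Longrightarrow> Ck k (\<lambda>X. pt (f X) (g X))"
proof (induction k arbitrary: f g)
  case 0
  then show ?case by (auto intro: continuous_on_pt)
next
  case (Suc k)
  have h: "((\<lambda>X. pt (f X) (g X)) has_derivative (\<lambda>v. pt (dirderiv v f X) (dirderiv v g X))) (at X)" for X
    using Suc.prems by (intro has_derivative_pt has_derivative_dirderiv) auto
  have "dirderiv v (\<lambda>X. pt (f X) (g X)) = (\<lambda>X. pt (dirderiv v f X) (dirderiv v g X))" for v
    by (rule ext) (rule dirderiv_eqI[OF h])
  moreover have "(\<lambda>X. pt (f X) (g X)) differentiable (at X)" for X using h unfolding differentiable_def by blast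
  ultimately show ?case using Suc by simp
qed

lemma Ck_nth: "Ck k (\<lambda>X. (X :: real^2) $ i)"
proof (cases k)
  case 0
  then show ?thesis by (simp add: continuous_on_component)
next
  case (Suc j)
  have "dirderiv v (\<lambda>X. (X :: real^2) $ i) = (\<lambda>X. v $ i)" for v by (simp add: fun_eq_iff dirderiv_nth)
  moreover have "Ck j (\<lambda>X :: real^2. c)" for c :: real by (rule Qb_imp_Ck[of 1 _ "\<bar>c\<bar>"]) (rule Qb_const, auto)
  ultimately show ?thesis using Suc dirderiv_nth(2) by simp
qed

lemma shift1_pt: "shift1 \<delta> g (pt a b) = g (pt (a + \<delta>) b)"
proof -
  have "pt a b + pt \<delta> 0 = pt (a + \<delta>) b" by (simp add: vec2_eq_iff)
  then show ?thesis by (simp add: shift1_def)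
qed

lemma shift1_0: "shift1 0 g = g"
proof
  fix X
  show "shift1 0 g X = g X" using shift1_pt[of 0 g "X $ 1" "X $ 2"] by simp
qed

lemma Ck_shift:
  fixes f :: "real^2 \<Rightarrow> real"
  shows "Ck k f \<Longrightarrow> Ck k (shift1 \<delta> f)"
proof (induction k arbitrary: f)
  case 0
  then have "continuous_on UNIV f" by simp
  moreover have "continuous_on UNIV (\<lambda>X :: real^2. X + pt \<delta> 0)"
    by (rule continuous_on_add[OF continuous_on_id continuous_on_const])
  ultimately have "continuous_on UNIV (\<lambda>X. f (X + pt \<delta> 0))" by (rule continuous_on_compose2) simp
  then show ?case by (simp add: shift1_def[abs_def])
next
  case (Suc k)
  have h: "(shift1 \<delta> f has_derivative (\<lambda>v. dirderiv v f (X + pt \<delta> 0))) (at X)" for X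
    unfolding shift1_def[abs_def]
  proof (rule has_derivative_compose[where f = "\<lambda>X. X + pt \<delta> 0" and f' = "\<lambda>v. v"])
    show "((\<lambda>X. X + pt \<delta> 0) has_derivative (\<lambda>v. v)) (at X)"
      by (rule has_derivative_add_const[OF has_derivative_ident])
    show "(f has_derivative (\<lambda>v. dirderiv v f (X + pt \<delta> 0))) (at (X + pt \<delta> 0))"
      by (rule has_derivative_dirderiv) (use Suc.prems in auto)
  qed
  have "dirderiv v (shift1 \<delta> f) = shift1 \<delta> (dirderiv v f)" for v
    by (rule ext, subst dirderiv_eqI[OF h]) (simp add: shift1_def)
  moreover have "shift1 \<delta> f differentiable (at X)" for X using h unfolding differentiable_def by blast
  ultimately show ?case using Suc by simp
qed

context shear
begin

lemma Ck_straightening_maps: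
  assumes L: "1 \<le> L" and Z: "SS L n B (\<lambda>X. X $ 2 - Z X)" and H: "SS L n B (\<lambda>X. H X - X $ 2)"
  shows "Ck (Suc n) Z" "Ck (Suc n) T" "Ck (Suc n) U"
proof -
  have "SS L n B (\<lambda>X. - (X $ 2 - Z X))" by (rule SS_uminus[OF L Z])
  from Ck_add[OF Ck_nth[of "Suc n" 2] Qb_imp_Ck[OF SS_imp_Qb_Suc[OF L this]]]
  show cZ: "Ck (Suc n) Z" by (simp del: Ck_on.simps)
  from Ck_add[OF Ck_nth[of "Suc n" 2] Qb_imp_Ck[OF SS_imp_Qb_Suc[OF L H]]]
  have cH: "Ck (Suc n) H" by (simp del: Ck_on.simps)
  show "Ck (Suc n) T" "Ck (Suc n) U"
    unfolding T_def[abs_def] U_def[abs_def] by (rule Ck_pt[OF Ck_nth cZ] Ck_pt[OF Ck_nth cH])+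
qed

lemma torus_automorphisms:
  assumes "Ck k T" "Ck k U"
  shows "torus_automorphism \<tau> k T" "torus_automorphism \<tau> k U"
proof -
  show "torus_automorphism \<tau> k T" unfolding torus_automorphism_def inv_T
    using assms bij_T T_lattice_iff by blast
  have "X - Y \<in> period_lattice \<tau> \<longleftrightarrow> U X - U Y \<in> period_lattice \<tau>" for X Y
    using T_lattice_iff[of "U X" "U Y"] by simp
  then show "torus_automorphism \<tau> k U" unfolding torus_automorphism_def inv_U
    using assms bij_U by blast
qed

end

lemma (in shear) integral_Z_shift:
  "integral {0..2*pi} (\<lambda>x. Z (pt (x + \<delta>) c)) = integral {0..2*pi} (\<lambda>x. Z (pt x c))"
proof (rule integral_periodic_shift)
  show "continuous_on UNIV (\<lambda>x. Z (pt x c))" by (rule continuous_on_compose2[OF Z_cont continuous_on_pt]) (auto intro: continuous_intros)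
  show "Z (pt (x + 2 * pi) c) = Z (pt x c)" for x
  proof -
    have "pt x c + pt (2 * pi) 0 = pt (x + 2 * pi) c" by (simp add: vec2_eq_iff)
    with Z_period(1)[of "pt x c"] show ?thesis by simp
  qed
qed simp

context flow
begin

text \<open>Each slice of \<open>W\<close>, shifted back by \<delta>, solves the unshifted equation
  and is therefore some slice \<open>Z (pt x c)\<close>. This makes it periodic, so its average may
  be taken over the shifted period, and \<open>c = b\<close> follows.\<close>

lemma straightening_solution:
  fixes W :: "real^2 \<Rightarrow> real"
  assumes "straightening (Suc k) (shift1 \<delta> V) W"
  shows "W = shift1 \<delta> Z"
proof -
  have W: "\<And>X. W differentiable (at X)" "\<And>a b. D1 W (pt a b) = V (pt (a + \<delta>) (W (pt a b))) $ 2 / V (pt (a + \<delta>) (W (pt a b))) $ 1"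
    "\<And>b. average_z1 W b = b"
    using assms by (simp_all add: straightening_def shift1_pt)
  have eq: "W (pt a b) = Z (pt (a + \<delta>) b)" for a b
  proof -
    define y where "y x = W (pt (x - \<delta>) b)" for x
    \<comment> \<open>Periodicity of \<open>W\<close> is not assumed, so the average of
      \<open>y\<close> over [0, 2 pi] is given a name before it can be identified with
      \<open>b\<close>.\<close>
    define c where "c = integral {0..2*pi} y / (2 * pi)"
    have "(y has_real_derivative V (pt x (y x)) $ 2 / V (pt x (y x)) $ 1) (at x)" for x
    proof -
      have "((\<lambda>x. W (pt x b)) has_real_derivative D1 W (pt (x - \<delta>) b)) (at (x - \<delta>))"
        by (rule has_real_derivative_D1(1)[OF W(1)])
      from this[unfolded diff_conv_add_uminus DERIV_shift] show ?thesis
        unfolding y_def W(2) by (simp add: W(2))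
    qed
    moreover have "integral {0..2*pi} y = 2 * pi * c" by (simp add: c_def)
    ultimately have y: "y x = Z (pt x c)" for x by (rule solution_unique)
    then have Wc: "W (pt x b) = Z (pt (x + \<delta>) c)" for x using y[of "x + \<delta>"] by (simp add: y_def)
    have "2 * pi * b = integral {0..2*pi} (\<lambda>x. W (pt x b))" using W(3)[of b] by (simp add: average_z1_def field_simps)
    also have "\<dots> = integral {0..2*pi} (\<lambda>x. Z (pt (x + \<delta>) c))" unfolding Wc ..
    also have "\<dots> = integral {0..2*pi} (\<lambda>x. Z (pt x c))" by (rule integral_Z_shift)
    also have "\<dots> = 2 * pi * c" using Z_avg[of c] by (simp add: average_z1_def field_simps)
    finally show ?thesis using Wc by simp
  qed
  show ?thesis
  proof
    fix X
    show "W X = shift1 \<delta> Z X" using eq[of "X $ 1" "X $ 2"] shift1_pt[of \<delta> Z "X $ 1" "X $ 2"] by simp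
  qed
qed

lemma straightening_shift_iff:
  fixes \<delta> :: real and W :: "real^2 \<Rightarrow> real"
  assumes Z: "Ck (Suc k) Z"
  shows "straightening (Suc k) (shift1 \<delta> V) W \<longleftrightarrow> W = shift1 \<delta> Z"
proof
  assume W: "W = shift1 \<delta> Z"
  have "D1 W (pt a b) = V (pt (a + \<delta>) (Z (pt (a + \<delta>) b))) $ 2 / V (pt (a + \<delta>) (Z (pt (a + \<delta>) b))) $ 1" for a b
  proof -
    have "((\<lambda>x. W (pt x b)) has_real_derivative D1 W (pt a b)) (at a)"
      using Ck_shift[OF Z, of \<delta>] W by (intro has_real_derivative_D1(1)) simp
    moreover have "((\<lambda>x. W (pt x b)) has_real_derivative V (pt (a + \<delta>) (Z (pt (a + \<delta>) b))) $ 2 / V (pt (a + \<delta>) (Z (pt (a + \<delta>) b))) $ 1) (at a)"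
      using DERIV_shift[of "\<lambda>x. Z (pt x b)" _ a \<delta>] Z_deriv1[of b "a + \<delta>"] unfolding W shift1_pt by simp
    ultimately show ?thesis by (rule DERIV_unique)
  qed
  moreover have "average_z1 W b = b" for b
    using Z_avg[of b] unfolding average_z1_def W shift1_pt integral_Z_shift .
  ultimately show "straightening (Suc k) (shift1 \<delta> V) W"
    unfolding straightening_def W shift1_pt using Ck_shift[OF Z] by blast
next
  assume "straightening (Suc k) (shift1 \<delta> V) W"
  then show "W = shift1 \<delta> Z" by (rule straightening_solution)
qed

lemma straightening_iff:
  fixes W :: "real^2 \<Rightarrow> real"
  assumes "Ck (Suc k) Z"
  shows "straightening (Suc k) V W \<longleftrightarrow> W = Z"
proof -
  show ?thesis using straightening_shift_iff[OF assms, where \<delta> = 0 and W = W] by (simp add: shift1_0)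
qed

end


lemma bicharacteristics_symbol:
  assumes mu: "0 < \<mu>" and a: "admissible \<tau> \<mu> U"
  shows "bicharacteristics (symbol \<mu> U) = integral_curves (Vfield U)"
proof (rule bicharacteristics_eq_integral_curves)
  have Vd: "\<And>i X. (\<lambda>X. Vfield U X $ i) differentiable (at X)" and V1: "\<And>X. 1 / 2 \<le> Vfield U X $ 1"
    and apos: "\<And>X. \<mu> / 2 \<le> acoef \<mu> U X"
    and cD: "\<And>i e. e \<in> Basis \<Longrightarrow> continuous_on UNIV (dirderiv e (\<lambda>X. Vfield U X $ i))"
    using a unfolding admissible_def by blast+
  show "(\<lambda>X. Vfield U X $ i) differentiable (at X)" for i X by (rule Vd)
  show "0 < Vfield U X $ 1" for X using V1[of X] by simp
  show "symbol \<mu> U (X, \<xi>) = 0 \<longleftrightarrow> Vfield U X \<bullet> \<xi> = 0" for X \<xi>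
    using apos[of X] mu by (auto simp: symbol_def)
  show "continuous_on UNIV (dirderiv v (\<lambda>X. Vfield U X $ i))" for i v
  proof -
    have "dirderiv v (\<lambda>X. Vfield U X $ i) = (\<lambda>X. v $ 1 *\<^sub>R D1 (\<lambda>X. Vfield U X $ i) X + v $ 2 *\<^sub>R D2 (\<lambda>X. Vfield U X $ i) X)"
      by (rule ext) (rule dirderiv_linear[OF Vd])
    moreover have "continuous_on UNIV (\<lambda>X. v $ 1 *\<^sub>R D1 (\<lambda>X. Vfield U X $ i) X + v $ 2 *\<^sub>R D2 (\<lambda>X. Vfield U X $ i) X)"
      by (intro continuous_intros cD) (simp_all add: Basis_vec2)
    ultimately show ?thesis by simp
  qed
qed

theorem lemma3p6:
  fixes \<tau> \<mu> :: real
  assumes "0 < \<tau>" and "0 < \<mu>"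
  shows "\<exists>\<epsilon>>0. \<exists>c :: nat \<Rightarrow> real \<Rightarrow> real. (\<forall>m. mono (c m)) \<and>
    (\<forall>m\<ge>4. \<forall>U \<in> sobolev_S \<tau> m. pair_norm \<tau> 4 U < \<epsilon> \<longrightarrow>
      (let V = Vfield U in
        (\<exists>!Z. straightening (m - 3) V Z) \<and>
        (\<forall>Z. straightening (m - 3) V Z \<longrightarrow>
          even1 Z \<and> odd2 Z \<and>
          (\<forall>z. Z z = Z (z + pt (2 * pi) 0) \<and>
               Z z = Z (z + pt 0 (2 * pi / \<tau>)) - 2 * pi / \<tau> \<and>
               Z z = Z (z + pt pi (pi / \<tau>)) - pi / \<tau>) \<and>
          (\<forall>\<delta> W. straightening (m - 3) (shift1 \<delta> V) W \<longleftrightarrow> W = shift1 \<delta> Z) \<and>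
          (let T = (\<lambda>z. pt (z $ 1) (Z z));
               U1 = inv T;
               d' = (\<lambda>z. z $ 2 - Z z);
               d = (\<lambda>X. U1 X $ 2 - X $ 2)
           in torus_automorphism \<tau> (m - 3) T \<and> torus_automorphism \<tau> (m - 3) U1 \<and>
              (\<forall>X. U1 X = pt (X $ 1) (X $ 2 + d X)) \<and>
              even1 d \<and> odd2 d \<and> even1 d' \<and> odd2 d' \<and>
              ck_norm (m - 3) d + ck_norm (m - 3) d'
                \<le> ennreal (c m (pair_norm \<tau> 4 U) * pair_norm \<tau> m U) \<and>
              (`) U1 ` maximal_arcs (integral_curves V) = range (\<lambda>a. {z. z $ 2 = a}) \<and>
              (\<exists>p. principal_symbol \<tau> 2 (lin_op \<tau> \<mu> U) p \<and>
                   bicharacteristics p = integral_curves V \<and>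
                   torus_foliation \<tau> (maximal_arcs (bicharacteristics p)) \<and>
                   rotation_number (maximal_arcs (bicharacteristics p)) 0)))))"
proof -
  obtain \<epsilon> K where eps: "0 < \<epsilon>" and K0: "\<And>n. (0 :: real) \<le> K n"
    and flow_data: "\<And>n U. U \<in> sobolev_S \<tau> (4 + n) \<Longrightarrow> pair_norm \<tau> 4 U < \<epsilon> \<Longrightarrow>
      admissible \<tau> \<mu> U \<and> shear (\<lambda>X. Vfield U X $ 2 / Vfield U X $ 1) (1 / 16) \<tau> \<and> pair_norm \<tau> 4 U \<le> 1 \<and>
      (\<exists>L\<ge>1. pair_norm \<tau> (4 + n) U = L ^ n * pair_norm \<tau> 4 U \<and>
         SS L n (K n * pair_norm \<tau> 4 U) (\<lambda>X. Vfield U X $ 2 / Vfield U X $ 1))"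
    using flow_setup[OF assms] by blast
  have "\<forall>n. \<exists>C\<ge>0. \<forall>L G f F \<tau>. 1 \<le> L \<longrightarrow> G \<le> K n \<longrightarrow> SS L n G f \<longrightarrow> shear f F \<tau> \<longrightarrow>
    SS L n (C * G) (\<lambda>X. X $ 2 - shear.Z f X) \<and> SS L n (C * G) (\<lambda>X. shear.H f X - X $ 2)"
    by (rule allI) (rule tame_straightening[OF K0])
  from choice[OF this] obtain C where C: "\<And>n. 0 \<le> C n"
    "\<And>n L G f F \<tau>. 1 \<le> L \<Longrightarrow> G \<le> K n \<Longrightarrow> SS L n G f \<Longrightarrow> shear f F \<tau> \<Longrightarrow>
      SS L n (C n * G) (\<lambda>X. X $ 2 - shear.Z f X) \<and> SS L n (C n * G) (\<lambda>X. shear.H f X - X $ 2)"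
    by blast
  define N where "N n = real (card {(i :: nat, j :: nat). i + j \<le> Suc n})" for n
  \<comment> \<open>\<open>c m\<close> is constant in \<open>r\<close>, since the H^4 norm is at
    most 1 for the data considered. The factor 2 accounts for the two functions d and d'; the powers
    \<open>L^(m-4)\<close> are absorbed into the H^m norm.\<close>
  define c :: "nat \<Rightarrow> real \<Rightarrow> real" where "c m r = 2 * N (m - 4) * C (m - 4) * K (m - 4)" for m r
  have "\<forall>m. mono (c m)" by (simp add: mono_def c_def)
  moreover have "\<forall>m\<ge>4. \<forall>U \<in> sobolev_S \<tau> m. pair_norm \<tau> 4 U < \<epsilon> \<longrightarrow> (let V = Vfield U in
        (\<exists>!Z. straightening (m - 3) V Z) \<and>
        (\<forall>Z. straightening (m - 3) V Z \<longrightarrow>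
          even1 Z \<and> odd2 Z \<and>
          (\<forall>z. Z z = Z (z + pt (2 * pi) 0) \<and>
               Z z = Z (z + pt 0 (2 * pi / \<tau>)) - 2 * pi / \<tau> \<and>
               Z z = Z (z + pt pi (pi / \<tau>)) - pi / \<tau>) \<and>
          (\<forall>\<delta> W. straightening (m - 3) (shift1 \<delta> V) W \<longleftrightarrow> W = shift1 \<delta> Z) \<and>
          (let T = (\<lambda>z. pt (z $ 1) (Z z));
               U1 = inv T;
               d' = (\<lambda>z. z $ 2 - Z z);
               d = (\<lambda>X. U1 X $ 2 - X $ 2)
           in torus_automorphism \<tau> (m - 3) T \<and> torus_automorphism \<tau> (m - 3) U1 \<and>
              (\<forall>X. U1 X = pt (X $ 1) (X $ 2 + d X)) \<and>
              even1 d \<and> odd2 d \<and> even1 d' \<and> odd2 d' \<and>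
              ck_norm (m - 3) d + ck_norm (m - 3) d'
                \<le> ennreal (c m (pair_norm \<tau> 4 U) * pair_norm \<tau> m U) \<and>
              (`) U1 ` maximal_arcs (integral_curves V) = range (\<lambda>a. {z. z $ 2 = a}) \<and>
              (\<exists>p. principal_symbol \<tau> 2 (lin_op \<tau> \<mu> U) p \<and>
                   bicharacteristics p = integral_curves V \<and>
                   torus_foliation \<tau> (maximal_arcs (bicharacteristics p)) \<and>
                   rotation_number (maximal_arcs (bicharacteristics p)) 0))))"
    (is "\<forall>m\<ge>4. \<forall>U \<in> _ m. _ U < _ \<longrightarrow> ?P m U")
  proof (rule allI, rule impI, rule ballI, rule impI)
    fix m U assume m: "4 \<le> m" and U: "U \<in> sobolev_S \<tau> m" and small: "pair_norm \<tau> 4 U < \<epsilon>"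
    obtain n where n: "m = 4 + n" using m le_Suc_ex by blast
    have m3: "m - 3 = Suc n" and m4: "m - 4 = n" using n by auto
    have adm: "admissible \<tau> \<mu> U" and sh: "shear (\<lambda>X. Vfield U X $ 2 / Vfield U X $ 1) (1 / 16) \<tau>"
      and le1: "pair_norm \<tau> 4 U \<le> 1"
      using flow_data[OF U[unfolded n] small] by blast+
    obtain L where L: "1 \<le> L" "pair_norm \<tau> m U = L ^ n * pair_norm \<tau> 4 U"
      "SS L n (K n * pair_norm \<tau> 4 U) (\<lambda>X. Vfield U X $ 2 / Vfield U X $ 1)"
      using flow_data[OF U[unfolded n] small] unfolding n by blast
    define V where "V = Vfield U"
    have Vd: "\<And>i X. (\<lambda>X. V X $ i) differentiable (at X)" and V1: "\<And>X. 1 / 2 \<le> V X $ 1"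
      using adm unfolding admissible_def V_def by blast+
    have cV: "continuous_on UNIV V"
      using continuous_on_pt[OF differentiable_continuous_UNIV[OF Vd[of 1]] differentiable_continuous_UNIV[OF Vd[of 2]]] by simp
    interpret S: flow V "1 / 16" \<tau>
      by (rule flow.intro[OF sh[folded V_def]]) (rule flow_axioms.intro[OF V1 cV])
    define B where "B = C n * (K n * pair_norm \<tau> 4 U)"
    have Kle: "K n * pair_norm \<tau> 4 U \<le> K n" using mult_left_mono[OF le1 K0[of n]] by simp
    have SZ: "SS L n B (\<lambda>X. X $ 2 - S.Z X)" and SH: "SS L n B (\<lambda>X. S.H X - X $ 2)"
      using C(2)[OF L(1) Kle L(3) sh] unfolding B_def V_def by blast+
    have T_eq: "(\<lambda>z. pt (z $ 1) (S.Z z)) = S.T" by (simp add: S.T_def[abs_def])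
    note Ck = S.Ck_straightening_maps[OF L(1) SZ SH]
    have unique: "straightening (Suc n) V Y \<longleftrightarrow> Y = S.Z" for Y by (rule S.straightening_iff[OF Ck(1)])
    have shifted: "\<forall>\<delta> W. straightening (Suc n) (shift1 \<delta> V) W \<longleftrightarrow> W = shift1 \<delta> S.Z"
      by (intro allI S.straightening_shift_iff Ck(1))
    have U2: "S.U X $ 2 = S.H X" for X by (simp add: S.U_def)
    have U_eq: "\<forall>X. S.U X = pt (X $ 1) (X $ 2 + (S.H X - X $ 2))" by (simp add: S.U_def)
    have periods: "\<forall>z. S.Z z = S.Z (z + pt (2 * pi) 0) \<and> S.Z z = S.Z (z + pt 0 (2 * pi / \<tau>)) - 2 * pi / \<tau> \<and>
        S.Z z = S.Z (z + pt pi (pi / \<tau>)) - pi / \<tau>"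
      by (simp only: S.Z_period) simp
    have norms: "ck_norm (Suc n) (\<lambda>X. S.H X - X $ 2) + ck_norm (Suc n) (\<lambda>z. z $ 2 - S.Z z)
        \<le> ennreal (c m (pair_norm \<tau> 4 U) * pair_norm \<tau> m U)"
    proof -
      have B0: "0 \<le> B" by (rule SSD(4)[OF SZ])
      have "ck_norm (Suc n) (\<lambda>X. S.H X - X $ 2) + ck_norm (Suc n) (\<lambda>z. z $ 2 - S.Z z)
          \<le> ennreal (N n * (B * L ^ n)) + ennreal (N n * (B * L ^ n))"
        unfolding N_def by (rule add_mono[OF ck_norm_le[OF L(1) SH] ck_norm_le[OF L(1) SZ]])
      also have "\<dots> = ennreal (N n * (B * L ^ n) + N n * (B * L ^ n))"
        using B0 L(1) by (intro ennreal_plus[symmetric]) (auto simp: N_def)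
      also have "N n * (B * L ^ n) + N n * (B * L ^ n) = c m (pair_norm \<tau> 4 U) * pair_norm \<tau> m U"
        unfolding c_def m4 L(2) B_def by (simp add: algebra_simps)
      finally show ?thesis .
    qed
    have parity: "even1 (\<lambda>X. S.H X - X $ 2)" "odd2 (\<lambda>X. S.H X - X $ 2)"
      "even1 (\<lambda>z. z $ 2 - S.Z z)" "odd2 (\<lambda>z. z $ 2 - S.Z z)"
      using S.H_even1 S.H_odd2 S.Z_even_per(1) S.Z_odd2 by (simp_all add: even1_def odd2_def)
    have bichar: "bicharacteristics (symbol \<mu> U) = integral_curves V"
      by (simp only: bicharacteristics_symbol[OF assms(2) adm] V_def)
    have leaves: "\<exists>p. principal_symbol \<tau> 2 (lin_op \<tau> \<mu> U) p \<and> bicharacteristics p = integral_curves V \<and>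
        torus_foliation \<tau> (maximal_arcs (bicharacteristics p)) \<and> rotation_number (maximal_arcs (bicharacteristics p)) 0"
      by (rule exI[of _ "symbol \<mu> U"])
        (simp only: bichar principal_symbol_lin_op[OF assms adm] S.maximal_integral_curves S.foliation S.rotation simp_thms)
    show "?P m U"
      unfolding Let_def m3 V_def[symmetric] unique
      apply (rule conjI, blast)
      apply (rule allI, rule impI, hypsubst)
      unfolding T_eq S.inv_T U2
      by (intro conjI S.Z_even_per(1) S.Z_odd2 periods shifted S.torus_automorphisms Ck(2,3) U_eq parity norms S.straightened leaves)
  qed
  ultimately show ?thesis by (intro exI[of _ \<epsilon>] exI[of _ c] conjI eps)
qed

end
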